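(* Let $L$ be a nonsolvable Lie algebra of dimension $5$ over a finite field $k$ of characteristic $p\ge 3$. Then (up to isomorphism) one of the following occurs. 1. $p=5$ and $L\cong W(1;\underline 1)$; 2. $L=P\rtimes \operatorname{rad}(L)$, where $P\cong\mathfrak{sl}(2,k)$, and (a) $\operatorname{rad}(L)=C(L)$, or (b) $\operatorname{rad}(L)=kh\oplus ku$ with $[h,u]=u$, $[P,\operatorname{rad}(L)]=\{0\}$, or (c) $\operatorname{rad}(L)$ is abelian and $\operatorname{rad}(L)\cong V(1)$ is the irreducible 2-dimensional $P$-module; 3. $p=3$, and $L$ is a nonsplit extension $0\to V(1)\to L\to \mathfrak{sl}(2,k)\to 0$; more exactly, $L$ has a basis $(e,h,f,v_0,v_1)$ with multiplication $$\begin{array}{llll} [h,e]=-e+v_1, & [h,v_0]=v_0, & [e,v_0]=0, & [f,v_0]=v_1,\\ {}[h,f]=f, & [h,v_1]=-v_1, & [e,v_1]=v_0, & [f,v_1]=0,\\ {}[e,f]=h, & [v_0,v_1]=0. & & \end{array}$$ The listed algebras are mutually nonisomorphic.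
   Context: $W(1;\underline 1)$ over a field $k$ of characteristic $p$: let $\mathcal O(1;\underline 1)$ be the commutative associative unital $k$-algebra with basis $1=x^{(0)},x=x^{(1)},\ldots,x^{(p-1)}$ and product $x^{(r)}x^{(s)}=\binom{r+s}{r}x^{(r+s)}$ (read as $0$ if $r+s\ge p$), and $\partial$ the derivation with $\partial(1)=0$, $\partial(x^{(r)})=x^{(r-1)}$. Then $W(1;\underline 1)=\{f\partial\mid f\in\mathcal O(1;\underline 1)\}$ with $[f\partial,g\partial]=(f\partial(g)-g\partial(f))\partial$; it is $p$-dimensional. $\operatorname{rad}(L)$ is the solvable radical and $C(L)$ the center of $L$. $P\rtimes I$ denotes a semidirect sum: a Lie algebra which is the vector space direct sum of a subalgebra $P$ and an ideal $I$. $V(1)$ is the irreducible 2-dimensional $\mathfrak{sl}(2,k)$-module: for a basis $(e,h,f)$ of $\mathfrak{sl}(2,k)$ with $[h,e]=2e$, $[h,f]=-2f$, $[e,f]=h$, it has a basis $v_0,v_1$ with $h.v_0=v_0$, $h.v_1=-v_1$, $e.v_0=0$, $e.v_1=v_0$, $f.v_0=v_1$, $f.v_1=0$. In item 3, $V(1)$ is regarded as the abelian ideal $kv_0\oplus kv_1$. *)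

theory Defs
  imports "HOL-Analysis.Determinants" "HOL-Library.Function_Algebras"
begin

section \<open>Lie algebras\<close>

text \<open>
  A Lie algebra is a subspace \<^term>\<open>carrier\<close> of an ambient vector space (a whole type, whose
  addition is that of the type class) together with a bracket. Subalgebras are
  thus obtained by shrinking the carrier.
\<close>

record ('k, 'v) lie =
  carrier :: "'v set"
  smul :: "'k \<Rightarrow> 'v \<Rightarrow> 'v"
  brk :: "'v \<Rightarrow> 'v \<Rightarrow> 'v"

locale lie_algebra = vector_space "smul L"
  for L :: "('k::field, 'v::ab_group_add) lie" +
  assumes carrier_subspace: "subspace (carrier L)"
    and brk_closed: "\<lbrakk>x \<in> carrier L; y \<in> carrier L\<rbrakk> \<Longrightarrow> brk L x y \<in> carrier L"
    and brk_add_left: "\<lbrakk>x \<in> carrier L; y \<in> carrier L; z \<in> carrier L\<rbrakk>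
          \<Longrightarrow> brk L (x + y) z = brk L x z + brk L y z"
    and brk_add_right: "\<lbrakk>x \<in> carrier L; y \<in> carrier L; z \<in> carrier L\<rbrakk>
          \<Longrightarrow> brk L x (y + z) = brk L x y + brk L x z"
    and brk_smul_left: "\<lbrakk>x \<in> carrier L; y \<in> carrier L\<rbrakk> \<Longrightarrow> brk L (smul L c x) y = smul L c (brk L x y)"
    and brk_smul_right: "\<lbrakk>x \<in> carrier L; y \<in> carrier L\<rbrakk> \<Longrightarrow> brk L x (smul L c y) = smul L c (brk L x y)"
    and brk_self: "x \<in> carrier L \<Longrightarrow> brk L x x = 0"
    and jacobi: "\<lbrakk>x \<in> carrier L; y \<in> carrier L; z \<in> carrier L\<rbrakk>
          \<Longrightarrow> brk L x (brk L y z) + brk L y (brk L z x) + brk L z (brk L x y) = 0"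

definition lie_dim :: "('k::field, 'v::ab_group_add) lie \<Rightarrow> nat" where
  "lie_dim L = vector_space.dim (smul L) (carrier L)"

definition lie_basis :: "('k::field, 'v::ab_group_add) lie \<Rightarrow> 'v list \<Rightarrow> 'v set \<Rightarrow> bool" where
  "lie_basis L xs S \<longleftrightarrow> distinct xs \<and> \<not> module.dependent (smul L) (set xs) \<and>
     module.span (smul L) (set xs) = S"

definition lie_hom ::
  "('k::field, 'v::ab_group_add) lie \<Rightarrow> ('k, 'w::ab_group_add) lie \<Rightarrow> ('v \<Rightarrow> 'w) \<Rightarrow> bool" where
  "lie_hom L M \<phi> \<longleftrightarrow>
     \<phi> ` carrier L \<subseteq> carrier M \<and>
     (\<forall>x\<in>carrier L. \<forall>y\<in>carrier L. \<phi> (x + y) = \<phi> x + \<phi> y) \<and>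
     (\<forall>c. \<forall>x\<in>carrier L. \<phi> (smul L c x) = smul M c (\<phi> x)) \<and>
     (\<forall>x\<in>carrier L. \<forall>y\<in>carrier L. \<phi> (brk L x y) = brk M (\<phi> x) (\<phi> y))"

definition lie_isomorphism ::
  "('k::field, 'v::ab_group_add) lie \<Rightarrow> ('k, 'w::ab_group_add) lie \<Rightarrow> ('v \<Rightarrow> 'w) \<Rightarrow> bool" where
  "lie_isomorphism L M \<phi> \<longleftrightarrow> lie_hom L M \<phi> \<and> bij_betw \<phi> (carrier L) (carrier M)"

definition lie_iso ::
  "('k::field, 'v::ab_group_add) lie \<Rightarrow> ('k, 'w::ab_group_add) lie \<Rightarrow> bool"
  (infix "\<cong>\<^sub>L" 50) where
  "L \<cong>\<^sub>L M \<longleftrightarrow> (\<exists>\<phi>. lie_isomorphism L M \<phi>)"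

definition lie_subalgebra :: "'v set \<Rightarrow> ('k::field, 'v::ab_group_add) lie \<Rightarrow> bool" where
  "lie_subalgebra P L \<longleftrightarrow> module.subspace (smul L) P \<and> P \<subseteq> carrier L \<and>
     (\<forall>x\<in>P. \<forall>y\<in>P. brk L x y \<in> P)"

definition lie_ideal :: "'v set \<Rightarrow> ('k::field, 'v::ab_group_add) lie \<Rightarrow> bool" where
  "lie_ideal I L \<longleftrightarrow> module.subspace (smul L) I \<and> I \<subseteq> carrier L \<and>
     (\<forall>x\<in>carrier L. \<forall>y\<in>I. brk L x y \<in> I)"

definition lie_prod :: "('k::field, 'v::ab_group_add) lie \<Rightarrow> 'v set \<Rightarrow> 'v set \<Rightarrow> 'v set" where
  "lie_prod L A B = module.span (smul L) {brk L a b | a b. a \<in> A \<and> b \<in> B}"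

primrec derived_series ::
  "('k::field, 'v::ab_group_add) lie \<Rightarrow> 'v set \<Rightarrow> nat \<Rightarrow> 'v set" where
  "derived_series L A 0 = A"
| "derived_series L A (Suc n) = lie_prod L (derived_series L A n) (derived_series L A n)"

definition lie_solvable :: "('k::field, 'v::ab_group_add) lie \<Rightarrow> 'v set \<Rightarrow> bool" where
  "lie_solvable L A \<longleftrightarrow> (\<exists>n. derived_series L A n = {0})"

text \<open>The sum of all solvable ideals; in finite dimension it is the largest solvable ideal.\<close>

definition lie_rad :: "('k::field, 'v::ab_group_add) lie \<Rightarrow> 'v set" where
  "lie_rad L = module.span (smul L) (\<Union>{I. lie_ideal I L \<and> lie_solvable L I})"

definition lie_center :: "('k::field, 'v::ab_group_add) lie \<Rightarrow> 'v set" where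
  "lie_center L = {x \<in> carrier L. \<forall>y\<in>carrier L. brk L x y = 0}"

definition semidirect_sum ::
  "('k::field, 'v::ab_group_add) lie \<Rightarrow> 'v set \<Rightarrow> 'v set \<Rightarrow> bool" where
  "semidirect_sum L P I \<longleftrightarrow> lie_subalgebra P L \<and> lie_ideal I L \<and>
     P \<inter> I = {0} \<and> carrier L = {a + b | a b. a \<in> P \<and> b \<in> I}"


section \<open>The algebra $W(1;\underline{1})$\<close>

text \<open>
  An element of $O(1;\underline{1})$ is the function of its coordinates \<open>r \<mapsto> f r\<close> with respect to the
  basis \<open>x\<^sup>(\<^sup>r\<^sup>)\<close>, zero from \<open>p = CHAR('k)\<close> on. An element \<open>f\<partial>\<close> of $W(1;\underline{1})$ is
  represented by \<open>f\<close>, which it determines because \<open>f = (f\<partial>)(x)\<close>.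
\<close>

definition O11 :: "(nat \<Rightarrow> 'k::field) set" where
  "O11 = {f. \<forall>n\<ge>CHAR('k). f n = 0}"

definition O11_basis :: "nat \<Rightarrow> nat \<Rightarrow> 'k::field" where
  "O11_basis r = (\<lambda>n. if n = r \<and> r < CHAR('k) then 1 else 0)"

definition O11_mult :: "(nat \<Rightarrow> 'k::field) \<Rightarrow> (nat \<Rightarrow> 'k) \<Rightarrow> nat \<Rightarrow> 'k" where
  "O11_mult f g = (\<lambda>n. if n < CHAR('k)
     then \<Sum>r\<le>n. of_nat (n choose r) * f r * g (n - r) else 0)"

definition O11_deriv :: "(nat \<Rightarrow> 'k::field) \<Rightarrow> nat \<Rightarrow> 'k" where
  "O11_deriv f = (\<lambda>n. f (Suc n))"

definition W11 :: "('k::field, nat \<Rightarrow> 'k) lie" where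
  "W11 = \<lparr>carrier = O11, smul = (\<lambda>c f n. c * f n),
     brk = (\<lambda>f g. O11_mult f (O11_deriv g) - O11_mult g (O11_deriv f))\<rparr>"

lemma O11_mult_basis:
  assumes "r < CHAR('k::field)" "s < CHAR('k)"
  shows "O11_mult (O11_basis r) (O11_basis s :: nat \<Rightarrow> 'k) =
    (\<lambda>n. of_nat ((r + s) choose r) * O11_basis (r + s) n)"
proof
  fix n
  show "O11_mult (O11_basis r) (O11_basis s :: nat \<Rightarrow> 'k) n =
    of_nat ((r + s) choose r) * O11_basis (r + s) n"
  proof (cases "n < CHAR('k)")
    case True
    have "(\<Sum>i\<le>n. of_nat (n choose i) * O11_basis r i * (O11_basis s (n - i) :: 'k))
      = (\<Sum>i\<le>n. if i = r then (if n - r = s then of_nat (n choose r) else 0) else 0)"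
      using assms by (intro sum.cong) (auto simp: O11_basis_def)
    also have "\<dots> = (if r \<le> n \<and> n - r = s then of_nat (n choose r) else 0)"
      by (subst sum.delta) auto
    finally show ?thesis
      using True assms by (auto simp: O11_mult_def O11_basis_def)
  qed (auto simp: O11_mult_def O11_basis_def)
qed

lemma O11_deriv_basis:
  "O11_deriv (O11_basis 0 :: nat \<Rightarrow> 'k::field) = 0"
  "Suc r < CHAR('k) \<Longrightarrow> O11_deriv (O11_basis (Suc r) :: nat \<Rightarrow> 'k) = O11_basis r"
  by (auto simp: O11_deriv_def O11_basis_def fun_eq_iff)


section \<open>The algebra $\mathfrak{sl}(2,k)$ and its module $V(1)$\<close>

definition sl2 :: "('k::field, 'k^2^2) lie" where
  "sl2 = \<lparr>carrier = {A. trace A = 0}, smul = (\<lambda>c A. \<chi> i. c *s A $ i),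
     brk = (\<lambda>A B. A ** B - B ** A)\<rparr>"

text \<open>
  $V(1)$ is the space \<^typ>\<open>'k^2\<close> of column vectors, on which \<^term>\<open>sl2\<close> acts by
  matrix-vector multiplication. The lemmas below give the usual structure constants for the
  bases \<open>(sl2_e, sl2_h, sl2_f)\<close> and \<open>(axis 1 1, axis 2 1)\<close>, and the irreducibility of $V(1)$.
\<close>

definition sl2_e :: "'k::field^2^2" where
  "sl2_e = (\<chi> i j. if i = 1 \<and> j = 2 then 1 else 0)"

definition sl2_h :: "'k::field^2^2" where
  "sl2_h = (\<chi> i j. if i = j then (if i = 1 then 1 else - 1) else 0)"

definition sl2_f :: "'k::field^2^2" where
  "sl2_f = (\<chi> i j. if i = 2 \<and> j = 1 then 1 else 0)"

lemmas sl2_simps = sl2_def sl2_e_def sl2_h_def sl2_f_def trace_def vec_eq_iff sum_2 forall_2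
  matrix_matrix_mult_def matrix_vector_mult_def axis_def vector_scalar_mult_def

lemma sl2_lie_algebra: "lie_algebra (sl2 :: ('k::field, 'k^2^2) lie)"
proof -
  interpret V: vector_space "\<lambda>c A. (\<chi> i. c *s (A :: 'k^2^2) $ i)"
    by unfold_locales (auto simp: vec_eq_iff algebra_simps)
  have "V.subspace {A. trace A = 0}"
  proof (rule V.subspaceI)
    fix A B :: "'k^2^2" and c :: 'k
    assume A: "A \<in> {A. trace A = 0}"
    show "(\<chi> i. c *s A $ i) \<in> {A. trace A = 0}"
      using A by (simp add: trace_def sum_2 flip: distrib_left)
    assume "B \<in> {A. trace A = 0}"
    with A show "A + B \<in> {A. trace A = 0}"
      by (simp add: trace_add)
  qed (simp add: trace_def)
  then show ?thesis
    by unfold_locales (auto simp: sl2_simps algebra_simps)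
qed

lemma sl2_structure:
  "brk sl2 sl2_h sl2_e = smul sl2 2 (sl2_e :: 'k::field^2^2)"
  "brk sl2 sl2_h sl2_f = smul sl2 (- 2) (sl2_f :: 'k^2^2)"
  "brk sl2 sl2_e sl2_f = (sl2_h :: 'k^2^2)"
  by (auto simp: sl2_simps)

lemma V1_structure:
  "sl2_h *v axis 1 1 = (axis 1 1 :: 'k::field^2)" "sl2_h *v axis 2 1 = - (axis 2 1 :: 'k^2)"
  "sl2_e *v axis 1 1 = (0 :: 'k^2)" "sl2_e *v axis 2 1 = (axis 1 1 :: 'k^2)"
  "sl2_f *v axis 1 1 = (axis 2 1 :: 'k^2)" "sl2_f *v axis 2 1 = (0 :: 'k^2)"
  by (auto simp: sl2_simps)

lemma V1_irreducible:
  fixes U :: "('k::field^2) set"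
  assumes U: "vec.subspace U" and inv: "\<And>A v. A \<in> carrier sl2 \<Longrightarrow> v \<in> U \<Longrightarrow> A *v v \<in> U"
  shows "U = {0} \<or> U = UNIV"
proof (rule disjCI)
  assume "U \<noteq> UNIV"
  show "U = {0}"
  proof (rule ccontr)
    assume "U \<noteq> {0}"
    then obtain v where v: "v \<in> U" "v \<noteq> 0"
      using vec.subspace_0[OF U] by blast
    have ef: "sl2_e \<in> carrier sl2" "sl2_f \<in> carrier (sl2 :: ('k, 'k^2^2) lie)"
      by (auto simp: sl2_simps)
    have "axis 1 1 \<in> U \<or> axis 2 1 \<in> U"
    proof (cases "v $ 2 = 0")
      case True
      have "inverse (v $ 1) *s v = axis 1 1"
        using v True by (auto simp: vec_eq_iff forall_2 axis_def)
      then show ?thesis using vec.subspace_scale[OF U v(1)] by metis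
    next
      case False
      have "inverse (v $ 2) *s (sl2_e *v v) = axis 1 1"
        using False by (auto simp: sl2_simps)
      then show ?thesis using vec.subspace_scale[OF U inv[OF ef(1) v(1)]] by metis
    qed
    then have ax: "axis 1 1 \<in> U" "axis 2 1 \<in> U"
      using inv[OF ef(1)] inv[OF ef(2)] V1_structure(4,5) by metis+
    have "w \<in> U" for w
    proof -
      have "w = w $ 1 *s axis 1 1 + w $ 2 *s axis 2 1"
        by (auto simp: vec_eq_iff forall_2 axis_def)
      then show ?thesis
        using vec.subspace_add[OF U vec.subspace_scale[OF U ax(1)] vec.subspace_scale[OF U ax(2)]]
        by metis
    qed
    with \<open>U \<noteq> UNIV\<close> show False by blast
  qed
qed

text \<open>
  The subspace \<open>I\<close> is stable under the subalgebra \<open>P\<close> and, for some identification \<open>\<phi>\<close> of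
  $\mathfrak{sl}(2,k)$ with \<open>P\<close>, is isomorphic to $V(1)$ as a module.
\<close>

definition is_V1_module ::
  "('k::field, 'v::ab_group_add) lie \<Rightarrow> 'v set \<Rightarrow> 'v set \<Rightarrow> bool" where
  "is_V1_module L P I \<longleftrightarrow> (\<exists>\<phi> \<psi>.
     lie_isomorphism sl2 (L\<lparr>carrier := P\<rparr>) \<phi> \<and>
     Vector_Spaces.linear (*s) (smul L) \<psi> \<and> bij_betw \<psi> (UNIV :: ('k^2) set) I \<and>
     (\<forall>A\<in>carrier sl2. \<forall>v. brk L (\<phi> A) (\<psi> v) = \<psi> (A *v v)))"

text \<open>
  An extension $0 \to V(1) \to L \to \mathfrak{sl}(2,k) \to 0$ with maps \<open>\<iota>\<close> and \<open>\<pi>\<close>, where $V(1)$ is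
  an abelian ideal on which $L$ acts through \<open>\<pi>\<close> by the given module structure.
\<close>

definition V1_extension ::
  "('k::field, 'v::ab_group_add) lie \<Rightarrow> ('k^2 \<Rightarrow> 'v) \<Rightarrow> ('v \<Rightarrow> 'k^2^2) \<Rightarrow> bool" where
  "V1_extension L \<iota> \<pi> \<longleftrightarrow>
     Vector_Spaces.linear (*s) (smul L) \<iota> \<and> inj \<iota> \<and>
     lie_hom L sl2 \<pi> \<and> \<pi> ` carrier L = carrier sl2 \<and>
     range \<iota> = {x \<in> carrier L. \<pi> x = 0} \<and>
     (\<forall>v w. brk L (\<iota> v) (\<iota> w) = 0) \<and>
     (\<forall>x\<in>carrier L. \<forall>v. brk L x (\<iota> v) = \<iota> (\<pi> x *v v))"

definition split_extension ::
  "('k::field, 'v::ab_group_add) lie \<Rightarrow> ('v \<Rightarrow> 'k^2^2) \<Rightarrow> bool" where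
  "split_extension L \<pi> \<longleftrightarrow> (\<exists>\<sigma>. lie_hom sl2 L \<sigma> \<and> (\<forall>A\<in>carrier sl2. \<pi> (\<sigma> A) = A))"


section \<open>The list\<close>

datatype entry = Witt | Central | Noncommutative | Split_V1 | Nonsplit_V1

primrec listed :: "entry \<Rightarrow> ('k::field, 'v::ab_group_add) lie \<Rightarrow> bool" where
  "listed Witt L \<longleftrightarrow> CHAR('k) = 5 \<and> L \<cong>\<^sub>L (W11 :: ('k, nat \<Rightarrow> 'k) lie)"
| "listed Central L \<longleftrightarrow> (\<exists>P.
     semidirect_sum L P (lie_rad L) \<and> L\<lparr>carrier := P\<rparr> \<cong>\<^sub>L (sl2 :: ('k, 'k^2^2) lie) \<and>
     lie_rad L = lie_center L)"
| "listed Noncommutative L \<longleftrightarrow> (\<exists>P.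
     semidirect_sum L P (lie_rad L) \<and> L\<lparr>carrier := P\<rparr> \<cong>\<^sub>L (sl2 :: ('k, 'k^2^2) lie) \<and>
     (\<exists>h u. lie_basis L [h, u] (lie_rad L) \<and> brk L h u = u) \<and>
     lie_prod L P (lie_rad L) = {0})"
| "listed Split_V1 L \<longleftrightarrow> (\<exists>P.
     semidirect_sum L P (lie_rad L) \<and> L\<lparr>carrier := P\<rparr> \<cong>\<^sub>L (sl2 :: ('k, 'k^2^2) lie) \<and>
     lie_prod L (lie_rad L) (lie_rad L) = {0} \<and> is_V1_module L P (lie_rad L))"
| "listed Nonsplit_V1 L \<longleftrightarrow> CHAR('k) = 3 \<and>
     (\<exists>\<iota> \<pi>. V1_extension L \<iota> \<pi> \<and> \<not> split_extension L \<pi>) \<and>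
     (\<exists>e h f v0 v1. lie_basis L [e, h, f, v0, v1] (carrier L) \<and>
       brk L h e = - e + v1 \<and> brk L h v0 = v0 \<and> brk L e v0 = 0 \<and> brk L f v0 = v1 \<and>
       brk L h f = f \<and> brk L h v1 = - v1 \<and> brk L e v1 = v0 \<and> brk L f v1 = 0 \<and>
       brk L e f = h \<and> brk L v0 v1 = 0)"

end

theory Submission
  imports Defs "HOL-Computational_Algebra.Primes" "HOL-Computational_Algebra.Polynomial"
begin

text \<open>
  Nonsolvability provides a nonzero perfect ideal \<open>D\<close>, the last term of the derived series.
  Most of the proof finds out what a perfect Lie algebra \<open>D\<close> of dimension at most five can be.
  Dimensions one and two are impossible, as brackets span at most a line there. Dimension four
  is impossible as well: a perfect algebra is unimodular, so \<open>df \<and> df = d(f \<and> df) = 0\<close> for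
  each linear form \<open>f\<close> on a 4-dimensional one, and these differentials would span a totally
  isotropic subspace of dimension four in the 6-dimensional quadratic space of 2-forms
  (\<open>no_perfect4_constants\<close>).

  If \<open>D\<close> has dimension three, it is \<open>sl(2)\<close> (\<open>perfect_dim3_sl2\<close>). All derivations of \<open>sl(2)\<close>
  are inner, hence \<open>L\<close> is the direct sum of \<open>D\<close> and a centralizer of dimension two, which
  gives the entries with a central or a noncommutative radical (\<open>sl2_ideal_imp_table\<close>).

  If \<open>D = L\<close> is not simple, the exclusion of dimension four, applied to quotients, leaves only
  ideals of dimension two. Such an ideal is the module \<open>V(1)\<close> of the quotient \<open>sl(2)\<close>
  (\<open>perfect_not_simple_imp_ext\<close>). The extension depends on two parameters. They can be changed
  by multiples of 3, so the extension splits for \<open>p \<noteq> 3\<close>; for \<open>p = 3\<close> they transform like a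
  vector of a Frobenius twist of \<open>V(1)\<close>, and all nonzero vectors are equivalent
  (\<open>ext_table_split\<close>, \<open>ext_table_nonsplit\<close>).

  If \<open>D = L\<close> is simple, the finiteness of the field enters through the theorem of Chevalley
  and Warning. The Pfaffian that represents \<open>f \<and> df \<and> df\<close> is a cubic polynomial in the five
  coordinates of \<open>f\<close>, so it has a nontrivial zero. This yields \<open>f \<noteq> 0\<close> and \<open>x \<noteq> 0\<close> with
  \<open>f x = 0\<close> and \<open>f\<close> vanishing on \<open>[x, L]\<close> (\<open>exists_degenerate_form\<close>). According to the
  dimension of the radical of the skew form \<open>f [u, v]\<close>, which is one or three, one finds an
  \<open>x\<close> whose adjoint map is a single Jordan block with image of its fourth power \<open>k x\<close>, or a
  subalgebra of codimension one (\<open>rank4_cases\<close>, \<open>rank2_imp_codim1\<close>). A subalgebra of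
  codimension one defines a filtration that again leads to such a Jordan block
  (\<open>codim1_imp_chain\<close>), and the Jordan block determines the multiplication: \<open>p = 5\<close> and \<open>L\<close> is
  \<open>W(1;1)\<close> (\<open>chain_imp_witt\<close>; finite fields contain the fifth root that removes the last
  parameter).

  The five types are told apart by invariants of the bracket (\<open>entry_criterion_unique\<close>): the
  existence of nonzero abelian ideals and of central elements, perfectness, and the splitting
  of the extension by the largest abelian ideal.

  All these computations take place for a bracket on the coordinate space. The locale
  \<open>lie_model\<close> relates it to a Lie algebra on a carrier, where the radical, the semidirect sums
  and the isomorphisms of the list are then identified.
\<close>


section \<open>Finite fields and the theorem of Chevalley and Warning\<close>

lemma finite_field_power_card_minus_1:
  fixes x :: "'k::{field,finite}"
  assumes "x \<noteq> 0"
  shows "x ^ (CARD('k) - 1) = 1"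
proof -
  have "x ^ (CARD('k) - 1) * \<Prod>(UNIV - {0}) = (\<Prod>y\<in>UNIV - {0}. x * y)"
    by (simp add: prod.distrib)
  also have "\<dots> = (\<Prod>y\<in>UNIV - {0}. y)"
    by (rule prod.reindex_bij_witness[of _ "\<lambda>y. y / x" "\<lambda>y. x * y"]) (use assms in auto)
  finally show ?thesis
    by simp
qed

lemma finite_field_surj_power_CHAR:
  fixes g :: "'k::{field,finite}"
  shows "\<exists>t. t ^ CHAR('k) = g"
proof -
  have pr: "prime CHAR('k)"
    by (rule prime_CHAR_semidom) (simp add: finite_imp_CHAR_pos)
  have "inj (\<lambda>t::'k. t ^ CHAR('k))"
  proof (rule injI)
    fix s t :: 'k
    assume eq: "s ^ CHAR('k) = t ^ CHAR('k)"
    have "s ^ CHAR('k) = ((s - t) + t) ^ CHAR('k)" by simp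
    also have "\<dots> = (s - t) ^ CHAR('k) + t ^ CHAR('k)"
      by (rule freshmans_dream) (use pr in auto)
    finally show "s = t"
      using eq by simp
  qed
  then have "surj (\<lambda>t::'k. t ^ CHAR('k))"
    by (intro finite_UNIV_inj_surj) auto
  then show ?thesis
    by (metis surjD)
qed

lemma finite_field_sum_power_eq_0:
  assumes "m < CARD('k::{field,finite}) - 1"
  shows "(\<Sum>t\<in>UNIV. (t::'k) ^ m) = 0"
proof (cases "m = 0")
  case True
  \<comment> \<open>Translation by 1 permutes the field.\<close>
  have "(\<Sum>t\<in>UNIV. (t::'k) + 1) = (\<Sum>t\<in>UNIV. t)"
    by (rule sum.reindex_bij_witness[of _ "\<lambda>t. t - 1" "\<lambda>t. t + 1"]) auto
  then show ?thesis
    using True by (simp add: sum.distrib)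
next
  case False
  have "\<exists>g::'k. g \<noteq> 0 \<and> g ^ m \<noteq> 1"
  proof (rule ccontr)
    assume "\<not> ?thesis"
    then have sub: "UNIV - {0} \<subseteq> {x::'k. poly (monom 1 m - 1) x = 0}"
      by (auto simp: poly_monom)
    have ne: "monom 1 m - 1 \<noteq> (0 :: 'k poly)"
      using False by (metis eq_iff_diff_eq_0 monom_eq_1_iff)
    have "CARD('k) - 1 = card (UNIV - {0::'k})"
      by simp
    also have "\<dots> \<le> card {x::'k. poly (monom 1 m - 1) x = 0}"
      by (rule card_mono[OF _ sub]) simp
    also have "\<dots> \<le> degree (monom 1 m - 1 :: 'k poly)"
      by (rule card_poly_roots_bound[OF ne])
    also have "\<dots> \<le> m"
      by (rule order.trans[OF degree_diff_le_max]) (simp add: degree_monom_eq)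
    finally show False
      using assms by simp
  qed
  then obtain g :: 'k where g: "g \<noteq> 0" "g ^ m \<noteq> 1"
    by blast
  have "g ^ m * (\<Sum>t\<in>UNIV. (t::'k) ^ m) = (\<Sum>t\<in>UNIV. (g * t) ^ m)"
    by (simp add: sum_distrib_left power_mult_distrib)
  also have "\<dots> = (\<Sum>t\<in>UNIV. t ^ m)"
    by (rule sum.reindex_bij_witness[of _ "\<lambda>t. t / g" "\<lambda>t. g * t"]) (use g in auto)
  finally show ?thesis
    using g by simp
qed

text \<open>
  Functions of the first \<open>n\<close> variables that are given by a polynomial of total degree at most
  \<open>d\<close>. The theorem of Chevalley and Warning is needed for a single polynomial whose
  coefficients are the structure constants of a Lie algebra, so evaluations suffice.
\<close>

inductive polyfun :: "nat \<Rightarrow> nat \<Rightarrow> ((nat \<Rightarrow> 'k::comm_ring_1) \<Rightarrow> 'k) \<Rightarrow> bool" for n d where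
  monomial: "(\<Sum>i<n. m i) \<le> d \<Longrightarrow> polyfun n d (\<lambda>a. c * (\<Prod>i<n. a i ^ m i))"
| add: "polyfun n d F \<Longrightarrow> polyfun n d G \<Longrightarrow> polyfun n d (\<lambda>a. F a + G a)"

lemma polyfun_const: "polyfun n d (\<lambda>a. c)"
  using polyfun.monomial[of "\<lambda>_. 0" n d c] by simp

lemma polyfun_var:
  assumes "i < n"
  shows "polyfun n 1 (\<lambda>a. a i)"
proof -
  have "(\<Prod>j<n. a j ^ (if j = i then 1 else 0)) = a i" for a :: "nat \<Rightarrow> 'a"
  proof -
    have "(\<Prod>j<n. a j ^ (if j = i then 1 else 0)) = (\<Prod>j<n. if j = i then a j else 1)"
      by (rule prod.cong) auto
    then show ?thesis
      using assms by (simp add: prod.delta)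
  qed
  then show ?thesis
    using polyfun.monomial[of "\<lambda>j. if j = i then 1 else 0" n 1 "1 :: 'a"] assms
    by (simp only: mult_1_left) (simp add: sum.delta)
qed

lemma polyfun_mult:
  assumes "polyfun n d F" "polyfun n e G"
  shows "polyfun n (d + e) (\<lambda>a. F a * G a)"
  using assms
proof (induction rule: polyfun.induct)
  case (monomial m c)
  from this(2) show ?case
  proof (induction rule: polyfun.induct)
    case (monomial m' c')
    have "polyfun n (d + e) (\<lambda>a. (c * c') * (\<Prod>i<n. a i ^ (m i + m' i)))"
      by (rule polyfun.monomial) (use \<open>sum m _ \<le> d\<close> monomial in \<open>simp add: sum.distrib\<close>)
    then show ?case
      by (simp add: power_add prod.distrib mult_ac)
  next
    case (add F G)
    then show ?case
      using polyfun.add by (fastforce simp: distrib_left)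
  qed
next
  case (add F' G')
  then show ?case
    using polyfun.add by (fastforce simp: distrib_right)
qed

lemma polyfun_cmult: "polyfun n d F \<Longrightarrow> polyfun n d (\<lambda>a. c * F a)"
  using polyfun_mult[OF polyfun_const[of n 0 c]] by simp

lemma polyfun_uminus: "polyfun n d F \<Longrightarrow> polyfun n d (\<lambda>a. - F a)"
  using polyfun_cmult[of n d F "-1"] by simp

lemma polyfun_diff: "polyfun n d F \<Longrightarrow> polyfun n d G \<Longrightarrow> polyfun n d (\<lambda>a. F a - G a)"
  using polyfun.add[OF _ polyfun_uminus] by fastforce

lemma polyfun_sum:
  assumes "\<And>i. i \<in> S \<Longrightarrow> polyfun n d (F i)"
  shows "polyfun n d (\<lambda>a. \<Sum>i\<in>S. F i a)"
  using assms
  by (induction S rule: infinite_finite_induct) (auto intro: polyfun_const polyfun.add)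

lemma polyfun_power: "polyfun n d F \<Longrightarrow> polyfun n (k * d) (\<lambda>a. F a ^ k)"
  by (induction k) (auto intro: polyfun_const polyfun_mult)

lemma polyfun_cong:
  assumes "polyfun n d F" "\<And>i. i < n \<Longrightarrow> a i = b i"
  shows "F a = F b"
  using assms by (induction rule: polyfun.induct) auto

lemma sum_polyfun_eq_0:
  fixes F :: "(nat \<Rightarrow> 'k::{field,finite}) \<Rightarrow> 'k"
  assumes "polyfun n d F" "d < n * (CARD('k) - 1)"
  shows "(\<Sum>a\<in>PiE {..<n} (\<lambda>_. UNIV). F a) = 0"
  using assms
proof (induction rule: polyfun.induct)
  case (monomial m c)
  have "\<exists>i<n. m i < CARD('k) - 1"
  proof (rule ccontr)
    assume "\<not> ?thesis"
    then have "(\<Sum>i<n. CARD('k) - 1) \<le> (\<Sum>i<n. m i)"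
      by (intro sum_mono) (metis lessThan_iff not_less)
    then show False
      using monomial by simp
  qed
  then have "(\<Prod>i<n. \<Sum>t\<in>UNIV. (t::'k) ^ m i) = 0"
    using finite_field_sum_power_eq_0 by fastforce
  moreover have "(\<Prod>i<n. \<Sum>t\<in>UNIV. (t::'k) ^ m i) =
      (\<Sum>a\<in>PiE {..<n} (\<lambda>_. UNIV). \<Prod>i<n. a i ^ m i)"
    by (rule prod_sum_PiE) auto
  ultimately show ?case
    by (simp flip: sum_distrib_left)
qed (simp add: sum.distrib)

text \<open>
  By Fermat, \<open>1 - F\<^sup>q\<^sup>-\<^sup>1\<close> is the indicator function of the zeros of \<open>F\<close>. Its sum over the
  whole space vanishes for degree reasons, so the zero at the origin cannot be the only one.
\<close>

theorem chevalley_warning: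
  fixes F :: "(nat \<Rightarrow> 'k::{field,finite}) \<Rightarrow> 'k"
  assumes F: "polyfun n d F" and "d < n" and "F (\<lambda>_. 0) = 0"
  shows "\<exists>a. (\<exists>i<n. a i \<noteq> 0) \<and> F a = 0"
proof (rule ccontr)
  assume neg: "\<not> ?thesis"
  let ?q = "CARD('k) - 1" and ?A = "PiE {..<n} (\<lambda>_. UNIV :: 'k set)"
  let ?o = "\<lambda>i\<in>{..<n}. (0::'k)"
  have "card {0, 1::'k} \<le> CARD('k)"
    by (rule card_mono) auto
  then have q: "?q > 0"
    by simp
  have ind: "1 - F a ^ ?q = (if a = ?o then 1 else 0)" if "a \<in> ?A" for a
  proof (cases "a = ?o")
    case True
    then have "F a = F (\<lambda>_. 0)"
      by (intro polyfun_cong[OF F]) auto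
    then show ?thesis
      using assms True q by simp
  next
    case False
    then have "\<exists>i<n. a i \<noteq> 0"
      using that by (force simp: PiE_iff extensional_def fun_eq_iff split: if_splits)
    then show ?thesis
      using neg False finite_field_power_card_minus_1[of "F a"] by auto
  qed
  have "polyfun n (?q * d) (\<lambda>a. 1 - F a ^ ?q)"
    by (intro polyfun_diff polyfun_const polyfun_power F)
  then have "(\<Sum>a\<in>?A. 1 - F a ^ ?q) = 0"
    by (rule sum_polyfun_eq_0) (use \<open>d < n\<close> q in simp)
  moreover have "(\<Sum>a\<in>?A. 1 - F a ^ ?q) = (\<Sum>a\<in>?A. if a = ?o then 1 else 0)"
    by (rule sum.cong) (use ind in auto)
  moreover have "?o \<in> ?A" "finite ?A"
    by (auto intro: finite_PiE)
  ultimately show False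
    by (simp add: sum.delta)
qed


section \<open>Linear algebra with explicit coefficients\<close>

text \<open>
  Gaussian elimination of the last unknown.
\<close>

lemma homogeneous_system:
  fixes A :: "nat \<Rightarrow> nat \<Rightarrow> 'k::field"
  assumes "m < n"
  shows "\<exists>c. (\<exists>i<n. c i \<noteq> 0) \<and> (\<forall>j<m. (\<Sum>i<n. c i * A j i) = 0)"
  using assms
proof (induction m arbitrary: n A)
  case 0
  then show ?case
    by (intro exI[of _ "\<lambda>_. 1"]) auto
next
  case (Suc m)
  then obtain n' where n: "n = Suc n'" "m < n'"
    by (cases n) auto
  show ?case
  proof (cases "\<exists>i<n. A m i \<noteq> 0")
    case False
    obtain c where "\<exists>i<n. c i \<noteq> 0" "\<forall>j<m. (\<Sum>i<n. c i * A j i) = 0"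
      using Suc.IH[of n A] Suc.prems by auto
    then show ?thesis
      using False by (intro exI[of _ c]) (auto simp: less_Suc_eq)
  next
    case True
    then obtain r where r: "r < n" "A m r \<noteq> 0"
      by blast
    let ?s = "\<lambda>i. if i = r then n' else if i = n' then r else i"
    have bij: "bij_betw ?s {..<n} {..<n}"
      using r(1) n by (intro bij_betw_byWitness[of _ ?s]) auto
    let ?B = "\<lambda>j i. A j (?s i) - A m (?s i) / A m r * A j r"
    obtain c where c: "\<exists>i<n'. c i \<noteq> 0" "\<forall>j<m. (\<Sum>i<n'. c i * ?B j i) = 0"
      using Suc.IH[OF n(2), of ?B] by blast
    define d where "d i = (if i = n' then - (\<Sum>i<n'. c i * A m (?s i)) / A m r else c i)" for i
    have sum_eq: "(\<Sum>i<n. d (?s i) * A j i) =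
        (\<Sum>i<n'. c i * A j (?s i)) - (\<Sum>i<n'. c i * A m (?s i)) / A m r * A j r" for j
    proof -
      have "(\<Sum>i<n. d (?s i) * A j i) = (\<Sum>i<n. d i * A j (?s i))"
        by (rule sum.reindex_bij_witness[of _ ?s ?s]) (use r(1) n in auto)
      then show ?thesis
        using n by (simp add: d_def)
    qed
    have "(\<Sum>i<n. d (?s i) * A j i) = 0" if "j < Suc m" for j
    proof (cases "j = m")
      case True
      then show ?thesis
        using r sum_eq[of m] by simp
    next
      case False
      then have "(\<Sum>i<n'. c i * ?B j i) = 0"
        using c that by auto
      then show ?thesis
        unfolding sum_eq
        by (simp add: algebra_simps sum_subtractf sum_distrib_left sum_divide_distrib)
    qed
    moreover obtain i where "i < n'" "c i \<noteq> 0"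
      using c by blast
    then have "?s i < n \<and> d (?s (?s i)) \<noteq> 0"
      using n r(1) by (auto simp: d_def)
    ultimately show ?thesis
      by (intro exI[of _ "\<lambda>i. d (?s i)"]) blast
  qed
qed

abbreviation form :: "('k::field^'n \<Rightarrow> 'k) \<Rightarrow> bool" where
  "form \<equiv> Vector_Spaces.linear (*s) (*)"

lemma form_add: "form g \<Longrightarrow> g (u + v) = g u + g v"
  by (simp add: Vector_Spaces.linear_iff)

lemma form_scale: "form g \<Longrightarrow> g (c *s v) = c * g v"
  by (simp add: Vector_Spaces.linear_iff)

lemma form_0: "form g \<Longrightarrow> g 0 = 0"
  using form_scale[of g 0] by fastforce

lemma form_minus: "form g \<Longrightarrow> g (- v) = - g v"
  using form_add[of g v "- v"] form_0[of g] by (simp add: eq_neg_iff_add_eq_0 add.commute)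

lemma form_diff: "form g \<Longrightarrow> g (u - v) = g u - g v"
  using form_add[of g u "- v"] form_minus[of g v] by simp

lemma form_sum: "form g \<Longrightarrow> g (\<Sum>i\<in>S. h i) = (\<Sum>i\<in>S. g (h i))"
  by (induction S rule: infinite_finite_induct) (auto simp: form_0 form_add)

lemmas form_simps = form_add form_scale form_0 form_minus form_diff form_sum

lemma formI: "(\<And>u v. g (u + v) = g u + g v) \<Longrightarrow> (\<And>c v. g (c *s v) = c * g v) \<Longrightarrow> form g"
  unfolding Vector_Spaces.linear_iff using vec.vector_space_axioms vector_space_over_itself.vector_space_axioms by auto

lemma subspace_form_kernel: "form g \<Longrightarrow> vec.subspace {v. g v = 0}"
  by (auto simp: vec.subspace_def form_simps)

lemma form_zero_on_span: "form g \<Longrightarrow> (\<And>v. v \<in> S \<Longrightarrow> g v = 0) \<Longrightarrow> v \<in> vec.span S \<Longrightarrow> g v = 0"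
  using vec.span_minimal[of S "{v. g v = 0}"] subspace_form_kernel by blast

lemma form_separating:
  fixes w :: "'k::field^'n"
  assumes S: "vec.subspace S" and w: "w \<notin> S"
  obtains g where "form g" "g w = 1" "\<And>s. s \<in> S \<Longrightarrow> g s = 0"
proof -
  obtain B where B: "B \<subseteq> S" "vec.independent B" "S \<subseteq> vec.span B"
    "card B = vec.dim S"
    by (rule vec.basis_exists)
  have "vec.span B = S"
    using B S vec.span_minimal[of B S] by auto
  then have ind: "vec.independent (insert w B)"
    using B w by (simp add: vec.independent_insert)
  interpret p: vector_space_pair "(*s) :: 'k \<Rightarrow> 'k^'n \<Rightarrow> 'k^'n" "(*) :: 'k \<Rightarrow> 'k \<Rightarrow> 'k" ..
  obtain g where g: "form g" "\<forall>x\<in>insert w B. g x = (if x = w then 1 else 0)"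
    using p.linear_independent_extend[of "insert w B" "\<lambda>x. if x = w then 1 else 0"] ind by blast
  have "g s = 0" if "s \<in> S" for s
    by (rule form_zero_on_span[OF g(1), of B]) (use g(2) B w that in auto)
  then show thesis
    using that g by auto
qed

text \<open>
  Linear independence of a family indexed by numbers. In contrast to the independence of a
  set, this form is preserved and tested by comparing coefficients; families with few members
  are written \<open>nth [a, b, c]\<close>.
\<close>

definition indep :: "nat \<Rightarrow> (nat \<Rightarrow> 'k::field^'n) \<Rightarrow> bool" where
  "indep n w \<longleftrightarrow> (\<forall>c. (\<Sum>i<n. c i *s w i) = 0 \<longrightarrow> (\<forall>i<n. c i = 0))"

lemma indep_cong: "(\<And>i. i < n \<Longrightarrow> w i = w' i) \<Longrightarrow> indep n w = indep n w'"
  unfolding indep_def by (metis (no_types, lifting) lessThan_iff sum.cong)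

lemma more_vectors_than_dim_dependent:
  fixes w :: "nat \<Rightarrow> 'k::field^'n"
  assumes "CARD('n) < n"
  shows "\<not> indep n w"
proof -
  obtain e where e: "bij_betw e {..<CARD('n)} (UNIV :: 'n set)"
    using ex_bij_betw_nat_finite[of "UNIV :: 'n set"] by (auto simp: atLeast0LessThan)
  obtain c where c: "\<exists>i<n. c i \<noteq> 0" "\<forall>j<CARD('n). (\<Sum>i<n. c i * (w i $ e j)) = 0"
    using homogeneous_system[OF assms, of "\<lambda>j i. w i $ e j"] by blast
  have "(\<Sum>i<n. c i * (w i $ k)) = 0" for k
  proof -
    have "k \<in> e ` {..<CARD('n)}"
      using e by (simp add: bij_betw_def)
    then show ?thesis
      using c by auto
  qed
  then have "(\<Sum>i<n. c i *s w i) = 0"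
    by (simp add: vec_eq_iff)
  then show ?thesis
    using c(1) by (auto simp: indep_def)
qed

lemma indep_extend:
  assumes w: "indep n w" and v: "v \<notin> vec.span (w ` {..<n})"
  shows "indep (Suc n) (w(n := v))"
  unfolding indep_def
proof (intro allI impI)
  fix c i
  assume sum: "(\<Sum>i<Suc n. c i *s (w(n := v)) i) = 0" and i: "i < Suc n"
  have s: "c n *s v = (\<Sum>i<n. - c i *s w i)"
    using sum by (simp add: sum_negf vector_smult_lneg eq_neg_iff_add_eq_0 add.commute)
  have cn: "c n = 0"
  proof (rule ccontr)
    assume "c n \<noteq> 0"
    then have "v = inverse (c n) *s (\<Sum>i<n. - c i *s w i)"
      unfolding s[symmetric] by (simp add: vector_smult_assoc)
    also have "\<dots> \<in> vec.span (w ` {..<n})"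
      by (intro vec.span_scale vec.span_sum vec.span_base) auto
    finally show False
      using v by blast
  qed
  then have "(\<Sum>i<n. c i *s w i) = 0"
    using sum by simp
  then show "c i = 0"
    using w cn i by (auto simp: indep_def less_Suc_eq)
qed

lemma indep_spanning:
  fixes w :: "nat \<Rightarrow> 'k::field^'n"
  assumes "indep CARD('n) w"
  shows "\<exists>c. v = (\<Sum>i<CARD('n). c i *s w i)"
proof -
  obtain c where c: "(\<Sum>i<Suc CARD('n). c i *s (w(CARD('n) := v)) i) = 0" "\<exists>i<Suc CARD('n). c i \<noteq> 0"
    using more_vectors_than_dim_dependent[of "Suc CARD('n)" "w(CARD('n) := v)"]
    by (auto simp: indep_def)
  let ?d = "c CARD('n)"
  have sum: "(\<Sum>i<CARD('n). c i *s w i) + ?d *s v = 0"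
    using c by simp
  have "?d \<noteq> 0"
    using assms c sum by (auto simp: indep_def less_Suc_eq)
  moreover have "?d *s v = - (\<Sum>i<CARD('n). c i *s w i)"
    using sum by (simp add: eq_neg_iff_add_eq_0 add.commute)
  ultimately have "v = inverse ?d *s - (\<Sum>i<CARD('n). c i *s w i)"
    by (metis left_inverse vector_smult_assoc vector_smult_lid)
  also have "\<dots> = (\<Sum>i<CARD('n). (- inverse ?d * c i) *s w i)"
    by (simp add: vec_eq_iff sum_distrib_left sum_negf mult.assoc)
  finally show ?thesis
    by (intro exI[of _ "\<lambda>i. - inverse ?d * c i"])
qed

lemma indep_extend_to_basis:
  fixes w :: "nat \<Rightarrow> 'k::field^'n"
  assumes "indep m w" "m \<le> n" "n \<le> CARD('n)"
  obtains w' where "indep n w'" "\<And>i. i < m \<Longrightarrow> w' i = w i"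
proof -
  have "\<exists>w'. indep n w' \<and> (\<forall>i<m. w' i = w i)"
    using assms(2,3)
  proof (induction n)
    case (Suc n)
    show ?case
    proof (cases "m = Suc n")
      case True
      then show ?thesis using assms by blast
    next
      case False
      then obtain w' where w': "indep n w'" "\<forall>i<m. w' i = w i"
        using Suc by auto
      have "vec.dim (vec.span (w' ` {..<n})) \<le> n"
        using vec.dim_le_card[of "w' ` {..<n}" "w' ` {..<n}"] card_image_le[of "{..<n}" w']
        by (simp add: vec.span_superset)
      then have "vec.span (w' ` {..<n}) \<noteq> UNIV"
        using Suc.prems vec_dim_card[where 'a='k and 'n='n] by (metis Suc_n_not_le_n order.trans)
      then obtain v where "v \<notin> vec.span (w' ` {..<n})"
        by blast
      then show ?thesis
        using w' False Suc.prems
        by (intro exI[of _ "w'(n := v)"] conjI indep_extend) auto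
    qed
  qed (use assms in auto)
  then show thesis
    using that by blast
qed

lemma indep_empty: "indep 0 w"
  by (simp add: indep_def)

lemma indep_dual_forms:
  assumes "indep n w"
  obtains g where "\<And>i. i < n \<Longrightarrow> form (g i)"
    "\<And>i j. i < n \<Longrightarrow> j < n \<Longrightarrow> g i (w j) = (if i = j then 1 else 0)"
proof -
  have "\<exists>g. form g \<and> (\<forall>j<n. g (w j) = (if i = j then 1 else 0))" if i: "i < n" for i
  proof -
    have "w i \<notin> vec.span (w ` ({..<n} - {i}))"
    proof
      have inj: "inj_on w ({..<n} - {i})"
      proof (rule inj_onI, rule ccontr)
        fix j k assume jk: "j \<in> {..<n} - {i}" "k \<in> {..<n} - {i}" "w j = w k" "j \<noteq> k"
        have "(\<Sum>l<n. (if l = j then 1 else if l = k then -1 else 0) *s w l) =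
            (\<Sum>l\<in>{j, k}. (if l = j then 1 else if l = k then -1 else 0) *s w l)"
          by (rule sum.mono_neutral_right) (use jk in auto)
        also have "\<dots> = 0"
          using jk by (simp add: vector_smult_lneg)
        finally show False
          using assms[unfolded indep_def, rule_format, of "\<lambda>l. if l = j then 1 else if l = k then -1 else 0" j] jk
          by simp
      qed
      assume "w i \<in> vec.span (w ` ({..<n} - {i}))"
      then obtain u where "w i = (\<Sum>v\<in>w ` ({..<n} - {i}). u v *s v)"
        using vec.span_finite[of "w ` ({..<n} - {i})"] by auto
      then have wi: "w i = (\<Sum>j\<in>{..<n} - {i}. u (w j) *s w j)"
        using sum.reindex[OF inj, of "\<lambda>v. u v *s v"] by (simp add: o_def)
      have "(\<Sum>j<n. (if j = i then -1 else u (w j)) *s w j) =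
          - w i + (\<Sum>j\<in>{..<n} - {i}. (if j = i then -1 else u (w j)) *s w j)"
        using i by (subst sum.remove[of _ i]) (auto simp: vector_smult_lneg)
      also have "(\<Sum>j\<in>{..<n} - {i}. (if j = i then -1 else u (w j)) *s w j) = w i"
        unfolding wi by (rule sum.cong) auto
      finally have "(\<Sum>j<n. (if j = i then -1 else u (w j)) *s w j) = 0"
        by simp
      then show False
        using assms[unfolded indep_def, rule_format, of "\<lambda>j. if j = i then -1 else u (w j)" i] i
        by simp
    qed
    then obtain g where g: "form g" "g (w i) = 1" "\<And>s. s \<in> vec.span (w ` ({..<n} - {i})) \<Longrightarrow> g s = 0"
      using form_separating[OF vec.subspace_span] by metis
    have "g (w j) = 0" if "j < n" "j \<noteq> i" for j
      using that by (intro g(3) vec.span_base) auto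
    then show ?thesis
      using g by (intro exI[of _ g]) auto
  qed
  then show thesis
    using that by metis
qed


lemma indep_nthI:
  assumes "\<And>cs. length cs = n \<Longrightarrow> (\<Sum>i<n. cs ! i *s w i) = 0 \<Longrightarrow> (\<forall>i<n. cs ! i = 0)"
  shows "indep n w"
  unfolding indep_def
proof (intro allI impI)
  fix c i
  assume "(\<Sum>i<n. c i *s w i) = 0" "i < n"
  then show "c i = 0"
    using assms[of "map c [0..<n]"] by simp
qed

lemma indep_iff_list:
  "indep n w \<longleftrightarrow> (\<forall>cs. length cs = n \<longrightarrow> (\<Sum>i<n. cs ! i *s w i) = 0 \<longrightarrow> (\<forall>i<n. cs ! i = 0))"
  using indep_nthI[of n w] unfolding indep_def by blast

lemma all_lists_of_length:
  "(\<forall>xs. length xs = 0 \<longrightarrow> P xs) \<longleftrightarrow> P []"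
  "(\<forall>xs. length xs = Suc n \<longrightarrow> P xs) \<longleftrightarrow> (\<forall>x xs. length xs = n \<longrightarrow> P (x # xs))"
  by (auto simp: length_Suc_conv)

lemmas indep_list_simps = indep_iff_list numeral_eq_Suc all_lists_of_length lessThan_Suc All_less_Suc ac_simps conj_ac

lemma indep1: "indep 1 (nth [a]) \<longleftrightarrow> a \<noteq> 0"
  unfolding indep_def by (auto dest: spec[of _ "\<lambda>_. 1"])

lemma indep2: "indep 2 (nth [a, b]) \<longleftrightarrow> (\<forall>r s. r *s a + s *s b = 0 \<longrightarrow> r = 0 \<and> s = 0)"
  by (simp add: indep_list_simps)

lemma indep3:
  "indep 3 (nth [a, b, c]) \<longleftrightarrow>
     (\<forall>r s t. r *s a + s *s b + t *s c = 0 \<longrightarrow> r = 0 \<and> s = 0 \<and> t = 0)"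
  by (simp add: indep_list_simps)

lemma indep4:
  "indep 4 (nth [a, b, c, d]) \<longleftrightarrow>
     (\<forall>r s t u. r *s a + s *s b + t *s c + u *s d = 0 \<longrightarrow> r = 0 \<and> s = 0 \<and> t = 0 \<and> u = 0)"
  by (simp add: indep_list_simps)

lemma indep5:
  "indep 5 (nth [a, b, c, d, e]) \<longleftrightarrow>
     (\<forall>r s t u v. r *s a + s *s b + t *s c + u *s d + v *s e = 0 \<longrightarrow>
        r = 0 \<and> s = 0 \<and> t = 0 \<and> u = 0 \<and> v = 0)"
  by (simp add: indep_list_simps)

lemma indep6:
  "indep 6 (nth [a, b, c, d, e, f]) \<longleftrightarrow>
     (\<forall>r s t u v w. r *s a + s *s b + t *s c + u *s d + v *s e + w *s f = 0 \<longrightarrow>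
        r = 0 \<and> s = 0 \<and> t = 0 \<and> u = 0 \<and> v = 0 \<and> w = 0)"
  by (simp add: indep_list_simps)

lemma sum_lessThan_5: "(\<Sum>i<5. F i) = F 0 + F 1 + F 2 + F 3 + F (4::nat)"
  by (simp add: numeral_eq_Suc)

lemma indep5_coordinates:
  fixes a b c d e :: "'k::field^'n"
  assumes "CARD('n) = 5" "indep 5 (nth [a, b, c, d, e])"
  obtains r s t u v where "x = r *s a + s *s b + t *s c + u *s d + v *s e"
  using indep_spanning[of "nth [a, b, c, d, e]" x] assms
  by (auto simp: sum_lessThan_5 numeral_eq_Suc)

section \<open>Pfaffians\<close>

text \<open>
  \<open>pf4 A i j k m\<close> is the Pfaffian of the skew submatrix of \<open>A\<close> with the indices \<open>i, j, k, m\<close>,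
  and \<open>pf6 a A\<close> that of the skew matrix of size six that arises from \<open>A\<close> by adding the row \<open>a\<close>
  and the column \<open>- a\<close>.
\<close>

definition pf4 :: "(nat \<Rightarrow> nat \<Rightarrow> 'k::field) \<Rightarrow> nat \<Rightarrow> nat \<Rightarrow> nat \<Rightarrow> nat \<Rightarrow> 'k" where
  "pf4 A i j k m = A i j * A k m - A i k * A j m + A i m * A j k"

definition pf6 :: "(nat \<Rightarrow> 'k) \<Rightarrow> (nat \<Rightarrow> nat \<Rightarrow> 'k::field) \<Rightarrow> 'k" where
  "pf6 a A = a 0 * pf4 A 1 2 3 4 - a 1 * pf4 A 0 2 3 4 + a 2 * pf4 A 0 1 3 4
     - a 3 * pf4 A 0 1 2 4 + a 4 * pf4 A 0 1 2 3"

lemma less_5_cases: "(m::nat) < 5 \<Longrightarrow> m = 0 \<or> m = 1 \<or> m = 2 \<or> m = 3 \<or> m = 4"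
  by auto

lemma pf4_swap:
  assumes skew: "\<And>i j. A j i = - A i j"
  shows "pf4 A j i k m = - pf4 A i j k m" "pf4 A i k j m = - pf4 A i j k m"
    "pf4 A i j m k = - pf4 A i j k m"
  using skew[of i j] skew[of j k] skew[of k m] by (auto simp: pf4_def)

lemma pf4_repeated:
  assumes skew: "\<And>i j. A j i = - A i j" and "\<And>i. A i i = 0"
  shows "pf4 A i i k m = 0" "pf4 A i j i m = 0" "pf4 A i j k i = 0" "pf4 A i j j m = 0"
    "pf4 A i j k j = 0" "pf4 A i j k k = 0"
  using assms(2) skew[of j i] skew[of k i] skew[of k j] by (auto simp: pf4_def)

lemma pf4_eq_0:
  assumes skew: "\<And>i j. A j i = - A i j" and diag: "\<And>i. A i i = 0"
    and z: "pf4 A 1 2 3 4 = 0" "pf4 A 0 2 3 4 = 0" "pf4 A 0 1 3 4 = 0" "pf4 A 0 1 2 4 = 0"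
      "pf4 A 0 1 2 3 = 0"
    and less: "i < 5" "j < 5" "k < 5" "m < 5"
  shows "pf4 A i j k m = 0"
proof -
  have sorted4: "pf4 A i j k m = 0" if "i < j" "j < k" "k < m" "m < 5" for i j k m
  proof -
    have "i = 0 \<or> i = 1" "j = 1 \<or> j = 2" "k = 2 \<or> k = 3" "m = 3 \<or> m = 4"
      using that by arith+
    then show ?thesis
      using z that by (elim disjE) simp_all
  qed
  \<comment> \<open>Bubble sort of the four indices.\<close>
  have sorted3: "pf4 A i j k m = 0" if "i < j" "j < k" "m < 5" "k < 5" for i j k m
  proof -
    consider "m = i" | "m = j" | "m = k" | "m < i" | "i < m" "m < j" | "j < m" "m < k" | "k < m"
      by linarith
    then show ?thesis
    proof cases
      case 4
      then have "pf4 A m i j k = 0" using sorted4 that by auto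
      then show ?thesis 
        using pf4_swap(3)[OF skew, where i=i and j=j and k=m and m=k]
          pf4_swap(2)[OF skew, where i=i and j=m and k=j and m=k]
          pf4_swap(1)[OF skew, where i=m and j=i and k=j and m=k]
        by simp
    next
      case 5
      then have "pf4 A i m j k = 0" using sorted4 that by auto
      then show ?thesis 
        using pf4_swap(3)[OF skew, where i=i and j=j and k=m and m=k]
          pf4_swap(2)[OF skew, where i=i and j=m and k=j and m=k]
        by simp
    next
      case 6
      then have "pf4 A i j m k = 0" using sorted4 that by auto
      then show ?thesis 
        using pf4_swap(3)[OF skew, where i=i and j=j and k=m and m=k]
        by simp
    qed (use sorted4 that pf4_repeated[of A, OF skew diag] in auto)
  qed
  have sorted2: "pf4 A i j k m = 0" if "i < j" "j < 5" "m < 5" "k < 5" for i j k m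
  proof -
    consider "k = i" | "k = j" | "k < i" | "i < k" "k < j" | "j < k"
      by linarith
    then show ?thesis
    proof cases
      case 3
      then have "pf4 A k i j m = 0" using sorted3 that by auto
      then show ?thesis 
        using pf4_swap(2)[OF skew, where i=i and j=k and k=j and m=m]
          pf4_swap(1)[OF skew, where i=k and j=i and k=j and m=m]
        by simp
    next
      case 4
      then have "pf4 A i k j m = 0" using sorted3 that by auto
      then show ?thesis 
        using pf4_swap(2)[OF skew, where i=i and j=k and k=j and m=m]
        by simp
    qed (use sorted3 that pf4_repeated[of A, OF skew diag] in auto)
  qed
  consider "i = j" | "i < j" | "j < i"
    by linarith
  then show ?thesis
  proof cases
    case 3
    then have "pf4 A j i k m = 0" using sorted2 less by auto
    then show ?thesis 
        using pf4_swap(1)[OF skew, where i=j and j=i and k=k and m=m]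
        by simp
  qed (use sorted2 less pf4_repeated[of A, OF skew diag] in auto)
qed

text \<open>
  The five Pfaffians of size four form a null vector of \<open>A\<close> (a skew matrix of odd size is
  singular), and \<open>pf6 a A\<close> is its product with \<open>a\<close>. If they all vanish then \<open>A\<close> has rank at
  most two, and a null vector in the kernel of \<open>a\<close> exists for reasons of dimension.
\<close>

lemma bordered_skew_null_vector:
  fixes A :: "nat \<Rightarrow> nat \<Rightarrow> 'k::field"
  assumes skew: "\<And>i j. A j i = - A i j" and diag: "\<And>i. A i i = 0" and pf: "pf6 a A = 0"
  shows "\<exists>c. (\<exists>i<5. c i \<noteq> 0) \<and> (\<Sum>i<5. c i * a i) = 0 \<and> (\<forall>j<5. (\<Sum>i<5. c i * A i j) = 0)"
proof (cases "\<exists>i<5. \<exists>j<5. A i j \<noteq> 0")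
  case False
  obtain c where "\<exists>i<5. c i \<noteq> 0" "(\<Sum>i<5. c i * a i) = 0"
    using homogeneous_system[of 1 5 "\<lambda>_. a"] by auto
  with False show ?thesis
    by (intro exI[of _ c]) (auto intro: sum.neutral)
next
  case True
  then obtain i j where ij: "i < 5" "j < 5" "A i j \<noteq> 0"
    by blast
  show ?thesis
  proof (cases "pf4 A 1 2 3 4 = 0 \<and> pf4 A 0 2 3 4 = 0 \<and> pf4 A 0 1 3 4 = 0 \<and>
      pf4 A 0 1 2 4 = 0 \<and> pf4 A 0 1 2 3 = 0")
    case False
    let ?c = "nth [pf4 A 1 2 3 4, - pf4 A 0 2 3 4, pf4 A 0 1 3 4, - pf4 A 0 1 2 4, pf4 A 0 1 2 3]"
    have s: "A 1 0 = - A 0 1" "A 2 0 = - A 0 2" "A 3 0 = - A 0 3" "A 4 0 = - A 0 4"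
      "A 2 1 = - A 1 2" "A 3 1 = - A 1 3" "A 4 1 = - A 1 4" "A 3 2 = - A 2 3" "A 4 2 = - A 2 4"
      "A 4 3 = - A 3 4"
      by (rule skew)+
    have "\<exists>i<5. ?c i \<noteq> 0"
      using False by (simp add: numeral_eq_Suc Ex_less_Suc) auto
    moreover have "(\<Sum>i<5. ?c i * a i) = 0"
      using pf by (simp add: pf6_def sum_lessThan_5 numeral_eq_Suc algebra_simps)
    moreover have "(\<Sum>i<5. ?c i * A i j) = 0" if "j < 5" for j
    proof -
      have "pf4 A 1 2 3 4 * A 0 j - pf4 A 0 2 3 4 * A 1 j + pf4 A 0 1 3 4 * A 2 j
          - pf4 A 0 1 2 4 * A 3 j + pf4 A 0 1 2 3 * A 4 j = 0"
        using less_5_cases[OF that]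
        by (elim disjE; simp only: pf4_def s diag; simp add: algebra_simps)
      then show ?thesis
        by (simp add: sum_lessThan_5 numeral_eq_Suc algebra_simps)
    qed
    ultimately show ?thesis
      by blast
  next
    case True
    then have pf0: "pf4 A i j k m = 0" if "k < 5" "m < 5" for k m
      using pf4_eq_0[of A, OF skew diag] that ij by auto
    define v where "v k m = (if m = k then A i j else 0) + (if m = i then A j k else 0)
      + (if m = j then A k i else 0)" for k m
    have sum_v: "(\<Sum>m<5. v k m * F m) = A i j * F k + A j k * F i + A k i * F j" if "k < 5" for k F
      using ij(1,2) that
      by (simp add: v_def distrib_right sum.distrib if_distrib[of "\<lambda>x. x * _"] cong: if_cong)
    have vA: "(\<Sum>m<5. v k m * A m n) = 0" if "k < 5" "n < 5" for k n
      using pf0[OF that] sum_v[OF that(1), of "\<lambda>m. A m n"] skew[of k i] skew[of j k]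
      by (simp add: pf4_def algebra_simps)
    have "i \<noteq> j"
      using ij diag by auto
    have "card ({..<5} - {i, j}) = 3"
      using ij \<open>i \<noteq> j\<close> by (subst card_Diff_subset) auto
    then obtain k l where kl: "k < 5" "l < 5" "k \<noteq> l" "k \<notin> {i, j}" "l \<notin> {i, j}"
      using card_3_iff[of "{..<5} - {i, j}"] by (metis DiffD1 DiffD2 insertCI lessThan_iff)
    let ?t = "\<lambda>k. \<Sum>m<5. v k m * a m"
    show ?thesis
    proof (cases "?t k = 0")
      case True
      moreover have "v k k \<noteq> 0"
        using kl ij by (simp add: v_def)
      ultimately show ?thesis
        using vA kl by (intro exI[of _ "v k"]) auto
    next
      case False
      let ?c = "\<lambda>m. ?t l * v k m - ?t k * v l m"
      have lin: "(\<Sum>m<5. ?c m * F m) = ?t l * (\<Sum>m<5. v k m * F m) - ?t k * (\<Sum>m<5. v l m * F m)" for F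
        by (simp add: sum_distrib_left sum_subtractf left_diff_distrib mult.assoc)
      have "?c l \<noteq> 0"
        using False kl ij by (simp add: v_def)
      moreover have "(\<Sum>m<5. ?c m * a m) = 0"
        unfolding lin by simp
      moreover have "(\<Sum>m<5. ?c m * A m n) = 0" if "n < 5" for n
        unfolding lin using vA kl that by simp
      ultimately show ?thesis
        using kl(2) by (intro exI[of _ ?c]) blast
    qed
  qed
qed


section \<open>Lie brackets on a coordinate space\<close>

locale lie_bracket =
  fixes br :: "'k::field^'n \<Rightarrow> 'k^'n \<Rightarrow> 'k^'n" (infixl "\<cdot>" 80)
  assumes br_add_left: "(x + y) \<cdot> z = x \<cdot> z + y \<cdot> z"
    and br_add_right: "x \<cdot> (y + z) = x \<cdot> y + x \<cdot> z"
    and br_scale_left: "(c *s x) \<cdot> y = c *s x \<cdot> y"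
    and br_scale_right: "x \<cdot> (c *s y) = c *s x \<cdot> y"
    and br_self: "x \<cdot> x = 0"
    and jacobi: "x \<cdot> (y \<cdot> z) + y \<cdot> (z \<cdot> x) + z \<cdot> (x \<cdot> y) = 0"
begin

lemma br_0_left: "0 \<cdot> y = 0"
  using br_scale_left[of 0 0 y] by simp

lemma br_0_right: "x \<cdot> 0 = 0"
  using br_scale_right[of x 0 0] by simp

lemma br_minus_left: "(- x) \<cdot> y = - (x \<cdot> y)"
  using br_add_left[of x "- x" y] by (simp add: br_0_left eq_neg_iff_add_eq_0 add.commute)

lemma br_minus_right: "x \<cdot> (- y) = - (x \<cdot> y)"
  using br_add_right[of x y "- y"] by (simp add: br_0_right eq_neg_iff_add_eq_0 add.commute)

lemma br_diff_left: "(x - y) \<cdot> z = x \<cdot> z - y \<cdot> z"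
  using br_add_left[of x "- y" z] by (simp add: br_minus_left)

lemma br_diff_right: "x \<cdot> (y - z) = x \<cdot> y - x \<cdot> z"
  using br_add_right[of x y "- z"] by (simp add: br_minus_right)

lemma br_anti: "x \<cdot> y = - (y \<cdot> x)"
  using br_self[of "x + y"]
  by (simp add: br_add_left br_add_right br_self[of x] br_self[of y] eq_neg_iff_add_eq_0 add.commute)

lemma br_sum_right: "x \<cdot> (\<Sum>i\<in>S. h i) = (\<Sum>i\<in>S. x \<cdot> h i)"
  by (induction S rule: infinite_finite_induct) (auto simp: br_0_right br_add_right)

lemma br_sum_left: "(\<Sum>i\<in>S. h i) \<cdot> x = (\<Sum>i\<in>S. h i \<cdot> x)"
  by (induction S rule: infinite_finite_induct) (auto simp: br_0_left br_add_left)

lemmas br_simps = br_add_left br_add_right br_scale_left br_scale_right br_self br_0_left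
  br_0_right br_minus_left br_minus_right br_diff_left br_diff_right

lemma br_derivation: "x \<cdot> (y \<cdot> z) = (x \<cdot> y) \<cdot> z + y \<cdot> (x \<cdot> z)"
  using jacobi[of x y z] br_anti[of z x] br_anti[of z "x \<cdot> y"] by (simp add: br_simps algebra_simps)

lemma form_br_right: "form f \<Longrightarrow> form (\<lambda>y. f (x \<cdot> y))"
  by (rule formI) (auto simp: form_simps br_simps)

lemma form_br_left: "form f \<Longrightarrow> form (\<lambda>x. f (x \<cdot> y))"
  by (rule formI) (auto simp: form_simps br_simps)

definition ideal :: "('k^'n) set \<Rightarrow> bool" where
  "ideal J \<longleftrightarrow> vec.subspace J \<and> (\<forall>x. \<forall>y\<in>J. x \<cdot> y \<in> J)"

definition simple :: bool where
  "simple \<longleftrightarrow> (\<forall>J. ideal J \<longrightarrow> J = {0} \<or> J = UNIV)"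

text \<open>
  Equivalently, the brackets span the algebra. The dual formulation is the one that the
  existence proofs for brackets with given values of linear forms use.
\<close>

definition perfect :: bool where
  "perfect \<longleftrightarrow> (\<forall>g. form g \<longrightarrow> (\<forall>x y. g (x \<cdot> y) = 0) \<longrightarrow> (\<forall>v. g v = 0))"

lemma ideal_spanI:
  assumes "\<And>x s. s \<in> S \<Longrightarrow> x \<cdot> s \<in> vec.span S"
  shows "ideal (vec.span S)"
proof -
  have "x \<cdot> y \<in> vec.span S" if "y \<in> vec.span S" for x y
    using that
    by (induction rule: vec.span_induct_alt)
      (auto simp: br_simps vec.span_zero intro: vec.span_add vec.span_scale assms)
  then show ?thesis
    by (auto simp: ideal_def vec.subspace_span)
qed

lemma span_neq_UNIV:
  assumes "finite S" "card S < CARD('n)"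
  shows "vec.span (S :: ('k^'n) set) \<noteq> UNIV"
proof
  assume "vec.span S = UNIV"
  then have "vec.dim (UNIV :: ('k^'n) set) \<le> card S"
    using vec.dim_le_card[of UNIV S] assms by auto
  then show False
    using assms vec_dim_card[where 'a='k and 'n='n] by simp
qed

end

locale finite_lie_bracket = lie_bracket br
  for br :: "'k::{field,finite}^'n \<Rightarrow> 'k^'n \<Rightarrow> 'k^'n" (infixl "\<cdot>" 80) +
  assumes dim5: "CARD('n) = 5"
    and two_neq_0: "(2::'k) \<noteq> 0"
begin

text \<open>
  The Pfaffian of the form \<open>(s, x), (t, y) \<mapsto> s f y - t f x + f (x \<cdot> y)\<close> on \<open>k \<oplus> L\<close> is cubic in
  \<open>f\<close>. As there are five coordinates, Chevalley--Warning provides a nonzero \<open>f\<close> where it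
  vanishes.
\<close>

lemma exists_degenerate_form:
  obtains f x where "form f" "\<exists>v. f v \<noteq> 0" "x \<noteq> 0" "f x = 0" "\<And>y. f (x \<cdot> y) = 0"
proof -
  obtain w :: "nat \<Rightarrow> 'k^'n" where w: "indep 5 w"
    using indep_extend_to_basis[OF indep_empty[of "\<lambda>_. 0 :: 'k^'n"], of 5] dim5 by auto
  obtain g where g: "\<And>i. i < 5 \<Longrightarrow> form (g i)"
    "\<And>i j. i < 5 \<Longrightarrow> j < 5 \<Longrightarrow> g i (w j) = (if i = j then 1 else 0)"
    using indep_dual_forms[OF w] by blast
  define f where "f a v = (\<Sum>k<5. a k * g k v)" for a :: "nat \<Rightarrow> 'k" and v
  have form_f: "form (f a)" for a
    by (rule formI) (simp_all add: f_def form_simps g(1) sum.distrib algebra_simps sum_distrib_left)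
  have fw: "f a (w i) = a i" if "i < 5" for a i
  proof -
    have "f a (w i) = (\<Sum>k<5. if k = i then a k else 0)"
      unfolding f_def by (rule sum.cong) (use g(2) that in auto)
    then show ?thesis
      using that by simp
  qed
  let ?A = "\<lambda>a i j. f a (w i \<cdot> w j)"
  have A: "polyfun 5 1 (\<lambda>a. ?A a i j)" for i j
  proof -
    have "polyfun 5 1 (\<lambda>a. g k (w i \<cdot> w j) * a k)" if "k < 5" for k
      using polyfun_cmult[OF polyfun_var[OF that]] by simp
    then show ?thesis
      unfolding f_def by (intro polyfun_sum) (simp add: mult.commute)
  qed
  have pf4: "polyfun 5 2 (\<lambda>a. pf4 (?A a) i j k m)" for i j k m
    unfolding pf4_def using polyfun_mult[OF A A]
    by (intro polyfun.add polyfun_diff) (simp_all add: numeral_2_eq_2)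
  have "polyfun 5 3 (\<lambda>a. a i * pf4 (?A a) j k l m)" if "i < 5" for i j k l m
    using polyfun_mult[OF polyfun_var[OF that] pf4] by (simp add: numeral_3_eq_3)
  then have "polyfun 5 3 (\<lambda>a. pf6 a (?A a))"
    unfolding pf6_def by (intro polyfun.add polyfun_diff) simp_all
  then obtain a where a: "\<exists>i<5. a i \<noteq> 0" "pf6 a (?A a) = 0"
    using chevalley_warning[of 5 3 "\<lambda>a. pf6 a (?A a)"] by (auto simp: pf6_def)
  have skew: "?A a j i = - ?A a i j" for i j
    using br_anti[of "w j" "w i"] form_f by (simp add: form_simps)
  have diag: "?A a i i = 0" for i
    using form_f by (simp add: br_self form_simps)
  obtain c where c: "\<exists>i<5. c i \<noteq> 0" "(\<Sum>i<5. c i * a i) = 0" "\<forall>j<5. (\<Sum>i<5. c i * ?A a i j) = 0"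
    using bordered_skew_null_vector[OF skew diag a(2)] by blast
  define x where "x = (\<Sum>i<5. c i *s w i)"
  have "x \<noteq> 0"
    using w c(1) by (auto simp: x_def indep_def)
  moreover have "f a x = 0"
    unfolding x_def using c(2) form_f fw by (simp add: form_simps)
  moreover have "f a (x \<cdot> y) = 0" for y
  proof -
    obtain d where y: "y = (\<Sum>j<5. d j *s w j)"
      using indep_spanning[of w y] w dim5 by auto
    have "f a (x \<cdot> w j) = 0" if "j < 5" for j
      unfolding x_def using c(3) form_f that by (simp add: br_sum_left br_simps form_simps)
    then show ?thesis
      unfolding y using form_f by (simp add: br_sum_right br_simps form_simps)
  qed
  moreover have "\<exists>v. f a v \<noteq> 0"
    using fw a(1) by metis
  ultimately show thesis
    using that form_f by blast
qed

end

section \<open>Jordan chains and the algebra \<open>W(1;1)\<close>\<close>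

context lie_bracket
begin

definition witt_table :: "'k^'n \<Rightarrow> 'k^'n \<Rightarrow> 'k^'n \<Rightarrow> 'k^'n \<Rightarrow> 'k^'n \<Rightarrow> bool" where
  "witt_table x h e1 e2 e3 \<longleftrightarrow> indep 5 (nth [x, h, e1, e2, e3]) \<and>
     x \<cdot> h = x \<and> x \<cdot> e1 = h \<and> x \<cdot> e2 = e1 \<and> x \<cdot> e3 = e2 \<and>
     h \<cdot> e1 = e1 \<and> h \<cdot> e2 = 2 *s e2 \<and> h \<cdot> e3 = 3 *s e3 \<and>
     e1 \<cdot> e2 = 2 *s e3 \<and> e1 \<cdot> e3 = 0 \<and> e2 \<cdot> e3 = 0"

text \<open>
  A full Jordan block of \<open>ad x\<close> that ends in \<open>x\<close> itself.
\<close>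

definition chain :: "'k^'n \<Rightarrow> 'k^'n \<Rightarrow> bool" where
  "chain x e \<longleftrightarrow> x \<noteq> 0 \<and> x \<cdot> (x \<cdot> (x \<cdot> (x \<cdot> e))) = x"

end

context finite_lie_bracket
begin

lemma chain_indep:
  assumes "chain x e"
  shows "indep 5 (nth [x, x \<cdot> (x \<cdot> (x \<cdot> e)), x \<cdot> (x \<cdot> e), x \<cdot> e, e])"
  unfolding indep5
proof (intro allI impI)
  fix r s t u v
  assume eq: "r *s x + s *s x \<cdot> (x \<cdot> (x \<cdot> e)) + t *s x \<cdot> (x \<cdot> e) + u *s x \<cdot> e + v *s e = 0"
  let ?D = "\<lambda>v. x \<cdot> v"
  have c: "x \<noteq> 0" "x \<cdot> (x \<cdot> (x \<cdot> (x \<cdot> e))) = x"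
    using assms by (auto simp: chain_def)
  have v: "v = 0"
    using arg_cong[OF eq, of "\<lambda>w. ?D (?D (?D (?D w)))"] c by (simp add: br_simps)
  have u: "u = 0"
    using arg_cong[OF eq, of "\<lambda>w. ?D (?D (?D w))"] c v by (simp add: br_simps)
  have t: "t = 0"
    using arg_cong[OF eq, of "\<lambda>w. ?D (?D w)"] c u v by (simp add: br_simps)
  have s: "s = 0"
    using arg_cong[OF eq, of "\<lambda>w. ?D w"] c t u v by (simp add: br_simps)
  show "r = 0 \<and> s = 0 \<and> t = 0 \<and> u = 0 \<and> v = 0"
    using eq c s t u v by simp
qed

lemma chain_eq_mod_kernel:
  assumes "chain x e" and "x \<cdot> u = x \<cdot> w"
  shows "\<exists>a. u = w + a *s x"
proof -
  obtain r s t p q where v: "u - w = r *s x + s *s x \<cdot> (x \<cdot> (x \<cdot> e)) + t *s x \<cdot> (x \<cdot> e) + p *s x \<cdot> e + q *s e"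
    using indep5_coordinates[OF dim5 chain_indep[OF assms(1)]] by blast
  have "x \<cdot> (u - w) = 0"
    using assms(2) by (simp add: br_simps)
  then have "0 *s e + s *s x + t *s x \<cdot> (x \<cdot> (x \<cdot> e)) + p *s x \<cdot> (x \<cdot> e) + q *s x \<cdot> e = 0"
    unfolding v using assms(1) by (simp add: br_simps chain_def)
  then have "s *s x + t *s x \<cdot> (x \<cdot> (x \<cdot> e)) + p *s x \<cdot> (x \<cdot> e) + q *s x \<cdot> e + 0 *s e = 0"
    by simp
  then have "s = 0 \<and> t = 0 \<and> p = 0 \<and> q = 0"
    using chain_indep[OF assms(1), unfolded indep5] by blast
  then have "u = w + r *s x"
    using v by (simp add: algebra_simps)
  then show ?thesis
    by blast
qed

lemma chain_fifth_power:
  assumes "chain x e"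
  shows "x \<cdot> (x \<cdot> (x \<cdot> (x \<cdot> (x \<cdot> v)))) = 0"
proof -
  obtain r s t p q where v: "v = r *s x + s *s x \<cdot> (x \<cdot> (x \<cdot> e)) + t *s x \<cdot> (x \<cdot> e) + p *s x \<cdot> e + q *s e"
    using indep5_coordinates[OF dim5 chain_indep[OF assms]] by blast
  show ?thesis
    unfolding v using assms by (simp add: br_simps chain_def)
qed

text \<open>
  The chain is a basis, and the kernel of \<open>ad x\<close> is the line through \<open>x\<close>. As \<open>ad x\<close> is a
  derivation that shifts the chain, it determines the products of chain vectors step by step,
  each up to a multiple of \<open>x\<close>; the Jacobi identity forces 5 = 0. The remaining parameters are
  removed by changes of the generator \<open>e\<close>, the last of them with the help of a fifth root in
  the finite field.
\<close>

lemma chain_imp_witt: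
  assumes "chain x e"
  shows "(5::'k) = 0" "\<exists>h e1 e2 e3. witt_table x h e1 e2 e3"
proof -
  have x0: "x \<noteq> 0"
    using assms by (simp add: chain_def)
  note two = two_neq_0
  \<comment> \<open>Adding a multiple of \<open>(ad x)\<^sup>2 e\<close> to \<open>e\<close> makes \<open>(ad x)\<^sup>2 e\<close> an eigenvector of \<open>(ad x)\<^sup>3 e\<close>.\<close>
  obtain e3 e2 e1 h where ch: "chain x e3" and e: "x \<cdot> e3 = e2" "x \<cdot> e2 = e1" "x \<cdot> e1 = h" "x \<cdot> h = x"
    and he1: "h \<cdot> e1 = e1"
  proof -
    let ?e2 = "x \<cdot> e" and ?e1 = "x \<cdot> (x \<cdot> e)" and ?h = "x \<cdot> (x \<cdot> (x \<cdot> e))"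
    have xh: "x \<cdot> ?h = x"
      using assms by (simp add: chain_def)
    then have "x \<cdot> (?h \<cdot> ?e1) = x \<cdot> ?e1"
      using br_derivation[of x ?h ?e1] by (simp add: br_simps)
    then obtain a where a: "?h \<cdot> ?e1 = ?e1 + a *s x"
      using chain_eq_mod_kernel[OF assms] by blast
    let ?t = "a / 2"
    show thesis
    proof (rule that[of "e + ?t *s ?e1" "?e2 + ?t *s ?h" "?e1 + ?t *s x" ?h])
      show "chain x (e + ?t *s ?e1)"
        using xh x0 by (simp add: chain_def br_simps)
      show "x \<cdot> (?e1 + ?t *s x) = ?h"
        by (simp add: br_simps)
      show "?h \<cdot> (?e1 + ?t *s x) = ?e1 + ?t *s x"
        using a br_anti[of ?h x] xh two by (simp add: br_simps vec_eq_iff field_simps)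
    qed (use xh in \<open>simp_all add: br_simps\<close>)
  qed
  have hx: "h \<cdot> x = - x" "e1 \<cdot> x = - h" "e2 \<cdot> x = - e1"
    using e br_anti[of h x] br_anti[of e1 x] br_anti[of e2 x] by simp_all
  have "x \<cdot> (h \<cdot> e2) = x \<cdot> (2 *s e2)"
    using br_derivation[of x h e2] e he1 by (simp add: br_simps vec_eq_iff)
  then obtain b where b: "h \<cdot> e2 = 2 *s e2 + b *s x"
    using chain_eq_mod_kernel[OF ch] by blast
  have "x \<cdot> (h \<cdot> e3) = x \<cdot> (3 *s e3 + b *s h)"
    using br_derivation[of x h e3] e b by (simp add: br_simps vec_eq_iff)
  then obtain c where c: "h \<cdot> e3 = 3 *s e3 + b *s h + c *s x"
    using chain_eq_mod_kernel[OF ch] by blast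
  have "x \<cdot> (e1 \<cdot> e2) = x \<cdot> (2 *s e3 + b *s h)"
    using br_derivation[of x e1 e2] e b by (simp add: br_simps)
  then obtain d where d: "e1 \<cdot> e2 = 2 *s e3 + b *s h + d *s x"
    using chain_eq_mod_kernel[OF ch] by blast
  have "x \<cdot> (e1 \<cdot> e3) = 5 *s e3 + (2 * b) *s h + (c + d) *s x"
    using br_derivation[of x e1 e3] e c d by (simp add: br_simps vec_eq_iff algebra_simps)
  then have "x \<cdot> (x \<cdot> (x \<cdot> (x \<cdot> (x \<cdot> (e1 \<cdot> e3))))) = 5 *s x"
    using e by (simp add: br_simps)
  then show five: "(5::'k) = 0"
    using chain_fifth_power[OF ch] x0 by simp
  have three: "(3::'k) \<noteq> 0"
  proof
    assume "(3::'k) = 0"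
    with five have "(2::'k) * 3 - 5 = 0" by simp
    then show False by simp
  qed
  \<comment> \<open>Likewise the eigenvalues 2 and 3 of \<open>h\<close> split off.\<close>
  define s where "s = b / 3"
  define r where "r = - c"
  define f3 where "f3 = e3 + s *s h + r *s x"
  define f2 where "f2 = e2 + s *s x"
  have f: "x \<cdot> f3 = f2" "x \<cdot> f2 = e1"
    using e by (simp_all add: f3_def f2_def br_simps)
  have chf: "chain x f3"
    using f e x0 by (simp add: chain_def)
  have b3: "b = 3 * s"
    using three by (simp add: s_def)
  have hf2: "h \<cdot> f2 = 2 *s f2"
    using b hx b3 by (simp add: f2_def br_simps vec_eq_iff algebra_simps)
  have fives: "(5::'k) = 0" "(10::'k) = 0" "(15::'k) = 0" "(20::'k) = 0"
  proof -
    have "(10::'k) = 2 * 5" "(15::'k) = 3 * 5" "(20::'k) = 4 * 5"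
      by simp_all
    then show "(5::'k) = 0" "(10::'k) = 0" "(15::'k) = 0" "(20::'k) = 0"
      by (simp_all only: five mult_zero_right)
  qed
  have vec_eq: "u = w \<longleftrightarrow> (\<forall>i. u $ i - w $ i = 0)" for u w :: "'k^'n"
    by (simp add: vec_eq_iff)
  have "c = - r"
    by (simp add: r_def)
  then have hf3: "h \<cdot> f3 = 3 *s f3"
    unfolding f3_def vec_eq by (simp add: br_simps c hx b3 fives algebra_simps)
  have "x \<cdot> (e1 \<cdot> f2) = x \<cdot> (2 *s f3)"
    using br_derivation[of x e1 f2] e f hf2 by (simp add: br_simps)
  then obtain d' where d': "e1 \<cdot> f2 = 2 *s f3 + d' *s x"
    using chain_eq_mod_kernel[OF chf] by blast
  have "d' = 0"
  proof -
    have "h \<cdot> (e1 \<cdot> f2) = 3 *s e1 \<cdot> f2"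
      using br_derivation[of h e1 f2] he1 hf2 by (simp add: br_simps vec_eq_iff)
    then have "(4 * d') *s x = 0"
      unfolding d' using hf3 hx by (simp add: br_simps vec_eq_iff algebra_simps)
    moreover have "(4::'k) \<noteq> 0"
      using two by (metis mult_2 mult_eq_0_iff numeral_Bit0 numeral_plus_numeral semiring_norm(2,6))
    ultimately show ?thesis
      using x0 by simp
  qed
  then have ef2: "e1 \<cdot> f2 = 2 *s f3"
    using d' by simp
  have "x \<cdot> (e1 \<cdot> f3) = 5 *s f3"
    using br_derivation[of x e1 f3] e f hf3 ef2 by (simp add: br_simps vec_eq_iff)
  then have "x \<cdot> (e1 \<cdot> f3) = x \<cdot> 0"
    by (simp add: five br_simps)
  then obtain g where ef3: "e1 \<cdot> f3 = g *s x"
    using chain_eq_mod_kernel[OF chf] by fastforce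
  have "x \<cdot> (f2 \<cdot> f3) = x \<cdot> (g *s h)"
    using br_derivation[of x f2 f3] e f ef3 by (simp add: br_simps)
  then obtain k where k: "f2 \<cdot> f3 = g *s h + k *s x"
    using chain_eq_mod_kernel[OF chf] by blast
  have "k = 0"
  proof -
    have "h \<cdot> (f2 \<cdot> f3) = 5 *s f2 \<cdot> f3"
      using br_derivation[of h f2 f3] hf2 hf3 by (simp add: br_simps vec_eq_iff)
    then show ?thesis
      unfolding k using hx x0 by (simp add: five br_simps)
  qed
  then have ff: "f2 \<cdot> f3 = g *s h"
    using k by simp
  \<comment> \<open>The parameter \<open>g\<close> is removed by the automorphism \<open>exp (t ad x)\<close> of the model, with \<open>t\<^sup>5 = g\<close>;
    modulo 5 the coefficients 1/2, 1/6, 1/24 of the exponential series are 3, 1, -1.\<close>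
  have "CHAR('k) = 5"
  proof -
    have "CHAR('k) dvd 5"
      using five of_nat_eq_0_iff_char_dvd[of 5, where 'a='k] by simp
    moreover have "CHAR('k) \<noteq> 1"
      by simp
    ultimately show ?thesis
      using prime_nat_iff[of 5] by auto
  qed
  then obtain t where t: "t ^ 5 = g"
    using finite_field_surj_power_CHAR[of g] by auto
  define g3 where "g3 = f3 + t *s f2 + (3 * t\<^sup>2) *s e1 + t ^ 3 *s h + (- (t ^ 4)) *s x"
  define g2 where "g2 = f2 + t *s e1 + (3 * t\<^sup>2) *s h + t ^ 3 *s x"
  define g1 where "g1 = e1 + t *s h + (3 * t\<^sup>2) *s x"
  define g0 where "g0 = h + t *s x"
  have br: "h \<cdot> x = - x" "e1 \<cdot> x = - h" "f2 \<cdot> x = - e1" "f3 \<cdot> x = - f2"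
    "e1 \<cdot> h = - e1" "f2 \<cdot> h = -2 *s f2" "f3 \<cdot> h = -3 *s f3" "f2 \<cdot> e1 = -2 *s f3"
    "f3 \<cdot> e1 = - g *s x" "f3 \<cdot> f2 = - g *s h"
    using hx e f he1 hf2 hf3 ef2 ef3 ff br_anti[of f2 x] br_anti[of f3 x] br_anti[of e1 h]
      br_anti[of f2 h] br_anti[of f3 h] br_anti[of f2 e1] br_anti[of f3 e1] br_anti[of f3 f2]
    by (simp_all add: vector_smult_lneg)
  note tab = br e f he1 hf2 hf3 ef2 ef3 ff
  have xg: "x \<cdot> g0 = x" "x \<cdot> g1 = g0" "x \<cdot> g2 = g1" "x \<cdot> g3 = g2"
    by (simp_all add: g0_def g1_def g2_def g3_def br_simps tab)
  have "chain x g3"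
    using xg x0 by (simp add: chain_def)
  from chain_indep[OF this] have "indep 5 (nth [x, g0, g1, g2, g3])"
    by (simp add: xg)
  moreover have "g0 \<cdot> g1 = g1"
    unfolding g0_def g1_def vec_eq
    by (simp add: br_simps tab fives algebra_simps power2_eq_square power3_eq_cube power4_eq_xxxx)
  moreover have "g0 \<cdot> g2 = 2 *s g2"
    unfolding g0_def g2_def vec_eq
    by (simp add: br_simps tab fives algebra_simps power2_eq_square power3_eq_cube power4_eq_xxxx)
  moreover have "g0 \<cdot> g3 = 3 *s g3"
    unfolding g0_def g3_def vec_eq
    by (simp add: br_simps tab fives algebra_simps power2_eq_square power3_eq_cube power4_eq_xxxx)
  moreover have "g1 \<cdot> g2 = 2 *s g3"
    unfolding g1_def g2_def g3_def vec_eq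
    by (simp add: br_simps tab fives algebra_simps power2_eq_square power3_eq_cube power4_eq_xxxx)
  moreover have "g1 \<cdot> g3 = 0"
    unfolding g1_def g3_def vec_eq
    by (simp add: br_simps tab t[symmetric] fives algebra_simps power2_eq_square power3_eq_cube power4_eq_xxxx eval_nat_numeral)
  moreover have "g2 \<cdot> g3 = 0"
    unfolding g2_def g3_def vec_eq
    by (simp add: br_simps tab t[symmetric] fives algebra_simps power2_eq_square power3_eq_cube power4_eq_xxxx eval_nat_numeral)
  ultimately show "\<exists>h e1 e2 e3. witt_table x h e1 e2 e3"
    unfolding witt_table_def using xg by blast
qed

end

section \<open>Extremal elements\<close>

lemma span_pairI: "a *s u + b *s v \<in> vec.span {u, v}"
  by (intro vec.span_add vec.span_scale vec.span_base) auto

lemma indep2_nonzero: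
  assumes "indep 2 (nth [u, v])"
  shows "u \<noteq> 0" "v \<noteq> 0"
proof -
  have "\<forall>r s. r *s u + s *s v = 0 \<longrightarrow> r = 0 \<and> s = 0"
    using assms by (simp only: indep2)
  from this[rule_format, of 1 0] this[rule_format, of 0 1] show "u \<noteq> 0" "v \<noteq> 0"
    by auto
qed

context finite_lie_bracket
begin

lemma simple_no_pair_ideal:
  assumes simple and "u \<noteq> 0"
    and "\<And>y. \<exists>a b. y \<cdot> u = a *s u + b *s v" "\<And>y. \<exists>a b. y \<cdot> v = a *s u + b *s v"
  shows False
proof -
  have "ideal (vec.span {u, v})"
    by (rule ideal_spanI) (metis assms(3,4) insertE singletonD span_pairI)
  moreover have "card {u, v} < CARD('n)"
    using card_insert_le_m1[of 2 "{v}" u] dim5 by simp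
  then have "vec.span {u, v} \<noteq> UNIV"
    by (intro span_neq_UNIV) auto
  moreover have "u \<in> vec.span {u, v}"
    by (simp add: vec.span_base)
  ultimately show False
    using assms(1,2) by (auto simp: simple_def)
qed

text \<open>
  Here \<open>x, h, y\<close> behave like an \<open>sl(2)\<close>-triple and \<open>w, z\<close> like a two-dimensional module, apart
  from the product \<open>y \<cdot> z\<close>. Comparing \<open>h\<close>-eigenvalues forces \<open>y \<cdot> z\<close> into the module unless 5
  = 0, and then \<open>y\<close> generates a full Jordan block.
\<close>

lemma extremal_imp_chain:
  assumes simple and ind: "indep 2 (nth [x, w])"
    and D: "x \<cdot> y = h" "x \<cdot> h = x" "x \<cdot> z = w" "x \<cdot> w = 0"
  shows "\<exists>x e. chain x e"
proof -
  have indep: "indep 5 (nth [y, h, x, z, w])" if "indep 2 (nth [x, w])" "x \<cdot> z = w" "x \<cdot> w = 0" for z w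
    unfolding indep5
  proof (intro allI impI)
    fix r s t u v
    assume eq: "r *s y + s *s h + t *s x + u *s z + v *s w = 0"
    have xw: "a *s x + b *s w = 0 \<Longrightarrow> a = 0 \<and> b = 0" for a b
      using that(1) by (simp add: indep2)
    have x0: "x \<noteq> 0"
      using xw[of 1 0] by auto
    have r: "r = 0"
      using arg_cong[OF eq, of "\<lambda>v. x \<cdot> (x \<cdot> v)"] that D x0 by (simp add: br_simps)
    have "s *s x + u *s w = 0"
      using arg_cong[OF eq, of "\<lambda>v. x \<cdot> v"] that D r by (simp add: br_simps)
    then have su: "s = 0" "u = 0"
      using xw by blast+
    then have "t *s x + v *s w = 0"
      using eq r by simp
    then show "r = 0 \<and> s = 0 \<and> t = 0 \<and> u = 0 \<and> v = 0"
      using r su xw by blast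
  qed
  have x0: "x \<noteq> 0"
    using indep2_nonzero[OF ind] by simp
  have ker: "\<exists>a b. v = a *s x + b *s w"
    if v0: "x \<cdot> v = 0" and xw: "indep 2 (nth [x, w])" "x \<cdot> z = w" "x \<cdot> w = 0" for v z w
  proof -
    obtain p q r s t where v: "v = p *s y + q *s h + r *s x + s *s z + t *s w"
      using indep5_coordinates[OF dim5 indep[OF xw]] by blast
    then have "0 *s y + p *s h + q *s x + 0 *s z + s *s w = 0"
      using v0 xw D by (simp add: br_simps)
    then have "p = 0 \<and> q = 0 \<and> s = 0"
      using indep[OF xw, unfolded indep5] by blast
    then show ?thesis
      using v by auto
  qed
  define \<alpha> :: 'k where "\<alpha> = - inverse 2"
  have \<alpha>: "2 * \<alpha> = -1" "\<alpha> \<noteq> 0"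
    using two_neq_0 by (auto simp: \<alpha>_def)
  \<comment> \<open>\<open>h\<close> acts on \<open>w\<close> with the eigenvalue - 1/2, up to a multiple of \<open>x\<close>.\<close>
  obtain \<beta> where \<beta>: "h \<cdot> w = \<alpha> *s w + \<beta> *s x"
  proof -
    have "x \<cdot> (h \<cdot> w) = 0"
      using br_derivation[of x h w] D by (simp add: br_simps)
    then obtain \<beta> a where hw: "h \<cdot> w = \<beta> *s x + a *s w"
      using ker[OF _ ind D(3,4)] by blast
    have "x \<cdot> (h \<cdot> z) = w + h \<cdot> w" "x \<cdot> (y \<cdot> w) = h \<cdot> w" "x \<cdot> (y \<cdot> z) = h \<cdot> z + y \<cdot> w"
      using br_derivation[of x h z] br_derivation[of x y w] br_derivation[of x y z] D
      by (simp_all add: br_simps)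
    then have k: "x \<cdot> (h \<cdot> z - ((1 + a) *s z + \<beta> *s h)) = 0" "x \<cdot> (y \<cdot> w - (a *s z + \<beta> *s h)) = 0"
      using D hw by (simp_all add: br_simps algebra_simps)
    obtain b c b' c' where
      "h \<cdot> z - ((1 + a) *s z + \<beta> *s h) = b *s x + c *s w" "y \<cdot> w - (a *s z + \<beta> *s h) = b' *s x + c' *s w"
      using ker[OF k(1) ind D(3,4)] ker[OF k(2) ind D(3,4)] by blast
    then have hz: "h \<cdot> z = (1 + a) *s z + \<beta> *s h + b *s x + c *s w"
      and yw: "y \<cdot> w = a *s z + \<beta> *s h + b' *s x + c' *s w"
      by (simp_all add: algebra_simps)
    obtain p q r s t where v: "y \<cdot> z = p *s y + q *s h + r *s x + s *s z + t *s w"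
      using indep5_coordinates[OF dim5 indep[OF ind D(3,4)]] by blast
    have "p *s h + q *s x + s *s w = h \<cdot> z + y \<cdot> w"
      using \<open>x \<cdot> (y \<cdot> z) = h \<cdot> z + y \<cdot> w\<close> unfolding v using D by (simp add: br_simps)
    then have "0 *s y + (2 * \<beta> - p) *s h + (b + b' - q) *s x + (1 + 2 * a) *s z + (c + c' - s) *s w = 0"
      unfolding hz yw by (simp add: vec_eq_iff algebra_simps)
    then have "1 + 2 * a = 0"
      using indep[OF ind D(3,4), unfolded indep5] by blast
    then have "2 * (a - \<alpha>) = 0"
      using \<alpha> by (simp add: algebra_simps)
    then have "a = \<alpha>"
      using two_neq_0 by simp
    then show thesis
      using hw that[of \<beta>] by (simp add: add.commute)
  qed
  define w' where "w' = w + (2 * \<beta>) *s x"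
  define z' where "z' = -2 *s y \<cdot> w'"
  have hx: "h \<cdot> x = - x"
    using br_anti[of h x] D by simp
  have xw': "x \<cdot> w' = 0"
    by (simp add: w'_def br_simps D)
  have hw': "h \<cdot> w' = \<alpha> *s w'"
  proof -
    have "\<beta> - 2 * \<beta> - \<alpha> * (2 * \<beta>) = - \<beta> * (1 + 2 * \<alpha>)"
      by (simp add: algebra_simps)
    then have "\<beta> - 2 * \<beta> = \<alpha> * (2 * \<beta>)"
      using \<alpha> by simp
    then show ?thesis
      unfolding w'_def vec_eq_iff by (simp add: br_simps \<beta> hx) algebra
  qed
  have yw': "y \<cdot> w' = \<alpha> *s z'"
    using \<alpha> by (simp add: z'_def vector_smult_assoc mult.commute)
  have xz': "x \<cdot> z' = w'"
    using br_derivation[of x y w'] D xw' hw' \<alpha>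
    by (simp add: z'_def br_simps vector_smult_assoc)
  have ind': "indep 2 (nth [x, w'])"
    unfolding indep2
  proof (intro allI impI)
    fix r s assume "r *s x + s *s w' = 0"
    then have "(r + s * (2 * \<beta>)) *s x + s *s w = 0"
      by (simp add: w'_def vec_eq_iff algebra_simps)
    then have "r + s * (2 * \<beta>) = 0 \<and> s = 0"
      using ind unfolding indep2 by blast
    then show "r = 0 \<and> s = 0"
      by auto
  qed
  note ker' = ker[OF _ ind' xz' xw']
  have "x \<cdot> (h \<cdot> y - y) = 0"
    using br_derivation[of x h y] D by (simp add: br_simps)
  then obtain \<mu> \<nu> where "h \<cdot> y - y = \<mu> *s x + \<nu> *s w'"
    using ker' by blast
  then have hy: "h \<cdot> y = y + \<mu> *s x + \<nu> *s w'"
    by (simp add: algebra_simps)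
  have hz': "h \<cdot> z' = (1 + \<alpha>) *s z'"
  proof -
    have "h \<cdot> (y \<cdot> w') = (1 + \<alpha>) *s y \<cdot> w'"
      using br_derivation[of h y w'] hy xw' hw' by (simp add: br_simps vec_eq_iff algebra_simps)
    then show ?thesis
      by (simp add: z'_def br_simps vec_eq_iff)
  qed
  have wz: "w' \<cdot> z' = 0"
  proof -
    have "x \<cdot> (w' \<cdot> z') = 0"
      using br_derivation[of x w' z'] xw' xz' by (simp add: br_simps)
    then obtain p q where pq: "w' \<cdot> z' = p *s x + q *s w'"
      using ker' by blast
    have "h \<cdot> (w' \<cdot> z') = (1 + 2 * \<alpha>) *s (w' \<cdot> z')"
      using br_derivation[of h w' z'] hw' hz' by (simp add: br_simps vec_eq_iff algebra_simps)
    then have "(- p) *s x + (\<alpha> * q) *s w' = 0"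
      unfolding pq using hx hw' \<alpha> by (simp add: br_simps vector_smult_assoc mult.commute vector_smult_lneg)
    then have "- p = 0 \<and> \<alpha> * q = 0"
      using ind' unfolding indep2 by blast
    then show ?thesis
      using pq \<alpha> by simp
  qed
  have "x \<cdot> (y \<cdot> z') = (1 + 2 * \<alpha>) *s z'"
    using br_derivation[of x y z'] D xz' hz' yw' by (simp add: vec_eq_iff algebra_simps)
  then have "x \<cdot> (y \<cdot> z') = 0"
    using \<alpha> by simp
  then obtain \<iota> \<kappa> where yz: "y \<cdot> z' = \<iota> *s x + \<kappa> *s w'"
    using ker' by blast
  have xz'_anti: "z' \<cdot> x = - w'" "w' \<cdot> x = 0" "z' \<cdot> w' = 0"
    using br_anti[of z' x] xz' br_anti[of w' x] xw' br_anti[of z' w'] wz by simp_all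
  have "h \<cdot> (y \<cdot> z') = (2 + \<alpha>) *s y \<cdot> z' + \<mu> *s w'"
    using br_derivation[of h y z'] hy hz' xz' wz by (simp add: br_simps vec_eq_iff algebra_simps)
  then have "(\<iota> * (3 + \<alpha>)) *s x + (\<kappa> * 2 + \<mu>) *s w' = 0"
    unfolding yz using hx hw' by (simp add: br_simps vec_eq_iff algebra_simps)
  then have "\<iota> * (3 + \<alpha>) = 0 \<and> \<kappa> * 2 + \<mu> = 0"
    using ind' unfolding indep2 by blast
  then have \<iota>\<mu>: "\<iota> * (3 + \<alpha>) = 0" "\<mu> = - 2 * \<kappa>"
    by (auto simp: eq_neg_iff_add_eq_0 algebra_simps)
  have "\<iota> \<noteq> 0"
  proof
    assume "\<iota> = 0"
    have "\<exists>a b. v \<cdot> w' = a *s w' + b *s z'" and "\<exists>a b. v \<cdot> z' = a *s w' + b *s z'" for v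
    proof -
      obtain p q r s t where v: "v = p *s y + q *s h + r *s x + s *s z' + t *s w'"
        using indep5_coordinates[OF dim5 indep[OF ind' xz' xw']] by blast
      have "v \<cdot> w' = (q * \<alpha>) *s w' + (p * \<alpha>) *s z'"
        unfolding v by (simp add: br_simps yw' hw' xw' xz'_anti vec_eq_iff algebra_simps)
      then show "\<exists>a b. v \<cdot> w' = a *s w' + b *s z'" by blast
      have "v \<cdot> z' = (p * \<kappa> + r) *s w' + (q * (1 + \<alpha>)) *s z'"
        unfolding v by (simp add: br_simps yz \<open>\<iota> = 0\<close> hz' xz' wz vec_eq_iff algebra_simps)
      then show "\<exists>a b. v \<cdot> z' = a *s w' + b *s z'" by blast
    qed
    moreover have "w' \<noteq> 0"
      using indep2_nonzero[OF ind'] by simp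
    ultimately show False
      using simple_no_pair_ideal[OF \<open>simple\<close>] by blast
  qed
  then have "3 + \<alpha> = 0"
    using \<iota>\<mu> by simp
  then have "\<alpha> = - 3"
    by (simp add: eq_neg_iff_add_eq_0 add.commute)
  define b where "b = \<nu> / 4"
  have four: "(4::'k) \<noteq> 0"
    using two_neq_0 by (metis mult_2 mult_eq_0_iff numeral_Bit0 numeral_plus_numeral semiring_norm(2,6))
  define y' where "y' = y - \<kappa> *s x + b *s w'"
  have "\<nu> = 4 * b"
    using four by (simp add: b_def)
  then have "h \<cdot> y' = y'"
    unfolding y'_def vec_eq_iff by (simp add: br_simps hy hx hw' \<iota>\<mu> \<open>\<alpha> = - 3\<close> algebra_simps)
  then have y'h: "y' \<cdot> h = - y'"
    using br_anti[of y' h] by simp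
  have y'x: "y' \<cdot> x = - h"
    using br_anti[of y x] D by (simp add: y'_def br_simps xz'_anti)
  have y'z: "y' \<cdot> z' = \<iota> *s x"
    by (simp add: y'_def br_simps yz xz' wz)
  have y'w: "y' \<cdot> w' = \<alpha> *s z'"
    by (simp add: y'_def br_simps yw' xw')
  obtain c where "c * \<alpha> * \<iota> = 1"
    using \<alpha>(2) \<open>\<iota> \<noteq> 0\<close> that[of "inverse (\<alpha> * \<iota>)"] by (simp add: mult.assoc del: inverse_mult_distrib)
  then have "y' \<cdot> (y' \<cdot> (y' \<cdot> (y' \<cdot> (c *s w')))) = y'"
    by (simp add: br_simps y'w y'z y'x y'h vector_smult_assoc)
  moreover have "y' \<noteq> 0"
    using y'x D x0 by (auto simp: br_simps)
  ultimately show ?thesis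
    unfolding chain_def by blast
qed

end

section \<open>Subalgebras of codimension one\<close>

context lie_bracket
begin

definition codim1_subalgebra_form :: "('k^'n \<Rightarrow> 'k) \<Rightarrow> bool" where
  "codim1_subalgebra_form \<pi> \<longleftrightarrow> form \<pi> \<and> (\<exists>v. \<pi> v \<noteq> 0) \<and>
     (\<forall>u v. \<pi> u = 0 \<longrightarrow> \<pi> v = 0 \<longrightarrow> \<pi> (u \<cdot> v) = 0)"

end

context finite_lie_bracket
begin

text \<open>
  Let \<open>z\<close> lie outside of the subalgebra \<open>M = ker \<pi>\<close>, and let \<open>F k\<close> be the set of the \<open>m\<close> in
  \<open>M\<close> for which \<open>(ad z)\<^sup>j m\<close> lies in \<open>M\<close> for all \<open>j \<le> k\<close>. All \<open>F k\<close> are stable under \<open>M\<close>, so a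
  term with \<open>F k = F (k + 1)\<close> would be an ideal. In a simple algebra the dimension therefore
  drops by one in each step, and \<open>z\<close> together with a vector \<open>e3\<close> from the last nonzero term
  generates a full flag. An element \<open>h\<close> acts on its quotients with the eigenvalues -1, 0, 1,
  2, 3, and an eigenvector for -1 outside of \<open>M\<close>, in place of \<open>z\<close>, has a full Jordan chain.
\<close>

lemma codim1_imp_chain:
  assumes simple and \<pi>: "codim1_subalgebra_form \<pi>"
  shows "\<exists>x e. chain x e"
proof -
  have form: "form \<pi>" and sub: "\<And>u v. \<pi> u = 0 \<Longrightarrow> \<pi> v = 0 \<Longrightarrow> \<pi> (u \<cdot> v) = 0"
    using \<pi> by (auto simp: codim1_subalgebra_form_def)
  note fs = form_simps[OF form]
  obtain z where z: "\<pi> z = 1"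
  proof -
    obtain v where "\<pi> v \<noteq> 0"
      using \<pi> by (auto simp: codim1_subalgebra_form_def)
    then show thesis
      using that[of "inverse (\<pi> v) *s v"] by (simp add: fs)
  qed
  define F where "F k = ((\<lambda>S. {m. \<pi> m = 0 \<and> z \<cdot> m \<in> S}) ^^ k) {m. \<pi> m = 0}" for k
  have F0: "m \<in> F 0 \<longleftrightarrow> \<pi> m = 0" for m
    by (simp add: F_def)
  have FSuc: "m \<in> F (Suc k) \<longleftrightarrow> \<pi> m = 0 \<and> z \<cdot> m \<in> F k" for m k
    by (simp add: F_def)
  have F1: "m \<in> F (Suc 0) \<longleftrightarrow> \<pi> m = 0 \<and> z \<cdot> m \<in> F 0"
    and F2: "m \<in> F 2 \<longleftrightarrow> \<pi> m = 0 \<and> z \<cdot> m \<in> F (Suc 0)"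
    and F3: "m \<in> F 3 \<longleftrightarrow> \<pi> m = 0 \<and> z \<cdot> m \<in> F 2"
    and F4: "m \<in> F 4 \<longleftrightarrow> \<pi> m = 0 \<and> z \<cdot> m \<in> F 3" for m
    using FSuc[of m 0] FSuc[of m 1] FSuc[of m 2] FSuc[of m 3] by (simp_all add: numeral_eq_Suc)
  have mono_Suc: "m \<in> F (Suc k) \<Longrightarrow> m \<in> F k" for m k
    by (induction k arbitrary: m) (auto simp: F0 FSuc)
  have mono: "m \<in> F (Suc 0) \<Longrightarrow> m \<in> F 0" "m \<in> F 2 \<Longrightarrow> m \<in> F (Suc 0)" "m \<in> F 3 \<Longrightarrow> m \<in> F 2"
    "m \<in> F 4 \<Longrightarrow> m \<in> F 3" for m
    using mono_Suc[of m 0] mono_Suc[of m 1] mono_Suc[of m 2] mono_Suc[of m 3]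
    by (simp_all add: numeral_eq_Suc)
  have Fle0: "m \<in> F k \<Longrightarrow> \<pi> m = 0" for m k
    by (cases k) (auto simp: F0 FSuc)
  have subspace: "vec.subspace (F k)" for k
  proof (induction k)
    case 0
    then show ?case by (auto simp: vec.subspace_def F0 fs)
  next
    case (Suc k)
    then show ?case by (auto simp: vec.subspace_def FSuc fs br_simps)
  qed
  note add = vec.subspace_add[OF subspace] and diff = vec.subspace_diff[OF subspace]
    and scale = vec.subspace_scale[OF subspace]
  have dec: "\<exists>v0. v = \<pi> v *s z + v0 \<and> v0 \<in> F 0" for v
    by (intro exI[of _ "v - \<pi> v *s z"]) (simp add: F0 fs z)
  have closed: "u \<cdot> m \<in> F k" if "u \<in> F 0" "m \<in> F k" for u m k
    using that
  proof (induction k arbitrary: m u)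
    case 0
    then show ?case
      using sub by (simp add: F0)
  next
    case (Suc k)
    obtain u' where u': "z \<cdot> u = \<pi> (z \<cdot> u) *s z + u'" "u' \<in> F 0"
      using dec by blast
    have "z \<cdot> (u \<cdot> m) = \<pi> (z \<cdot> u) *s z \<cdot> m + u' \<cdot> m + u \<cdot> (z \<cdot> m)"
      using br_derivation[of z u m] u'(1) by (metis br_add_left br_scale_left)
    also have "\<dots> \<in> F k"
      using Suc u'(2) mono_Suc by (intro add scale) (auto simp: FSuc)
    finally show ?case
      using Suc.prems sub by (simp add: FSuc F0)
  qed
  have strict: "F k = {0}" if "F k \<subseteq> F (Suc k)" for k
  proof -
    have "x \<cdot> y \<in> F k" if y: "y \<in> F k" for x y
    proof -
      obtain x0 where x0: "x = \<pi> x *s z + x0" "x0 \<in> F 0"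
        using dec by blast
      have "x \<cdot> y = \<pi> x *s z \<cdot> y + x0 \<cdot> y"
        using x0(1) by (metis br_add_left br_scale_left)
      also have "\<dots> \<in> F k"
        using y x0 closed \<open>F k \<subseteq> F (Suc k)\<close> by (intro add scale) (auto simp: FSuc)
      finally show ?thesis .
    qed
    then have "ideal (F k)"
      by (simp add: ideal_def subspace)
    moreover have "z \<notin> F k"
      using z Fle0 by fastforce
    ultimately show ?thesis
      using \<open>simple\<close> by (auto simp: simple_def)
  qed
  \<comment> \<open>Four linear conditions in dimension five leave a vector \<open>e3\<close> in the last nonzero
    term of the filtration.\<close>
  obtain e3 where e3: "\<pi> e3 = 0" "\<pi> (z \<cdot> e3) = 0" "\<pi> (z \<cdot> (z \<cdot> e3)) = 0"
    "\<pi> (z \<cdot> (z \<cdot> (z \<cdot> e3))) = 0" "\<pi> (z \<cdot> (z \<cdot> (z \<cdot> (z \<cdot> e3)))) = 1"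
  proof -
    obtain w :: "nat \<Rightarrow> 'k^'n" where w: "indep 5 w"
      using indep_extend_to_basis[OF indep_empty[of "\<lambda>_. 0 :: 'k^'n"], of 5] dim5 by auto
    obtain c where c: "\<exists>i<5. c i \<noteq> 0" "\<forall>j<4. (\<Sum>i<5. c i * \<pi> (((\<cdot>) z ^^ j) (w i))) = 0"
      using homogeneous_system[of 4 5 "\<lambda>j i. \<pi> (((\<cdot>) z ^^ j) (w i))"] by auto
    define m where "m = (\<Sum>i<5. c i *s w i)"
    have "m \<noteq> 0"
      using w c(1) by (auto simp: m_def indep_def)
    have "m \<in> F 3"
      unfolding F3 F2 F1 F0
      using c(2)[rule_format, of 0] c(2)[rule_format, of 1] c(2)[rule_format, of 2] c(2)[rule_format, of 3]
      by (simp add: m_def br_sum_right br_simps fs numeral_eq_Suc)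
    then have "\<not> F 3 \<subseteq> F 4"
      using strict[of 3] \<open>m \<noteq> 0\<close> by (auto simp: numeral_eq_Suc)
    then obtain e where e: "e \<in> F 3" "e \<notin> F 4"
      by blast
    let ?c = "\<pi> (z \<cdot> (z \<cdot> (z \<cdot> (z \<cdot> e))))"
    have "?c \<noteq> 0"
      using e by (auto simp: F4 F3 F2 F1 F0)
    then show thesis
      using e(1) that[of "inverse ?c *s e"] by (simp add: F3 F2 F1 F0 br_simps fs)
  qed
  define e2 where "e2 = z \<cdot> e3"
  define e1 where "e1 = z \<cdot> e2"
  define h where "h = z \<cdot> e1"
  note ze = e2_def[symmetric] e1_def[symmetric] h_def[symmetric]
  have \<pi>e: "\<pi> e3 = 0" "\<pi> e2 = 0" "\<pi> e1 = 0" "\<pi> h = 0" "\<pi> (z \<cdot> h) = 1"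
    using e3 by (simp_all add: e2_def e1_def h_def)
  have eF: "h \<in> F 0" "e1 \<in> F (Suc 0)" "e2 \<in> F 2" "e3 \<in> F 3"
    by (simp_all add: F0 F1 F2 F3 ze \<pi>e)
  note eF' = mono(1)[OF eF(2)] mono(2)[OF eF(3)] mono(1)[OF mono(2)[OF eF(3)]] mono(3)[OF eF(4)]
    mono(2)[OF mono(3)[OF eF(4)]] mono(1)[OF mono(2)[OF mono(3)[OF eF(4)]]]
  have indep: "indep 5 (nth [z, h, e1, e2, e3])"
    unfolding indep5
  proof (intro allI impI)
    fix r s t u v
    assume eq: "r *s z + s *s h + t *s e1 + u *s e2 + v *s e3 = 0"
    have r: "r = 0"
      using arg_cong[OF eq, of \<pi>] by (simp add: fs \<pi>e z)
    have s: "s = 0"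
      using arg_cong[OF eq, of "\<lambda>v. \<pi> (z \<cdot> v)"] by (simp add: fs \<pi>e br_simps ze r)
    have t: "t = 0"
      using arg_cong[OF eq, of "\<lambda>v. \<pi> (z \<cdot> (z \<cdot> v))"] by (simp add: fs \<pi>e br_simps ze r s)
    have u: "u = 0"
      using arg_cong[OF eq, of "\<lambda>v. \<pi> (z \<cdot> (z \<cdot> (z \<cdot> v)))"] by (simp add: fs \<pi>e br_simps ze r s t)
    have v: "v = 0"
      using arg_cong[OF eq, of "\<lambda>v. \<pi> (z \<cdot> (z \<cdot> (z \<cdot> (z \<cdot> v))))"]
      by (simp add: fs \<pi>e br_simps ze r s t u)
    show "r = 0 \<and> s = 0 \<and> t = 0 \<and> u = 0 \<and> v = 0"
      using r s t u v by simp
  qed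
  have F4_0: "v = 0" if "v \<in> F 4" for v
  proof -
    obtain p q r s t where v: "v = p *s z + q *s h + r *s e1 + s *s e2 + t *s e3"
      using indep5_coordinates[OF dim5 indep] by blast
    have "p = 0"
      using that by (simp add: v F4 F3 F2 F1 F0 br_simps fs ze \<pi>e z)
    moreover have "q = 0"
      using that by (simp add: v F4 F3 F2 F1 F0 br_simps fs ze \<pi>e z \<open>p = 0\<close>)
    moreover have "r = 0"
      using that by (simp add: v F4 F3 F2 F1 F0 br_simps fs ze \<pi>e z \<open>p = 0\<close> \<open>q = 0\<close>)
    moreover have "s = 0"
      using that by (simp add: v F4 F3 F2 F1 F0 br_simps fs ze \<pi>e z \<open>p = 0\<close> \<open>q = 0\<close> \<open>r = 0\<close>)
    moreover have "t = 0"
      using that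
      by (simp add: v F4 F3 F2 F1 F0 br_simps fs ze \<pi>e z \<open>p = 0\<close> \<open>q = 0\<close> \<open>r = 0\<close> \<open>s = 0\<close>)
    ultimately show ?thesis
      using v by simp
  qed
  have step: "v \<in> F 0 \<Longrightarrow> \<exists>t. v - t *s h \<in> F (Suc 0)" "v \<in> F (Suc 0) \<Longrightarrow> \<exists>t. v - t *s e1 \<in> F 2"
    "v \<in> F 2 \<Longrightarrow> \<exists>t. v - t *s e2 \<in> F 3" "v \<in> F 3 \<Longrightarrow> \<exists>t. v - t *s e3 \<in> F 4" for v
       apply (intro exI[of _ "\<pi> (z \<cdot> v)"], simp add: F4 F3 F2 F1 F0 br_simps fs ze \<pi>e)
      apply (intro exI[of _ "\<pi> (z \<cdot> (z \<cdot> v))"], simp add: F4 F3 F2 F1 F0 br_simps fs ze \<pi>e)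
     apply (intro exI[of _ "\<pi> (z \<cdot> (z \<cdot> (z \<cdot> v)))"], simp add: F4 F3 F2 F1 F0 br_simps fs ze \<pi>e)
    apply (intro exI[of _ "\<pi> (z \<cdot> (z \<cdot> (z \<cdot> (z \<cdot> v))))"], simp add: F4 F3 F2 F1 F0 br_simps fs ze \<pi>e)
    done
  obtain m where m: "z \<cdot> h = z + m" "m \<in> F 0"
    using dec[of "z \<cdot> h"] \<pi>e by auto
  \<comment> \<open>Modulo the filtration, \<open>h\<close> has the eigenvalues -1, 0, 1, 2, 3.\<close>
  have he1: "h \<cdot> e1 - e1 \<in> F 2"
  proof -
    have "z \<cdot> (h \<cdot> e1 - e1) = m \<cdot> e1"
      using br_derivation[of z h e1] m(1) by (simp add: br_simps ze)
    then show ?thesis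
      using closed[OF m(2) eF(2)] closed[OF eF(1) eF'(1)] \<pi>e by (simp add: F2 F0 fs)
  qed
  have he2: "h \<cdot> e2 - 2 *s e2 \<in> F 3"
  proof -
    have "z \<cdot> (h \<cdot> e2 - 2 *s e2) = m \<cdot> e2 + (h \<cdot> e1 - e1)"
      using br_derivation[of z h e2] m(1) by (simp add: br_simps ze vec_eq_iff)
    also have "\<dots> \<in> F 2"
      by (rule add[OF closed[OF m(2) eF(3)] he1])
    finally show ?thesis
      using closed[OF eF(1) eF'(3)] \<pi>e by (simp add: F3 F0 fs)
  qed
  have he3: "h \<cdot> e3 = 3 *s e3"
  proof -
    have "z \<cdot> (h \<cdot> e3 - 3 *s e3) = m \<cdot> e3 + (h \<cdot> e2 - 2 *s e2)"
      using br_derivation[of z h e3] m(1) by (simp add: br_simps ze vec_eq_iff)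
    also have "\<dots> \<in> F 3"
      by (rule add[OF closed[OF m(2) eF(4)] he2])
    finally have "h \<cdot> e3 - 3 *s e3 \<in> F 4"
      using closed[OF eF(1) eF'(6)] \<pi>e by (simp add: F4 F0 fs)
    from F4_0[OF this] show ?thesis by simp
  qed
  have e12: "e1 \<cdot> e2 = 2 *s e3"
  proof -
    have "z \<cdot> (e1 \<cdot> e2 - 2 *s e3) = h \<cdot> e2 - 2 *s e2"
      using br_derivation[of z e1 e2] by (simp add: br_simps ze)
    then have "e1 \<cdot> e2 - 2 *s e3 \<in> F 4"
      using he2 closed[OF eF'(1) eF'(3)] \<pi>e by (simp add: F4 F0 fs)
    from F4_0[OF this] show ?thesis by simp
  qed
  have five: "(5::'k) = 0"
  proof -
    have *: "z \<cdot> (e1 \<cdot> e3) = 5 *s e3"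
      using br_derivation[of z e1 e3] he3 e12 by (simp add: br_simps ze vec_eq_iff)
    then have "e1 \<cdot> e3 \<in> F 4"
      using closed[OF eF'(1) eF'(6)] scale[OF eF(4)] by (simp add: F4 F0)
    then have "5 *s e3 = 0"
      using F4_0 * by (metis br_0_right)
    then show ?thesis
      using indep[unfolded indep5, rule_format, of 0 0 0 0 5] by auto
  qed
  have nz: "(2::'k) \<noteq> 0" "(3::'k) \<noteq> 0" "(4::'k) \<noteq> 0"
  proof -
    show "(2::'k) \<noteq> 0" by (rule two_neq_0)
    have eqs: "(3::'k) * 2 = 5 + 1" "(5::'k) = 4 + 1"
      by simp_all
    show "(3::'k) \<noteq> 0"
      using eqs(1) unfolding five by (metis add_0 mult_zero_left zero_neq_one)
    show "(4::'k) \<noteq> 0"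
      using eqs(2) unfolding five by (metis add_0 zero_neq_one)
  qed
  \<comment> \<open>The eigenvector of eigenvalue -1 that lies outside the subalgebra.\<close>
  obtain z' where z': "h \<cdot> z' = - z'" "z' - z \<in> F 0"
  proof -
    let ?T = "\<lambda>w. h \<cdot> w + w"
    have hz: "h \<cdot> z = - (z + m)"
      using br_anti[of h z] m(1) by simp
    have "?T z \<in> F 0"
      using m(2) hz vec.subspace_neg[OF subspace] by simp
    then obtain t0 where t0: "?T z - t0 *s h \<in> F (Suc 0)"
      using step(1) by blast
    define w1 where "w1 = z - t0 *s h"
    have "?T w1 \<in> F (Suc 0)"
      using t0 by (simp add: w1_def br_simps algebra_simps)
    then obtain t1 where t1: "?T w1 - t1 *s e1 \<in> F 2"
      using step(2) by blast
    obtain s1 where s1: "t1 = 2 * s1"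
      using nz that[of "t1 / 2"] by simp
    define w2 where "w2 = w1 - s1 *s e1"
    have "?T w2 = (?T w1 - t1 *s e1) - s1 *s (h \<cdot> e1 - e1)"
      by (simp add: w2_def br_simps s1 vec_eq_iff algebra_simps)
    then have "?T w2 \<in> F 2"
      using diff[OF t1 scale[OF he1]] by simp
    then obtain t2 where t2: "?T w2 - t2 *s e2 \<in> F 3"
      using step(3) by blast
    obtain s2 where s2: "t2 = 3 * s2"
      using nz that[of "t2 / 3"] by simp
    define w3 where "w3 = w2 - s2 *s e2"
    have "?T w3 = (?T w2 - t2 *s e2) - s2 *s (h \<cdot> e2 - 2 *s e2)"
      by (simp add: w3_def br_simps s2 vec_eq_iff algebra_simps)
    then have "?T w3 \<in> F 3"
      using diff[OF t2 scale[OF he2]] by simp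
    then obtain t3 where t3: "?T w3 - t3 *s e3 \<in> F 4"
      using step(4) by blast
    obtain s3 where s3: "t3 = 4 * s3"
      using nz that[of "t3 / 4"] by simp
    define w4 where "w4 = w3 - s3 *s e3"
    have "?T w4 = ?T w3 - t3 *s e3"
      by (simp add: w4_def br_simps he3 s3 vec_eq_iff algebra_simps)
    then have "?T w4 = 0"
      using F4_0[OF t3] by simp
    moreover have "w4 - z \<in> F 0"
      using eF(1) eF' by (simp add: w4_def w3_def w2_def w1_def F0 fs)
    ultimately show thesis
      using that by (simp add: eq_neg_iff_add_eq_0)
  qed
  define m0 where "m0 = z' - z"
  have m0: "m0 \<in> F 0" and z'_eq: "z' = z + m0"
    using z' by (simp_all add: m0_def)
  define v2 where "v2 = z' \<cdot> e3"
  define v1 where "v1 = z' \<cdot> v2"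
  define v0 where "v0 = z' \<cdot> v1"
  have v2: "v2 - e2 \<in> F 3"
    using closed[OF m0 eF(4)] by (simp add: v2_def z'_eq br_simps ze)
  have v2F: "v2 \<in> F 2"
    using add[OF mono(3)[OF v2] eF(3)] by simp
  have v1: "v1 - e1 \<in> F 2"
  proof -
    have "v1 - e1 = z \<cdot> (v2 - e2) + m0 \<cdot> v2"
      by (simp add: v1_def z'_eq br_simps ze)
    moreover have "z \<cdot> (v2 - e2) \<in> F 2"
      using v2 by (simp add: F3)
    ultimately show ?thesis
      using add closed[OF m0 v2F] by simp
  qed
  have v1F: "v1 \<in> F (Suc 0)"
    using add[OF mono(2)[OF v1] eF(2)] by simp
  have v0: "v0 - h \<in> F (Suc 0)"
  proof -
    have "v0 - h = z \<cdot> (v1 - e1) + m0 \<cdot> v1"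
      by (simp add: v0_def z'_eq br_simps ze)
    moreover have "z \<cdot> (v1 - e1) \<in> F (Suc 0)"
      using v1 by (simp add: F2)
    ultimately show ?thesis
      using add closed[OF m0 v1F] by simp
  qed
  have hv2: "h \<cdot> v2 = 2 *s v2"
    using br_derivation[of h z' e3] z' he3 by (simp add: v2_def br_simps vec_eq_iff)
  have hv1: "h \<cdot> v1 = v1"
    using br_derivation[of h z' v2] z' hv2 by (simp add: v1_def br_simps vec_eq_iff)
  have hv0: "h \<cdot> v0 = 0"
    using br_derivation[of h z' v1] z' hv1 by (simp add: v0_def br_simps)
  \<comment> \<open>\<open>ad h\<close> is injective on the second term of the filtration.\<close>
  have "v0 - h = 0"
  proof -
    let ?w = "v0 - h"
    have h0: "h \<cdot> ?w = 0"
      using hv0 by (simp add: br_simps)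
    obtain t where t: "?w - t *s e1 \<in> F 2"
      using step(2)[OF v0] by blast
    have "t *s e1 = - (h \<cdot> (?w - t *s e1)) - t *s (h \<cdot> e1 - e1)"
      using h0 by (simp add: br_simps algebra_simps)
    also have "\<dots> \<in> F 2"
      by (intro diff vec.subspace_neg[OF subspace] closed[OF eF(1) t] scale[OF he1])
    finally have "t = 0"
      by (simp add: F2 F1 F0 br_simps fs ze \<pi>e)
    then have w2: "?w \<in> F 2"
      using t by simp
    obtain t where t: "?w - t *s e2 \<in> F 3"
      using step(3)[OF w2] by blast
    have "(2 * t) *s e2 = - (h \<cdot> (?w - t *s e2)) - t *s (h \<cdot> e2 - 2 *s e2)"
      using h0 by (simp add: br_simps vec_eq_iff algebra_simps)
    also have "\<dots> \<in> F 3"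
      by (intro diff vec.subspace_neg[OF subspace] closed[OF eF(1) t] scale[OF he2])
    finally have "t = 0"
      using nz by (simp add: F3 F2 F1 F0 br_simps fs ze \<pi>e)
    then have w3: "?w \<in> F 3"
      using t by simp
    obtain t where "?w - t *s e3 \<in> F 4"
      using step(4)[OF w3] by blast
    then have w: "?w = t *s e3"
      using F4_0 by fastforce
    then have "(t * 3) *s e3 = 0"
      using h0 he3 by (simp add: br_simps vector_smult_assoc)
    then have "t * 3 = 0"
      using indep[unfolded indep5, rule_format, of 0 0 0 0 "t * 3"] by auto
    then show ?thesis
      using w nz by simp
  qed
  then have "z' \<cdot> (z' \<cdot> (z' \<cdot> (z' \<cdot> e3))) = z'"
    using br_anti[of z' h] z'(1) by (simp add: v0_def v1_def v2_def)
  moreover have "\<pi> z' = 1"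
    using z'(2) z by (simp add: F0 fs)
  then have "z' \<noteq> 0"
    by (auto simp: fs)
  ultimately show ?thesis
    unfolding chain_def by blast
qed

end

section \<open>Linear forms with a three-dimensional radical\<close>

lemma indep_snoc:
  fixes xs :: "('k::field^'n) list"
  assumes "indep (length xs) (nth xs)" "length xs < CARD('n)"
  obtains v where "indep (Suc (length xs)) (nth (xs @ [v]))"
proof -
  obtain w where w: "indep (Suc (length xs)) w" "\<And>i. i < length xs \<Longrightarrow> w i = xs ! i"
    using indep_extend_to_basis[OF assms(1), of "Suc (length xs)"] assms(2) by auto
  have "indep (Suc (length xs)) (nth (xs @ [w (length xs)])) = indep (Suc (length xs)) w"
    by (rule indep_cong) (auto simp: nth_append less_Suc_eq w(2))
  then show thesis
    using w(1) that by blast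
qed

context finite_lie_bracket
begin

text \<open>
  The radical of the skew bilinear form \<open>f (u \<cdot> v)\<close>, known as the stabilizer of \<open>f\<close> in the
  coadjoint representation.
\<close>

definition radical :: "('k^'n \<Rightarrow> 'k) \<Rightarrow> ('k^'n) set" where
  "radical f = {n. \<forall>y. f (n \<cdot> y) = 0}"

lemma radical_subspace: "form f \<Longrightarrow> vec.subspace (radical f)"
  by (auto simp: vec.subspace_def radical_def br_simps form_simps)

lemma radical_br_closed:
  assumes "form f" "n \<in> radical f" "m \<in> radical f"
  shows "n \<cdot> m \<in> radical f"
proof -
  have "f ((n \<cdot> m) \<cdot> y) = 0" for y
  proof -
    have "(n \<cdot> m) \<cdot> y = n \<cdot> (m \<cdot> y) - m \<cdot> (n \<cdot> y)"
      using br_derivation[of n m y] by simp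
    then show ?thesis
      using assms by (simp add: radical_def form_simps)
  qed
  then show ?thesis
    by (simp add: radical_def)
qed

lemma perfect_imp_hyperbolic_pair:
  assumes perfect "form f" "f v \<noteq> 0"
  obtains y1 y2 where "f (y1 \<cdot> y2) = 1"
proof -
  obtain a b where "f (a \<cdot> b) \<noteq> 0"
    using assms unfolding perfect_def by metis
  then show thesis
    using that[of "inverse (f (a \<cdot> b)) *s a" b] assms by (simp add: br_simps form_simps)
qed

text \<open>
  For a radical of codimension two, the orthogonal space of a vector \<open>v\<close> outside of it is the
  radical plus the line through \<open>v\<close>. As the radical is a subalgebra, only its stability of
  this line modulo the radical has to be checked.
\<close>

lemma orthogonal_codim1:
  assumes f: "form f" and y: "f (y1 \<cdot> y2) = 1"
    and dec: "\<And>w. w - f (w \<cdot> y2) *s y1 + f (w \<cdot> y1) *s y2 \<in> radical f"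
    and v: "v = v1 *s y1 + v2 *s y2" "v1 \<noteq> 0 \<or> v2 \<noteq> 0"
    and stable: "\<And>n. n \<in> radical f \<Longrightarrow> f ((n \<cdot> v) \<cdot> v) = 0"
  shows "codim1_subalgebra_form (\<lambda>w. f (w \<cdot> v))"
proof -
  note fs = form_simps[OF f]
  have y': "f (y2 \<cdot> y1) = -1"
    using br_anti[of y2 y1] y by (simp add: fs)
  have form: "form (\<lambda>w. f (w \<cdot> v))"
    by (rule form_br_left[OF f])
  have "f (y1 \<cdot> v) = v2" "f (y2 \<cdot> v) = - v1"
    by (simp_all add: v br_simps fs y y')
  then have nz: "\<exists>w. f (w \<cdot> v) \<noteq> 0"
    using v(2) by (metis neg_equal_0_iff_equal)
  have mult: "\<exists>\<sigma>. w - \<sigma> *s v \<in> radical f" if "f (w \<cdot> v) = 0" for w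
  proof -
    let ?s = "f (w \<cdot> y2)" and ?t = "- f (w \<cdot> y1)"
    have "?s * v2 = ?t * v1"
      using that by (simp add: v br_simps fs algebra_simps add_eq_0_iff)
    then obtain \<sigma> where "?s = \<sigma> * v1" "?t = \<sigma> * v2"
    proof (cases "v1 = 0")
      case True
      then show ?thesis
        using v(2) \<open>?s * v2 = _\<close> that[of "?t / v2"] by simp
    next
      case False
      then show ?thesis
        using \<open>?s * v2 = _\<close> that[of "?s / v1"] by (simp add: field_simps)
    qed
    then have "w - \<sigma> *s v = w - f (w \<cdot> y2) *s y1 + f (w \<cdot> y1) *s y2"
      by (simp add: v vec_eq_iff algebra_simps) (metis (no_types, lifting) add_uminus_conv_diff diff_add_cancel minus_mult_left mult.commute mult.left_commute neg_eq_iff_add_eq_0)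
    then show ?thesis
      using dec by metis
  qed
  have "f ((w1 \<cdot> w2) \<cdot> v) = 0" if w12: "f (w1 \<cdot> v) = 0" "f (w2 \<cdot> v) = 0" for w1 w2
  proof -
    obtain s1 s2 where s: "w1 - s1 *s v \<in> radical f" "w2 - s2 *s v \<in> radical f"
      using mult[OF w12(1)] mult[OF w12(2)] by blast
    define n1 n2 where "n1 = w1 - s1 *s v" and "n2 = w2 - s2 *s v"
    have n: "n1 \<in> radical f" "n2 \<in> radical f"
      using s by (simp_all add: n1_def n2_def)
    have w: "w1 = n1 + s1 *s v" "w2 = n2 + s2 *s v"
      by (simp_all add: n1_def n2_def)
    have "v \<cdot> n2 = - (n2 \<cdot> v)"
      by (rule br_anti)
    then have "w1 \<cdot> w2 = n1 \<cdot> n2 + s2 *s n1 \<cdot> v - s1 *s n2 \<cdot> v"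
      by (simp add: w br_simps vec_eq_iff)
    moreover have "f ((n1 \<cdot> n2) \<cdot> v) = 0"
      using radical_br_closed[OF f n] by (simp add: radical_def)
    ultimately show ?thesis
      using stable n by (simp add: br_simps fs)
  qed
  then show ?thesis
    using form nz by (simp add: codim1_subalgebra_form_def)
qed

text \<open>
  The radical \<open>N\<close> is a subalgebra of dimension three and acts on the symplectic plane \<open>L / N\<close>
  by matrices of trace zero. If \<open>f\<close> vanishes on \<open>N\<close>, the kernel of \<open>f\<close> is a subalgebra.
  Otherwise the action is not faithful, since \<open>sl(2)\<close> is perfect and \<open>f\<close> vanishes on the
  brackets of \<open>N\<close>. The image is then a proper subalgebra of \<open>sl(2)\<close>. Either it stabilizes a
  line of the plane, and the preceding lemma applies to a vector on this line, or it is
  spanned by one invertible matrix, and the kernel of the action is an ideal.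
\<close>

lemma rank2_imp_codim1:
  assumes simple perfect and f: "form f" "\<exists>v. f v \<noteq> 0"
    and x: "x \<in> radical f" "n \<in> radical f" and ind: "indep 2 (nth [x, n])"
  shows "\<exists>\<pi>. codim1_subalgebra_form \<pi>"
proof -
  note fs = form_simps[OF f(1)]
  obtain y1 y2 where y: "f (y1 \<cdot> y2) = 1"
    using perfect_imp_hyperbolic_pair \<open>perfect\<close> f by metis
  have y': "f (y2 \<cdot> y1) = -1"
    using br_anti[of y2 y1] y by (simp add: fs)
  define N where "N = radical f"
  have N: "m \<in> N \<longleftrightarrow> (\<forall>y. f (m \<cdot> y) = 0)" for m
    by (simp add: N_def radical_def)
  have N0: "m \<in> N \<Longrightarrow> f (y \<cdot> m) = 0" "m \<in> N \<Longrightarrow> f (m \<cdot> y) = 0" for m y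
    using br_anti[of y m] by (simp_all add: N fs)
  have subspace: "vec.subspace N"
    unfolding N_def by (rule radical_subspace[OF f(1)])
  have closed: "m \<cdot> m' \<in> N" if "m \<in> N" "m' \<in> N" for m m'
    using that radical_br_closed[OF f(1)] by (simp add: N_def)
  \<comment> \<open>The radical is a three-dimensional complement of \<open>y1, y2\<close>.\<close>
  have "indep (length [x, n, y1, y2]) (nth [x, n, y1, y2])"
  proof -
    have "r = 0 \<and> s = 0 \<and> t = 0 \<and> u = 0" if eq: "r *s x + s *s n + t *s y1 + u *s y2 = 0" for r s t u
    proof -
      have t: "t = 0"
        using arg_cong[OF eq, of "\<lambda>w. f (w \<cdot> y2)"] x y by (simp add: br_simps fs radical_def)
      have u: "u = 0"
        using arg_cong[OF eq, of "\<lambda>w. f (w \<cdot> y1)"] x y' by (simp add: br_simps fs radical_def)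
      have "r *s x + s *s n = 0"
        using eq t u by simp
      then have "r = 0 \<and> s = 0"
        using ind unfolding indep2 by blast
      then show ?thesis
        using t u by simp
    qed
    then have "indep 4 (nth [x, n, y1, y2])"
      unfolding indep4 by blast
    then show ?thesis
      by (simp add: numeral_eq_Suc)
  qed
  from indep_snoc[OF this] obtain v0 where "indep (Suc (length [x, n, y1, y2])) (nth ([x, n, y1, y2] @ [v0]))"
    using dim5 by auto
  then have ind0: "indep 5 (nth [x, n, y1, y2, v0])"
    by (simp add: numeral_eq_Suc)
  define v where "v = v0 - f (v0 \<cdot> y2) *s y1 + f (v0 \<cdot> y1) *s y2"
  have vy: "f (v \<cdot> y1) = 0" "f (v \<cdot> y2) = 0"
    by (simp_all add: v_def br_simps fs y y')
  have xN: "x \<in> N" "n \<in> N"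
    using x by (simp_all add: N_def)
  have vN: "v \<in> N"
    unfolding N
  proof
    fix w
    obtain p q r s t where w: "w = p *s x + q *s n + r *s y1 + s *s y2 + t *s v0"
      using indep5_coordinates[OF dim5 ind0] by blast
    have "v0 = v + f (v0 \<cdot> y2) *s y1 - f (v0 \<cdot> y1) *s y2"
      by (simp add: v_def)
    then have "f (v \<cdot> v0) = f (v \<cdot> (v + f (v0 \<cdot> y2) *s y1 - f (v0 \<cdot> y1) *s y2))"
      by simp
    also have "\<dots> = 0"
      by (simp add: br_simps fs vy)
    finally show "f (v \<cdot> w) = 0"
      by (simp add: w br_simps fs vy N0 xN)
  qed
  have indN: "indep 3 (nth [x, n, v])"
    unfolding indep3
  proof (intro allI impI)
    fix r s t assume "r *s x + s *s n + t *s v = 0"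
    then have "r *s x + s *s n + (- t * f (v0 \<cdot> y2)) *s y1 + (t * f (v0 \<cdot> y1)) *s y2 + t *s v0 = 0"
      by (simp add: v_def vec_eq_iff algebra_simps)
    then have "r = 0 \<and> s = 0 \<and> t = 0"
      using ind0 unfolding indep5 by blast
    then show "r = 0 \<and> s = 0 \<and> t = 0" .
  qed
  have spanN: "\<exists>p q r. m = p *s x + q *s n + r *s v" if "m \<in> N" for m
  proof -
    obtain p q r s t where m: "m = p *s x + q *s n + r *s y1 + s *s y2 + t *s v0"
      using indep5_coordinates[OF dim5 ind0] by blast
    have "f (m \<cdot> y2) = 0" "f (m \<cdot> y1) = 0"
      using that N by auto
    then have "r = - t * f (v0 \<cdot> y2)" "s = t * f (v0 \<cdot> y1)"
      by (simp_all add: m br_simps fs y y' N0 xN eq_neg_iff_add_eq_0)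
    then have "m = p *s x + q *s n + t *s v"
      by (simp add: m v_def vec_eq_iff algebra_simps)
    then show ?thesis by blast
  qed
  have dec: "w - f (w \<cdot> y2) *s y1 + f (w \<cdot> y1) *s y2 \<in> N" for w
  proof -
    obtain p q r s t where w: "w = p *s x + q *s n + r *s y1 + s *s y2 + t *s v0"
      using indep5_coordinates[OF dim5 ind0] by blast
    have "w - f (w \<cdot> y2) *s y1 + f (w \<cdot> y1) *s y2 = p *s x + q *s n + t *s v"
      by (simp add: w v_def br_simps fs y y' N0 xN vec_eq_iff algebra_simps)
    also have "\<dots> \<in> N"
      by (intro vec.subspace_add[OF subspace] vec.subspace_scale[OF subspace] xN vN)
    finally show ?thesis .
  qed
  show ?thesis
  proof (cases "\<forall>m\<in>N. f m = 0")
    case True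
    \<comment> \<open>The form \<open>f (u \<cdot> w)\<close> of rank two
      is then a multiple of the wedge product of \<open>f\<close> with another linear form.\<close>
    have fw: "f w = f (w \<cdot> y2) * f y1 - f (w \<cdot> y1) * f y2" for w
      using bspec[OF True dec[of w]] by (simp add: fs algebra_simps)
    have fbr: "f (u \<cdot> w) = f (u \<cdot> y2) * - f (w \<cdot> y1) + f (u \<cdot> y1) * f (w \<cdot> y2)" for u w
    proof -
      define w' where "w' = w - f (w \<cdot> y2) *s y1 + f (w \<cdot> y1) *s y2"
      have "f (u \<cdot> w') = 0"
        unfolding w'_def by (rule N0(1)[OF dec])
      then show ?thesis
        by (simp add: w'_def br_simps fs algebra_simps)
    qed
    have nz: "f y1 \<noteq> 0 \<or> f y2 \<noteq> 0"
      using f(2) fw by fastforce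
    have "f (u \<cdot> w) = 0" if "f u = 0" "f w = 0" for u w
    proof -
      let ?u1 = "f (u \<cdot> y1)" and ?u2 = "f (u \<cdot> y2)" and ?w1 = "f (w \<cdot> y1)" and ?w2 = "f (w \<cdot> y2)"
      have u: "?u2 * f y1 = ?u1 * f y2" and w: "?w2 * f y1 = ?w1 * f y2"
        using that fw[of u] fw[of w] by simp_all
      have "(?u1 * ?w2 - ?u2 * ?w1) * f y1 = ?u1 * (?w2 * f y1) - (?u2 * f y1) * ?w1"
        by (simp add: algebra_simps)
      also have "\<dots> = 0"
        unfolding u w by simp
      finally have 1: "(?u1 * ?w2 - ?u2 * ?w1) * f y1 = 0" .
      have "(?u1 * ?w2 - ?u2 * ?w1) * f y2 = (?u1 * f y2) * ?w2 - ?u2 * (?w1 * f y2)"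
        by (simp add: algebra_simps)
      also have "\<dots> = 0"
        unfolding u[symmetric] w[symmetric] by simp
      finally have "(?u1 * ?w2 - ?u2 * ?w1) * f y2 = 0" .
      with 1 nz have "?u1 * ?w2 - ?u2 * ?w1 = 0"
        by auto
      then show ?thesis
        using fbr[of u w] by (simp add: algebra_simps)
    qed
    then have "codim1_subalgebra_form f"
      using f by (simp add: codim1_subalgebra_form_def)
    then show ?thesis by blast
  next
    case False
    then obtain n0 where n0: "n0 \<in> N" "f n0 \<noteq> 0"
      by blast
    \<comment> \<open>The action of the radical on the quotient is by the matrices with rows \<open>(a, b)\<close> and
      \<open>(c, - a)\<close>.\<close>
    define a where "a m = f ((m \<cdot> y1) \<cdot> y2)" for m
    define b where "b m = - f ((m \<cdot> y1) \<cdot> y1)" for m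
    define c where "c m = f ((m \<cdot> y2) \<cdot> y2)" for m
    have lin: "a (p *s m + q *s m') = p * a m + q * a m'" "b (p *s m + q *s m') = p * b m + q * b m'"
      "c (p *s m + q *s m') = p * c m + q * c m'" for p q m m'
      by (simp_all add: a_def b_def c_def br_simps fs)
    have lin_diff: "a (m - m') = a m - a m'" "b (m - m') = b m - b m'" "c (m - m') = c m - c m'" for m m'
      by (simp_all add: a_def b_def c_def br_simps fs)
    have lin_scale: "a (p *s m) = p * a m" "b (p *s m) = p * b m" "c (p *s m) = p * c m" for p m
      by (simp_all add: a_def b_def c_def br_simps fs)
    have lin_add: "a (m + m') = a m + a m'" "b (m + m') = b m + b m'" "c (m + m') = c m + c m'" for m m'
      by (simp_all add: a_def b_def c_def br_simps fs)
    note lins = lin_diff lin_scale lin_add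
    have a': "f ((m \<cdot> y2) \<cdot> y1) = a m" if "m \<in> N" for m
    proof -
      have "(m \<cdot> y1) \<cdot> y2 = m \<cdot> (y1 \<cdot> y2) + (m \<cdot> y2) \<cdot> y1"
        using br_derivation[of m y1 y2] br_anti[of "m \<cdot> y2" y1] by simp
      then show ?thesis
        using that by (simp add: a_def N fs)
    qed
    have act: "f ((m \<cdot> w) \<cdot> y2) = f (w \<cdot> y2) * a m - f (w \<cdot> y1) * c m"
      "f ((m \<cdot> w) \<cdot> y1) = - f (w \<cdot> y2) * b m - f (w \<cdot> y1) * a m" if m: "m \<in> N" for m w
    proof -
      define k where "k = w - f (w \<cdot> y2) *s y1 + f (w \<cdot> y1) *s y2"
      have "m \<cdot> k \<in> N"
        unfolding k_def by (rule closed[OF m dec])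
      then have "f ((m \<cdot> k) \<cdot> y2) = 0" "f ((m \<cdot> k) \<cdot> y1) = 0"
        by (simp_all add: N)
      then show "f ((m \<cdot> w) \<cdot> y2) = f (w \<cdot> y2) * a m - f (w \<cdot> y1) * c m"
        "f ((m \<cdot> w) \<cdot> y1) = - f (w \<cdot> y2) * b m - f (w \<cdot> y1) * a m"
        using a'[OF m] by (simp_all add: k_def a_def b_def c_def br_simps fs algebra_simps)
    qed
    have comm: "a (m \<cdot> m') = b m' * c m - b m * c m'" "b (m \<cdot> m') = 2 * (a m' * b m - a m * b m')"
      "c (m \<cdot> m') = 2 * (a m * c m' - a m' * c m)" if m: "m \<in> N" "m' \<in> N" for m m'
    proof -
      have e: "(m \<cdot> m') \<cdot> w = m \<cdot> (m' \<cdot> w) - m' \<cdot> (m \<cdot> w)" for w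
        using br_derivation[of m m' w] by simp
      show "a (m \<cdot> m') = b m' * c m - b m * c m'" "b (m \<cdot> m') = 2 * (a m' * b m - a m * b m')"
        "c (m \<cdot> m') = 2 * (a m * c m' - a m' * c m)"
        unfolding a_def[of "m \<cdot> m'"] b_def[of "m \<cdot> m'"] c_def[of "m \<cdot> m'"] e
        using a'[OF m(1)] a'[OF m(2)]
        by (simp_all add: br_simps fs act m flip: a_def b_def c_def)
          (simp_all add: a_def b_def c_def y y' algebra_simps)
    qed
    have quad: "f ((m \<cdot> (v1 *s y1 + v2 *s y2)) \<cdot> (v1 *s y1 + v2 *s y2)) =
        2 * a m * v1 * v2 + c m * v2\<^sup>2 - b m * v1\<^sup>2" if "m \<in> N" for m v1 v2
      using a'[OF that]
      by (simp add: br_simps fs a_def b_def c_def power2_eq_square algebra_simps)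
    have eigenvector: ?thesis
      if "v1 \<noteq> 0 \<or> v2 \<noteq> 0" "\<And>m. m \<in> N \<Longrightarrow> 2 * a m * v1 * v2 + c m * v2\<^sup>2 - b m * v1\<^sup>2 = 0" for v1 v2
      using orthogonal_codim1[OF f(1) y _ refl that(1)] dec quad that(2) unfolding N_def by metis
    show ?thesis
    proof (cases "\<exists>m1\<in>N. m1 \<noteq> 0 \<and> a m1 = 0 \<and> b m1 = 0 \<and> c m1 = 0")
      case False
      then have inj: "m = 0" if "m \<in> N" "a m = 0" "b m = 0" "c m = 0" for m
        using that by blast
      \<comment> \<open>Then the radical is \<open>sl(2)\<close>, hence perfect, and \<open>f\<close> vanishes on it.\<close>
      have solve: "\<exists>m\<in>N. m \<noteq> 0 \<and> g1 m = 0 \<and> g2 m = 0"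
        if lin: "\<And>m m'. g1 (m + m') = g1 m + g1 m'" "\<And>p m. g1 (p *s m) = p * g1 m"
          "\<And>m m'. g2 (m + m') = g2 m + g2 m'" "\<And>p m. g2 (p *s m) = p * g2 m" for g1 g2 :: "'k^'n \<Rightarrow> 'k"
      proof -
        let ?w = "nth [x, n, v]" and ?g = "nth [g1, g2]"
        obtain d where d: "\<exists>i<3. d i \<noteq> 0" "\<forall>j<2. (\<Sum>i<3. d i * (?g j) (?w i)) = 0"
          using homogeneous_system[of 2 3 "\<lambda>j i. (?g j) (?w i)"] by auto
        have "(\<Sum>i<3. d i *s ?w i) \<noteq> 0"
          using indN d(1) unfolding indep_def by blast
        moreover have "(\<Sum>i<3. d i *s ?w i) = d 0 *s x + d 1 *s n + d 2 *s v"
          by (simp add: numeral_eq_Suc)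
        moreover have "d 0 *s x + d 1 *s n + d 2 *s v \<in> N"
          by (intro vec.subspace_add[OF subspace] vec.subspace_scale[OF subspace] xN vN)
        moreover have "g1 (d 0 *s x + d 1 *s n + d 2 *s v) = 0"
          using d(2)[rule_format, of 0] by (simp add: lin numeral_eq_Suc)
        moreover have "g2 (d 0 *s x + d 1 *s n + d 2 *s v) = 0"
          using d(2)[rule_format, of 1] by (simp add: lin numeral_eq_Suc)
        ultimately show ?thesis by metis
      qed
      have scaleN: "p *s m \<in> N" if "m \<in> N" for p m
        using vec.subspace_scale[OF subspace that] .
      obtain E where E: "E \<in> N" "a E = 0" "b E = 0" "c E = 1"
      proof -
        obtain m where m: "m \<in> N" "m \<noteq> 0" "a m = 0" "b m = 0"
          using solve[of a b] lins by blast
        then have "c m \<noteq> 0"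
          using inj by blast
        then show thesis
          using m that[of "inverse (c m) *s m"] scaleN by (simp add: lins)
      qed
      obtain G where G: "G \<in> N" "a G = 0" "b G = 1" "c G = 0"
      proof -
        obtain m where m: "m \<in> N" "m \<noteq> 0" "a m = 0" "c m = 0"
          using solve[of a c] lins by blast
        then have "b m \<noteq> 0"
          using inj by blast
        then show thesis
          using m that[of "inverse (b m) *s m"] scaleN by (simp add: lins)
      qed
      obtain H where H: "H \<in> N" "a H = 1" "b H = 0" "c H = 0"
      proof -
        obtain m where m: "m \<in> N" "m \<noteq> 0" "b m = 0" "c m = 0"
          using solve[of b c] lins by blast
        then have "a m \<noteq> 0"
          using inj by blast
        then show thesis
          using m that[of "inverse (a m) *s m"] scaleN by (simp add: lins)
      qed
      have diffN: "m - m' \<in> N" if "m \<in> N" "m' \<in> N" for m m'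
        using vec.subspace_diff[OF subspace that] .
      have "H \<cdot> E - 2 *s E = 0"
        by (rule inj) (simp_all add: diffN closed scaleN E H comm lins)
      then have "2 * f E = f (H \<cdot> E)"
        using fs(2)[of 2 E] by simp
      then have "f E = 0"
        using H N two_neq_0 by simp
      have "H \<cdot> G + 2 *s G = 0"
        by (rule inj) (simp_all add: vec.subspace_add[OF subspace] closed scaleN G H comm lins)
      then have "f (H \<cdot> G) + 2 * f G = 0"
        by (metis fs(1) fs(2) fs(3))
      then have "f G = 0"
        using H N two_neq_0 by simp
      have "E \<cdot> G - H = 0"
        by (rule inj) (simp_all add: diffN closed scaleN E G H comm lins)
      then have "H = E \<cdot> G"
        by simp
      then have "f H = 0"
        using E N by metis
      have "n0 - (a n0 *s H + b n0 *s G + c n0 *s E) = 0"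
        by (rule inj)
          (simp_all add: n0 diffN vec.subspace_add[OF subspace] scaleN E G H lins)
      then have "n0 = a n0 *s H + b n0 *s G + c n0 *s E"
        by simp
      then have "f n0 = f (a n0 *s H + b n0 *s G + c n0 *s E)"
        by simp
      then have "f n0 = 0"
        by (simp add: fs \<open>f E = 0\<close> \<open>f G = 0\<close> \<open>f H = 0\<close>)
      then show ?thesis
        using n0 by blast
    next
      case True
      then obtain m1 where m1: "m1 \<in> N" "m1 \<noteq> 0" "a m1 = 0" "b m1 = 0" "c m1 = 0"
        by blast
      obtain m2 m3 where m23: "m2 \<in> N" "m3 \<in> N"
        and span: "\<And>m. m \<in> N \<Longrightarrow> \<exists>\<alpha> \<beta> \<gamma>. m = \<alpha> *s m1 + \<beta> *s m2 + \<gamma> *s m3"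
      proof -
        obtain p q r where pqr: "m1 = p *s x + q *s n + r *s v"
          using spanN m1 by blast
        then consider "p \<noteq> 0" | "q \<noteq> 0" | "r \<noteq> 0"
          using m1(2) by fastforce
        then show thesis
        proof cases
          case 1
          then have x_eq: "x = inverse p *s m1 + (- inverse p * q) *s n + (- inverse p * r) *s v"
            by (simp add: pqr vec_eq_iff field_simps)
          have "\<exists>\<alpha> \<beta> \<gamma>. m = \<alpha> *s m1 + \<beta> *s n + \<gamma> *s v" if mN: "m \<in> N" for m
          proof -
            obtain p' q' r' where m: "m = p' *s x + q' *s n + r' *s v"
              using spanN[OF mN] by blast
            have "m = (p' * inverse p) *s m1 + (q' - p' * inverse p * q) *s n + (r' - p' * inverse p * r) *s v"
              unfolding m by (subst x_eq) (simp add: vec_eq_iff algebra_simps)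
            then show ?thesis by blast
          qed
          then show thesis
            using that xN vN by blast
        next
          case 2
          then have n_eq: "n = inverse q *s m1 + (- inverse q * p) *s x + (- inverse q * r) *s v"
            by (simp add: pqr vec_eq_iff field_simps)
          have "\<exists>\<alpha> \<beta> \<gamma>. m = \<alpha> *s m1 + \<beta> *s x + \<gamma> *s v" if mN: "m \<in> N" for m
          proof -
            obtain p' q' r' where m: "m = p' *s x + q' *s n + r' *s v"
              using spanN[OF mN] by blast
            have "m = (q' * inverse q) *s m1 + (p' - q' * inverse q * p) *s x + (r' - q' * inverse q * r) *s v"
              unfolding m by (subst n_eq) (simp add: vec_eq_iff algebra_simps)
            then show ?thesis by blast
          qed
          then show thesis
            using that xN vN by blast
        next
          case 3
          then have v_eq: "v = inverse r *s m1 + (- inverse r * p) *s x + (- inverse r * q) *s n"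
            by (simp add: pqr vec_eq_iff field_simps)
          have "\<exists>\<alpha> \<beta> \<gamma>. m = \<alpha> *s m1 + \<beta> *s x + \<gamma> *s n" if mN: "m \<in> N" for m
          proof -
            obtain p' q' r' where m: "m = p' *s x + q' *s n + r' *s v"
              using spanN[OF mN] by blast
            have "m = (r' * inverse r) *s m1 + (p' - r' * inverse r * p) *s x + (q' - r' * inverse r * q) *s n"
              unfolding m by (subst v_eq) (simp add: vec_eq_iff algebra_simps)
            then show ?thesis by blast
          qed
          then show thesis
            using that xN vN by blast
        qed
      qed
      \<comment> \<open>The linear equation \<open>p a + q b + r c = 0\<close> of the image; closedness under brackets says that
        \<open>(p, q, r)\<close> is isotropic, i.e. that the image stabilises a line.\<close>
      define p q r where "p = b m2 * c m3 - c m2 * b m3" and "q = c m2 * a m3 - a m2 * c m3"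
        and "r = a m2 * b m3 - b m2 * a m3"
      have lineq: "p * a m + q * b m + r * c m = 0" if mN: "m \<in> N" for m
      proof -
        obtain \<alpha> \<beta> \<gamma> where "m = \<alpha> *s m1 + \<beta> *s m2 + \<gamma> *s m3"
          using span[OF mN] by blast
        then show ?thesis
          by (simp add: lins m1 p_def q_def r_def algebra_simps)
      qed
      have "p * a (m2 \<cdot> m3) + q * b (m2 \<cdot> m3) + r * c (m2 \<cdot> m3) = 0"
        by (rule lineq[OF closed[OF m23]])
      then have "p * - p + q * (- 2 * r) + r * (- 2 * q) = 0"
        by (simp add: comm[OF m23] p_def q_def r_def algebra_simps)
      then have iso: "p\<^sup>2 = - 4 * q * r"
        by (simp add: power2_eq_square eq_neg_iff_add_eq_0 algebra_simps add_eq_0_iff)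
      show ?thesis
      proof (cases "p = 0 \<and> q = 0 \<and> r = 0")
        case False
        show ?thesis
        proof (cases "q = 0")
          case True
          then have "p = 0" "r \<noteq> 0"
            using iso False by auto
          then have "c m = 0" if "m \<in> N" for m
            using lineq[OF that] True by simp
          then show ?thesis
            using eigenvector[of 0 1] by simp
        next
          case q: False
          show ?thesis
          proof (rule eigenvector[of "2 * q" "- p"])
            show "2 * q \<noteq> 0 \<or> - p \<noteq> 0"
              using q two_neq_0 by simp
            fix m assume "m \<in> N"
            have "2 * a m * (2 * q) * - p + c m * (- p)\<^sup>2 - b m * (2 * q)\<^sup>2 =
                - 4 * q * (p * a m + q * b m) + c m * p\<^sup>2"
              by (simp add: power2_eq_square algebra_simps)
            also have "\<dots> = - 4 * q * (p * a m + q * b m + r * c m)"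
              unfolding iso by (simp add: algebra_simps)
            finally show "2 * a m * (2 * q) * - p + c m * (- p)\<^sup>2 - b m * (2 * q)\<^sup>2 = 0"
              using lineq[OF \<open>m \<in> N\<close>] by simp
          qed
        qed
      next
        case rank1: True
        obtain m' t where m't: "m' \<in> N" "t \<in> N" "a m' = 0" "b m' = 0" "c m' = 0"
          and span': "\<And>m. m \<in> N \<Longrightarrow> \<exists>\<alpha> \<beta> \<gamma>. m = \<alpha> *s m1 + \<beta> *s m' + \<gamma> *s t"
        proof (cases "a m2 = 0 \<and> b m2 = 0 \<and> c m2 = 0")
          case True
          then show thesis
            using that[of m2 m3] m23 span by blast
        next
          case False
          have "\<exists>s. a m3 = s * a m2 \<and> b m3 = s * b m2 \<and> c m3 = s * c m2"
          proof -
            consider "a m2 \<noteq> 0" | "b m2 \<noteq> 0" | "c m2 \<noteq> 0"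
              using False by blast
            then show ?thesis
            proof cases
              case 1
              then show ?thesis
                using rank1 by (intro exI[of _ "a m3 / a m2"]) (auto simp: p_def q_def r_def field_simps)
            next
              case 2
              then show ?thesis
                using rank1 by (intro exI[of _ "b m3 / b m2"]) (auto simp: p_def q_def r_def field_simps)
            next
              case 3
              then show ?thesis
                using rank1 by (intro exI[of _ "c m3 / c m2"]) (auto simp: p_def q_def r_def field_simps)
            qed
          qed
          then obtain s where s: "a m3 = s * a m2" "b m3 = s * b m2" "c m3 = s * c m2"
            by blast
          show thesis
          proof (rule that[of "m3 - s *s m2" m2])
            show "m3 - s *s m2 \<in> N"
              by (intro vec.subspace_diff[OF subspace] vec.subspace_scale[OF subspace] m23)
            fix m assume "m \<in> N"
            then obtain \<alpha> \<beta> \<gamma> where m: "m = \<alpha> *s m1 + \<beta> *s m2 + \<gamma> *s m3"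
              using span by blast
            then have "m = \<alpha> *s m1 + \<gamma> *s (m3 - s *s m2) + (\<beta> + \<gamma> * s) *s m2"
              by (simp add: vec_eq_iff algebra_simps)
            then show "\<exists>\<alpha> \<beta> \<gamma>. m = \<alpha> *s m1 + \<beta> *s (m3 - s *s m2) + \<gamma> *s m2"
              by blast
          qed (use s m23 in \<open>simp_all add: lins\<close>)
        qed
        show ?thesis
        proof (cases "(a t)\<^sup>2 + b t * c t = 0")
          case True
          have mult: "\<exists>\<gamma>. a m = \<gamma> * a t \<and> b m = \<gamma> * b t \<and> c m = \<gamma> * c t" if mN: "m \<in> N" for m
          proof -
            obtain \<alpha> \<beta> \<gamma> where "m = \<alpha> *s m1 + \<beta> *s m' + \<gamma> *s t"
              using span'[OF mN] by blast
            then show ?thesis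
              using m1 m't by (intro exI[of _ \<gamma>]) (simp add: lins)
          qed
          show ?thesis
          proof (cases "b t = 0")
            case b: True
            show ?thesis
            proof (rule eigenvector[of 1 0])
              fix m assume "m \<in> N"
              then show "2 * a m * 1 * 0 + c m * 0\<^sup>2 - b m * 1\<^sup>2 = 0"
                using mult b by fastforce
            qed simp
          next
            case b: False
            show ?thesis
            proof (rule eigenvector[of "a t" "b t"])
              fix m assume "m \<in> N"
              then obtain \<gamma> where \<gamma>: "a m = \<gamma> * a t" "b m = \<gamma> * b t" "c m = \<gamma> * c t"
                using mult by blast
              have "2 * a m * a t * b t + c m * (b t)\<^sup>2 - b m * (a t)\<^sup>2 = \<gamma> * b t * ((a t)\<^sup>2 + b t * c t)"
                unfolding \<gamma> by (simp add: power2_eq_square algebra_simps)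
              then show "2 * a m * a t * b t + c m * (b t)\<^sup>2 - b m * (a t)\<^sup>2 = 0"
                using True by simp
            qed (use b in simp)
          qed
        next
          \<comment> \<open>If \<open>t\<close> acts invertibly on the quotient then the kernel of the action is an ideal.\<close>
          case False
          define Ker where "Ker = {m \<in> N. a m = 0 \<and> b m = 0 \<and> c m = 0}"
          have Ker: "\<exists>\<alpha> \<beta>. m = \<alpha> *s m1 + \<beta> *s m'" if mK: "m \<in> Ker" for m
          proof -
            obtain \<alpha> \<beta> \<gamma> where m: "m = \<alpha> *s m1 + \<beta> *s m' + \<gamma> *s t"
              using span' mK unfolding Ker_def by blast
            have "\<gamma> * a t = 0" "\<gamma> * b t = 0" "\<gamma> * c t = 0"
              using mK m1 m't by (simp_all add: Ker_def m lins)
            then have "\<gamma> = 0"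
              using False by (metis add_0 mult_zero_left no_zero_divisors power_zero_numeral)
            then show ?thesis
              using m by auto
          qed
          have KerN: "m \<cdot> w \<in> N" if "m \<in> Ker" for m w
          proof -
            have z: "f ((m \<cdot> w) \<cdot> y2) = 0" "f ((m \<cdot> w) \<cdot> y1) = 0"
              using that act[of m w] by (simp_all add: Ker_def)
            show ?thesis
              using dec[of "m \<cdot> w"] by (simp add: z)
          qed
          have Ker_y: "m \<cdot> y1 \<in> Ker \<and> m \<cdot> y2 \<in> Ker" if mK: "m \<in> Ker" for m
          proof -
            have N12: "m \<cdot> y1 \<in> N" "m \<cdot> y2 \<in> N"
              using KerN mK by blast+
            have "m \<cdot> (y1 \<cdot> y2) = (m \<cdot> y1) \<cdot> y2 - (m \<cdot> y2) \<cdot> y1"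
              using br_derivation[of m y1 y2] br_anti[of "m \<cdot> y2" y1] by simp
            then have "(m \<cdot> y1) \<cdot> y2 - (m \<cdot> y2) \<cdot> y1 \<in> N"
              using KerN[OF mK, of "y1 \<cdot> y2"] by simp
            then have "f (((m \<cdot> y1) \<cdot> y2 - (m \<cdot> y2) \<cdot> y1) \<cdot> y2) = 0"
              "f (((m \<cdot> y1) \<cdot> y2 - (m \<cdot> y2) \<cdot> y1) \<cdot> y1) = 0"
              using N by blast+
            then have ac: "c (m \<cdot> y1) = a (m \<cdot> y2)" "a (m \<cdot> y1) = - b (m \<cdot> y2)"
              using a'[OF N12(1)] a'[OF N12(2)] by (simp_all add: br_simps fs a_def b_def c_def)
            obtain g1 where g1: "a (m \<cdot> y1) = g1 * a t" "b (m \<cdot> y1) = g1 * b t" "c (m \<cdot> y1) = g1 * c t"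
            proof -
              obtain \<alpha> \<beta> \<gamma> where "m \<cdot> y1 = \<alpha> *s m1 + \<beta> *s m' + \<gamma> *s t"
                using span'[OF N12(1)] by blast
              then show thesis
                using that[of \<gamma>] m1 m't by (simp add: lins)
            qed
            obtain g2 where g2: "a (m \<cdot> y2) = g2 * a t" "b (m \<cdot> y2) = g2 * b t" "c (m \<cdot> y2) = g2 * c t"
            proof -
              obtain \<alpha> \<beta> \<gamma> where "m \<cdot> y2 = \<alpha> *s m1 + \<beta> *s m' + \<gamma> *s t"
                using span'[OF N12(2)] by blast
              then show thesis
                using that[of \<gamma>] m1 m't by (simp add: lins)
            qed
            have e: "g1 * c t = g2 * a t" "g1 * a t = - (g2 * b t)"
              using ac g1 g2 by simp_all
            have "g1 * ((a t)\<^sup>2 + b t * c t) = (g1 * a t) * a t + (g1 * c t) * b t"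
              by (simp add: power2_eq_square algebra_simps)
            also have "\<dots> = 0"
              unfolding e by (simp add: algebra_simps)
            finally have "g1 = 0"
              using False by simp
            have "g2 * ((a t)\<^sup>2 + b t * c t) = (g2 * a t) * a t + (g2 * b t) * c t"
              by (simp add: power2_eq_square algebra_simps)
            also have "\<dots> = (g1 * c t) * a t - (g1 * a t) * c t"
              unfolding e by simp
            also have "\<dots> = 0"
              by (simp add: \<open>g1 = 0\<close>)
            finally have "g2 = 0"
              using False by simp
            show ?thesis
              using N12 g1 g2 \<open>g1 = 0\<close> \<open>g2 = 0\<close> by (simp add: Ker_def)
          qed
          have Ker_subspace: "vec.subspace Ker"
            unfolding vec.subspace_def Ker_def
            using subspace lin_scale[of 0 0] by (auto simp: lins vec.subspace_def)
          have "w \<cdot> m \<in> Ker" if mK: "m \<in> Ker" for w m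
          proof -
            have mN: "m \<in> N"
              using mK by (simp add: Ker_def)
            define k where "k = w - f (w \<cdot> y2) *s y1 + f (w \<cdot> y1) *s y2"
            have k: "k \<in> N"
              unfolding k_def by (rule dec)
            have "m \<cdot> k \<in> Ker"
              using mK closed[OF mN k] comm[OF mN k] by (simp add: Ker_def)
            moreover have "w \<cdot> m = (- f (w \<cdot> y2)) *s m \<cdot> y1 + f (w \<cdot> y1) *s m \<cdot> y2 - m \<cdot> k"
              using br_anti[of w m] by (simp add: k_def br_simps vec_eq_iff)
            ultimately show ?thesis
              using Ker_y[OF mK]
              by (simp only:) (intro vec.subspace_diff[OF Ker_subspace] vec.subspace_add[OF Ker_subspace]
                vec.subspace_scale[OF Ker_subspace]; blast)
          qed
          moreover have "m1 \<in> Ker" "m' \<in> Ker"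
            using m1 m't by (simp_all add: Ker_def)
          ultimately have False
            using simple_no_pair_ideal[OF \<open>simple\<close> m1(2), of m'] Ker by blast
          then show ?thesis ..
        qed
      qed
    qed
  qed
qed

end

section \<open>Linear forms with a one-dimensional radical\<close>

lemma indep1_iff: "indep (Suc 0) (nth [a]) \<longleftrightarrow> a \<noteq> 0"
  using indep1 by simp

lemma span_tripleI: "a *s u + b *s v + c *s w \<in> vec.span {u, v, w}"
  by (intro vec.span_add vec.span_scale vec.span_base) auto

lemma solve_relation:
  fixes x y z :: "'k::field^'n"
  assumes "t \<noteq> 0"
  shows "r *s x + t *s z = 0 \<Longrightarrow> z = (- r / t) *s x"
    and "r *s x + s *s y + t *s z = 0 \<Longrightarrow> z = (- r / t) *s x + (- s / t) *s y"
proof -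
  have div: "w = inverse t *s v" if "t *s w = v" for v w :: "'k^'n"
    using assms by (simp add: vector_smult_assoc flip: that)
  show "z = (- r / t) *s x" if "r *s x + t *s z = 0"
  proof -
    have "t *s z = (- r) *s x"
      using that by (simp add: vector_smult_lneg eq_neg_iff_add_eq_0 add.commute)
    from div[OF this] show ?thesis
      by (simp add: vec_eq_iff divide_inverse)
  qed
  show "z = (- r / t) *s x + (- s / t) *s y" if "r *s x + s *s y + t *s z = 0"
  proof -
    have "t *s z = - (r *s x + s *s y)"
      using that by (metis add.commute eq_neg_iff_add_eq_0)
    from div[OF this] show ?thesis
      by (simp add: vec_eq_iff divide_inverse algebra_simps)
  qed
qed

context finite_lie_bracket
begin

text \<open>
  The formula of Leibniz, solved for the term where all derivations fall on the second factor.
  It is applied to vectors \<open>v\<close> in the kernel of a power of \<open>ad x\<close>.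
\<close>

lemma reverse_Leibniz:
  assumes "((\<cdot>) x ^^ m) v = 0"
  shows "\<exists>w'. v \<cdot> ((\<cdot>) x ^^ (n + m)) w = ((\<cdot>) x ^^ n) w'"
  using assms
proof (induction m arbitrary: v n w)
  case 0
  then have "v \<cdot> ((\<cdot>) x ^^ (n + 0)) w = 0"
    by (simp add: br_0_left)
  moreover have "((\<cdot>) x ^^ n) 0 = 0"
    by (induction n) (simp_all add: br_0_right)
  ultimately show ?case
    by metis
next
  case (Suc m)
  have Dv: "((\<cdot>) x ^^ m) (x \<cdot> v) = 0"
    using Suc.prems by (simp add: funpow_swap1)
  have add: "((\<cdot>) x ^^ n) (u + v) = ((\<cdot>) x ^^ n) u + ((\<cdot>) x ^^ n) v" for n u v
    by (induction n) (simp_all add: br_simps)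
  have minus: "((\<cdot>) x ^^ n) (- u) = - ((\<cdot>) x ^^ n) u" for n u
    by (induction n) (simp_all add: br_simps)
  note IH = Suc.IH[OF Dv]
  show ?case
  proof (induction n)
    case 0
    then show ?case by simp
  next
    case (Suc n)
    then obtain w1 where w1: "v \<cdot> ((\<cdot>) x ^^ (n + Suc m)) w = ((\<cdot>) x ^^ n) w1"
      by blast
    obtain w2 where w2: "(x \<cdot> v) \<cdot> ((\<cdot>) x ^^ (Suc n + m)) w = ((\<cdot>) x ^^ Suc n) w2"
      using IH by blast
    have "v \<cdot> ((\<cdot>) x ^^ (Suc n + Suc m)) w =
        x \<cdot> (v \<cdot> ((\<cdot>) x ^^ (n + Suc m)) w) - (x \<cdot> v) \<cdot> ((\<cdot>) x ^^ (Suc n + m)) w"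
      using br_derivation[of x v "((\<cdot>) x ^^ (n + Suc m)) w"] by simp
    also have "\<dots> = ((\<cdot>) x ^^ Suc n) w1 + ((\<cdot>) x ^^ Suc n) (- w2)"
      unfolding w1 w2 minus by simp
    also have "\<dots> = ((\<cdot>) x ^^ Suc n) (w1 + - w2)"
      by (simp only: add)
    finally show ?case
      by blast
  qed
qed

text \<open>
  The Fitting one-component of \<open>ad x\<close> is spanned by \<open>p\<close> and \<open>q\<close>. By the formula above it is
  mapped by every \<open>ad v\<close> into the span of \<open>p\<close>, \<open>q\<close> and \<open>p \<cdot> q\<close>, which therefore is an ideal of
  dimension at most three.
\<close>

lemma simple_no_two_dim_fitting:
  assumes simple and D5: "\<And>v. x \<cdot> (x \<cdot> (x \<cdot> (x \<cdot> (x \<cdot> v)))) = l *s x \<cdot> (x \<cdot> (x \<cdot> v))" and "l \<noteq> 0"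
    and range: "\<And>v. \<exists>c d. x \<cdot> (x \<cdot> (x \<cdot> v)) = c *s p + d *s q"
    and p: "p = x \<cdot> (x \<cdot> (x \<cdot> p'))" "q = x \<cdot> (x \<cdot> (x \<cdot> q'))" and nz: "p \<noteq> 0 \<or> q \<noteq> 0"
  shows False
proof -
  let ?D = "(\<cdot>) x"
  let ?J = "vec.span {p, q, p \<cdot> q}"
  define \<kappa> where "\<kappa> = inverse (l * l)"
  have \<kappa>: "\<kappa> * (l * l) = 1"
    using \<open>l \<noteq> 0\<close> by (simp add: \<kappa>_def del: inverse_mult_distrib)
  have step: "v \<cdot> (x \<cdot> (x \<cdot> (x \<cdot> w))) \<in> ?J" for v w
  proof -
    define v1 where "v1 = \<kappa> *s x \<cdot> (x \<cdot> (x \<cdot> (x \<cdot> v)))"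
    define v0 where "v0 = v - v1"
    have "x \<cdot> (x \<cdot> (x \<cdot> v0)) = x \<cdot> (x \<cdot> (x \<cdot> v)) -
        \<kappa> *s x \<cdot> (x \<cdot> (x \<cdot> (x \<cdot> (x \<cdot> (x \<cdot> (x \<cdot> v))))))"
      by (simp add: v0_def v1_def br_simps)
    also have "x \<cdot> (x \<cdot> (x \<cdot> (x \<cdot> (x \<cdot> (x \<cdot> (x \<cdot> v)))))) = (l * l) *s x \<cdot> (x \<cdot> (x \<cdot> v))"
      by (simp add: D5 br_simps vector_smult_assoc)
    finally have "(?D ^^ 3) v0 = 0"
      using \<kappa> by (simp add: numeral_3_eq_3 vector_smult_assoc)
    moreover have "x \<cdot> (x \<cdot> (x \<cdot> w)) = (?D ^^ (3 + 3)) (\<kappa> *s x \<cdot> w)"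
      using \<kappa> by (simp add: D5 br_simps vector_smult_assoc numeral_eq_Suc mult.assoc)
    ultimately obtain w' where "v0 \<cdot> (x \<cdot> (x \<cdot> (x \<cdot> w))) = x \<cdot> (x \<cdot> (x \<cdot> w'))"
      using reverse_Leibniz[of 3 x v0 3] by (metis (no_types, lifting) comp_apply funpow.simps(2) funpow_0 numeral_3_eq_3)
    then have v0: "v0 \<cdot> (x \<cdot> (x \<cdot> (x \<cdot> w))) \<in> ?J"
      using range[of w'] span_tripleI[of _ p _ q 0 "p \<cdot> q"] by (metis add.right_neutral vector_smult_lzero)
    obtain c d where cd: "v1 = c *s p + d *s q"
    proof -
      obtain c d where "x \<cdot> (x \<cdot> (x \<cdot> (x \<cdot> v))) = c *s p + d *s q"
        using range by blast
      then show thesis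
        using that[of "\<kappa> * c" "\<kappa> * d"]
        by (simp add: v1_def vec_eq_iff algebra_simps)
    qed
    obtain c' d' where cd': "x \<cdot> (x \<cdot> (x \<cdot> w)) = c' *s p + d' *s q"
      using range by blast
    have "v1 \<cdot> (x \<cdot> (x \<cdot> (x \<cdot> w))) = 0 *s p + 0 *s q + (c * d' - d * c') *s p \<cdot> q"
      unfolding cd cd' using br_anti[of q p] by (simp add: br_simps vec_eq_iff algebra_simps)
    then have "v1 \<cdot> (x \<cdot> (x \<cdot> (x \<cdot> w))) \<in> ?J"
      using span_tripleI by metis
    then have "v0 \<cdot> (x \<cdot> (x \<cdot> (x \<cdot> w))) + v1 \<cdot> (x \<cdot> (x \<cdot> (x \<cdot> w))) \<in> ?J"
      using v0 by (intro vec.span_add)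
    then show ?thesis
      by (simp add: v0_def br_simps)
  qed
  have pJ: "v \<cdot> p \<in> ?J" "v \<cdot> q \<in> ?J" for v
    using step p by simp_all
  have "v \<cdot> (p \<cdot> q) \<in> ?J" for v
  proof -
    have "v \<cdot> (p \<cdot> q) = (v \<cdot> p) \<cdot> q - (v \<cdot> q) \<cdot> p"
      using br_derivation[of v p q] br_anti[of p "v \<cdot> q"] by simp
    then show ?thesis
      using pJ vec.span_diff by metis
  qed
  then have "ideal ?J"
    using pJ by (intro ideal_spanI) auto
  moreover have "card {p, q, p \<cdot> q} \<le> 3"
    by (simp add: card_insert_if)
  then have "?J \<noteq> UNIV"
    using dim5 by (intro span_neq_UNIV) auto
  moreover have "p \<in> ?J" "q \<in> ?J"
    by (auto intro: vec.span_base)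
  ultimately show False
    using \<open>simple\<close> nz by (auto simp: simple_def)
qed

text \<open>
  The rank of \<open>ad x\<close> modulo \<open>k x\<close> is zero, one or two. In the first case \<open>k x\<close> is an ideal, in
  the second the vectors \<open>v\<close> with \<open>x \<cdot> v \<in> k x\<close> form a subalgebra of codimension one. In the
  third, unless \<open>(ad x)\<^sup>2\<close> vanishes, \<open>x\<close> belongs to a configuration as in the lemma on
  extremal elements.
\<close>

lemma extremal_cases:
  assumes simple and x0: "x \<noteq> 0" and D2: "\<And>v. \<exists>c. x \<cdot> (x \<cdot> v) = c *s x"
  shows "(\<exists>x e. chain x e) \<or> (\<exists>\<pi>. codim1_subalgebra_form \<pi>)"
proof (cases "\<forall>v. \<exists>c. x \<cdot> v = c *s x")
  case True
  have "\<exists>a b. y \<cdot> x = a *s x + b *s x" for y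
  proof -
    obtain c where "x \<cdot> y = c *s x"
      using True by blast
    then have "y \<cdot> x = (- c) *s x + 0 *s x"
      using br_anti[of y x] by (simp add: vector_smult_lneg)
    then show ?thesis by blast
  qed
  then show ?thesis
    using simple_no_pair_ideal[OF \<open>simple\<close> x0] by blast
next
  case False
  then obtain z1 where z1: "\<And>c. x \<cdot> z1 \<noteq> c *s x"
    by blast
  define w1 where "w1 = x \<cdot> z1"
  show ?thesis
  proof (cases "\<forall>v. \<exists>c d. x \<cdot> v = c *s x + d *s w1")
    case True
    have "w1 \<notin> vec.span {x}"
      using z1 by (auto simp: w1_def vec.span_singleton)
    then obtain g where g: "form g" "g w1 = 1" "\<And>s. s \<in> vec.span {x} \<Longrightarrow> g s = 0"
      using form_separating[OF vec.subspace_span] by metis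
    have gx: "g x = 0"
      using g(3) vec.span_base by blast
    have line: "\<exists>c. x \<cdot> v = c *s x" if gv: "g (x \<cdot> v) = 0" for v
    proof -
      obtain c d where cd: "x \<cdot> v = c *s x + d *s w1"
        using True by blast
      then have "d = 0"
        using gv g(2) gx by (simp add: form_simps[OF g(1)])
      then show ?thesis
        using cd by auto
    qed
    have "g (x \<cdot> (u \<cdot> v)) = 0" if uv: "g (x \<cdot> u) = 0" "g (x \<cdot> v) = 0" for u v
    proof -
      obtain c d where "x \<cdot> u = c *s x" "x \<cdot> v = d *s x"
        using line uv by blast
      then have "x \<cdot> (u \<cdot> v) = (c * d - d * c) *s x"
        using br_derivation[of x u v] br_anti[of u x] by (simp add: br_simps vector_smult_assoc)
      then show ?thesis
        by (simp add: form_simps[OF g(1)])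
    qed
    then have "codim1_subalgebra_form (\<lambda>v. g (x \<cdot> v))"
      using form_br_right[OF g(1)] g(2)
      by (auto simp: codim1_subalgebra_form_def w1_def intro: exI[of _ z1])
    then show ?thesis by blast
  next
    case False
    then obtain z2 where z2: "\<And>c d. x \<cdot> z2 \<noteq> c *s x + d *s w1"
      by blast
    define w2 where "w2 = x \<cdot> z2"
    obtain \<phi>1 where \<phi>1: "x \<cdot> w1 = \<phi>1 *s x"
      using D2 by (auto simp: w1_def)
    obtain \<phi>2 where \<phi>2: "x \<cdot> w2 = \<phi>2 *s x"
      using D2 by (auto simp: w2_def)
    have ind3: "r = 0 \<and> s = 0 \<and> t = 0" if eq: "r *s x + s *s w1 + t *s w2 = 0" for r s t
    proof -
      have t: "t = 0"
      proof (rule ccontr)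
        assume "t \<noteq> 0"
        then show False
          using solve_relation(2)[OF _ eq] z2 by (metis w2_def)
      qed
      have s: "s = 0"
      proof (rule ccontr)
        assume "s \<noteq> 0"
        have "r *s x + s *s w1 = 0"
          using eq t by simp
        then show False
          using solve_relation(1)[OF \<open>s \<noteq> 0\<close>] z1 by (metis w1_def)
      qed
      show ?thesis
        using eq s t x0 by simp
    qed
    have ind: "indep 5 (nth [x, w1, w2, z1, z2])"
      unfolding indep5
    proof (intro allI impI)
      fix r s t u v
      assume eq: "r *s x + s *s w1 + t *s w2 + u *s z1 + v *s z2 = 0"
      have "(s * \<phi>1 + t * \<phi>2) *s x + u *s w1 + v *s w2 = 0"
        using arg_cong[OF eq, of "\<lambda>w. x \<cdot> w"] \<phi>1 \<phi>2 w1_def w2_def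
        by (simp add: br_simps vec_eq_iff algebra_simps)
      then have "u = 0" "v = 0"
        using ind3 by blast+
      then show "r = 0 \<and> s = 0 \<and> t = 0 \<and> u = 0 \<and> v = 0"
        using eq ind3 by simp
    qed
    have chain: "\<exists>x e. chain x e"
      if "x \<cdot> (x \<cdot> y) = x" "x \<cdot> (x \<cdot> z) = 0" "indep 2 (nth [x, x \<cdot> z])" for y z
      using extremal_imp_chain[OF \<open>simple\<close> that(3) refl that(1) refl that(2)] .
    consider "\<phi>1 = 0" "\<phi>2 = 0" | "\<phi>1 = 0" "\<phi>2 \<noteq> 0" | "\<phi>1 \<noteq> 0"
      by blast
    then show ?thesis
    proof cases
      \<comment> \<open>For a sandwich element \<open>x\<close> of rank two, its kernel is an ideal.\<close>
      case 1
      let ?J = "vec.span {x, w1, w2}"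
      have coord: "\<exists>r s t. v = r *s x + s *s w1 + t *s w2" if Dv: "x \<cdot> v = 0" for v
      proof -
        obtain r s t p q where v: "v = r *s x + s *s w1 + t *s w2 + p *s z1 + q *s z2"
          using indep5_coordinates[OF dim5 ind] by blast
        then have "0 *s x + p *s w1 + q *s w2 = 0"
          using Dv \<phi>1 \<phi>2 1 w1_def w2_def by (simp add: br_simps)
        then have "p = 0 \<and> q = 0"
          using ind3 by blast
        then show ?thesis
          using v by auto
      qed
      have DD: "x \<cdot> (x \<cdot> v) = 0" for v
      proof -
        obtain r s t p q where v: "v = r *s x + s *s w1 + t *s w2 + p *s z1 + q *s z2"
          using indep5_coordinates[OF dim5 ind] by blast
        then show ?thesis
          using \<phi>1 \<phi>2 1 w1_def w2_def by (simp add: br_simps)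
      qed
      have comm: "(x \<cdot> u) \<cdot> (x \<cdot> v) = 0" for u v
      proof -
        have "x \<cdot> (x \<cdot> (u \<cdot> v)) = x \<cdot> ((x \<cdot> u) \<cdot> v) + x \<cdot> (u \<cdot> (x \<cdot> v))"
          using br_derivation[of x u v] by (simp add: br_simps)
        also have "\<dots> = (x \<cdot> u) \<cdot> (x \<cdot> v) + (x \<cdot> u) \<cdot> (x \<cdot> v)"
          using br_derivation[of x "x \<cdot> u" v] br_derivation[of x u "x \<cdot> v"] DD by (simp add: br_simps)
        finally have "x \<cdot> (x \<cdot> (u \<cdot> v)) = 2 *s (x \<cdot> u) \<cdot> (x \<cdot> v)"
          by (simp add: vec_eq_iff)
        then show ?thesis
          using DD two_neq_0 by simp
      qed
      have J: "v \<in> ?J" if "x \<cdot> v = 0" for v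
        using coord[OF that] span_tripleI by metis
      have "v \<cdot> x \<in> ?J" for v
        by (rule J) (use br_anti[of v x] DD in \<open>simp add: br_simps\<close>)
      moreover have "v \<cdot> (x \<cdot> z) \<in> ?J" for v z
        by (rule J) (use br_derivation[of x v "x \<cdot> z"] DD comm in \<open>simp add: br_simps\<close>)
      ultimately have "ideal ?J"
        by (intro ideal_spanI) (auto simp: w1_def w2_def)
      moreover have "card {x, w1, w2} \<le> 3"
        by (simp add: card_insert_if)
      then have "?J \<noteq> UNIV"
        using dim5 by (intro span_neq_UNIV) auto
      moreover have "x \<in> ?J"
        by (auto intro: vec.span_base)
      ultimately show ?thesis
        using \<open>simple\<close> x0 by (auto simp: simple_def)
    next
      case 2
      have "indep 2 (nth [x, x \<cdot> z1])"
        unfolding indep2 using ind3[of _ _ 0] by (simp add: w1_def)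
      then show ?thesis
        using chain[of "inverse \<phi>2 *s z2" z1] 2 \<phi>1 \<phi>2
        by (simp add: br_simps w1_def w2_def vector_smult_assoc)
    next
      case 3
      define y where "y = inverse \<phi>1 *s z1"
      have y: "x \<cdot> (x \<cdot> y) = x"
        using 3 \<phi>1 by (simp add: y_def br_simps w1_def vector_smult_assoc)
      have "x \<cdot> (x \<cdot> (z2 - \<phi>2 *s y)) = 0"
        using y \<phi>2 by (simp add: br_simps w2_def)
      moreover have "indep 2 (nth [x, x \<cdot> (z2 - \<phi>2 *s y)])"
        unfolding indep2
      proof (intro allI impI)
        fix r s assume "r *s x + s *s x \<cdot> (z2 - \<phi>2 *s y) = 0"
        then have "r *s x + (- s * \<phi>2 * inverse \<phi>1) *s w1 + s *s w2 = 0"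
          by (simp add: y_def br_simps w1_def w2_def vec_eq_iff algebra_simps)
        then show "r = 0 \<and> s = 0"
          using ind3 by blast
      qed
      ultimately show ?thesis
        using chain y by blast
    qed
  qed
qed

text \<open>
  The remaining case of a nondegenerate \<open>f (u \<cdot> v)\<close> on \<open>L / k x\<close>: there \<open>ad x\<close> is an
  infinitesimal symplectic transformation fixing the flag \<open>\<langle>x\<rangle> \<subseteq> \<langle>x, u\<rangle> \<subseteq> \<langle>x, u, a, b\<rangle>\<close>, whose
  only possible nonzero eigenvalues are \<open>\<plusminus> \<surd>l\<close> on the span of \<open>a, b\<close>. For \<open>l \<noteq> 0\<close> its Fitting
  one-component is a plane. For \<open>l = 0\<close> either its fourth power maps onto \<open>k x\<close> or its square
  maps into \<open>k x\<close>.
\<close>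

lemma rank4_cases:
  assumes simple and f: "form f" "\<exists>v. f v \<noteq> 0" and x0: "x \<noteq> 0" and fx: "f x = 0"
    and xrad: "x \<in> radical f" and rad: "\<And>n. n \<in> radical f \<Longrightarrow> \<exists>c. n = c *s x"
  shows "(\<exists>x e. chain x e) \<or> (\<exists>\<pi>. codim1_subalgebra_form \<pi>)"
proof -
  note fs = form_simps[OF f(1)]
  have fD: "f (x \<cdot> v) = 0" for v
    using xrad by (simp add: radical_def)
  have fvx: "f (v \<cdot> x) = 0" for v
    using br_anti[of v x] fD by (simp add: fs)
  have skew: "f ((x \<cdot> v) \<cdot> w) = - f (v \<cdot> (x \<cdot> w))" for v w
  proof -
    have "f (x \<cdot> (v \<cdot> w)) = 0" by (rule fD)
    then show ?thesis
      using br_derivation[of x v w] by (simp add: fs eq_neg_iff_add_eq_0)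
  qed
  have anti: "f (v \<cdot> w) = - f (w \<cdot> v)" for v w
    using br_anti[of v w] by (simp add: fs)
  \<comment> \<open>The vector \<open>u\<close> representing \<open>f\<close> itself.\<close>
  obtain u where u: "\<And>v. f (u \<cdot> v) = f v"
  proof -
    obtain w :: "nat \<Rightarrow> 'k^'n" where w: "indep 5 w" "w 0 = x"
    proof -
      have i1: "indep (Suc 0) (nth [x])"
        using x0 by (simp add: indep1_iff)
      show thesis
        by (rule indep_extend_to_basis[OF i1, of 5]) (use dim5 that in auto)
    qed
    define A where "A j i = (if i = 4 then - f (w (Suc j)) else f (w (Suc i) \<cdot> w (Suc j)))" for i j
    obtain d where d: "\<exists>i<5. d i \<noteq> 0" "\<forall>j<4. (\<Sum>i<5. d i * A j i) = 0"
      using homogeneous_system[of 4 5 A] by auto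
    define u where "u = (\<Sum>i<4. d i *s w (Suc i))"
    have uw: "f (u \<cdot> w (Suc j)) = d 4 * f (w (Suc j))" if "j < 4" for j
    proof -
      have "(\<Sum>i<5. d i * A j i) = (\<Sum>i<4. d i * f (w (Suc i) \<cdot> w (Suc j))) + d 4 * A j 4"
        by (simp add: A_def numeral_eq_Suc)
      then show ?thesis
        using d(2) that by (simp add: u_def br_sum_left br_simps fs A_def eq_neg_iff_add_eq_0)
    qed
    have u_all: "f (u \<cdot> v) = d 4 * f v" for v
    proof -
      obtain c where v: "v = (\<Sum>i<5. c i *s w i)"
        using indep_spanning[of w v] w dim5 by auto
      have "f (u \<cdot> w i) = d 4 * f (w i)" if "i < 5" for i
        using uw that w(2) fvx fx by (cases i) auto
      then show ?thesis
        by (simp add: v br_sum_right br_simps fs sum_distrib_left mult.left_commute)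
    qed
    have "d 4 \<noteq> 0"
    proof
      assume "d 4 = 0"
      then have "u \<in> radical f"
        using u_all by (simp add: radical_def)
      then obtain c where "u = c *s x"
        using rad by blast
      then have "(\<Sum>i<5. (case i of 0 \<Rightarrow> - c | Suc i \<Rightarrow> d i) *s w i) = 0"
        using w(2) by (simp add: u_def numeral_eq_Suc vector_smult_lneg add.assoc algebra_simps)
      then have "\<forall>i<5. (case i of 0 \<Rightarrow> - c | Suc i \<Rightarrow> d i) = 0"
        using spec[OF w(1)[unfolded indep_def], of "\<lambda>i. case i of 0 \<Rightarrow> - c | Suc i \<Rightarrow> d i"] by blast
      then have "(case Suc i of 0 \<Rightarrow> - c | Suc i \<Rightarrow> d i) = 0" if "i < 4" for i
        using that by (metis Suc_less_eq eval_nat_numeral(3))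
      then have "d i = 0" if "i < 4" for i
        using that by simp
      then have "\<forall>i<5. d i = 0"
        using \<open>d 4 = 0\<close> by (metis less_antisym eval_nat_numeral(3))
      then show False
        using d(1) by blast
    qed
    then show thesis
      using that[of "inverse (d 4) *s u"] u_all by (simp add: br_simps fs)
  qed
  have fu: "f u = 0"
    using u[of u] by (simp add: br_self fs)
  have ux: "f (v \<cdot> u) = - f v" for v
    using anti[of v u] u by simp
  obtain y where y: "f y = 1"
  proof -
    obtain v where "f v \<noteq> 0" using f by blast
    then show thesis
      using that[of "inverse (f v) *s v"] by (simp add: fs)
  qed
  obtain w1 w2 where w: "indep 5 (nth [x, u, y, w1, w2])"
  proof -
    have "indep 3 (nth [x, u, y])"
      unfolding indep3
    proof (intro allI impI)
      fix r s t assume eq: "r *s x + s *s u + t *s y = 0"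
      have t: "t = 0"
        using arg_cong[OF eq, of f] by (simp add: fs fx fu y)
      have s: "s = 0"
        using arg_cong[OF eq, of "\<lambda>v. f (v \<cdot> y)"] t by (simp add: br_simps fs fD u y)
      show "r = 0 \<and> s = 0 \<and> t = 0"
        using eq s t x0 by simp
    qed
    then have "indep (length [x, u, y]) (nth [x, u, y])"
      by (simp add: numeral_eq_Suc)
    from indep_snoc[OF this] obtain w1 where "indep (Suc (length [x, u, y])) (nth ([x, u, y] @ [w1]))"
      using dim5 by auto
    then have "indep (length [x, u, y, w1]) (nth [x, u, y, w1])"
      by simp
    from indep_snoc[OF this] obtain w2 where "indep (Suc (length [x, u, y, w1])) (nth ([x, u, y, w1] @ [w2]))"
      using dim5 by auto
    then have "indep 5 (nth [x, u, y, w1, w2])"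
      by (simp add: numeral_eq_Suc)
    then show thesis
      using that by blast
  qed
  define a where "a = w1 - f w1 *s y + f (y \<cdot> w1) *s u"
  define b where "b = w2 - f w2 *s y + f (y \<cdot> w2) *s u"
  have fab: "f a = 0" "f b = 0" "f (y \<cdot> a) = 0" "f (y \<cdot> b) = 0"
    by (simp_all add: a_def b_def fs br_simps fu y ux)
  have fab': "f (a \<cdot> y) = 0" "f (b \<cdot> y) = 0"
    using fab anti[of a y] anti[of b y] by simp_all
  have ind: "indep 5 (nth [x, u, y, a, b])"
    unfolding indep5
  proof (intro allI impI)
    fix r s t p q
    assume "r *s x + s *s u + t *s y + p *s a + q *s b = 0"
    then have "r *s x + (s + p * f (y \<cdot> w1) + q * f (y \<cdot> w2)) *s u + (t - p * f w1 - q * f w2) *s y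
        + p *s w1 + q *s w2 = 0"
      by (simp add: a_def b_def vec_eq_iff algebra_simps)
    then have "r = 0 \<and> s + p * f (y \<cdot> w1) + q * f (y \<cdot> w2) = 0 \<and> t - p * f w1 - q * f w2 = 0 \<and> p = 0 \<and> q = 0"
      using w unfolding indep5 by blast
    then show "r = 0 \<and> s = 0 \<and> t = 0 \<and> p = 0 \<and> q = 0"
      by auto
  qed
  note coord = indep5_coordinates[OF dim5 ind]
  define g where "g = f (a \<cdot> b)"
  have gba: "f (b \<cdot> a) = - g"
    using anti[of b a] by (simp add: g_def)
  have "g \<noteq> 0"
  proof
    assume g0: "g = 0"
    have "f (a \<cdot> v) = 0" for v
    proof -
      obtain r s t p q where "v = r *s x + s *s u + t *s y + p *s a + q *s b"
        using coord by blast
      then show ?thesis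
        using g0 by (simp add: br_simps fs fvx ux fab fab' g_def)
    qed
    then obtain c where "a = c *s x"
      using rad by (auto simp: radical_def)
    then have "(- c) *s x + 0 *s u + 0 *s y + 1 *s a + 0 *s b = 0"
      by (simp add: vector_smult_lneg)
    then show False
      using ind unfolding indep5 by (metis one_neq_zero)
  qed
  \<comment> \<open>The matrix of \<open>ad x\<close>.\<close>
  obtain \<mu> where Du: "x \<cdot> u = \<mu> *s x"
  proof -
    have "x \<cdot> u \<in> radical f"
      by (simp add: radical_def skew u fD)
    then show thesis
      using rad that by blast
  qed
  have D_K: "\<exists>r s p q. x \<cdot> v = r *s x + s *s u + p *s a + q *s b" for v
  proof -
    obtain r s t p q where v: "x \<cdot> v = r *s x + s *s u + t *s y + p *s a + q *s b"
      using coord by blast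
    have "t = 0"
      using fD[of v] by (simp add: v fs fx fu y fab)
    then show ?thesis
      using v by auto
  qed
  obtain r1 s1 \<alpha> \<beta> where Da: "x \<cdot> a = r1 *s x + s1 *s u + \<alpha> *s a + \<beta> *s b"
    using D_K by blast
  obtain r2 s2 \<gamma> \<delta> where Db: "x \<cdot> b = r2 *s x + s2 *s u + \<gamma> *s a + \<delta> *s b"
    using D_K by blast
  obtain r3 s3 c1 c2 where Dy: "x \<cdot> y = r3 *s x + s3 *s u + c1 *s a + c2 *s b"
    using D_K by blast
  have "\<delta> = - \<alpha>"
  proof -
    have "f ((x \<cdot> a) \<cdot> b) = \<alpha> * g"
      unfolding Da by (simp add: br_simps fs fD u fab g_def)
    moreover have "f (a \<cdot> (x \<cdot> b)) = \<delta> * g"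
      unfolding Db by (simp add: br_simps fs fvx ux fab g_def)
    ultimately have "\<alpha> * g = - (\<delta> * g)"
      using skew[of a b] by simp
    then have "(\<alpha> + \<delta>) * g = 0"
      by (simp add: distrib_right)
    then show ?thesis
      using \<open>g \<noteq> 0\<close> by (simp add: eq_neg_iff_add_eq_0 add.commute)
  qed
  define l where "l = \<alpha> * \<alpha> + \<beta> * \<gamma>"
  have D2a: "x \<cdot> (x \<cdot> a) = l *s a + (\<alpha> * s1 + \<beta> * s2) *s u + (s1 * \<mu> + \<alpha> * r1 + \<beta> * r2) *s x"
    unfolding Da by (simp add: br_simps Da Db Du \<open>\<delta> = - \<alpha>\<close> l_def vec_eq_iff algebra_simps)
  have D2b: "x \<cdot> (x \<cdot> b) = l *s b + (\<gamma> * s1 - \<alpha> * s2) *s u + (s2 * \<mu> + \<gamma> * r1 - \<alpha> * r2) *s x"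
    unfolding Db by (simp add: br_simps Da Db Du \<open>\<delta> = - \<alpha>\<close> l_def vec_eq_iff algebra_simps)
  have D4: "x \<cdot> (x \<cdot> (x \<cdot> (x \<cdot> a))) = l *s x \<cdot> (x \<cdot> a)" "x \<cdot> (x \<cdot> (x \<cdot> (x \<cdot> b))) = l *s x \<cdot> (x \<cdot> b)"
    by (simp_all add: D2a D2b br_simps Du)
  have D5: "x \<cdot> (x \<cdot> (x \<cdot> (x \<cdot> (x \<cdot> v)))) = l *s x \<cdot> (x \<cdot> (x \<cdot> v))" for v
  proof -
    obtain r s p q where v: "x \<cdot> v = r *s x + s *s u + p *s a + q *s b"
      using D_K by blast
    show ?thesis
      unfolding v by (simp add: br_simps Du D4 vec_eq_iff algebra_simps)
  qed
  show ?thesis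
  proof (cases "l = 0")
    case False
    let ?p = "x \<cdot> (x \<cdot> (x \<cdot> a))" and ?q = "x \<cdot> (x \<cdot> (x \<cdot> b))"
    have D2: "x \<cdot> (x \<cdot> a) = (\<alpha> / l) *s ?p + (\<beta> / l) *s ?q" "x \<cdot> (x \<cdot> b) = (\<gamma> / l) *s ?p + (\<delta> / l) *s ?q"
    proof -
      have e: "l *s x \<cdot> (x \<cdot> a) = \<alpha> *s ?p + \<beta> *s ?q"
        using arg_cong[OF Da, of "\<lambda>v. x \<cdot> (x \<cdot> (x \<cdot> v))"] by (simp add: D4 br_simps Du)
      have e': "l *s x \<cdot> (x \<cdot> b) = \<gamma> *s ?p + \<delta> *s ?q"
        using arg_cong[OF Db, of "\<lambda>v. x \<cdot> (x \<cdot> (x \<cdot> v))"] by (simp add: D4 br_simps Du)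
      have div: "v = (c / l) *s p + (d / l) *s q" if "l *s v = c *s p + d *s q" for v p q :: "'k^'n" and c d
      proof -
        have "v = inverse l *s (l *s v)"
          using False by (simp add: vector_smult_assoc)
        also have "\<dots> = (c / l) *s p + (d / l) *s q"
          unfolding that by (simp add: vec_eq_iff field_simps)
        finally show ?thesis .
      qed
      show "x \<cdot> (x \<cdot> a) = (\<alpha> / l) *s ?p + (\<beta> / l) *s ?q" "x \<cdot> (x \<cdot> b) = (\<gamma> / l) *s ?p + (\<delta> / l) *s ?q"
        by (rule div[OF e], rule div[OF e'])
    qed
    have range: "\<exists>c d. x \<cdot> (x \<cdot> (x \<cdot> v)) = c *s ?p + d *s ?q" for v
    proof -
      obtain r s p q where v: "x \<cdot> v = r *s x + s *s u + p *s a + q *s b"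
        using D_K by blast
      have "x \<cdot> (x \<cdot> (x \<cdot> v)) = p *s x \<cdot> (x \<cdot> a) + q *s x \<cdot> (x \<cdot> b)"
        unfolding v by (simp add: br_simps Du)
      also have "\<dots> = (p * (\<alpha> / l) + q * (\<gamma> / l)) *s ?p + (p * (\<beta> / l) + q * (\<delta> / l)) *s ?q"
      proof -
        have "p *s A + q *s B = (p * (\<alpha> / l) + q * (\<gamma> / l)) *s P + (p * (\<beta> / l) + q * (\<delta> / l)) *s Q"
          if "A = (\<alpha> / l) *s P + (\<beta> / l) *s Q" "B = (\<gamma> / l) *s P + (\<delta> / l) *s Q" for A B P Q :: "'k^'n"
          unfolding that by (simp add: vec_eq_iff algebra_simps)
        from this[OF D2] show ?thesis .
      qed
      finally show ?thesis by blast
    qed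
    have "?p \<noteq> 0 \<or> ?q \<noteq> 0"
    proof (rule ccontr)
      assume "\<not> ?thesis"
      then have "x \<cdot> (x \<cdot> a) = 0"
        using D2(1) by simp
      then have "(s1 * \<mu> + \<alpha> * r1 + \<beta> * r2) *s x + (\<alpha> * s1 + \<beta> * s2) *s u + 0 *s y + l *s a + 0 *s b = 0"
        unfolding D2a by (simp add: algebra_simps)
      then have "l = 0"
        using ind unfolding indep5 by blast
      then show False
        using False by blast
    qed
    then show ?thesis
      using simple_no_two_dim_fitting[OF \<open>simple\<close> D5 False range refl refl] by blast
  next
    case l0: True
    have D4x: "\<exists>c. x \<cdot> (x \<cdot> (x \<cdot> (x \<cdot> v))) = c *s x" for v
    proof -
      obtain r s p q where v: "x \<cdot> v = r *s x + s *s u + p *s a + q *s b"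
        using D_K by blast
      have "x \<cdot> (x \<cdot> (x \<cdot> (x \<cdot> v))) =
          (p * (\<alpha> * s1 + \<beta> * s2) * \<mu> + q * (\<gamma> * s1 - \<alpha> * s2) * \<mu>) *s x"
        unfolding v by (simp add: br_simps Du D2a D2b l0 vec_eq_iff algebra_simps)
      then show ?thesis by blast
    qed
    show ?thesis
    proof (cases "\<forall>v. \<exists>c. x \<cdot> (x \<cdot> (x \<cdot> v)) = c *s x")
      case False
      then obtain y0 where y0: "\<And>c. x \<cdot> (x \<cdot> (x \<cdot> y0)) \<noteq> c *s x"
        by blast
      obtain c where c: "x \<cdot> (x \<cdot> (x \<cdot> (x \<cdot> y0))) = c *s x"
        using D4x by blast
      have "c \<noteq> 0"
      proof
        assume "c = 0"
        define y1 where "y1 = x \<cdot> y0"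
        define y2 where "y2 = x \<cdot> y1"
        define y3 where "y3 = x \<cdot> y2"
        note yD = y1_def[symmetric] y2_def[symmetric] y3_def[symmetric]
        have Dy3: "x \<cdot> y3 = 0"
          using c \<open>c = 0\<close> by (simp add: y3_def y2_def y1_def)
        have y3x: "y3 \<noteq> c *s x" for c
          using y0 by (simp add: y3_def y2_def y1_def)
        have y3_0: "y3 \<noteq> 0"
          using y3x[of 0] by simp
        have ind': "indep 5 (nth [x, y3, y2, y1, y0])"
          unfolding indep5
        proof (intro allI impI)
          fix r s t p q
          assume eq: "r *s x + s *s y3 + t *s y2 + p *s y1 + q *s y0 = 0"
          have q: "q = 0"
            using arg_cong[OF eq, of "\<lambda>v. x \<cdot> (x \<cdot> (x \<cdot> v))"] y3_0 by (simp add: br_simps yD Dy3)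
          have p: "p = 0"
            using arg_cong[OF eq, of "\<lambda>v. x \<cdot> (x \<cdot> v)"] y3_0 q by (simp add: br_simps yD Dy3)
          have t: "t = 0"
            using arg_cong[OF eq, of "\<lambda>v. x \<cdot> v"] y3_0 q p by (simp add: br_simps yD Dy3)
          have "s = 0"
          proof (rule ccontr)
            assume "s \<noteq> 0"
            have "r *s x + s *s y3 = 0"
              using eq q p t by simp
            then show False
              using solve_relation(1)[OF \<open>s \<noteq> 0\<close>] y3x by blast
          qed
          then show "r = 0 \<and> s = 0 \<and> t = 0 \<and> p = 0 \<and> q = 0"
            using eq q p t x0 by simp
        qed
        \<comment> \<open>If \<open>(ad x)\<^sup>4\<close> annihilated \<open>y0\<close>, then \<open>y3\<close>
          would be a second vector in the radical.\<close>
        have shift: "x \<cdot> (v \<cdot> y3) = (x \<cdot> v) \<cdot> y3" for v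
          using br_derivation[of x v y3] Dy3 by (simp add: br_simps)
        obtain r s t p q where v: "y0 \<cdot> y3 = r *s x + s *s y3 + t *s y2 + p *s y1 + q *s y0"
          using indep5_coordinates[OF dim5 ind'] by blast
        have "q *s y3 = x \<cdot> (x \<cdot> (x \<cdot> (y0 \<cdot> y3)))"
          unfolding v by (simp add: br_simps yD Dy3)
        also have "\<dots> = 0"
          by (simp add: shift yD br_self)
        finally have "q = 0"
          using y3_0 by simp
        then have f0: "f (y0 \<cdot> y3) = 0"
          unfolding v using fx fD by (simp add: fs y1_def y2_def y3_def)
        have f1: "f (y1 \<cdot> y3) = 0" "f (y2 \<cdot> y3) = 0"
          using fD[of "y0 \<cdot> y3"] fD[of "y1 \<cdot> y3"] by (simp_all add: shift yD)
        have "f (y3 \<cdot> v) = 0" for v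
        proof -
          obtain r s t p q where v: "v = r *s x + s *s y3 + t *s y2 + p *s y1 + q *s y0"
            using indep5_coordinates[OF dim5 ind'] by blast
          have "f (v \<cdot> y3) = 0"
            unfolding v by (simp add: br_simps fs fD f0 f1)
          then show ?thesis
            using anti[of y3 v] by simp
        qed
        then show False
          using rad y3x by (auto simp: radical_def)
      qed
      then have "chain x (inverse c *s y0)"
        using c x0 by (simp add: chain_def br_simps vector_smult_assoc)
      then show ?thesis by blast
    next
      case D3: True
      have "\<exists>c. x \<cdot> (x \<cdot> v) = c *s x" for v
      proof (rule ccontr)
        assume neg: "\<not> ?thesis"
        then have "x \<cdot> (x \<cdot> v) \<notin> radical f"
          using rad by blast
        then obtain w where vw: "f ((x \<cdot> (x \<cdot> v)) \<cdot> w) \<noteq> 0"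
          by (auto simp: radical_def)
        have D3f: "f ((x \<cdot> (x \<cdot> (x \<cdot> s))) \<cdot> t) = 0" for s t
        proof -
          obtain c where "x \<cdot> (x \<cdot> (x \<cdot> s)) = c *s x"
            using D3 by blast
          then show ?thesis
            by (simp add: br_simps fs fD)
        qed
        have D4_0: "x \<cdot> (x \<cdot> (x \<cdot> (x \<cdot> s))) = 0" for s
        proof -
          obtain c where "x \<cdot> (x \<cdot> (x \<cdot> s)) = c *s x"
            using D3 by blast
          then show ?thesis
            by (simp add: br_simps)
        qed
        have S0: "f ((x \<cdot> (x \<cdot> s)) \<cdot> s) = 0" for s
          by (simp add: skew[of "x \<cdot> s" s] br_self fs)
        have wv: "f ((x \<cdot> (x \<cdot> w)) \<cdot> v) \<noteq> 0"
          using vw by (simp add: skew[of "x \<cdot> w" v] skew[of w "x \<cdot> v"] anti[of w])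
        \<comment> \<open>A vector \<open>(ad x)\<^sup>2 v\<close>
          outside of the radical, paired with a vector \<open>w\<close>, makes these six vectors independent:
          the values \<open>f ((ad x)\<^sup>j s \<cdot> w)\<close> and \<open>f ((ad x)\<^sup>j s \<cdot> v)\<close> for \<open>j = 2, 1, 0\<close> form a triangular system.\<close>
        have "indep 6 (nth [v, w, x \<cdot> v, x \<cdot> w, x \<cdot> (x \<cdot> v), x \<cdot> (x \<cdot> w)])"
          unfolding indep6
        proof (intro allI impI)
          fix c1 c2 c3 c4 c5 c6
          assume eq: "c1 *s v + c2 *s w + c3 *s x \<cdot> v + c4 *s x \<cdot> w + c5 *s x \<cdot> (x \<cdot> v) + c6 *s x \<cdot> (x \<cdot> w) = 0"
          have c1: "c1 = 0"
            using arg_cong[OF eq, of "\<lambda>s. f ((x \<cdot> (x \<cdot> s)) \<cdot> w)"] vw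
            by (simp add: br_simps fs D3f D4_0 S0)
          have c2: "c2 = 0"
            using arg_cong[OF eq, of "\<lambda>s. f ((x \<cdot> (x \<cdot> s)) \<cdot> v)"] wv
            by (simp add: br_simps fs D3f D4_0 S0)
          have c3: "c3 = 0"
            using arg_cong[OF eq, of "\<lambda>s. f ((x \<cdot> s) \<cdot> w)"] vw c1 c2
            by (simp add: br_simps fs D3f D4_0 S0)
          have c4: "c4 = 0"
            using arg_cong[OF eq, of "\<lambda>s. f ((x \<cdot> s) \<cdot> v)"] wv c1 c2
            by (simp add: br_simps fs D3f D4_0 S0)
          have c5: "c5 = 0"
            using arg_cong[OF eq, of "\<lambda>s. f (s \<cdot> w)"] vw c1 c2 c3 c4
            by (simp add: br_simps fs D3f D4_0 S0)
          have c6: "c6 = 0"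
            using arg_cong[OF eq, of "\<lambda>s. f (s \<cdot> v)"] wv c1 c2 c3 c4
            by (simp add: br_simps fs D3f D4_0 S0)
          show "c1 = 0 \<and> c2 = 0 \<and> c3 = 0 \<and> c4 = 0 \<and> c5 = 0 \<and> c6 = 0"
            using c1 c2 c3 c4 c5 c6 by simp
        qed
        then show False
          using more_vectors_than_dim_dependent[where 'n='n and n=6] dim5 by auto
      qed
      then show ?thesis
        by (rule extremal_cases[OF \<open>simple\<close> x0])
    qed
  qed
qed

text \<open>
  The degenerate form \<open>f\<close> has a radical of dimension one or three, as \<open>f (u \<cdot> v)\<close> has even
  rank and is nonzero. In both cases, a full Jordan chain or a subalgebra of codimension one
  arises, and the latter leads to a chain, too.
\<close>

theorem simple_imp_witt:
  assumes simple perfect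
  shows "(5::'k) = 0" "\<exists>x h e1 e2 e3. witt_table x h e1 e2 e3"
proof -
  obtain f x where f: "form f" "\<exists>v. f v \<noteq> 0" and x: "x \<noteq> 0" "f x = 0" "\<And>y. f (x \<cdot> y) = 0"
    using exists_degenerate_form by blast
  have xr: "x \<in> radical f"
    using x by (simp add: radical_def)
  have "(\<exists>x e. chain x e) \<or> (\<exists>\<pi>. codim1_subalgebra_form \<pi>)"
  proof (cases "\<forall>n\<in>radical f. \<exists>c. n = c *s x")
    case True
    then show ?thesis
      using rank4_cases[OF \<open>simple\<close> f x(1,2) xr] by blast
  next
    case False
    then obtain n where n: "n \<in> radical f" "\<And>c. n \<noteq> c *s x"
      by blast
    have "indep 2 (nth [x, n])"
      unfolding indep2
    proof (intro allI impI)
      fix r s assume eq: "r *s x + s *s n = 0"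
      have "s = 0"
      proof (rule ccontr)
        assume "s \<noteq> 0"
        then show False
          using solve_relation(1)[OF _ eq] n(2) by blast
      qed
      then show "r = 0 \<and> s = 0"
        using eq x by simp
    qed
    then show ?thesis
      using rank2_imp_codim1[OF assms f xr n(1)] by blast
  qed
  then obtain x e where "chain x e"
    using codim1_imp_chain[OF \<open>simple\<close>] by blast
  then show "(5::'k) = 0" "\<exists>x h e1 e2 e3. witt_table x h e1 e2 e3"
    using chain_imp_witt by blast+
qed

end

section \<open>There is no perfect Lie algebra of dimension four\<close>

text \<open>
  The six brackets of four basis vectors, in an order where complementary pairs sum to 5.
\<close>

definition bracket6 :: "(nat \<Rightarrow> nat \<Rightarrow> 'a) \<Rightarrow> nat \<Rightarrow> 'a" where
  "bracket6 F = nth [F 0 1, F 0 2, F 0 3, F 1 2, F 1 3, F 2 3]"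

lemma sum_lessThan_4: "(\<Sum>i<4. F i) = F 0 + F 1 + F 2 + F (3::nat)"
  by (simp add: numeral_eq_Suc)

lemma sum_lessThan_6: "(\<Sum>i<6. F i) = F 0 + F 1 + F 2 + F 3 + F 4 + F (5::nat)"
  by (simp add: numeral_eq_Suc)

lemma bracket6_simps:
  "bracket6 F 0 = F 0 1" "bracket6 F 1 = F 0 2" "bracket6 F 2 = F 0 3" "bracket6 F 3 = F 1 2"
  "bracket6 F 4 = F 1 3" "bracket6 F 5 = F 2 3"
  by (simp_all add: bracket6_def numeral_eq_Suc)

text \<open>
  If all \<open>ad x\<close> have trace zero, the differential \<open>d\<close> of the Chevalley--Eilenberg complex
  vanishes on 3-forms. In particular \<open>df \<and> df = d(f \<and> df)\<close> is zero for each linear form \<open>f\<close>.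
\<close>

lemma unimodular_pfaffian_0:
  fixes c :: "nat \<Rightarrow> nat \<Rightarrow> nat \<Rightarrow> 'k::field"
  assumes skew: "\<And>i j k. c j i k = - c i j k" and diag: "\<And>i k. c i i k = 0"
    and jac: "\<And>i j k m. i < 4 \<Longrightarrow> j < 4 \<Longrightarrow> k < 4 \<Longrightarrow> m < 4 \<Longrightarrow>
      (\<Sum>l<4. c i l m * c j k l + c j l m * c k i l + c k l m * c i j l) = 0"
    and trace: "\<And>i. i < 4 \<Longrightarrow> (\<Sum>k<4. c i k k) = 0"
    and two: "(2::'k) \<noteq> 0"
    and F: "\<And>i j. F i j = (\<Sum>k<4. f k * c i j k)"
  shows "F 0 1 * F 2 3 - F 0 2 * F 1 3 + F 0 3 * F 1 2 = 0"
proof -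
  have Fskew: "F j i = - F i j" for i j
  proof -
    have "f k * c j i k = - (f k * c i j k)" for k
      using skew[of j i k] by simp
    then show ?thesis
      by (simp only: F sum_negf)
  qed
  have Fdiag: "F i i = 0" for i
    by (simp add: F diag)
  define W where "W i j k = f i * F j k + f j * F k i + f k * F i j" for i j k
  define E where "E i j k l = (\<Sum>m<4. c i j m * W m k l)" for i j k l
  have E: "E i j k l = F i j * F k l + f k * (\<Sum>m<4. c i j m * F l m) + f l * (\<Sum>m<4. c i j m * F m k)" for i j k l
  proof -
    have "E i j k l = (\<Sum>m<4. f m * c i j m) * F k l + f k * (\<Sum>m<4. c i j m * F l m) + f l * (\<Sum>m<4. c i j m * F m k)"
      unfolding E_def W_def by (simp add: sum_lessThan_4 algebra_simps)
    then show ?thesis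
      by (simp add: F)
  qed
  have J: "(\<Sum>m<4. c j k m * F i m) + (\<Sum>m<4. c k i m * F j m) + (\<Sum>m<4. c i j m * F k m) = 0"
    if "i < 4" "j < 4" "k < 4" for i j k
  proof -
    have "(\<Sum>m<4. c j k m * F i m) + (\<Sum>m<4. c k i m * F j m) + (\<Sum>m<4. c i j m * F k m) =
        (\<Sum>n<4. f n * (\<Sum>l<4. c i l n * c j k l + c j l n * c k i l + c k l n * c i j l))"
      unfolding F by (simp add: sum_lessThan_4 algebra_simps)
    then show ?thesis
      using jac[OF that] by simp
  qed
  have neg: "(\<Sum>m<4. c i j m * F m k) = - (\<Sum>m<4. c i j m * F k m)" for i j k
  proof -
    have "c i j m * F m k = - (c i j m * F k m)" for m
      using Fskew[of m k] by simp
    then show ?thesis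
      by (simp only: sum_negf)
  qed
  have neg': "(\<Sum>m<4. c j i m * F k m) = - (\<Sum>m<4. c i j m * F k m)" for i j k
  proof -
    have "c j i m * F k m = - (c i j m * F k m)" for m
      using skew[of j i m] by simp
    then show ?thesis
      by (simp only: sum_negf)
  qed
  define S where "S i j k = (\<Sum>m<4. c i j m * F k m)" for i j k
  have Sskew: "S j i k = - S i j k" for i j k
    unfolding S_def by (rule neg')
  have ES: "E i j k l = F i j * F k l + f k * S i j l - f l * S i j k" for i j k l
    using E[of i j k l] neg[of i j k] by (simp add: S_def)
  have SJ: "S j k i + S k i j + S i j k = 0" if "i < 4" "j < 4" "k < 4" for i j k
    using J[OF that] by (simp add: S_def)
  have tot: "E 0 1 2 3 - E 0 2 1 3 + E 0 3 1 2 + E 1 2 0 3 - E 1 3 0 2 + E 2 3 0 1 =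
      2 * (F 0 1 * F 2 3 - F 0 2 * F 1 3 + F 0 3 * F 1 2)"
  proof -
    have "S 2 3 1 = S 1 3 2 - S 1 2 3" "S 2 3 0 = S 0 3 2 - S 0 2 3" "S 1 3 0 = S 0 3 1 - S 0 1 3"
      "S 1 2 0 = S 0 2 1 - S 0 1 2"
      using SJ[of 1 2 3] SJ[of 0 2 3] SJ[of 0 1 3] SJ[of 0 1 2]
        Sskew[of 1 3 2] Sskew[of 0 3 2] Sskew[of 0 3 1] Sskew[of 0 2 1]
      by (simp_all add: add_eq_0_iff)
    note eqs = this
    show ?thesis
      unfolding ES eqs by (simp add: algebra_simps)
  qed
  have "E 0 1 2 3 - E 0 2 1 3 + E 0 3 1 2 + E 1 2 0 3 - E 1 3 0 2 + E 2 3 0 1 =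
      (\<Sum>k<4. c 0 k k) * W 1 2 3 - (\<Sum>k<4. c 1 k k) * W 0 2 3 + (\<Sum>k<4. c 2 k k) * W 0 1 3 -
      (\<Sum>k<4. c 3 k k) * W 0 1 2"
  proof -
    have s: "c 1 0 k = - c 0 1 k" "c 2 0 k = - c 0 2 k" "c 3 0 k = - c 0 3 k" "c 2 1 k = - c 1 2 k"
      "c 3 1 k = - c 1 3 k" "c 3 2 k = - c 2 3 k" for k
      by (rule skew)+
    have Fs: "F 1 0 = - F 0 1" "F 2 0 = - F 0 2" "F 3 0 = - F 0 3" "F 2 1 = - F 1 2"
      "F 3 1 = - F 1 3" "F 3 2 = - F 2 3"
      by (rule Fskew)+
    show ?thesis
      unfolding E_def W_def sum_lessThan_4 s Fs Fdiag diag
      by (simp add: algebra_simps)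
  qed
  also have "\<dots> = 0"
    using trace by simp
  finally show ?thesis
    unfolding tot using two by (metis mult_eq_0_iff)
qed

text \<open>
  In a perfect algebra the trace of \<open>ad x\<close> vanishes, because it vanishes on brackets. The four
  forms \<open>df\<close> of a perfect algebra of dimension four would be independent and span a totally
  isotropic subspace of the nondegenerate 6-dimensional quadratic space of 2-forms, where such
  subspaces have dimension at most three.
\<close>

lemma no_perfect4_constants:
  fixes c :: "nat \<Rightarrow> nat \<Rightarrow> nat \<Rightarrow> 'k::field"
  assumes skew: "\<And>i j k. c j i k = - c i j k" and diag: "\<And>i k. c i i k = 0"
    and jac: "\<And>i j k m. i < 4 \<Longrightarrow> j < 4 \<Longrightarrow> k < 4 \<Longrightarrow> m < 4 \<Longrightarrow>
      (\<Sum>l<4. c i l m * c j k l + c j l m * c k i l + c k l m * c i j l) = 0"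
    and two: "(2::'k) \<noteq> 0"
    and perfect: "\<And>i. i < 4 \<Longrightarrow>
      \<exists>r. \<forall>k<4. (\<Sum>p<6. r p * bracket6 (\<lambda>i j. c i j k) p) = (if k = i then 1 else 0)"
  shows False
proof -
  let ?B = "\<lambda>k. bracket6 (\<lambda>i j. c i j k)"
  obtain r where r: "\<And>i k. i < 4 \<Longrightarrow> k < 4 \<Longrightarrow> (\<Sum>p<6. r i p * ?B k p) = (if k = i then 1 else 0)"
    using perfect by metis
  have kill: "f i = 0" if f: "\<And>p. p < 6 \<Longrightarrow> (\<Sum>k<4. f k * ?B k p) = 0" and i: "i < 4" for f i
  proof -
    have "f i = (\<Sum>k<4. f k * (if k = i then 1 else 0))"
      using i by (simp add: if_distrib cong: if_cong)
    also have "\<dots> = (\<Sum>k<4. f k * (\<Sum>p<6. r i p * ?B k p))"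
      by (rule sum.cong) (use r i in auto)
    also have "\<dots> = (\<Sum>p<6. r i p * (\<Sum>k<4. f k * ?B k p))"
      by (simp add: sum_distrib_left mult.left_commute) (rule sum.swap)
    finally show ?thesis
      using f by simp
  qed
  have F6: "(\<Sum>k<4. f k * ?B k p) = bracket6 (\<lambda>i j. \<Sum>k<4. f k * c i j k) p" if "p < 6" for f p
  proof -
    have "p = 0 \<or> p = 1 \<or> p = 2 \<or> p = 3 \<or> p = 4 \<or> p = 5"
      using that by auto
    then show ?thesis
      by (elim disjE) (simp_all only: bracket6_simps)
  qed
  have trace: "(\<Sum>k<4. c i k k) = 0" if "i < 4" for i
  proof (rule kill[OF _ that])
    fix p :: nat assume p: "p < 6"
    have 1: "(\<Sum>l<4. c i j l * (\<Sum>m<4. c l m m)) = 0" if "i < 4" "j < 4" for i j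
    proof -
      have "(\<Sum>m<4. \<Sum>l<4. c i l m * c j m l + c j l m * c m i l + c m l m * c i j l) = 0"
        by (intro sum.neutral ballI jac that) auto
      moreover have "(\<Sum>m<4. \<Sum>l<4. c j l m * c m i l) = - (\<Sum>m<4. \<Sum>l<4. c i l m * c j m l)"
      proof -
        have "c j l m * c m i l = - (c i m l * c j l m)" for l m
          using skew[of m i l] by simp
        then show ?thesis
          by (subst sum.swap) (simp only: sum_negf)
      qed
      moreover have "(\<Sum>m<4. \<Sum>l<4. c m l m * c i j l) = - (\<Sum>l<4. c i j l * (\<Sum>m<4. c l m m))"
      proof -
        have "c m l m * c i j l = - (c i j l * c l m m)" for l m
          using skew[of m l m] by simp
        then show ?thesis
          by (subst sum.swap) (simp only: sum_negf sum_distrib_left)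
      qed
      ultimately show ?thesis
        by (simp add: sum.distrib)
    qed
    have "(\<Sum>k<4. (\<Sum>m<4. c k m m) * c i j k) = 0" if "i < 4" "j < 4" for i j
      using 1[OF that] by (simp add: mult.commute)
    then have "bracket6 (\<lambda>i j. \<Sum>k<4. (\<Sum>m<4. c k m m) * c i j k) p = 0"
      using p by (auto simp: bracket6_def numeral_eq_Suc less_Suc_eq)
    then show "(\<Sum>k<4. (\<Sum>ka<4. c k ka ka) * ?B k p) = 0"
      using F6[OF p, of "\<lambda>k. \<Sum>m<4. c k m m"] by simp
  qed
  define F where "F f i j = (\<Sum>k<4. f k * c i j k)" for f i j
  have pf: "F f 0 1 * F f 2 3 - F f 0 2 * F f 1 3 + F f 0 3 * F f 1 2 = 0" for f
    by (rule unimodular_pfaffian_0[OF skew diag jac trace two]) (auto simp: F_def)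
  have F_add: "F (\<lambda>k. f k + g k) i j = F f i j + F g i j" for f g i j
    by (simp add: F_def distrib_right sum.distrib)
  have polar: "F f 2 3 * F g 0 1 - F f 1 3 * F g 0 2 + F f 1 2 * F g 0 3 + F f 0 3 * F g 1 2
      - F f 0 2 * F g 1 3 + F f 0 1 * F g 2 3 = 0" for f g
    using pf[of "\<lambda>k. f k + g k"] pf[of f] pf[of g] unfolding F_add by algebra
  \<comment> \<open>The forms \<open>df\<close> thus give a 4-dimensional space of relations between the six brackets, which
    leaves room for only two independent brackets.\<close>
  define \<epsilon> :: "nat \<Rightarrow> 'k" where "\<epsilon> = nth [1, -1, 1, 1, -1, 1]"
  define s where "s i p = \<epsilon> p * bracket6 (\<lambda>a b. c a b i) (5 - p)" for i p
  have rel: "(\<Sum>p<6. s i p * ?B k p) = 0" if "i < 4" "k < 4" for i k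
  proof -
    have "F (\<lambda>m. if m = i then 1 else 0) a b = c a b i" "F (\<lambda>m. if m = k then 1 else 0) a b = c a b k" for a b
      using that by (simp_all add: F_def if_distrib[of "\<lambda>x. x * _"] cong: if_cong)
    from polar[of "\<lambda>m. if m = i then 1 else 0" "\<lambda>m. if m = k then 1 else 0", unfolded this]
    show ?thesis
      by (simp add: s_def \<epsilon>_def bracket6_def sum_lessThan_6 numeral_eq_Suc)
  qed
  obtain d where d: "\<exists>i<8. d i \<noteq> 0"
    "\<forall>p<6. (\<Sum>i<8. d i * (if i < 4 then r i p else s (i - 4) p)) = 0"
    using homogeneous_system[of 6 8 "\<lambda>p i. if i < 4 then r i p else s (i - 4) p"] by auto
  have d2: "(\<Sum>i<4. d i * r i p) + (\<Sum>i<4. d (i + 4) * s i p) = 0" if "p < 6" for p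
    using d(2)[rule_format, OF that] by (simp add: numeral_eq_Suc add.assoc)
  have d0: "d k = 0" if k: "k < 4" for k
  proof -
    have "0 = (\<Sum>p<6. ((\<Sum>i<4. d i * r i p) + (\<Sum>i<4. d (i + 4) * s i p)) * ?B k p)"
      using d2 by simp
    also have "\<dots> = (\<Sum>i<4. d i * (\<Sum>p<6. r i p * ?B k p)) + (\<Sum>i<4. d (i + 4) * (\<Sum>p<6. s i p * ?B k p))"
      by (simp add: sum_lessThan_4 sum_lessThan_6 algebra_simps)
    also have "\<dots> = (\<Sum>i<4. d i * (if k = i then 1 else 0))"
      using r rel k by simp
    also have "\<dots> = d k"
      using k by (simp add: if_distrib cong: if_cong)
    finally show ?thesis by simp
  qed
  have "d (k + 4) = 0" if "k < 4" for k
  proof (rule kill[OF _ that, of "\<lambda>k. d (k + 4)"])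
    fix p :: nat assume p: "p < 6"
    have "(\<Sum>i<4. d (i + 4) * s i (5 - p)) = 0"
      using d2[of "5 - p"] d0 by simp
    then have "\<epsilon> (5 - p) * (\<Sum>i<4. d (i + 4) * ?B i p) = 0"
      using p by (simp add: s_def sum_distrib_left mult.left_commute)
    moreover have "\<epsilon> (5 - p) \<noteq> 0"
      using p by (auto simp: \<epsilon>_def numeral_eq_Suc less_Suc_eq)
    ultimately show "(\<Sum>k<4. d (k + 4) * ?B k p) = 0"
      by simp
  qed
  then have "d i = 0" if "i < 8" for i
    using d0 that by (cases "i < 4") (metis add.commute le_add_diff_inverse less_diff_conv2 not_less numeral_Bit0)+
  then show False
    using d(1) by blast
qed

section \<open>Dimensions of perfect algebras and of their ideals\<close>

context vector_space
begin

lemma independent_family_iff: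
  "inj_on w {..<n} \<and> independent (w ` {..<n}) \<longleftrightarrow>
     (\<forall>c. (\<Sum>i<n. scale (c i) (w i)) = 0 \<longrightarrow> (\<forall>i<n. c i = 0))" for n :: nat
proof (intro iffI allI impI conjI)
  fix c i
  assume ind: "inj_on w {..<n} \<and> independent (w ` {..<n})"
    and sum: "(\<Sum>i<n. scale (c i) (w i)) = 0" and i: "i < n"
  have inv: "the_inv_into {..<n} w (w j) = j" if "j < n" for j
    using ind that by (simp add: the_inv_into_f_f)
  have "(\<Sum>v\<in>w ` {..<n}. scale (c (the_inv_into {..<n} w v)) v) = (\<Sum>i<n. scale (c i) (w i))"
    using ind by (subst sum.reindex) (auto simp: inv)
  then have "c (the_inv_into {..<n} w (w i)) = 0"
    using independentD[of "w ` {..<n}" "w ` {..<n}" "\<lambda>v. c (the_inv_into {..<n} w v)" "w i"] ind sum i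
    by auto
  then show "c i = 0"
    using inv i by simp
next
  assume *: "\<forall>c. (\<Sum>i<n. scale (c i) (w i)) = 0 \<longrightarrow> (\<forall>i<n. c i = 0)"
  show inj: "inj_on w {..<n}"
  proof (rule inj_onI, rule ccontr)
    fix j k assume jk: "j \<in> {..<n}" "k \<in> {..<n}" "w j = w k" "j \<noteq> k"
    have "(\<Sum>l<n. scale (if l = j then 1 else if l = k then -1 else 0) (w l)) =
        (\<Sum>l\<in>{j, k}. scale (if l = j then 1 else if l = k then -1 else 0) (w l))"
      by (rule sum.mono_neutral_right) (use jk in auto)
    also have "\<dots> = 0"
      using jk by simp
    finally show False
      using *[rule_format, of "\<lambda>l. if l = j then 1 else if l = k then -1 else 0" j] jk by simp
  qed
  show "independent (w ` {..<n})"
  proof (rule independent_if_scalars_zero)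
    fix f v
    assume sum: "(\<Sum>v\<in>w ` {..<n}. scale (f v) v) = 0" and v: "v \<in> w ` {..<n}"
    have "(\<Sum>i<n. scale (f (w i)) (w i)) = 0"
      using sum inj by (simp add: sum.reindex)
    then show "f v = 0"
      using *[rule_format, of "\<lambda>i. f (w i)"] v by auto
  qed simp
qed

lemma span_family: "span (w ` {..<n}) = {\<Sum>i<n. scale (c i) (w i) | c. True}" for n :: nat
proof
  have "subspace {\<Sum>i<n. scale (c i) (w i) | c. True}"
  proof (rule subspaceI)
    show "0 \<in> {\<Sum>i<n. scale (c i) (w i) | c. True}"
      by (auto intro!: exI[of _ "\<lambda>_. 0"])
  next
    fix x y assume "x \<in> {\<Sum>i<n. scale (c i) (w i) | c. True}" "y \<in> {\<Sum>i<n. scale (c i) (w i) | c. True}"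
    then obtain c d where "x = (\<Sum>i<n. scale (c i) (w i))" "y = (\<Sum>i<n. scale (d i) (w i))"
      by blast
    then have "x + y = (\<Sum>i<n. scale (c i + d i) (w i))"
      by (simp add: scale_left_distrib sum.distrib)
    then show "x + y \<in> {\<Sum>i<n. scale (c i) (w i) | c. True}"
      by (auto intro: exI[of _ "\<lambda>i. c i + d i"])
  next
    fix a x assume "x \<in> {\<Sum>i<n. scale (c i) (w i) | c. True}"
    then obtain c where "x = (\<Sum>i<n. scale (c i) (w i))"
      by blast
    then have "scale a x = (\<Sum>i<n. scale (a * c i) (w i))"
      by (simp add: scale_sum_right)
    then show "scale a x \<in> {\<Sum>i<n. scale (c i) (w i) | c. True}"
      by (auto intro: exI[of _ "\<lambda>i. a * c i"])
  qed
  moreover have "w ` {..<n} \<subseteq> {\<Sum>i<n. scale (c i) (w i) | c. True}"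
  proof
    fix v assume "v \<in> w ` {..<n}"
    then obtain j where j: "j < n" "v = w j"
      by blast
    have "(\<Sum>i<n. scale (if i = j then 1 else 0) (w i)) = (\<Sum>i<n. if i = j then w i else 0)"
      by (rule sum.cong) auto
    then have "(\<Sum>i<n. scale (if i = j then 1 else 0) (w i)) = v"
      using j by simp
    then show "v \<in> {\<Sum>i<n. scale (c i) (w i) | c. True}"
      by (auto intro!: exI[of _ "\<lambda>i. if i = j then 1 else 0"])
  qed
  ultimately show "span (w ` {..<n}) \<subseteq> {\<Sum>i<n. scale (c i) (w i) | c. True}"
    by (rule span_minimal[rotated])
  show "{\<Sum>i<n. scale (c i) (w i) | c. True} \<subseteq> span (w ` {..<n})"
    by (auto intro!: span_sum span_scale[OF span_base])
qed

end

lemma indep_iff_independent: "indep n w \<longleftrightarrow> inj_on w {..<n} \<and> vec.independent (w ` {..<n})"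
  unfolding vec.independent_family_iff indep_def ..

lemma subspace_basis:
  fixes S :: "('k::field^'n) set"
  assumes "vec.subspace S"
  obtains w where "indep (vec.dim S) w" "vec.span (w ` {..<vec.dim S}) = S"
proof -
  obtain B where B: "B \<subseteq> S" "vec.independent B" "S \<subseteq> vec.span B" "card B = vec.dim S"
    by (rule vec.basis_exists)
  have "finite B"
    using B(2) by (rule vec.finiteI_independent)
  then obtain w where w: "bij_betw w {..<vec.dim S} B"
    using ex_bij_betw_nat_finite[of B] B(4) by (auto simp: atLeast0LessThan)
  have "vec.span B = S"
    using B assms vec.span_minimal[of B S] by auto
  then show thesis
    using that[of w] w B(2) by (simp add: indep_iff_independent bij_betw_def)
qed

lemma dim_span_indep: "indep n w \<Longrightarrow> vec.dim (vec.span (w ` {..<n})) = n"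
  by (simp add: indep_iff_independent vec.dim_eq_card_independent card_image)

lemma indep_spans_subspace:
  assumes "vec.subspace S" "indep (vec.dim S) w" "\<And>i. i < vec.dim S \<Longrightarrow> w i \<in> S"
  shows "vec.span (w ` {..<vec.dim S}) = S"
proof (rule vec.subspace_dim_equal)
  show "vec.span (w ` {..<vec.dim S}) \<subseteq> S"
    using assms by (intro vec.span_minimal) auto
qed (use assms dim_span_indep[OF assms(2)] in auto)

context lie_bracket
begin

definition brackets :: "('k^'n) set \<Rightarrow> ('k^'n) set" where
  "brackets D = {x \<cdot> y | x y. x \<in> D \<and> y \<in> D}"

lemma perfect_span: "perfect \<Longrightarrow> vec.span (brackets UNIV) = UNIV"
proof (rule ccontr)
  assume perfect "vec.span (brackets UNIV) \<noteq> UNIV"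
  then obtain v where "v \<notin> vec.span (brackets UNIV)"
    by blast
  then obtain g where g: "form g" "g v = 1" "\<And>s. s \<in> vec.span (brackets UNIV) \<Longrightarrow> g s = 0"
    using form_separating[OF vec.subspace_span] by metis
  have "g (x \<cdot> y) = 0" for x y
    by (intro g(3) vec.span_base) (auto simp: brackets_def)
  then have "g v = 0"
    using g(1) \<open>perfect\<close> unfolding perfect_def by blast
  then show False
    using g(2) by simp
qed

end

context finite_lie_bracket
begin

text \<open>
  The quotient \<open>D / J\<close> of dimension four cannot be perfect, where the \<open>b i\<close> represent a basis.
  The cases that occur are a subalgebra \<open>D\<close> with \<open>J = 0\<close>, and \<open>D = L\<close> with a one-dimensional
  ideal \<open>J\<close>.
\<close>

lemma no_perfect_dim4_mod:
  fixes b :: "nat \<Rightarrow> 'k^'n"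
  assumes g: "\<And>i. i < 4 \<Longrightarrow> form (g i)" "\<And>i j. i < 4 \<Longrightarrow> j < 4 \<Longrightarrow> g i (b j) = (if i = j then 1 else 0)"
    and gJ: "\<And>i j. i < 4 \<Longrightarrow> j \<in> J \<Longrightarrow> g i j = 0"
    and J: "vec.subspace J" and D: "\<And>x. x \<in> D \<Longrightarrow> \<exists>a. x - (\<Sum>i<4. a i *s b i) \<in> J"
    and b: "\<And>i. i < 4 \<Longrightarrow> b i \<in> D"
    and JD: "\<And>x j. x \<in> D \<Longrightarrow> j \<in> J \<Longrightarrow> x \<cdot> j \<in> J" and "J \<subseteq> D"
    and closed: "\<And>x y. x \<in> D \<Longrightarrow> y \<in> D \<Longrightarrow> x \<cdot> y \<in> D"
    and perfect: "\<And>i. i < 4 \<Longrightarrow> b i \<in> vec.span (brackets D)"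
  shows False
proof -
  define c where "c i j k = g k (b i \<cdot> b j)" for i j k
  let ?c = "\<lambda>i j k. if k < 4 then c i j k else 0"
  have cf: "(\<Sum>l<4. F l * ?c i j l) = (\<Sum>l<4. F l * c i j l)" for F :: "nat \<Rightarrow> 'k" and i j
    by (rule sum.cong) auto
  have skew: "?c j i k = - ?c i j k" for i j k
    using br_anti[of "b j" "b i"] g(1) by (simp add: c_def form_simps)
  have diag: "?c i i k = 0" for i k
    using g(1) by (simp add: c_def br_self form_simps)
  have exp: "\<exists>j\<in>J. b i \<cdot> b k = (\<Sum>l<4. c i k l *s b l) + j" if ik: "i < 4" "k < 4" for i k
  proof -
    obtain a where a: "b i \<cdot> b k - (\<Sum>l<4. a l *s b l) \<in> J"
      using D[OF closed[OF b[OF ik(1)] b[OF ik(2)]]] by blast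
    have "a m = c i k m" if m: "m < 4" for m
    proof -
      have "g m (b i \<cdot> b k - (\<Sum>l<4. a l *s b l)) = 0"
        using gJ[OF m a] .
      then have "c i k m = (\<Sum>l<4. a l * g m (b l))"
        using g(1)[OF m] by (simp add: c_def form_simps)
      also have "\<dots> = (\<Sum>l<4. a l * (if m = l then 1 else 0))"
        by (rule sum.cong) (use g(2) m in auto)
      also have "\<dots> = a m"
        using m by (simp add: if_distrib cong: if_cong)
      finally show ?thesis by simp
    qed
    then have "(\<Sum>l<4. a l *s b l) = (\<Sum>l<4. c i k l *s b l)"
      by (intro sum.cong) auto
    then show ?thesis
      using a by (intro bexI[of _ "b i \<cdot> b k - (\<Sum>l<4. a l *s b l)"]) auto
  qed
  have triple: "g m (b i \<cdot> (b j \<cdot> b k)) = (\<Sum>l<4. c i l m * c j k l)" if ijkm: "i < 4" "j < 4" "k < 4" "m < 4" for i j k m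
  proof -
    obtain j' where j': "j' \<in> J" "b j \<cdot> b k = (\<Sum>l<4. c j k l *s b l) + j'"
      using exp[OF ijkm(2,3)] by blast
    have "g m (b i \<cdot> j') = 0"
      using gJ[OF ijkm(4) JD[OF b[OF ijkm(1)] j'(1)]] .
    then have "g m (b i \<cdot> (b j \<cdot> b k)) = (\<Sum>l<4. c j k l * g m (b i \<cdot> b l))"
      unfolding j'(2) using g(1)[OF ijkm(4)] by (simp add: br_sum_right br_simps form_simps)
    then show ?thesis
      by (simp add: c_def mult.commute)
  qed
  have jac: "(\<Sum>l<4. ?c i l m * ?c j k l + ?c j l m * ?c k i l + ?c k l m * ?c i j l) = 0"
    if "i < 4" "j < 4" "k < 4" "m < 4" for i j k m
  proof -
    have "(\<Sum>l<4. ?c i l m * ?c j k l + ?c j l m * ?c k i l + ?c k l m * ?c i j l) =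
        (\<Sum>l<4. c i l m * c j k l) + (\<Sum>l<4. c j l m * c k i l) + (\<Sum>l<4. c k l m * c i j l)"
      using that by (simp add: sum.distrib)
    also have "\<dots> = g m (b i \<cdot> (b j \<cdot> b k) + b j \<cdot> (b k \<cdot> b i) + b k \<cdot> (b i \<cdot> b j))"
      using triple that g(1) by (simp add: form_simps)
    also have "\<dots> = 0"
      using jacobi g(1) that by (simp add: form_simps)
    finally show ?thesis .
  qed
  let ?F = "\<lambda>i j. b i \<cdot> b j"
  let ?S = "vec.span (bracket6 ?F ` {..<6} \<union> J)"
  have bb: "b i \<cdot> b j \<in> ?S" if "i < 4" "j < 4" for i j
  proof -
    have in6: "bracket6 ?F p \<in> ?S" if "p < 6" for p
      using that by (intro vec.span_base) auto
    have lt: "b i \<cdot> b j \<in> ?S" if "i < j" "j < 4" for i j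
    proof -
      have "j = 1 \<and> i = 0 \<or> j = 2 \<and> i = 0 \<or> j = 2 \<and> i = 1 \<or> j = 3 \<and> i = 0 \<or> j = 3 \<and> i = 1 \<or> j = 3 \<and> i = 2"
        using that by (auto simp: numeral_eq_Suc less_Suc_eq)
      then show ?thesis
        using in6[of 0] in6[of 1] in6[of 2] in6[of 3] in6[of 4] in6[of 5]
        unfolding bracket6_simps by auto
    qed
    consider "i = j" | "i < j" | "j < i" by linarith
    then show ?thesis
    proof cases
      case 3
      then have "- (b j \<cdot> b i) \<in> ?S"
        using lt that by (intro vec.span_neg) auto
      then show ?thesis
        using br_anti[of "b i" "b j"] by simp
    qed (use lt that in \<open>auto simp: br_self vec.span_zero\<close>)
  qed
  have "x \<cdot> y \<in> ?S" if xy: "x \<in> D" "y \<in> D" for x y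
  proof -
    obtain a where a: "x - (\<Sum>i<4. a i *s b i) \<in> J"
      using D xy by blast
    obtain a' where a': "y - (\<Sum>i<4. a' i *s b i) \<in> J"
      using D xy by blast
    let ?x = "\<Sum>i<4. a i *s b i" and ?y = "\<Sum>i<4. a' i *s b i"
    have "?x \<cdot> ?y \<in> ?S"
      by (auto simp: br_sum_left br_sum_right br_simps intro!: vec.span_sum vec.span_scale bb)
    moreover have "x \<cdot> (y - ?y) \<in> ?S"
      using JD[OF xy(1) a'] by (intro vec.span_base) auto
    moreover have "- (?y \<cdot> (x - ?x)) \<in> ?S"
    proof -
      have yJ: "y \<cdot> (x - ?x) \<in> J"
        using JD[OF xy(2) a] .
      have "(y - ?y) \<in> D"
        using a' \<open>J \<subseteq> D\<close> by blast
      from JD[OF this a] have "y \<cdot> (x - ?x) - (y - ?y) \<cdot> (x - ?x) \<in> J"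
        using yJ J by (intro vec.subspace_diff)
      then have "?y \<cdot> (x - ?x) \<in> J"
        by (simp add: br_diff_left)
      then have "- (?y \<cdot> (x - ?x)) \<in> J"
        using J by (intro vec.subspace_neg)
      then show ?thesis
        by (intro vec.span_base) auto
    qed
    ultimately have "?x \<cdot> ?y + x \<cdot> (y - ?y) + - (?y \<cdot> (x - ?x)) \<in> ?S"
      by (intro vec.span_add)
    moreover have "x \<cdot> y = ?x \<cdot> ?y + x \<cdot> (y - ?y) + (x - ?x) \<cdot> ?y"
      by (simp add: br_diff_left br_diff_right)
    moreover have "(x - ?x) \<cdot> ?y = - (?y \<cdot> (x - ?x))"
      by (rule br_anti)
    ultimately show ?thesis
      by (simp only:)
  qed
  then have sub: "vec.span (brackets D) \<subseteq> ?S"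
    by (intro vec.span_minimal) (auto simp: brackets_def)
  have "\<exists>r. \<forall>k<4. (\<Sum>p<6. r p * bracket6 (\<lambda>i j. ?c i j k) p) = (if k = i then 1 else 0)" if i: "i < 4" for i
  proof -
    have "b i \<in> ?S"
      using sub perfect[OF i] by blast
    then obtain u j where u: "u \<in> vec.span (bracket6 ?F ` {..<6})" "j \<in> vec.span J" "b i = u + j"
      unfolding vec.span_Un by blast
    then obtain r where r: "u = (\<Sum>p<6. r p *s bracket6 ?F p)"
      unfolding vec.span_family by blast
    have jJ: "j \<in> J"
      using u(2) J by (metis vec.span_eq_iff)
    have "(\<Sum>p<6. r p * bracket6 (\<lambda>i j. ?c i j k) p) = (if k = i then 1 else 0)" if k: "k < 4" for k
    proof -
      have "g k (b i) = (\<Sum>p<6. r p * g k (bracket6 ?F p))"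
        unfolding u(3) r using gJ[OF k jJ] g(1)[OF k] by (simp add: form_simps)
      moreover have "g k (bracket6 ?F p) = bracket6 (\<lambda>i j. ?c i j k) p" if "p < 6" for p
        using that k by (auto simp: bracket6_def c_def numeral_eq_Suc less_Suc_eq)
      ultimately show ?thesis
        using g(2)[OF k i] by simp
    qed
    then show ?thesis by blast
  qed
  then show False
    using no_perfect4_constants[of ?c, OF skew diag jac two_neq_0] by blast
qed

definition adapted :: "('k^'n) set \<Rightarrow> (nat \<Rightarrow> 'k^'n) \<Rightarrow> (nat \<Rightarrow> 'k^'n \<Rightarrow> 'k) \<Rightarrow> bool" where
  "adapted S w g \<longleftrightarrow> indep 5 w \<and> vec.span (w ` {..<vec.dim S}) = S \<and> (\<forall>i<5. form (g i)) \<and>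
     (\<forall>i<5. \<forall>j<5. g i (w j) = (if i = j then 1 else 0)) \<and> (\<forall>v. v = (\<Sum>i<5. g i v *s w i)) \<and>
     (\<forall>v. v \<in> S \<longleftrightarrow> (\<forall>i<5. vec.dim S \<le> i \<longrightarrow> g i v = 0))"

lemma adaptedD:
  assumes "adapted S w g"
  shows "indep 5 w" "vec.span (w ` {..<vec.dim S}) = S"
    "\<And>i. i < 5 \<Longrightarrow> form (g i)" "\<And>i j. i < 5 \<Longrightarrow> j < 5 \<Longrightarrow> g i (w j) = (if i = j then 1 else 0)"
    "v = (\<Sum>i<5. g i v *s w i)" "v \<in> S \<longleftrightarrow> (\<forall>i<5. vec.dim S \<le> i \<longrightarrow> g i v = 0)"
  using assms unfolding adapted_def by blast+

lemma adapted_basis: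
  fixes S :: "('k^'n) set"
  assumes "vec.subspace S"
  obtains w g where "adapted S w g"
proof -
  obtain w0 where w0: "indep (vec.dim S) w0" "vec.span (w0 ` {..<vec.dim S}) = S"
    using subspace_basis[OF assms] by blast
  have le: "vec.dim S \<le> 5"
    using vec.dim_subset_UNIV[of S] dim5 by (simp add: vec.dimension_def card_cart_basis)
  obtain w where w: "indep 5 w" "\<And>i. i < vec.dim S \<Longrightarrow> w i = w0 i"
    using indep_extend_to_basis[OF w0(1) le] dim5 by auto
  have span: "vec.span (w ` {..<vec.dim S}) = S"
    using w0(2) w(2) by (metis image_cong lessThan_iff)
  obtain g where g: "\<And>i. i < 5 \<Longrightarrow> form (g i)"
    "\<And>i j. i < 5 \<Longrightarrow> j < 5 \<Longrightarrow> g i (w j) = (if i = j then 1 else 0)"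
    using indep_dual_forms[OF w(1)] by blast
  have coord: "v = (\<Sum>i<5. g i v *s w i)" for v
  proof -
    obtain c where c: "v = (\<Sum>i<5. c i *s w i)"
      using indep_spanning[of w v] w(1) dim5 by auto
    have "g i v = c i" if i: "i < 5" for i
    proof -
      have "g i v = (\<Sum>j<5. c j * g i (w j))"
        unfolding c using g(1)[OF i] by (simp add: form_simps)
      also have "\<dots> = (\<Sum>j<5. c j * (if i = j then 1 else 0))"
        by (rule sum.cong) (use g(2) i in auto)
      also have "\<dots> = c i"
        using i by (simp add: if_distrib cong: if_cong)
      finally show ?thesis .
    qed
    then show ?thesis
      by (subst c) (auto intro: sum.cong)
  qed
  have mem: "v \<in> S \<longleftrightarrow> (\<forall>i<5. vec.dim S \<le> i \<longrightarrow> g i v = 0)" for v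
  proof
    assume "v \<in> S"
    then have v: "v \<in> vec.span (w ` {..<vec.dim S})"
      using span by simp
    have "g i v = 0" if i: "i < 5" "vec.dim S \<le> i" for i
      by (rule form_zero_on_span[OF g(1)[OF i(1)] _ v]) (use g(2) i le in auto)
    then show "\<forall>i<5. vec.dim S \<le> i \<longrightarrow> g i v = 0"
      by blast
  next
    assume *: "\<forall>i<5. vec.dim S \<le> i \<longrightarrow> g i v = 0"
    have "(\<Sum>i<5. g i v *s w i) \<in> vec.span (w ` {..<vec.dim S})"
    proof (rule vec.span_sum)
      fix i assume "i \<in> {..<5::nat}"
      then show "g i v *s w i \<in> vec.span (w ` {..<vec.dim S})"
        using * by (cases "i < vec.dim S") (auto intro: vec.span_scale vec.span_base simp: vec.span_zero)
    qed
    then show "v \<in> S"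
      using coord span by metis
  qed
  have "adapted S w g"
    unfolding adapted_def using w(1) span g coord mem by blast
  then show thesis
    by (rule that)
qed

end

context finite_lie_bracket
begin

lemma ideal_br_left: "ideal J \<Longrightarrow> j \<in> J \<Longrightarrow> j \<cdot> x \<in> J"
  using br_anti[of j x] by (simp add: ideal_def vec.subspace_neg)

text \<open>
  The quotient by \<open>J\<close> is perfect, too. It cannot have dimension one or two, where the brackets
  span at most a line, nor dimension four.
\<close>

lemma perfect_ideal_dim:
  assumes perfect "ideal J" "J \<noteq> {0}" "J \<noteq> UNIV"
  shows "vec.dim J = 2"
proof -
  have sub: "vec.subspace J" and br: "\<And>x y. y \<in> J \<Longrightarrow> x \<cdot> y \<in> J"
    using assms(2) by (auto simp: ideal_def)
  note bl = ideal_br_left[OF assms(2)]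
  note add = vec.subspace_add[OF sub] and scale = vec.subspace_scale[OF sub]
  obtain w g where wg: "adapted J w g"
    by (rule adapted_basis[OF sub])
  note w = adaptedD(1,2)[OF wg] and g = adaptedD(3,4)[OF wg] and coord = adaptedD(5)[OF wg]
    and mem = adaptedD(6)[OF wg]
  have perf: "h v = 0" if "form h" "\<And>x y. h (x \<cdot> y) = 0" for h v
    using assms(1) that unfolding perfect_def by blast
  consider "vec.dim J = 0" | "vec.dim J = 1" | "vec.dim J = 2" | "vec.dim J = 3" | "vec.dim J = 4" | "5 \<le> vec.dim J"
    by linarith
  then show ?thesis
  proof cases
    case 1
    have "v = 0" if "v \<in> J" for v
    proof -
      have "\<forall>i<5. g i v = 0"
        using that mem 1 by simp
      then have "(\<Sum>i<5. g i v *s w i) = 0"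
        by simp
      then show ?thesis
        using coord[of v] by metis
    qed
    then show ?thesis
      using assms(3) vec.subspace_0[OF sub] by blast
  next
    case 2
    have False
    proof (rule no_perfect_dim4_mod[of "\<lambda>i. g (Suc i)" "\<lambda>i. w (Suc i)" J UNIV])
      fix i :: nat and j assume "i < 4" "j \<in> J"
      then show "g (Suc i) j = 0"
        using mem 2 by auto
    next
      fix x :: "'k^'n"
      have "x = g 0 x *s w 0 + (\<Sum>i<4. g (Suc i) x *s w (Suc i))"
        using coord[of x] by (simp add: numeral_eq_Suc add.assoc)
      then have "x - (\<Sum>i<4. g (Suc i) x *s w (Suc i)) = g 0 x *s w 0"
        by (metis add_diff_cancel_right')
      moreover have "w 0 \<in> J"
        using mem g(2) 2 by auto
      ultimately show "\<exists>a. x - (\<Sum>i<4. a i *s w (Suc i)) \<in> J"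
        using scale by metis
    qed (use g br sub perfect_span[OF assms(1)] in auto)
    then show ?thesis ..
  next
    case 4
    let ?\<beta> = "w 3 \<cdot> w 4"
    obtain p q where pq: "p * g 3 ?\<beta> + q * g 4 ?\<beta> = 0" "p \<noteq> 0 \<or> q \<noteq> 0"
    proof (cases "g 3 ?\<beta> = 0 \<and> g 4 ?\<beta> = 0")
      case True
      then show thesis using that[of 1 0] by simp
    next
      case False
      then show thesis using that[of "g 4 ?\<beta>" "- g 3 ?\<beta>"] by auto
    qed
    define h where "h v = p * g 3 v + q * g 4 v" for v
    have form: "form h"
      by (rule formI) (use g(1)[of 3] g(1)[of 4] in \<open>simp_all add: h_def form_simps algebra_simps\<close>)
    have hJ: "h j = 0" if "j \<in> J" for j
      using that mem 4 by (simp add: h_def)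
    have "h (x \<cdot> y) = 0" for x y
    proof -
      define j j' where "j = x - (g 3 x *s w 3 + g 4 x *s w 4)" and "j' = y - (g 3 y *s w 3 + g 4 y *s w 4)"
      have jJ: "v - (g 3 v *s w 3 + g 4 v *s w 4) \<in> J" for v
      proof -
        have "g i (v - (g 3 v *s w 3 + g 4 v *s w 4)) = 0" if "i < 5" "3 \<le> i" for i :: nat
        proof -
          have "i = 3 \<or> i = 4"
            using that by auto
          then show ?thesis
            using g by (auto simp: form_simps)
        qed
        then show ?thesis
          unfolding mem using 4 by simp
      qed
      let ?X = "g 3 x *s w 3 + g 4 x *s w 4" and ?Y = "g 3 y *s w 3 + g 4 y *s w 4"
      have "?X \<cdot> ?Y = (g 3 x * g 4 y - g 4 x * g 3 y) *s ?\<beta>"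
        using br_anti[of "w 4" "w 3"] by (simp add: br_simps vec_eq_iff algebra_simps)
      moreover have "x \<cdot> y = ?X \<cdot> ?Y + (?X \<cdot> j' + j \<cdot> y)"
        by (simp add: j_def j'_def br_diff_left br_diff_right)
      ultimately have "x \<cdot> y = (g 3 x * g 4 y - g 4 x * g 3 y) *s ?\<beta> + (?X \<cdot> j' + j \<cdot> y)"
        by (simp only:)
      moreover have "(g 3 x *s w 3 + g 4 x *s w 4) \<cdot> j' + j \<cdot> y \<in> J"
        using jJ by (intro add br bl) (simp_all add: j_def j'_def)
      then have "h (?X \<cdot> j' + j \<cdot> y) = 0"
        by (rule hJ)
      ultimately have "h (x \<cdot> y) = (g 3 x * g 4 y - g 4 x * g 3 y) * h ?\<beta>"
        using form_add[OF form, of "(g 3 x * g 4 y - g 4 x * g 3 y) *s ?\<beta>" "?X \<cdot> j' + j \<cdot> y"]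
        by (simp only: form_scale[OF form] add_0_right)
      then show ?thesis
        using pq(1) by (simp add: h_def[of ?\<beta>])
    qed
    then have "h (w 3) = 0" "h (w 4) = 0"
      using perf[OF form] by blast+
    then show ?thesis
      using pq(2) g(2) by (simp add: h_def)
  next
    case 5
    have "g 4 (x \<cdot> y) = 0" for x y
    proof -
      define j j' where "j = x - g 4 x *s w 4" and "j' = y - g 4 y *s w 4"
      have jJ: "v - g 4 v *s w 4 \<in> J" for v
      proof -
        have "g i (v - g 4 v *s w 4) = 0" if "i < 5" "4 \<le> i" for i :: nat
        proof -
          have "i = 4"
            using that by simp
          then show ?thesis
            using g by (simp add: form_simps)
        qed
        then show ?thesis
          unfolding mem using 5 by simp
      qed
      have "x \<cdot> y = (g 4 x *s w 4) \<cdot> (g 4 y *s w 4) + ((g 4 x *s w 4) \<cdot> j' + j \<cdot> y)"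
        by (simp add: j_def j'_def br_diff_left br_diff_right)
      then have "x \<cdot> y = (g 4 x *s w 4) \<cdot> j' + j \<cdot> y"
        by (simp add: br_scale_left br_scale_right br_self)
      moreover have "(g 4 x *s w 4) \<cdot> j' + j \<cdot> y \<in> J"
        using jJ by (intro add br bl) (simp_all add: j_def j'_def)
      ultimately show ?thesis
        using mem 5 by simp
    qed
    then have "g 4 (w 4) = 0"
      using perf[of "g 4"] g(1) by simp
    then show ?thesis
      using g(2) by simp
  next
    case 6
    then have "J = UNIV"
      using mem by auto
    then show ?thesis
      using assms(4) by blast
  qed
qed

lemma perfect_subspace_dim:
  assumes sub: "vec.subspace D" and D: "vec.span (brackets D) = D" "D \<noteq> {0}"
  shows "vec.dim D = 3 \<or> D = UNIV"
proof -
  have closed: "x \<cdot> y \<in> D" if "x \<in> D" "y \<in> D" for x y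
  proof -
    have "x \<cdot> y \<in> vec.span (brackets D)"
      using that by (intro vec.span_base) (auto simp: brackets_def)
    then show ?thesis using D by simp
  qed
  obtain w g where wg: "adapted D w g"
    by (rule adapted_basis[OF sub])
  note w = adaptedD(1,2)[OF wg] and g = adaptedD(3,4)[OF wg] and coord = adaptedD(5)[OF wg]
    and mem = adaptedD(6)[OF wg]
  have small: False if m: "vec.dim D \<le> 2"
  proof -
    have x: "v = g 0 v *s w 0 + g 1 v *s w 1" if "v \<in> D" for v
    proof -
      have "g 2 v = 0" "g 3 v = 0" "g 4 v = 0"
        using that mem m by auto
      then show ?thesis
        using coord[of v] by (simp add: numeral_eq_Suc)
    qed
    have "x \<cdot> y \<in> vec.span {w 0 \<cdot> w 1}" if "x \<in> D" "y \<in> D" for x y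
    proof -
      have "x \<cdot> y = (g 0 x *s w 0 + g 1 x *s w 1) \<cdot> (g 0 y *s w 0 + g 1 y *s w 1)"
        using x that by metis
      also have "\<dots> = (g 0 x * g 1 y - g 1 x * g 0 y) *s w 0 \<cdot> w 1"
        using br_anti[of "w 1" "w 0"] by (simp add: br_simps vec_eq_iff algebra_simps)
      finally show ?thesis
        by (simp add: vec.span_scale vec.span_base)
    qed
    then have le: "D \<subseteq> vec.span {w 0 \<cdot> w 1}"
      using D(1) vec.span_minimal[of "brackets D" "vec.span {w 0 \<cdot> w 1}"] by (auto simp: brackets_def)
    have "vec.dim D \<le> card {w 0 \<cdot> w 1}"
      by (rule vec.dim_le_card[OF le]) simp
    then have "g 1 v = 0" if "v \<in> D" for v
      using that mem by auto
    then have x1: "v = g 0 v *s w 0" if "v \<in> D" for v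
      using x that by (metis add.right_neutral vector_smult_lzero)
    have "x \<cdot> y = 0" if "x \<in> D" "y \<in> D" for x y
    proof -
      have "x \<cdot> y = (g 0 x *s w 0) \<cdot> (g 0 y *s w 0)"
        using x1 that by metis
      then show ?thesis
        by (simp add: br_simps)
    qed
    then have "brackets D \<subseteq> {0}"
      by (auto simp: brackets_def)
    then have "vec.span (brackets D) \<subseteq> {0}"
      using vec.span_mono[of "brackets D" "{0}"] by simp
    then show False
      using D vec.subspace_0[OF sub] by auto
  qed
  have four: False if m: "vec.dim D = 4"
  proof (rule no_perfect_dim4_mod[of g w "{0}" D])
    fix x assume "x \<in> D"
    then have "g 4 x = 0"
      using mem m by auto
    then have "x - (\<Sum>i<4. g i x *s w i) = 0"
      using coord[of x] by (simp add: numeral_eq_Suc add.assoc)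
    then show "\<exists>a. x - (\<Sum>i<4. a i *s w i) \<in> {0}"
      by (intro exI[of _ "\<lambda>i. g i x"]) simp
  next
    fix i :: nat assume "i < 4"
    then show "w i \<in> D"
      using w(2) m by (auto intro: vec.span_base)
    then show "w i \<in> vec.span (brackets D)"
      using D by simp
  qed (use g closed vec.subspace_0[OF sub] in \<open>auto simp: form_simps vec.subspace_def br_0_right\<close>)
  show ?thesis
  proof (cases "5 \<le> vec.dim D")
    case True
    then show ?thesis
      using mem by auto
  next
    case False
    have "\<not> vec.dim D \<le> 2" "vec.dim D \<noteq> 4"
      using small four by blast+
    then have "vec.dim D = 3"
      using False by linarith
    then show ?thesis ..
  qed
qed


section \<open>Extensions of \<open>sl(2)\<close> by its two-dimensional module\<close>

text \<open>
  Up to a change of basis, \<open>b\<close> and \<open>c\<close> are the only freedom in a cocycle of \<open>sl(2)\<close> with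
  values in \<open>V(1)\<close>.
\<close>

definition ext_table :: "'k^'n \<Rightarrow> 'k^'n \<Rightarrow> 'k^'n \<Rightarrow> 'k^'n \<Rightarrow> 'k^'n \<Rightarrow> 'k \<Rightarrow> 'k \<Rightarrow> bool" where
  "ext_table e h f v0 v1 b c \<longleftrightarrow> indep 5 (nth [e, h, f, v0, v1]) \<and>
     h \<cdot> e = 2 *s e + b *s v1 \<and> h \<cdot> f = -2 *s f + c *s v0 \<and> e \<cdot> f = h \<and>
     h \<cdot> v0 = v0 \<and> h \<cdot> v1 = - v1 \<and> e \<cdot> v0 = 0 \<and> e \<cdot> v1 = v0 \<and> f \<cdot> v0 = v1 \<and> f \<cdot> v1 = 0 \<and>
     v0 \<cdot> v1 = 0"

lemma ext_table_eqs:
  assumes "ext_table e h f v0 v1 b c"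
  shows "h \<cdot> e = 2 *s e + b *s v1" "h \<cdot> f = -2 *s f + c *s v0" "e \<cdot> f = h" "h \<cdot> v0 = v0"
    "h \<cdot> v1 = - v1" "e \<cdot> v0 = 0" "e \<cdot> v1 = v0" "f \<cdot> v0 = v1" "f \<cdot> v1 = 0" "v0 \<cdot> v1 = 0"
  using assms by (simp_all add: ext_table_def)

lemma ext_table_anti:
  assumes "ext_table e h f v0 v1 b c"
  shows "e \<cdot> h = -2 *s e - b *s v1" "f \<cdot> h = 2 *s f - c *s v0" "f \<cdot> e = - h"
    "v0 \<cdot> h = - v0" "v1 \<cdot> h = v1" "v0 \<cdot> e = 0" "v1 \<cdot> e = - v0" "v0 \<cdot> f = - v1" "v1 \<cdot> f = 0" "v1 \<cdot> v0 = 0"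
  using assms br_anti[of e h] br_anti[of f h] br_anti[of f e] br_anti[of v0 h] br_anti[of v1 h]
    br_anti[of v0 e] br_anti[of v1 e] br_anti[of v0 f] br_anti[of v1 f] br_anti[of v1 v0]
  by (simp_all add: ext_table_def vec_eq_iff)

text \<open>
  A proper nonzero ideal \<open>J\<close> has dimension two. It is abelian, as the brackets of its elements
  would otherwise span a one-dimensional ideal. Perfectness forces the quotient, of dimension
  three, to act on \<open>J\<close> by matrices of trace zero, and faithfully, hence as \<open>sl(2)\<close>. Vectors
  \<open>e\<close>, \<open>f\<close> that act as the matrix units and \<open>h = e \<cdot> f\<close> are the required basis.
\<close>

lemma perfect_not_simple_imp_ext:
  assumes perfect "\<not> simple"
  shows "\<exists>e h f v0 v1 b c. ext_table e h f v0 v1 b c"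
proof -
  have perf: "h v = 0" if "form h" "\<And>x y. h (x \<cdot> y) = 0" for h v
    using assms(1) that unfolding perfect_def by blast
  obtain J where J: "ideal J" "J \<noteq> {0}" "J \<noteq> UNIV"
    using assms(2) by (auto simp: simple_def)
  note dim2 = perfect_ideal_dim[OF assms(1)]
  note dJ = dim2[OF J]
  have sub: "vec.subspace J" and br: "\<And>x y. y \<in> J \<Longrightarrow> x \<cdot> y \<in> J"
    using J by (auto simp: ideal_def)
  obtain w g where wg: "adapted J w g"
    by (rule adapted_basis[OF sub])
  note w = adaptedD(1,2)[OF wg] and g = adaptedD(3,4)[OF wg] and coord = adaptedD(5)[OF wg]
    and mem = adaptedD(6)[OF wg]
  define v0 v1 where "v0 = w 0" and "v1 = w 1"
  have vJ: "v0 \<in> J" "v1 \<in> J"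
    using mem g(2) dJ by (auto simp: v0_def v1_def)
  have v_nz: "v0 \<noteq> 0" "v1 \<noteq> 0"
    using g(2)[of 0 0] g(2)[of 1 1] form_0[OF g(1)[of 0]] form_0[OF g(1)[of 1]] by (auto simp: v0_def v1_def)
  have Jspan: "j = g 0 j *s v0 + g 1 j *s v1" if "j \<in> J" for j
  proof -
    have "g 2 j = 0" "g 3 j = 0" "g 4 j = 0"
      using that mem dJ by auto
    then show ?thesis
      using coord[of j] by (simp add: numeral_eq_Suc v0_def v1_def)
  qed
  have gv: "g 0 v0 = 1" "g 1 v0 = 0" "g 0 v1 = 0" "g 1 v1 = 1"
    using g(2) by (simp_all add: v0_def v1_def)
  \<comment> \<open>A perfect algebra has no one-dimensional ideals, as all proper ideals have dimension two.\<close>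
  have no_line: "u = 0" if "\<And>y. \<exists>a. y \<cdot> u = a *s u" for u
  proof (rule ccontr)
    assume "u \<noteq> 0"
    have "ideal (vec.span {u})"
      by (rule ideal_spanI) (metis that singletonD vec.span_base vec.span_scale singletonI)
    moreover have "vec.span {u} \<noteq> UNIV"
      using dim5 by (intro span_neq_UNIV) auto
    moreover have "vec.span {u} \<noteq> {0}"
      using \<open>u \<noteq> 0\<close> vec.span_base[of u "{u}"] by auto
    ultimately have "vec.dim (vec.span {u}) = 2"
      by (intro dim2)
    moreover have "vec.dim (vec.span {u}) \<le> card {u}"
      by (rule vec.dim_le_card) auto
    ultimately show False
      by simp
  qed
  have v01: "v0 \<cdot> v1 = 0"
  proof (rule no_line)
    fix y
    have JJ: "\<exists>a. j \<cdot> j' = a *s v0 \<cdot> v1" if "j \<in> J" "j' \<in> J" for j j'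
    proof -
      have "j \<cdot> j' = (g 0 j *s v0 + g 1 j *s v1) \<cdot> (g 0 j' *s v0 + g 1 j' *s v1)"
        using Jspan that by metis
      also have "\<dots> = (g 0 j * g 1 j' - g 1 j * g 0 j') *s v0 \<cdot> v1"
        using br_anti[of v1 v0] by (simp add: br_simps vec_eq_iff algebra_simps)
      finally show ?thesis by blast
    qed
    obtain a a' where "(y \<cdot> v0) \<cdot> v1 = a *s v0 \<cdot> v1" "v0 \<cdot> (y \<cdot> v1) = a' *s v0 \<cdot> v1"
      using JJ br vJ by meson
    then have "y \<cdot> (v0 \<cdot> v1) = (a + a') *s v0 \<cdot> v1"
      using br_derivation[of y v0 v1] by (simp add: vec_eq_iff algebra_simps)
    then show "\<exists>a. y \<cdot> (v0 \<cdot> v1) = a *s v0 \<cdot> v1"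
      by blast
  qed
  define \<alpha> \<beta> \<gamma> \<delta> where "\<alpha> x = g 0 (x \<cdot> v0)" and "\<beta> x = g 1 (x \<cdot> v0)"
    and "\<gamma> x = g 0 (x \<cdot> v1)" and "\<delta> x = g 1 (x \<cdot> v1)" for x
  have act: "x \<cdot> v0 = \<alpha> x *s v0 + \<beta> x *s v1" "x \<cdot> v1 = \<gamma> x *s v0 + \<delta> x *s v1" for x
    using Jspan br vJ by (simp_all add: \<alpha>_def \<beta>_def \<gamma>_def \<delta>_def)
  have forms: "form \<alpha>" "form \<beta>" "form \<gamma>" "form \<delta>"
    using form_br_left[OF g(1)[of 0]] form_br_left[OF g(1)[of 1]]
    unfolding \<alpha>_def[abs_def] \<beta>_def[abs_def] \<gamma>_def[abs_def] \<delta>_def[abs_def] by simp_all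
  note fs = form_simps[OF forms(1)] form_simps[OF forms(2)] form_simps[OF forms(3)] form_simps[OF forms(4)]
  have comm: "\<alpha> (x \<cdot> y) = \<beta> y * \<gamma> x - \<beta> x * \<gamma> y"
    "\<beta> (x \<cdot> y) = \<alpha> y * \<beta> x + \<beta> y * \<delta> x - \<alpha> x * \<beta> y - \<beta> x * \<delta> y"
    "\<gamma> (x \<cdot> y) = \<gamma> y * \<alpha> x + \<delta> y * \<gamma> x - \<gamma> x * \<alpha> y - \<delta> x * \<gamma> y"
    "\<delta> (x \<cdot> y) = \<gamma> y * \<beta> x - \<gamma> x * \<beta> y" for x y
  proof -
    have e: "(x \<cdot> y) \<cdot> v = x \<cdot> (y \<cdot> v) - y \<cdot> (x \<cdot> v)" for v
      using br_derivation[of x y v] by simp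
    have g0: "form (g 0)" "form (g 1)"
      using g(1) by simp_all
    show "\<alpha> (x \<cdot> y) = \<beta> y * \<gamma> x - \<beta> x * \<gamma> y"
      "\<beta> (x \<cdot> y) = \<alpha> y * \<beta> x + \<beta> y * \<delta> x - \<alpha> x * \<beta> y - \<beta> x * \<delta> y"
      "\<gamma> (x \<cdot> y) = \<gamma> y * \<alpha> x + \<delta> y * \<gamma> x - \<gamma> x * \<alpha> y - \<delta> x * \<gamma> y"
      "\<delta> (x \<cdot> y) = \<gamma> y * \<beta> x - \<gamma> x * \<beta> y"
      unfolding \<alpha>_def[of "x \<cdot> y"] \<beta>_def[of "x \<cdot> y"] \<gamma>_def[of "x \<cdot> y"] \<delta>_def[of "x \<cdot> y"] e
      by (simp_all add: act br_simps form_simps[OF g0(1)] form_simps[OF g0(2)] gv algebra_simps del: One_nat_def)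
  qed
  have trace: "\<delta> x = - \<alpha> x" for x
  proof -
    have "form (\<lambda>x. \<alpha> x + \<delta> x)"
      by (rule formI) (simp_all add: fs algebra_simps)
    then have "\<alpha> x + \<delta> x = 0"
      using perf[of "\<lambda>x. \<alpha> x + \<delta> x" x] comm by (simp add: algebra_simps)
    then show ?thesis
      by (simp add: eq_neg_iff_add_eq_0 add.commute)
  qed
  \<comment> \<open>The centralizer of the ideal is the ideal itself, so the quotient acts faithfully.\<close>
  define C where "C = {x. \<alpha> x = 0 \<and> \<beta> x = 0 \<and> \<gamma> x = 0}"
  have "ideal C"
    unfolding ideal_def vec.subspace_def by (auto simp: C_def fs comm trace)
  moreover have "J \<subseteq> C"
  proof
    fix j assume "j \<in> J"
    then have j: "j = g 0 j *s v0 + g 1 j *s v1"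
      by (rule Jspan)
    have "j \<cdot> v0 = 0" "j \<cdot> v1 = 0"
      using v01 br_anti[of v1 v0] by (subst j, simp add: br_simps)+
    then show "j \<in> C"
      using form_0[OF g(1)[of 0]] form_0[OF g(1)[of 1]] by (simp add: C_def \<alpha>_def \<beta>_def \<gamma>_def)
  qed
  moreover have "C \<noteq> UNIV"
  proof
    assume "C = UNIV"
    then have "\<alpha> y = 0" "\<beta> y = 0" for y
      by (auto simp: C_def)
    then have "y \<cdot> v0 = 0 *s v0" for y
      using act by simp
    then have "v0 = 0"
      using no_line by blast
    then show False
      using v_nz by simp
  qed
  moreover have "C \<noteq> {0}"
    using \<open>J \<subseteq> C\<close> vJ v_nz by auto
  ultimately have "vec.dim C = 2"
    by (intro dim2)
  then have CJ: "C = J"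
    using \<open>J \<subseteq> C\<close> \<open>ideal C\<close> sub dJ vec.subspace_dim_equal[of J C] by (auto simp: ideal_def)
  have solve: "\<exists>m. m \<notin> J \<and> h1 m = 0 \<and> h2 m = 0" if h: "form h1" "form h2" for h1 h2
  proof -
    let ?w = "\<lambda>i. w (i + 2)" and ?h = "nth [h1, h2]"
    obtain d where d: "\<exists>i<3. d i \<noteq> 0" "\<forall>j<2. (\<Sum>i<3. d i * (?h j) (?w i)) = 0"
      using homogeneous_system[of 2 3 "\<lambda>j i. (?h j) (?w i)"] by auto
    let ?m = "\<Sum>i<3. d i *s ?w i"
    have "h1 ?m = 0" "h2 ?m = 0"
      using d(2)[rule_format, of 0] d(2)[rule_format, of 1] h by (simp_all add: form_simps)
    moreover have "?m \<notin> J"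
    proof
      assume mJ: "?m \<in> J"
      have "d i = 0" if i: "i < 3" for i
      proof -
        have i5: "i + 2 < 5" using i by simp
        have "0 = g (i + 2) ?m"
          using mJ mem dJ i5 by auto
        also have "\<dots> = (\<Sum>j<3. d j * g (i + 2) (?w j))"
          using g(1)[OF i5] by (simp add: form_simps)
        also have "\<dots> = (\<Sum>j<3. d j * (if i = j then 1 else 0))"
          by (rule sum.cong) (use g(2) i5 in auto)
        also have "\<dots> = d i"
          using i by (simp add: if_distrib cong: if_cong)
        finally show ?thesis by simp
      qed
      then show False
        using d(1) by blast
    qed
    ultimately show ?thesis by blast
  qed
  obtain e where e: "\<alpha> e = 0" "\<beta> e = 0" "\<gamma> e = 1"
  proof -
    obtain m where m: "m \<notin> J" "\<alpha> m = 0" "\<beta> m = 0"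
      using solve[OF forms(1,2)] by blast
    then have "\<gamma> m \<noteq> 0"
      using CJ by (auto simp: C_def)
    then show thesis
      using m that[of "inverse (\<gamma> m) *s m"] by (simp add: fs)
  qed
  obtain f where f: "\<alpha> f = 0" "\<beta> f = 1" "\<gamma> f = 0"
  proof -
    obtain m where m: "m \<notin> J" "\<alpha> m = 0" "\<gamma> m = 0"
      using solve[OF forms(1,3)] by blast
    then have "\<beta> m \<noteq> 0"
      using CJ by (auto simp: C_def)
    then show thesis
      using m that[of "inverse (\<beta> m) *s m"] by (simp add: fs)
  qed
  define h where "h = e \<cdot> f"
  have h: "\<alpha> h = 1" "\<beta> h = 0" "\<gamma> h = 0"
    by (simp_all add: h_def comm e f trace)
  have "h \<cdot> e - 2 *s e \<in> J" "h \<cdot> f + 2 *s f \<in> J"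
    unfolding CJ[symmetric] C_def by (simp_all add: fs comm e f h trace)
  then obtain a b c d where "h \<cdot> e - 2 *s e = a *s v0 + b *s v1" "h \<cdot> f + 2 *s f = c *s v0 + d *s v1"
    using Jspan by metis
  then have he: "h \<cdot> e = 2 *s e + a *s v0 + b *s v1" and hf: "h \<cdot> f = -2 *s f + c *s v0 + d *s v1"
    by (simp_all add: vec_eq_iff algebra_simps)
  have acts: "h \<cdot> v0 = v0" "h \<cdot> v1 = - v1" "e \<cdot> v0 = 0" "e \<cdot> v1 = v0" "f \<cdot> v0 = v1" "f \<cdot> v1 = 0"
    by (simp_all add: act e f h trace vector_smult_lneg)
  have indv: "r = 0 \<and> s = 0" if "r *s v0 + s *s v1 = 0" for r s
    using arg_cong[OF that, of "g 0"] arg_cong[OF that, of "g 1"] g(1)[of 0] g(1)[of 1]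
    by (simp add: form_simps gv del: One_nat_def)
  \<comment> \<open>The Jacobi identity for \<open>e, f, h\<close>.\<close>
  have "h \<cdot> (e \<cdot> f) = 0"
    by (simp add: h_def br_self)
  then have "(h \<cdot> e) \<cdot> f + e \<cdot> (h \<cdot> f) = 0"
    using br_derivation[of h e f] by simp
  then have "d *s v0 + (- a) *s v1 = 0"
    unfolding he hf using acts br_anti[of v0 f] br_anti[of v1 f]
    by (simp add: br_simps vec_eq_iff algebra_simps)
  then have "d = 0" "a = 0"
    using indv by fastforce+
  have "indep 5 (nth [e, h, f, v0, v1])"
    unfolding indep5
  proof (intro allI impI)
    fix r s t p q
    assume eq: "r *s e + s *s h + t *s f + p *s v0 + q *s v1 = 0"
    have z: "\<alpha> v0 = 0" "\<alpha> v1 = 0" "\<beta> v0 = 0" "\<beta> v1 = 0" "\<gamma> v0 = 0" "\<gamma> v1 = 0"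
      using \<open>J \<subseteq> C\<close> vJ by (auto simp: C_def)
    have "s = 0" "t = 0" "r = 0"
      using arg_cong[OF eq, of \<alpha>] arg_cong[OF eq, of \<beta>] arg_cong[OF eq, of \<gamma>]
      by (simp_all add: fs e f h z)
    then show "r = 0 \<and> s = 0 \<and> t = 0 \<and> p = 0 \<and> q = 0"
      using eq indv by simp
  qed
  then have "ext_table e h f v0 v1 b c"
    using he hf acts v01 \<open>d = 0\<close> \<open>a = 0\<close> by (simp add: ext_table_def h_def)
  then show ?thesis by blast
qed

text \<open>
  The cocycle parameters \<open>b, c\<close> can be changed by \<open>3 v\<close> with \<open>v\<close> in the ideal. If 3 = 0, they
  form a vector of the Frobenius twist of \<open>V(1)\<close>, on which the unipotent automorphisms of
  \<open>sl(2)\<close>, the Weyl element and the scalings act.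
\<close>

lemma ext_table_split:
  assumes "ext_table e h f v0 v1 b c" "(3::'k) \<noteq> 0"
  shows "\<exists>e f. ext_table e h f v0 v1 0 0"
proof -
  note t = assms(1)[unfolded ext_table_def] and a = ext_table_eqs[OF assms(1)] ext_table_anti[OF assms(1)]
  obtain s where s: "b = 3 * s"
    using assms(2) that[of "b / 3"] by simp
  obtain r where r: "c = - (3 * r)"
    using assms(2) that[of "- c / 3"] by simp
  have "ext_table (e + s *s v1) h (f + r *s v0) v0 v1 0 0"
    unfolding ext_table_def
  proof (intro conjI)
    show "indep 5 (nth [e + s *s v1, h, f + r *s v0, v0, v1])"
      unfolding indep5
    proof (intro allI impI)
      fix p q u v w
      assume "p *s (e + s *s v1) + q *s h + u *s (f + r *s v0) + v *s v0 + w *s v1 = 0"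
      then have "p *s e + q *s h + u *s f + (v + u * r) *s v0 + (w + p * s) *s v1 = 0"
        by (simp add: vec_eq_iff algebra_simps)
      then have "p = 0 \<and> q = 0 \<and> u = 0 \<and> v + u * r = 0 \<and> w + p * s = 0"
        using t unfolding indep5 by blast
      then show "p = 0 \<and> q = 0 \<and> u = 0 \<and> v = 0 \<and> w = 0"
        by auto
    qed
  qed (simp_all add: br_simps a s r vec_eq_iff algebra_simps)
  then show ?thesis by blast
qed

lemma ext_table_nonsplit:
  assumes "ext_table e h f v0 v1 b c" "(3::'k) = 0" "b \<noteq> 0 \<or> c \<noteq> 0"
  shows "\<exists>e h f v0 v1. ext_table e h f v0 v1 1 0"
proof -
  have "\<exists>e h f v0 v1 b c. ext_table e h f v0 v1 b c \<and> b \<noteq> 0"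
  proof (cases "b = 0")
    case True
    note t = assms(1)[unfolded ext_table_def] and a = ext_table_eqs[OF assms(1)] ext_table_anti[OF assms(1)]
    have "ext_table (- f) (- h) (- e) v1 (- v0) (- c) b"
      unfolding ext_table_def
    proof (intro conjI)
      show "indep 5 (nth [- f, - h, - e, v1, - v0])"
        unfolding indep5
      proof (intro allI impI)
        fix p q u v w
        assume "p *s (- f) + q *s (- h) + u *s (- e) + v *s v1 + w *s (- v0) = 0"
        then have "(- u) *s e + (- q) *s h + (- p) *s f + (- w) *s v0 + v *s v1 = 0"
          by (simp add: vec_eq_iff algebra_simps)
        then have "- u = 0 \<and> - q = 0 \<and> - p = 0 \<and> - w = 0 \<and> v = 0"
          using t unfolding indep5 by blast
        then show "p = 0 \<and> q = 0 \<and> u = 0 \<and> v = 0 \<and> w = 0"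
          by auto
      qed
    qed (simp_all add: br_simps a vec_eq_iff algebra_simps)
    then show ?thesis
      using assms(3) True by (metis neg_equal_0_iff_equal)
  qed (use assms in blast)
  then obtain e h f v0 v1 b c where tab: "ext_table e h f v0 v1 b c" and b: "b \<noteq> 0"
    by blast
  note t = tab[unfolded ext_table_def] and a = ext_table_eqs[OF tab] ext_table_anti[OF tab]
  have "CHAR('k) = 3"
  proof -
    have "CHAR('k) dvd 3"
      using assms(2) of_nat_eq_0_iff_char_dvd[of 3, where 'a='k] by simp
    moreover have "CHAR('k) \<noteq> 1"
      by simp
    ultimately show ?thesis
      using prime_nat_iff[of 3] by auto
  qed
  then obtain s where s: "s ^ 3 = c / b"
    using finite_field_surj_power_CHAR[of "c / b"] by auto
  then have c: "c = s * s * s * b"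
    using b by (simp add: field_simps power3_eq_cube)
  define h' where "h' = h - (2 * s) *s e - (s * b) *s v1"
  define f' where "f' = f + s *s h - (s * s) *s e"
  have "ext_table e h' f' (b *s v0) (b *s (v1 + s *s v0)) 1 0"
    unfolding ext_table_def
  proof (intro conjI)
    show "indep 5 (nth [e, h', f', b *s v0, b *s (v1 + s *s v0)])"
      unfolding indep5
    proof (intro allI impI)
      fix p q u v w
      assume "p *s e + q *s h' + u *s f' + v *s (b *s v0) + w *s (b *s (v1 + s *s v0)) = 0"
      then have "(p - q * (2 * s) - u * (s * s)) *s e + (q + u * s) *s h + u *s f +
          (v * b + w * b * s) *s v0 + (w * b - q * (s * b)) *s v1 = 0"
        by (simp add: h'_def f'_def vec_eq_iff algebra_simps)
      then have "p - q * (2 * s) - u * (s * s) = 0 \<and> q + u * s = 0 \<and> u = 0 \<and>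
          v * b + w * b * s = 0 \<and> w * b - q * (s * b) = 0"
        using t unfolding indep5 by blast
      then show "p = 0 \<and> q = 0 \<and> u = 0 \<and> v = 0 \<and> w = 0"
        using b by auto
    qed
  qed (simp_all add: br_simps a h'_def f'_def c vec_eq_iff algebra_simps)
  then show ?thesis by blast
qed


section \<open>Algebras that are not perfect\<close>

definition sl2_triple :: "'k^'n \<Rightarrow> 'k^'n \<Rightarrow> 'k^'n \<Rightarrow> bool" where
  "sl2_triple e h f \<longleftrightarrow> h \<cdot> e = 2 *s e \<and> h \<cdot> f = -2 *s f \<and> e \<cdot> f = h"

definition commutes_with_triple :: "'k^'n \<Rightarrow> 'k^'n \<Rightarrow> 'k^'n \<Rightarrow> 'k^'n \<Rightarrow> bool" where
  "commutes_with_triple e h f c \<longleftrightarrow> e \<cdot> c = 0 \<and> h \<cdot> c = 0 \<and> f \<cdot> c = 0"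

lemma sl2_triple_anti:
  assumes "sl2_triple e h f"
  shows "e \<cdot> h = -2 *s e" "f \<cdot> h = 2 *s f" "f \<cdot> e = - h"
  using assms br_anti[of e h] br_anti[of f h] br_anti[of f e]
  by (simp_all add: sl2_triple_def vec_eq_iff)

text \<open>
  For a form \<open>F a\<close> on a three-dimensional algebra, \<open>F a\<close> wedge its differential is a quadratic
  form in \<open>a\<close>, and has a nontrivial zero by Chevalley and Warning. The kernel of such an \<open>F a\<close>
  is a subalgebra, a Borel subalgebra of \<open>sl(2)\<close>, from which the triple is constructed.
\<close>

lemma perfect_dim3_sl2:
  assumes sub: "vec.subspace D" and D: "vec.span (brackets D) = D" and dim: "vec.dim D = 3"
  shows "\<exists>e h f. sl2_triple e h f \<and> e \<in> D \<and> h \<in> D \<and> f \<in> D \<and> indep 3 (nth [e, h, f])"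
proof -
  have closed: "x \<cdot> y \<in> D" if "x \<in> D" "y \<in> D" for x y
  proof -
    have "x \<cdot> y \<in> vec.span (brackets D)"
      using that by (intro vec.span_base) (auto simp: brackets_def)
    then show ?thesis using D by simp
  qed
  note add = vec.subspace_add[OF sub] and scale = vec.subspace_scale[OF sub]
  obtain w g where wg: "adapted D w g"
    by (rule adapted_basis[OF sub])
  note w = adaptedD(1,2)[OF wg] and g = adaptedD(3,4)[OF wg] and coord = adaptedD(5)[OF wg]
    and mem = adaptedD(6)[OF wg]
  have wD: "w i \<in> D" if "i < 3" for i
    using that mem g(2) dim by auto
  have Dspan: "v = g 0 v *s w 0 + g 1 v *s w 1 + g 2 v *s w 2" if "v \<in> D" for v
  proof -
    have "g 3 v = 0" "g 4 v = 0"
      using that mem dim by auto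
    then show ?thesis
      using coord[of v] by (simp add: numeral_eq_Suc)
  qed
  have indD: "r = 0 \<and> s = 0 \<and> t = 0" if eq: "r *s w 0 + s *s w 1 + t *s w 2 = 0" for r s t
    using arg_cong[OF eq, of "g 0"] arg_cong[OF eq, of "g 1"] arg_cong[OF eq, of "g 2"] g(1)[of 0] g(1)[of 1] g(1)[of 2]
    by (simp add: form_simps g(2) del: One_nat_def)
  define F where "F a v = a 0 * g 0 v + a 1 * g 1 v + a 2 * g 2 v" for a :: "nat \<Rightarrow> 'k" and v
  have formF: "form (F a)" for a
    by (rule formI)
      (use g(1)[of 0] g(1)[of 1] g(1)[of 2] in \<open>simp_all add: F_def form_simps algebra_simps del: One_nat_def\<close>)
  let ?A = "\<lambda>a i j. F a (w i \<cdot> w j)"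
  have Apoly: "polyfun 3 1 (\<lambda>a. ?A a i j)" for i j
  proof -
    have "polyfun 3 1 (\<lambda>a. g k (w i \<cdot> w j) * a k)" if "k < 3" for k
      using polyfun_cmult[OF polyfun_var[OF that]] by simp
    then show ?thesis
      unfolding F_def by (intro polyfun.add) (simp_all add: mult.commute)
  qed
  let ?P = "\<lambda>a. a 0 * ?A a 1 2 - a 1 * ?A a 0 2 + a 2 * ?A a 0 1"
  have "polyfun 3 2 (\<lambda>a. a i * ?A a j k)" if "i < 3" for i j k
    using polyfun_mult[OF polyfun_var[OF that] Apoly] by (simp add: numeral_2_eq_2)
  then have "polyfun 3 2 ?P"
    by (intro polyfun.add polyfun_diff) simp_all
  then obtain a where a: "\<exists>i<3. a i \<noteq> 0" "?P a = 0"
    using chevalley_warning[of 3 2 ?P] by auto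
  note fs = form_simps[OF formF[of a]]
  have Fw: "F a (w 0) = a 0" "F a (w 1) = a 1" "F a (w 2) = a 2"
    using g(2) by (simp_all add: F_def)
  define x where "x = ?A a 1 2 *s w 0 - ?A a 0 2 *s w 1 + ?A a 0 1 *s w 2"
  have xD: "x \<in> D"
    unfolding x_def by (intro add vec.subspace_diff[OF sub] scale wD) auto
  have Fx: "F a x = 0"
    using a(2) by (simp add: x_def fs Fw mult.commute del: One_nat_def)
  have Fxw: "F a (x \<cdot> w i) = 0" if "i < 3" for i
  proof -
    have anti: "?A a j i = - ?A a i j" for i j
      using br_anti[of "w j" "w i"] by (simp add: fs)
    have "i = 0 \<or> i = 1 \<or> i = 2"
      using that by auto
    then show ?thesis
      using anti[of 1 0] anti[of 2 0] anti[of 2 1]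
      by (auto simp: x_def br_simps fs simp del: One_nat_def)
  qed
  have Fxv: "F a (x \<cdot> v) = 0" if "v \<in> D" for v
  proof -
    have "F a (x \<cdot> (g 0 v *s w 0 + g 1 v *s w 1 + g 2 v *s w 2)) = 0"
      using Fxw by (simp add: br_simps fs)
    then show ?thesis
      using Dspan[OF that] by simp
  qed
  obtain k where k: "k < 3" "a k \<noteq> 0"
    using a(1) by blast
  have Fwk: "F a (w k) = a k"
  proof -
    have "k = 0 \<or> k = 1 \<or> k = 2"
      using k by auto
    then show ?thesis
      using Fw by auto
  qed
  have kill: False if "\<And>u v. u \<in> D \<Longrightarrow> v \<in> D \<Longrightarrow> G (u \<cdot> v) = 0" "form G" "v \<in> D" "G v \<noteq> 0" for G v
  proof -
    have "v \<in> vec.span (brackets D)"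
      using that D by simp
    from form_zero_on_span[OF that(2) _ this] show False
      using that by (auto simp: brackets_def)
  qed
  have x0: "x \<noteq> 0"
  proof
    assume "x = 0"
    then have "?A a 1 2 *s w 0 + (- ?A a 0 2) *s w 1 + ?A a 0 1 *s w 2 = 0"
      by (simp add: x_def vec_eq_iff)
    then have z: "?A a 1 2 = 0" "?A a 0 2 = 0" "?A a 0 1 = 0"
      using indD by fastforce+
    have z': "?A a 2 1 = 0" "?A a 2 0 = 0" "?A a 1 0 = 0"
      using z br_anti[of "w 2" "w 1"] br_anti[of "w 2" "w 0"] br_anti[of "w 1" "w 0"] by (simp_all add: fs)
    have "F a (u \<cdot> v) = 0" if uv: "u \<in> D" "v \<in> D" for u v
    proof -
      have "F a ((g 0 u *s w 0 + g 1 u *s w 1 + g 2 u *s w 2) \<cdot> (g 0 v *s w 0 + g 1 v *s w 1 + g 2 v *s w 2)) = 0"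
        using z z' by (simp add: br_simps fs del: One_nat_def)
      then show ?thesis
        using Dspan uv by metis
    qed
    then show False
      using kill[of "F a" "w k"] formF wD k Fwk by simp
  qed
  define y where "y = inverse (a k) *s w k"
  have yD: "y \<in> D" and Fy: "F a y = 1"
    using wD k scale Fwk by (simp_all add: y_def fs)
  have "x \<notin> vec.span {0}"
    using x0 by simp
  then obtain l where l: "form l" "l x = 1"
    using form_separating[OF vec.subspace_span] by metis
  obtain u where u: "u \<in> D" "u \<noteq> 0" "F a u = 0" "l u = 0"
  proof -
    let ?h = "nth [F a, l]"
    obtain d where d: "\<exists>i<3. d i \<noteq> 0" "\<forall>j<2. (\<Sum>i<3. d i * (?h j) (w i)) = 0"
      using homogeneous_system[of 2 3 "\<lambda>j i. (?h j) (w i)"] by auto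
    have "d 0 *s w 0 + d 1 *s w 1 + d 2 *s w 2 \<noteq> 0"
    proof
      assume "d 0 *s w 0 + d 1 *s w 1 + d 2 *s w 2 = 0"
      then have "d 0 = 0 \<and> d 1 = 0 \<and> d 2 = 0"
        by (rule indD)
      then have "d i = 0" if "i < 3" for i
        using that by (auto simp: numeral_eq_Suc less_Suc_eq)
      then show False
        using d(1) by blast
    qed
    moreover have "d 0 *s w 0 + d 1 *s w 1 + d 2 *s w 2 \<in> D"
      by (intro add scale wD) auto
    moreover have "F a (d 0 *s w 0 + d 1 *s w 1 + d 2 *s w 2) = 0" "l (d 0 *s w 0 + d 1 *s w 1 + d 2 *s w 2) = 0"
      using d(2)[rule_format, of 0] d(2)[rule_format, of 1] by (simp_all add: fs form_simps[OF l(1)] numeral_eq_Suc)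
    ultimately show thesis
      using that by blast
  qed
  have ind: "indep 3 (nth [x, u, y])"
    unfolding indep3
  proof (intro allI impI)
    fix r s t assume eq: "r *s x + s *s u + t *s y = 0"
    have t: "t = 0"
      using arg_cong[OF eq, of "F a"] by (simp add: fs Fx u Fy)
    have r: "r = 0"
      using arg_cong[OF eq, of l] t by (simp add: form_simps[OF l(1)] l u)
    show "r = 0 \<and> s = 0 \<and> t = 0"
      using eq r t u by simp
  qed
  have span: "\<exists>r s t. v = r *s x + s *s u + t *s y" if vD: "v \<in> D" for v
  proof -
    have "[x, u, y] ! i \<in> D" if "i < 3" for i
    proof -
      have "i = 0 \<or> i = 1 \<or> i = 2"
        using that by auto
      then show ?thesis
        using xD u yD by (elim disjE) simp_all
    qed
    then have "vec.span (nth [x, u, y] ` {..<3}) = D"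
      using indep_spans_subspace[OF sub, of "nth [x, u, y]"] ind unfolding dim by blast
    then obtain c where "v = (\<Sum>i<3. c i *s [x, u, y] ! i)"
      using vD unfolding vec.span_family by blast
    then have "v = c 0 *s x + c 1 *s u + c 2 *s y"
      by (simp add: numeral_eq_Suc)
    then show ?thesis by blast
  qed
  have ind': "r = 0 \<and> s = 0 \<and> t = 0" if "r *s x + s *s u + t *s y = 0" for r s t
    using ind that unfolding indep3 by blast
  obtain \<gamma> \<delta> where xu: "x \<cdot> u = \<gamma> *s x + \<delta> *s u"
  proof -
    obtain r s t where rst: "x \<cdot> u = r *s x + s *s u + t *s y"
      using span closed xD u(1) by blast
    then have "t = 0"
      using Fxv[OF u(1)] by (simp add: fs Fx u Fy)
    then show thesis
      using rst that by simp
  qed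
  obtain p q where xy: "x \<cdot> y = p *s x + q *s u"
  proof -
    obtain r s t where rst: "x \<cdot> y = r *s x + s *s u + t *s y"
      using span closed xD yD by blast
    then have "t = 0"
      using Fxv[OF yD] by (simp add: fs Fx u Fy)
    then show thesis
      using rst that by simp
  qed
  obtain c d e' where uy: "u \<cdot> y = c *s x + d *s u + e' *s y"
    using span closed u(1) yD by blast
  have brD: "\<exists>r s t. v \<cdot> v' = r *s x \<cdot> u + s *s x \<cdot> y + t *s u \<cdot> y" if vD: "v \<in> D" "v' \<in> D" for v v'
  proof -
    obtain r s t r' s' t' where v: "v = r *s x + s *s u + t *s y" "v' = r' *s x + s' *s u + t' *s y"
      using span[OF vD(1)] span[OF vD(2)] by blast
    have "v \<cdot> v' = (r * s' - s * r') *s x \<cdot> u + (r * t' - t * r') *s x \<cdot> y + (s * t' - t * s') *s u \<cdot> y"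
      unfolding v using br_anti[of u x] br_anti[of y x] br_anti[of y u]
      by (simp add: br_simps vec_eq_iff algebra_simps)
    then show ?thesis by blast
  qed
  have kill3: False if G: "form G" "G (x \<cdot> u) = 0" "G (x \<cdot> y) = 0" "G (u \<cdot> y) = 0" "v \<in> D" "G v \<noteq> 0" for G v
  proof (rule kill[of G v])
    fix v v' assume "v \<in> D" "v' \<in> D"
    then obtain r s t where "v \<cdot> v' = r *s x \<cdot> u + s *s x \<cdot> y + t *s u \<cdot> y"
      using brD by blast
    then show "G (v \<cdot> v') = 0"
      using G by (simp add: form_simps)
  qed (use G in auto)
  have "e' \<noteq> 0"
    using kill3[of "F a" y] yD Fy formF by (auto simp: xu xy uy fs Fx u)
  \<comment> \<open>The Jacobi identity for \<open>x, u, y\<close>, in the coordinate of \<open>y\<close>.\<close>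
  have "F a (x \<cdot> (u \<cdot> y)) = F a ((x \<cdot> u) \<cdot> y + u \<cdot> (x \<cdot> y))"
    using br_derivation[of x u y] by (rule arg_cong)
  moreover have "F a (x \<cdot> (u \<cdot> y)) = 0"
    by (rule Fxv) (intro closed u yD)
  moreover have "F a ((x \<cdot> u) \<cdot> y + u \<cdot> (x \<cdot> y)) = \<delta> * e'"
    unfolding xu xy using br_anti[of u x] xu by (simp add: br_simps fs xy uy Fx u Fy)
  ultimately have "\<delta> = 0"
    using \<open>e' \<noteq> 0\<close> by simp
  have forms3: "\<exists>G. form G \<and> G x = r \<and> G u = s \<and> G y = t" for r s t
  proof -
    obtain G where G: "\<And>i. i < 3 \<Longrightarrow> form (G i)"
      "\<And>i j. i < 3 \<Longrightarrow> j < 3 \<Longrightarrow> G i ([x, u, y] ! j) = (if i = j then 1 else 0)"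
      using indep_dual_forms[OF ind] by blast
    have "form (\<lambda>v. r * G 0 v + s * G 1 v + t * G 2 v)"
      by (rule formI)
        (use G(1)[of 0] G(1)[of 1] G(1)[of 2] in \<open>simp_all add: form_simps algebra_simps del: One_nat_def\<close>)
    moreover have "G 0 x = 1" "G 0 u = 0" "G 0 y = 0" "G 1 x = 0" "G 1 u = 1" "G 1 y = 0"
      "G 2 x = 0" "G 2 u = 0" "G 2 y = 1"
      using G(2)[of 0 0] G(2)[of 0 1] G(2)[of 0 2] G(2)[of 1 0] G(2)[of 1 1] G(2)[of 1 2]
        G(2)[of 2 0] G(2)[of 2 1] G(2)[of 2 2] by simp_all
    ultimately show ?thesis
      by (intro exI[of _ "\<lambda>v. r * G 0 v + s * G 1 v + t * G 2 v"]) simp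
  qed
  have "\<gamma> \<noteq> 0"
  proof
    assume "\<gamma> = 0"
    then have z: "x \<cdot> u = 0"
      using xu \<open>\<delta> = 0\<close> by simp
    \<comment> \<open>A form that vanishes on the two remaining brackets.\<close>
    have "\<exists>r s t. (r \<noteq> 0 \<or> s \<noteq> 0) \<and> r * p + s * q = 0 \<and> r * c + s * d + t * e' = 0"
    proof (cases "p = 0 \<and> q = 0")
      case True
      then show ?thesis
        using \<open>e' \<noteq> 0\<close> by (intro exI[of _ 1] exI[of _ 0] exI[of _ "- c / e'"]) simp
    next
      case False
      then show ?thesis
        using \<open>e' \<noteq> 0\<close> by (intro exI[of _ q] exI[of _ "- p"] exI[of _ "(p * d - q * c) / e'"]) auto
    qed
    then obtain r s t where rst: "r \<noteq> 0 \<or> s \<noteq> 0" "r * p + s * q = 0" "r * c + s * d + t * e' = 0"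
      by blast
    obtain G where G: "form G" "G x = r" "G u = s" "G y = t"
      using forms3 by blast
    have "G (x \<cdot> u) = 0" "G (x \<cdot> y) = 0" "G (u \<cdot> y) = 0"
      using rst by (simp_all add: z xy uy form_simps[OF G(1)] G(2-4) mult.commute)
    then show False
      using kill3[OF G(1)] xD u(1) G rst(1) by metis
  qed
  have "q \<noteq> 0"
  proof
    assume "q = 0"
    obtain G where G: "form G" "G x = 0" "G u = 1" "G y = - d / e'"
      using forms3 by blast
    have "G (x \<cdot> u) = 0" "G (x \<cdot> y) = 0" "G (u \<cdot> y) = 0"
      using \<open>e' \<noteq> 0\<close> by (simp_all add: xu xy uy \<open>q = 0\<close> \<open>\<delta> = 0\<close> form_simps[OF G(1)] G(2-4))
    then show False
      using kill3[OF G(1)] u(1) G(3) by (metis zero_neq_one)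
  qed
  obtain m where m: "m * q * \<gamma> = - 2"
    using \<open>q \<noteq> 0\<close> \<open>\<gamma> \<noteq> 0\<close> that[of "- 2 / (q * \<gamma>)"] by (simp add: field_simps)
  have m0: "m \<noteq> 0"
    using m two_neq_0 by auto
  define y' where "y' = m *s y"
  define h where "h = x \<cdot> y'"
  have h_eq: "h = (m * p) *s x + (m * q) *s u"
    by (simp add: h_def y'_def br_simps xy vec_eq_iff algebra_simps)
  have xh: "x \<cdot> h = -2 *s x"
    unfolding h_eq using m by (simp add: br_simps xu \<open>\<delta> = 0\<close> vector_smult_assoc)
  have hx: "h \<cdot> x = 2 *s x"
    using br_anti[of h x] xh by (simp add: vec_eq_iff)
  have "x \<cdot> (h \<cdot> y' + 2 *s y') = 0"
    using br_derivation[of x h y'] xh by (simp add: br_simps br_self h_def[symmetric] vec_eq_iff)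
  moreover have hD: "h \<in> D" "y' \<in> D"
    using scale yD closed xD by (simp_all add: h_def y'_def)
  then have "h \<cdot> y' + 2 *s y' \<in> D"
    by (intro add closed scale)
  then obtain r s t where rst: "h \<cdot> y' + 2 *s y' = r *s x + s *s u + t *s y"
    using span by blast
  ultimately have "(s * \<gamma> + t * p) *s x + (t * q) *s u + 0 *s y = 0"
    by (simp add: br_simps xu xy \<open>\<delta> = 0\<close> vec_eq_iff algebra_simps)
  then have "s * \<gamma> + t * p = 0 \<and> t * q = 0 \<and> 0 = (0::'k)"
    by (rule ind')
  then have "t = 0" "s = 0"
    using \<open>q \<noteq> 0\<close> \<open>\<gamma> \<noteq> 0\<close> by auto
  then have "h \<cdot> y' = r *s x - 2 *s y'"
    using rst by (simp add: eq_diff_eq)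
  then have hy: "h \<cdot> y' = -2 *s y' + r *s x"
    by (simp add: vec_eq_iff)
  obtain k' where k': "r = - 4 * k'"
  proof -
    have "(4::'k) \<noteq> 0"
      using two_neq_0 by (metis mult_2 mult_eq_0_iff numeral_Bit0 numeral_plus_numeral semiring_norm(2,6))
    then show thesis
      using that[of "- r / 4"] by simp
  qed
  define f where "f = y' + k' *s x"
  have "sl2_triple x h f"
    unfolding sl2_triple_def f_def
    using hx hy h_def[symmetric] k' by (simp add: br_simps vec_eq_iff algebra_simps)
  moreover have "f \<in> D"
    unfolding f_def by (intro add scale hD xD)
  moreover have "indep 3 (nth [x, h, f])"
    unfolding indep3
  proof (intro allI impI)
    fix r s t assume "r *s x + s *s h + t *s f = 0"
    then have "(r + s * (m * p) + t * k') *s x + (s * (m * q)) *s u + (t * m) *s y = 0"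
      by (simp add: f_def h_eq y'_def vec_eq_iff algebra_simps)
    from ind'[OF this] show "r = 0 \<and> s = 0 \<and> t = 0"
      using m0 \<open>q \<noteq> 0\<close> by auto
  qed
  ultimately show ?thesis
    using xD hD by blast
qed

end

context finite_lie_bracket
begin

definition central_table :: "'k^'n \<Rightarrow> 'k^'n \<Rightarrow> 'k^'n \<Rightarrow> 'k^'n \<Rightarrow> 'k^'n \<Rightarrow> bool" where
  "central_table e h f c1 c2 \<longleftrightarrow> indep 5 (nth [e, h, f, c1, c2]) \<and> sl2_triple e h f \<and>
     commutes_with_triple e h f c1 \<and> commutes_with_triple e h f c2 \<and> c1 \<cdot> c2 = 0"

definition noncommutative_table :: "'k^'n \<Rightarrow> 'k^'n \<Rightarrow> 'k^'n \<Rightarrow> 'k^'n \<Rightarrow> 'k^'n \<Rightarrow> bool" where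
  "noncommutative_table e h f a u \<longleftrightarrow> indep 5 (nth [e, h, f, a, u]) \<and> sl2_triple e h f \<and>
     commutes_with_triple e h f a \<and> commutes_with_triple e h f u \<and> a \<cdot> u = u"

text \<open>
  All derivations of \<open>sl(2)\<close> are inner. Here \<open>ad y\<close> is one; subtracting a combination of
  \<open>ad e\<close> and \<open>ad f\<close> makes it map \<open>h\<close> to a multiple of itself, and then it is a multiple of
  \<open>ad h\<close>.
\<close>

lemma sl2_ideal_inner:
  assumes t: "sl2_triple e h f" and ind: "indep 3 (nth [e, h, f])"
    and stable: "\<exists>p q r. y \<cdot> e = p *s e + q *s h + r *s f" "\<exists>p q r. y \<cdot> h = p *s e + q *s h + r *s f"
      "\<exists>p q r. y \<cdot> f = p *s e + q *s h + r *s f"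
  shows "\<exists>p q r. commutes_with_triple e h f (y - (p *s e + q *s h + r *s f))"
proof -
  have eq: "h \<cdot> e = 2 *s e" "h \<cdot> f = -2 *s f" "e \<cdot> f = h"
    using t by (simp_all add: sl2_triple_def)
  note anti = sl2_triple_anti[OF t]
  have coeff: "p = 0 \<and> q = 0 \<and> r = 0" if "p *s e + q *s h + r *s f = 0" for p q r
    using ind that unfolding indep3 by blast
  have four: "(4::'k) \<noteq> 0"
    using two_neq_0 by (metis mult_2 mult_eq_0_iff numeral_Bit0 numeral_plus_numeral semiring_norm(2,6))
  obtain p q r where yh: "y \<cdot> h = p *s e + q *s h + r *s f"
    using stable by blast
  obtain p' where p': "p = - 2 * p'"
    using two_neq_0 that[of "- p / 2"] by simp
  obtain r' where r': "r = 2 * r'"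
    using two_neq_0 that[of "r / 2"] by simp
  define z where "z = y - (p' *s e + r' *s f)"
  have zh: "z \<cdot> h = q *s h"
    by (simp add: z_def br_simps yh anti p' r' vec_eq_iff algebra_simps)
  obtain a b c where ze: "z \<cdot> e = a *s e + b *s h + c *s f"
  proof -
    obtain a b c where "y \<cdot> e = a *s e + b *s h + c *s f"
      using stable by blast
    then have "z \<cdot> e = a *s e + (b + r') *s h + c *s f"
      by (simp add: z_def br_simps anti vec_eq_iff algebra_simps)
    then show thesis by (rule that)
  qed
  obtain a' b' c' where zf: "z \<cdot> f = a' *s e + b' *s h + c' *s f"
  proof -
    obtain a b c where "y \<cdot> f = a *s e + b *s h + c *s f"
      using stable by blast
    then have "z \<cdot> f = a *s e + (b - p') *s h + c *s f"
      by (simp add: z_def br_simps eq vec_eq_iff algebra_simps)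
    then show thesis by (rule that)
  qed
  have "z \<cdot> (h \<cdot> e) = (z \<cdot> h) \<cdot> e + h \<cdot> (z \<cdot> e)"
    by (rule br_derivation)
  then have "(2 * q) *s e + (- 2 * b) *s h + (- 4 * c) *s f = 0"
    unfolding eq zh ze br_scale_right by (simp add: br_simps eq vec_eq_iff algebra_simps)
  from coeff[OF this] have "q = 0" "b = 0" "c = 0"
    using two_neq_0 four by simp_all
  have "z \<cdot> (h \<cdot> f) = (z \<cdot> h) \<cdot> f + h \<cdot> (z \<cdot> f)"
    by (rule br_derivation)
  then have "(4 * a') *s e + (2 * b') *s h + (- 2 * q) *s f = 0"
    unfolding eq zh zf br_scale_right by (simp add: br_simps eq vec_eq_iff algebra_simps)
  from coeff[OF this] have "a' = 0" "b' = 0"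
    using two_neq_0 four by simp_all
  have "z \<cdot> (e \<cdot> f) = (z \<cdot> e) \<cdot> f + e \<cdot> (z \<cdot> f)"
    by (rule br_derivation)
  then have "0 *s e + (a + c') *s h + 0 *s f = 0"
    unfolding eq zh ze zf using \<open>q = 0\<close> \<open>b = 0\<close> \<open>c = 0\<close> \<open>a' = 0\<close> \<open>b' = 0\<close>
    by (simp add: br_simps eq vec_eq_iff algebra_simps)
  from coeff[OF this] have "c' = - a"
    by (simp add: eq_neg_iff_add_eq_0 add.commute)
  obtain s where s: "a = 2 * s"
    using two_neq_0 that[of "a / 2"] by simp
  define v where "v = y - (p' *s e + s *s h + r' *s f)"
  have v: "v = z - s *s h"
    by (simp add: v_def z_def vec_eq_iff)
  have "v \<cdot> e = 0" "v \<cdot> h = 0" "v \<cdot> f = 0"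
    unfolding v using ze zh zf s \<open>q = 0\<close> \<open>b = 0\<close> \<open>c = 0\<close> \<open>a' = 0\<close> \<open>b' = 0\<close> \<open>c' = - a\<close>
    by (simp_all add: br_simps eq vec_eq_iff algebra_simps)
  then have "commutes_with_triple e h f v"
    using br_anti[of e v] br_anti[of h v] br_anti[of f v] by (simp add: commutes_with_triple_def)
  then show ?thesis
    unfolding v_def by blast
qed

text \<open>
  As the derivations of \<open>D\<close> are inner, \<open>L\<close> is the direct sum of \<open>D\<close> and its centralizer, which
  has dimension two: it is abelian or has a basis \<open>a, u\<close> with \<open>a \<cdot> u = u\<close>.
\<close>

lemma sl2_ideal_imp_table:
  assumes "ideal D" and dim: "vec.dim D = 3" and t: "sl2_triple e h f"
    and D: "e \<in> D" "h \<in> D" "f \<in> D" and ind: "indep 3 (nth [e, h, f])"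
  shows "(\<exists>c1 c2. central_table e h f c1 c2) \<or> (\<exists>a u. noncommutative_table e h f a u)"
proof -
  have sub: "vec.subspace D" and br: "\<And>x y. y \<in> D \<Longrightarrow> x \<cdot> y \<in> D"
    using assms(1) by (auto simp: ideal_def)
  have span: "\<exists>p q r. v = p *s e + q *s h + r *s f" if vD: "v \<in> D" for v
  proof -
    have "[e, h, f] ! i \<in> D" if "i < 3" for i
    proof -
      have "i = 0 \<or> i = 1 \<or> i = 2"
        using that by auto
      then show ?thesis
        using D by (elim disjE) simp_all
    qed
    then have "vec.span (nth [e, h, f] ` {..<3}) = D"
      using indep_spans_subspace[OF sub, of "nth [e, h, f]"] ind unfolding dim by blast
    then obtain c where "v = (\<Sum>i<3. c i *s [e, h, f] ! i)"
      using vD unfolding vec.span_family by blast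
    then have "v = c 0 *s e + c 1 *s h + c 2 *s f"
      by (simp add: numeral_eq_Suc)
    then show ?thesis by blast
  qed
  have eq: "h \<cdot> e = 2 *s e" "h \<cdot> f = -2 *s f" "e \<cdot> f = h"
    using t by (simp_all add: sl2_triple_def)
  note anti = sl2_triple_anti[OF t]
  have inner: "\<exists>p q r. commutes_with_triple e h f (y - (p *s e + q *s h + r *s f))" for y
    by (rule sl2_ideal_inner[OF t ind]) (intro span br D)+
  obtain y1 y2 where y: "indep 5 (nth [e, h, f, y1, y2])"
  proof -
    have "indep (length [e, h, f]) (nth [e, h, f])"
      using ind by (simp add: numeral_eq_Suc)
    from indep_snoc[OF this] obtain w1 where "indep (Suc (length [e, h, f])) (nth ([e, h, f] @ [w1]))"
      using dim5 by auto
    then have "indep (length [e, h, f, w1]) (nth [e, h, f, w1])"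
      by simp
    from indep_snoc[OF this] obtain w2 where "indep (Suc (length [e, h, f, w1])) (nth ([e, h, f, w1] @ [w2]))"
      using dim5 by auto
    then have "indep 5 (nth [e, h, f, w1, w2])"
      by (simp add: numeral_eq_Suc)
    then show thesis
      using that by blast
  qed
  obtain p1 q1 r1 where 1: "commutes_with_triple e h f (y1 - (p1 *s e + q1 *s h + r1 *s f))"
    using inner by blast
  obtain p2 q2 r2 where 2: "commutes_with_triple e h f (y2 - (p2 *s e + q2 *s h + r2 *s f))"
    using inner by blast
  define c1 where "c1 = y1 - (p1 *s e + q1 *s h + r1 *s f)"
  define c2 where "c2 = y2 - (p2 *s e + q2 *s h + r2 *s f)"
  have c: "commutes_with_triple e h f c1" "commutes_with_triple e h f c2"
    using 1 2 by (simp_all add: c1_def c2_def)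
  have ind5: "indep 5 (nth [e, h, f, c1, c2])"
    unfolding indep5
  proof (intro allI impI)
    fix r s t u v
    assume "r *s e + s *s h + t *s f + u *s c1 + v *s c2 = 0"
    then have "(r - u * p1 - v * p2) *s e + (s - u * q1 - v * q2) *s h + (t - u * r1 - v * r2) *s f
        + u *s y1 + v *s y2 = 0"
      by (simp add: c1_def c2_def vec_eq_iff algebra_simps)
    then have "r - u * p1 - v * p2 = 0 \<and> s - u * q1 - v * q2 = 0 \<and> t - u * r1 - v * r2 = 0 \<and> u = 0 \<and> v = 0"
      using y unfolding indep5 by blast
    then show "r = 0 \<and> s = 0 \<and> t = 0 \<and> u = 0 \<and> v = 0"
      by auto
  qed
  obtain p q r s s' where cc: "c1 \<cdot> c2 = p *s e + q *s h + r *s f + s *s c1 + s' *s c2"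
    using indep5_coordinates[OF dim5 ind5] by blast
  have c0: "e \<cdot> c1 = 0" "h \<cdot> c1 = 0" "e \<cdot> c2 = 0" "h \<cdot> c2 = 0"
    using c by (simp_all add: commutes_with_triple_def)
  have "e \<cdot> (c1 \<cdot> c2) = 0" "h \<cdot> (c1 \<cdot> c2) = 0"
    using br_derivation[of e c1 c2] br_derivation[of h c1 c2] by (simp_all add: c0 br_simps)
  then have "(- 2 * q) *s e + r *s h + 0 *s f + 0 *s c1 + 0 *s c2 = 0"
    "(2 * p) *s e + 0 *s h + (- 2 * r) *s f + 0 *s c1 + 0 *s c2 = 0"
    unfolding cc by (simp_all add: br_simps c0 eq anti vec_eq_iff algebra_simps)
  then have "- 2 * q = 0 \<and> r = 0" "2 * p = 0 \<and> - 2 * r = 0"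
    using ind5 unfolding indep5 by blast+
  then have cc': "c1 \<cdot> c2 = s *s c1 + s' *s c2"
    using two_neq_0 cc by simp
  have cs: "commutes_with_triple e h f (k *s c1 + k' *s c2)" for k k'
    using c by (simp add: commutes_with_triple_def br_simps)
  consider "s = 0" "s' = 0" | "s' \<noteq> 0" | "s \<noteq> 0"
    by blast
  then show ?thesis
  proof cases
    case 1
    then have "central_table e h f c1 c2"
      using cc' ind5 t c by (simp add: central_table_def)
    then show ?thesis by blast
  next
    case 2
    have "noncommutative_table e h f (inverse s' *s c1) (c1 \<cdot> c2)"
      unfolding noncommutative_table_def
    proof (intro conjI)
      show "indep 5 (nth [e, h, f, inverse s' *s c1, c1 \<cdot> c2])"
        unfolding indep5
      proof (intro allI impI)
        fix p q r u v
        assume "p *s e + q *s h + r *s f + u *s (inverse s' *s c1) + v *s c1 \<cdot> c2 = 0"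
        then have "p *s e + q *s h + r *s f + (u * inverse s' + v * s) *s c1 + (v * s') *s c2 = 0"
          by (simp add: cc' vec_eq_iff algebra_simps)
        then have "p = 0 \<and> q = 0 \<and> r = 0 \<and> u * inverse s' + v * s = 0 \<and> v * s' = 0"
          using ind5 unfolding indep5 by blast
        then show "p = 0 \<and> q = 0 \<and> r = 0 \<and> u = 0 \<and> v = 0"
          using 2 by auto
      qed
      show "commutes_with_triple e h f (inverse s' *s c1)"
        using cs[of "inverse s'" 0] by simp
      show "commutes_with_triple e h f (c1 \<cdot> c2)"
        unfolding cc' by (rule cs)
      have "c1 \<cdot> (c1 \<cdot> c2) = s' *s c1 \<cdot> c2"
        by (subst cc') (simp add: br_simps)
      show "(inverse s' *s c1) \<cdot> (c1 \<cdot> c2) = c1 \<cdot> c2"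
        using \<open>c1 \<cdot> (c1 \<cdot> c2) = s' *s c1 \<cdot> c2\<close> 2 by (simp add: br_simps vector_smult_assoc)
    qed (rule t)
    then show ?thesis by blast
  next
    case 3
    have "noncommutative_table e h f ((- inverse s) *s c2) (c1 \<cdot> c2)"
      unfolding noncommutative_table_def
    proof (intro conjI)
      show "indep 5 (nth [e, h, f, (- inverse s) *s c2, c1 \<cdot> c2])"
        unfolding indep5
      proof (intro allI impI)
        fix p q r u v
        assume "p *s e + q *s h + r *s f + u *s ((- inverse s) *s c2) + v *s c1 \<cdot> c2 = 0"
        then have "p *s e + q *s h + r *s f + (v * s) *s c1 + (v * s' - u * inverse s) *s c2 = 0"
          by (simp add: cc' vec_eq_iff algebra_simps)
        then have "p = 0 \<and> q = 0 \<and> r = 0 \<and> v * s = 0 \<and> v * s' - u * inverse s = 0"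
          using ind5 unfolding indep5 by blast
        then show "p = 0 \<and> q = 0 \<and> r = 0 \<and> u = 0 \<and> v = 0"
          using 3 by auto
      qed
      show "commutes_with_triple e h f ((- inverse s) *s c2)"
        using cs[of 0 "- inverse s"] by simp
      show "commutes_with_triple e h f (c1 \<cdot> c2)"
        unfolding cc' by (rule cs)
      have "c2 \<cdot> (c1 \<cdot> c2) = (- s) *s c1 \<cdot> c2"
        using br_anti[of c2 c1] by (subst cc') (simp add: br_simps vector_smult_lneg)
      then show "((- inverse s) *s c2) \<cdot> (c1 \<cdot> c2) = c1 \<cdot> c2"
        using 3 by (simp add: br_simps vector_smult_assoc)
    qed (rule t)
    then show ?thesis by blast
  qed
qed

text \<open>
  An ideal \<open>D\<close> of dimension three is \<open>sl(2)\<close> and has a centralizer as complement. If \<open>D\<close> is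
  everything, the algebra is either simple or an extension of \<open>sl(2)\<close>, whose parameters can be
  normalized to \<open>0, 0\<close> or, only if 3 = 0, to \<open>1, 0\<close>.
\<close>

theorem classification_by_tables:
  assumes "ideal D" "D \<noteq> {0}" "vec.span (brackets D) = D"
  shows "((5::'k) = 0 \<and> (\<exists>x h e1 e2 e3. witt_table x h e1 e2 e3)) \<or>
    (\<exists>e h f c1 c2. central_table e h f c1 c2) \<or>
    (\<exists>e h f a u. noncommutative_table e h f a u) \<or>
    (\<exists>e h f v0 v1. ext_table e h f v0 v1 0 0) \<or>
    ((3::'k) = 0 \<and> (\<exists>e h f v0 v1. ext_table e h f v0 v1 1 0))"
proof -
  have sub: "vec.subspace D"
    using assms(1) by (simp add: ideal_def)
  consider "vec.dim D = 3" | "D = UNIV"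
    using perfect_subspace_dim[OF sub assms(3,2)] by blast
  then show ?thesis
  proof cases
    case 1
    obtain e h f where "sl2_triple e h f" "e \<in> D" "h \<in> D" "f \<in> D" "indep 3 (nth [e, h, f])"
      using perfect_dim3_sl2[OF sub assms(3) 1] by blast
    from sl2_ideal_imp_table[OF assms(1) 1 this] show ?thesis
      by blast
  next
    case 2
    have perfect
      unfolding perfect_def
    proof (intro allI impI)
      fix g v assume g: "form g" "\<forall>x y. g (x \<cdot> y) = 0"
      show "g v = 0"
        by (rule form_zero_on_span[OF g(1), of "brackets D"]) (use g assms(3) 2 in \<open>auto simp: brackets_def\<close>)
    qed
    show ?thesis
    proof (cases simple)
      case True
      then show ?thesis
        using simple_imp_witt \<open>perfect\<close> by blast
    next
      case False
      then obtain e h f v0 v1 b c where tab: "ext_table e h f v0 v1 b c"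
        using perfect_not_simple_imp_ext \<open>perfect\<close> by blast
      show ?thesis
      proof (cases "(3::'k) = 0")
        case three: True
        show ?thesis
        proof (cases "b = 0 \<and> c = 0")
          case True
          then show ?thesis
            using tab by blast
        next
          case False
          then have "\<exists>e h f v0 v1. ext_table e h f v0 v1 1 0"
            using ext_table_nonsplit[OF tab three] by blast
          then show ?thesis
            using three by simp
        qed
      next
        case False
        then have "\<exists>e f. ext_table e h f v0 v1 0 0"
          by (rule ext_table_split[OF tab])
        then show ?thesis by blast
      qed
    qed
  qed
qed

end

section \<open>The five types exclude each other\<close>

context finite_lie_bracket
begin

lemma four_neq_0: "(4::'k) \<noteq> 0"
  using two_neq_0 by (metis mult_2 mult_eq_0_iff numeral_Bit0 numeral_plus_numeral semiring_norm(2,6))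

lemma span_pair: "vec.span {a, b} = {s *s a + t *s b | s t. True}" for a b :: "'k^'n"
proof -
  have "w \<in> vec.span {a, b} \<longleftrightarrow> (\<exists>s t. w = s *s a + t *s b)" for w
    by (simp add: vec.span_breakdown_eq[of _ a] vec.span_breakdown_eq[of _ b] vec.span_empty
      diff_eq_eq add.commute)
  then show ?thesis by blast
qed

definition abelian_ideal :: "('k^'n) set \<Rightarrow> bool" where
  "abelian_ideal J \<longleftrightarrow> ideal J \<and> (\<forall>x\<in>J. \<forall>y\<in>J. x \<cdot> y = 0)"

lemma abelian_ideal_span_pair:
  assumes "\<And>x. x \<cdot> a \<in> vec.span {a, b}" "\<And>x. x \<cdot> b \<in> vec.span {a, b}" "a \<cdot> b = 0"
  shows "abelian_ideal (vec.span {a, b})"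
proof -
  have "ideal (vec.span {a, b})"
    using assms by (intro ideal_spanI) auto
  moreover have "x \<cdot> y = 0" if xJ: "x \<in> vec.span {a, b}" and yJ: "y \<in> vec.span {a, b}" for x y
  proof -
    have "b \<cdot> a = 0"
      using assms(3) br_anti[of b a] by simp
    with xJ yJ assms(3) show ?thesis
      unfolding span_pair by (auto simp: br_simps)
  qed
  ultimately show ?thesis
    by (simp add: abelian_ideal_def)
qed

text \<open>
  A nonzero ideal contains \<open>x\<close>, because \<open>ad x\<close> acts as a single Jordan block with image of its
  fourth power \<open>k x\<close>. It then contains \<open>h\<close>, which does not commute with \<open>x\<close>.
\<close>

lemma witt_table_no_abelian_ideal:
  assumes t: "witt_table x h e1 e2 e3" and J: "abelian_ideal J"
  shows "J = {0}"
proof (rule ccontr)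
  assume "J \<noteq> {0}"
  have sub: "vec.subspace J" and ideal: "\<And>z y. y \<in> J \<Longrightarrow> z \<cdot> y \<in> J"
    and abelian: "\<And>z y. z \<in> J \<Longrightarrow> y \<in> J \<Longrightarrow> z \<cdot> y = 0"
    using J by (auto simp: abelian_ideal_def ideal_def)
  obtain y where "y \<in> J" "y \<noteq> 0"
    using \<open>J \<noteq> {0}\<close> vec.subspace_0[OF sub] by blast
  have ind: "indep 5 (nth [x, h, e1, e2, e3])" and eq: "x \<cdot> h = x" "x \<cdot> e1 = h" "x \<cdot> e2 = e1" "x \<cdot> e3 = e2"
    using t by (auto simp: witt_table_def)
  obtain p q r s u where y: "y = p *s x + q *s h + r *s e1 + s *s e2 + u *s e3"
    using indep5_coordinates[OF dim5 ind] by blast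
  \<comment> \<open>The operator \<open>ad x\<close> shifts the coordinates of \<open>y\<close> down, so that its last nonzero iterate is
    a multiple of \<open>x\<close>.\<close>
  have 1: "x \<cdot> y = q *s x + r *s h + s *s e1 + u *s e2"
    by (simp add: y br_simps eq)
  have 2: "x \<cdot> (x \<cdot> y) = r *s x + s *s h + u *s e1"
    by (simp add: 1 br_simps eq)
  have 3: "x \<cdot> (x \<cdot> (x \<cdot> y)) = s *s x + u *s h"
    by (simp add: 2 br_simps eq)
  have 4: "x \<cdot> (x \<cdot> (x \<cdot> (x \<cdot> y))) = u *s x"
    by (simp add: 3 br_simps eq)
  have "\<exists>c. c \<noteq> 0 \<and> c *s x \<in> J"
  proof (rule ccontr)
    assume no: "\<nexists>c. c \<noteq> 0 \<and> c *s x \<in> J"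
    have "u = 0"
      using no ideal[OF ideal[OF ideal[OF ideal[OF \<open>y \<in> J\<close>, of x], of x], of x], of x] unfolding 4 by blast
    have "s = 0"
      using no ideal[OF ideal[OF ideal[OF \<open>y \<in> J\<close>, of x], of x], of x] unfolding 3 \<open>u = 0\<close> by auto
    have "r = 0"
      using no ideal[OF ideal[OF \<open>y \<in> J\<close>, of x], of x] unfolding 2 \<open>u = 0\<close> \<open>s = 0\<close> by auto
    have "q = 0"
      using no ideal[OF \<open>y \<in> J\<close>, of x] unfolding 1 \<open>u = 0\<close> \<open>s = 0\<close> \<open>r = 0\<close> by auto
    show False
      using no \<open>y \<in> J\<close> \<open>y \<noteq> 0\<close> unfolding y \<open>u = 0\<close> \<open>s = 0\<close> \<open>r = 0\<close> \<open>q = 0\<close> by auto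
  qed
  then obtain c where c: "c \<noteq> 0" "c *s x \<in> J"
    by blast
  have xJ: "x \<in> J"
    using vec.subspace_scale[OF sub c(2), of "inverse c"] c(1) by simp
  have "- h \<in> J"
    using ideal[OF xJ, of e1] br_anti[of e1 x] eq by simp
  then have "x \<cdot> (- h) = 0"
    using xJ by (rule abelian[rotated])
  then have "x = 0"
    by (simp add: br_simps eq)
  then have "1 *s x + 0 *s h + 0 *s e1 + 0 *s e2 + 0 *s e3 = 0"
    by simp
  then show False
    using ind unfolding indep5 by (metis zero_neq_one)
qed

lemma ext_table_abelian_ideal:
  assumes t: "ext_table e h f v0 v1 b c"
  shows "abelian_ideal (vec.span {v0, v1})" "vec.span {v0, v1} \<noteq> {0}"
proof -
  note eqs = ext_table_eqs[OF t] ext_table_anti[OF t]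
  have ind: "indep 5 (nth [e, h, f, v0, v1])"
    using t by (simp add: ext_table_def)
  show "abelian_ideal (vec.span {v0, v1})"
  proof (rule abelian_ideal_span_pair)
    fix x
    obtain p q r s u where x: "x = p *s e + q *s h + r *s f + s *s v0 + u *s v1"
      using indep5_coordinates[OF dim5 ind] by blast
    have "x \<cdot> v0 = q *s v0 + r *s v1" "x \<cdot> v1 = p *s v0 + (- q) *s v1"
      by (simp_all add: x br_simps eqs vec_eq_iff)
    then show "x \<cdot> v0 \<in> vec.span {v0, v1}" "x \<cdot> v1 \<in> vec.span {v0, v1}"
      unfolding span_pair by blast+
  qed (rule eqs)
  show "vec.span {v0, v1} \<noteq> {0}"
  proof
    assume "vec.span {v0, v1} = {0}"
    then have "v0 = 0"
      using vec.span_base[of v0 "{v0, v1}"] by auto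
    then have "0 *s e + 0 *s h + 0 *s f + 1 *s v0 + 0 *s v1 = 0"
      by simp
    then show False
      using ind unfolding indep5 by (metis zero_neq_one)
  qed
qed

text \<open>
  If \<open>x\<close> belongs to an abelian ideal then \<open>(ad x)\<^sup>2 = 0\<close>. No nonzero element of \<open>sl(2)\<close> has
  this property, so \<open>x\<close> is mapped to zero by the projection to \<open>sl(2)\<close>.
\<close>

lemma ext_table_abelian_ideal_subset:
  assumes t: "ext_table e h f v0 v1 b c" and J: "abelian_ideal J"
  shows "J \<subseteq> vec.span {v0, v1}"
proof
  fix x assume "x \<in> J"
  note eqs = ext_table_eqs[OF t] ext_table_anti[OF t]
  have ind: "indep 5 (nth [e, h, f, v0, v1])"
    using t by (simp add: ext_table_def)
  have square: "x \<cdot> (x \<cdot> y) = 0" for y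
  proof -
    have "y \<cdot> x \<in> J"
      using \<open>x \<in> J\<close> J by (auto simp: abelian_ideal_def ideal_def)
    then have "x \<cdot> (y \<cdot> x) = 0"
      using \<open>x \<in> J\<close> J by (auto simp: abelian_ideal_def)
    then show ?thesis
      using br_anti[of x y] by (simp add: br_simps)
  qed
  obtain p q r s u where x: "x = p *s e + q *s h + r *s f + s *s v0 + u *s v1"
    using indep5_coordinates[OF dim5 ind] by blast
  obtain g where g: "\<And>i. i < 5 \<Longrightarrow> form (g i)"
    "\<And>i j. i < 5 \<Longrightarrow> j < 5 \<Longrightarrow> g i ([e, h, f, v0, v1] ! j) = (if i = j then 1 else 0)"
    using indep_dual_forms[OF ind] by blast
  define ge where "ge = g 0"
  define gf where "gf = g 2"
  have forms: "form ge" "form gf"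
    using g(1) by (simp_all add: ge_def gf_def)
  have ge: "ge e = 1" "ge h = 0" "ge f = 0" "ge v0 = 0" "ge v1 = 0"
    using g(2)[of 0 0] g(2)[of 0 1] g(2)[of 0 2] g(2)[of 0 3] g(2)[of 0 4] by (simp_all add: ge_def)
  have gf: "gf e = 0" "gf h = 0" "gf f = 1" "gf v0 = 0" "gf v1 = 0"
    using g(2)[of 2 0] g(2)[of 2 1] g(2)[of 2 2] g(2)[of 2 3] g(2)[of 2 4] by (simp_all add: gf_def)
  note simps = br_simps eqs forms[THEN form_add] forms[THEN form_scale] forms[THEN form_diff]
    forms[THEN form_minus] forms[THEN form_0] ge gf
  have "gf (x \<cdot> (x \<cdot> e)) = - 2 * (r * r)"
    by ((simp add: x simps)?, (simp add: algebra_simps)?)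
  then have "r = 0"
    using two_neq_0 by (simp add: square form_0[OF forms(2)])
  have "ge (x \<cdot> (x \<cdot> e)) = 4 * (q * q)"
    by ((simp add: x simps \<open>r = 0\<close>)?, (simp add: algebra_simps)?)
  then have "q = 0"
    using four_neq_0 by (simp add: square form_0[OF forms(1)])
  have "ge (x \<cdot> (x \<cdot> f)) = - 2 * (p * p)"
    by ((simp add: x simps \<open>r = 0\<close> \<open>q = 0\<close>)?, (simp add: algebra_simps)?)
  then have "p = 0"
    using two_neq_0 by (simp add: square form_0[OF forms(1)])
  show "x \<in> vec.span {v0, v1}"
    unfolding span_pair x \<open>p = 0\<close> \<open>q = 0\<close> \<open>r = 0\<close> by auto
qed

text \<open>
  A change of the representatives \<open>h\<close>, \<open>e\<close> by elements of \<open>kv\<^sub>0 + kv\<^sub>1\<close> changes the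
  coefficient of \<open>v\<^sub>1\<close> in \<open>h \<cdot> e - 2 e\<close> by a multiple of 3.
\<close>

lemma nonsplit_ext_table:
  assumes t: "ext_table e h f v0 v1 1 0" and three: "(3::'k) = 0"
    and r: "r \<in> vec.span {v0, v1}" "r' \<in> vec.span {v0, v1}"
  shows "(h + r') \<cdot> (e + r) \<noteq> 2 *s (e + r)"
proof
  assume eq: "(h + r') \<cdot> (e + r) = 2 *s (e + r)"
  note eqs = ext_table_eqs[OF t] ext_table_anti[OF t]
  have ind: "indep 5 (nth [e, h, f, v0, v1])"
    using t by (simp add: ext_table_def)
  obtain s t s' t' where rs: "r = s *s v0 + t *s v1" "r' = s' *s v0 + t' *s v1"
    using r unfolding span_pair by blast
  have "0 *s e + 0 *s h + 0 *s f + (- s - t') *s v0 + (1 - 3 * t) *s v1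
      = (h + r') \<cdot> (e + r) - 2 *s (e + r)"
    by (simp add: rs br_simps eqs vec_eq_iff algebra_simps)
  also have "\<dots> = 0"
    using eq by simp
  finally have "1 - 3 * t = 0"
    using ind unfolding indep5 by blast
  then show False
    by (simp add: three)
qed

text \<open>
  The plane \<open>V\<close> is the largest abelian ideal, hence the same in both tables. The first table
  provides a subalgebra complement of \<open>V\<close>; the components of \<open>H\<close> and \<open>E\<close> in it would satisfy
  the relation that the preceding lemma excludes.
\<close>

lemma split_nonsplit_ext_table:
  assumes t: "ext_table e h f v0 v1 0 0" and T: "ext_table E H F w0 w1 1 0" and three: "(3::'k) = 0"
  shows False
proof -
  define V where "V = vec.span {v0, v1}"
  have V: "V = vec.span {w0, w1}"
    using ext_table_abelian_ideal(1)[OF t] ext_table_abelian_ideal(1)[OF T]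
      ext_table_abelian_ideal_subset[OF t] ext_table_abelian_ideal_subset[OF T]
    unfolding V_def by (meson equalityI)
  have sub: "vec.subspace V"
    by (simp add: V_def vec.subspace_span)
  have ideal: "x \<cdot> y \<in> V" "y \<cdot> x \<in> V" if yV: "y \<in> V" for x y
  proof -
    show "x \<cdot> y \<in> V"
      using yV ext_table_abelian_ideal(1)[OF t] by (auto simp: abelian_ideal_def ideal_def V_def)
    then show "y \<cdot> x \<in> V"
      using br_anti[of y x] vec.subspace_neg[OF sub] by simp
  qed
  note eqs = ext_table_eqs[OF t] ext_table_anti[OF t]
  have ind: "indep 5 (nth [e, h, f, v0, v1])"
    using t by (simp add: ext_table_def)
  define P where "P = {p *s e + q *s h + r *s f | p q r. True}"
  have decomposition: "\<exists>y\<in>P. x - y \<in> V" for x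
  proof -
    obtain p q r s u where x: "x = p *s e + q *s h + r *s f + s *s v0 + u *s v1"
      using indep5_coordinates[OF dim5 ind] by blast
    have "x - (p *s e + q *s h + r *s f) = s *s v0 + u *s v1"
      by (simp add: x)
    then show ?thesis
      unfolding P_def V_def span_pair by blast
  qed
  have direct: "x = 0" if xP: "x \<in> P" and xV: "x \<in> V" for x
  proof -
    obtain p q r where x: "x = p *s e + q *s h + r *s f"
      using xP by (auto simp: P_def)
    obtain s u where x': "x = s *s v0 + u *s v1"
      using xV by (auto simp: V_def span_pair)
    have "p *s e + q *s h + r *s f + (- s) *s v0 + (- u) *s v1
        = (p *s e + q *s h + r *s f) - (s *s v0 + u *s v1)"
      by (simp add: vec_eq_iff)
    also have "\<dots> = 0"
      using x x' by simp
    finally have "p *s e + q *s h + r *s f + (- s) *s v0 + (- u) *s v1 = 0" .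
    then have "p = 0 \<and> q = 0 \<and> r = 0"
      using ind unfolding indep5 by blast
    then show ?thesis
      by (simp add: x)
  qed
  obtain h' where h': "h' \<in> P" "H - h' \<in> V"
    using decomposition by blast
  obtain e' where e': "e' \<in> P" "E - e' \<in> V"
    using decomposition by blast
  have "h' \<cdot> e' - 2 *s e' \<in> P"
  proof -
    obtain p q r p' q' r' where eh: "h' = p *s e + q *s h + r *s f" "e' = p' *s e + q' *s h + r' *s f"
      using h'(1) e'(1) by (auto simp: P_def)
    have "h' \<cdot> e' - 2 *s e' = (2 * (q * p') - 2 * (p * q') - 2 * p') *s e + (p * r' - r * p' - 2 * q') *s h
        + (2 * (r * q') - 2 * (q * r') - 2 * r') *s f"
      by (simp add: eh br_simps eqs vec_eq_iff algebra_simps)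
    then show ?thesis
      unfolding P_def by blast
  qed
  moreover have "h' \<cdot> e' - 2 *s e' \<in> V"
  proof -
    have "w1 \<in> V"
      by (simp add: V vec.span_base)
    have "h' \<cdot> e' - 2 *s e' = w1 + 2 *s (E - e') - (H - h') \<cdot> E - h' \<cdot> (E - e')"
      using ext_table_eqs(1)[OF T] by (simp add: br_simps vec_eq_iff algebra_simps)
    also have "\<dots> \<in> V"
      by (rule vec.subspace_diff[OF sub vec.subspace_diff[OF sub
        vec.subspace_add[OF sub \<open>w1 \<in> V\<close> vec.subspace_scale[OF sub e'(2)]] ideal(2)[OF h'(2)]] ideal(1)[OF e'(2)]])
    finally show ?thesis .
  qed
  ultimately have "h' \<cdot> e' = 2 *s e'"
    using direct by fastforce
  then have "(H + (h' - H)) \<cdot> (E + (e' - E)) = 2 *s (E + (e' - E))"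
    by simp
  moreover have "h' - H \<in> V" "e' - E \<in> V"
    using h'(2) e'(2) vec.subspace_neg[OF sub] by fastforce+
  ultimately show False
    using nonsplit_ext_table[OF T three] unfolding V by blast
qed

lemma ext_table_perfect:
  assumes t: "ext_table e h f v0 v1 b c"
  shows perfect
  unfolding perfect_def
proof (intro allI impI)
  fix g x
  assume g: "form g" "\<forall>x y. g (x \<cdot> y) = 0"
  note eqs = ext_table_eqs[OF t]
  have ind: "indep 5 (nth [e, h, f, v0, v1])"
    using t by (simp add: ext_table_def)
  have v: "g h = 0" "g v0 = 0" "g v1 = 0"
    using g(2)[rule_format, of e f] g(2)[rule_format, of e v1] g(2)[rule_format, of f v0]
    by (simp_all add: eqs)
  have "g e = 0" "g f = 0"
    using g(2)[rule_format, of h e] g(2)[rule_format, of h f] two_neq_0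
    unfolding eqs by (simp_all add: form_simps[OF g(1)] v)
  obtain p q r s u where "x = p *s e + q *s h + r *s f + s *s v0 + u *s v1"
    using indep5_coordinates[OF dim5 ind] by blast
  then show "g x = 0"
    by (simp add: form_simps[OF g(1)] v \<open>g e = 0\<close> \<open>g f = 0\<close>)
qed

lemma noncommutative_table_eqs:
  assumes "noncommutative_table e h f a u"
  shows "h \<cdot> e = 2 *s e" "h \<cdot> f = -2 *s f" "e \<cdot> f = h" "e \<cdot> h = -2 *s e" "f \<cdot> h = 2 *s f" "f \<cdot> e = - h"
    "e \<cdot> a = 0" "h \<cdot> a = 0" "f \<cdot> a = 0" "e \<cdot> u = 0" "h \<cdot> u = 0" "f \<cdot> u = 0"
    "a \<cdot> e = 0" "a \<cdot> h = 0" "a \<cdot> f = 0" "u \<cdot> e = 0" "u \<cdot> h = 0" "u \<cdot> f = 0" "a \<cdot> u = u" "u \<cdot> a = - u"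
  using assms sl2_triple_anti[of e h f] br_anti[of a e] br_anti[of a h] br_anti[of a f] br_anti[of u e]
    br_anti[of u h] br_anti[of u f] br_anti[of u a]
  by (auto simp: noncommutative_table_def commutes_with_triple_def sl2_triple_def)

lemma noncommutative_table_not_perfect:
  assumes t: "noncommutative_table e h f a u"
  shows "\<not> perfect"
proof -
  have ind: "indep 5 (nth [e, h, f, a, u])"
    using t by (simp add: noncommutative_table_def)
  obtain g where g: "\<And>i. i < 5 \<Longrightarrow> form (g i)"
    "\<And>i j. i < 5 \<Longrightarrow> j < 5 \<Longrightarrow> g i ([e, h, f, a, u] ! j) = (if i = j then 1 else 0)"
    using indep_dual_forms[OF ind] by blast
  have form: "form (g 3)"
    using g(1) by simp
  have g3: "g 3 e = 0" "g 3 h = 0" "g 3 f = 0" "g 3 a = 1" "g 3 u = 0"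
    using g(2)[of 3 0] g(2)[of 3 1] g(2)[of 3 2] g(2)[of 3 3] g(2)[of 3 4] by simp_all
  have "g 3 (x \<cdot> y) = 0" for x y
  proof -
    obtain p q r s v where x: "x = p *s e + q *s h + r *s f + s *s a + v *s u"
      using indep5_coordinates[OF dim5 ind] by blast
    obtain p' q' r' s' v' where y: "y = p' *s e + q' *s h + r' *s f + s' *s a + v' *s u"
      using indep5_coordinates[OF dim5 ind] by blast
    show ?thesis
      by (simp add: x y br_simps noncommutative_table_eqs[OF t] form_simps[OF form] g3)
  qed
  then show ?thesis
    using form g3(4) unfolding perfect_def by (metis zero_neq_one)
qed

definition central :: "'k^'n \<Rightarrow> bool" where
  "central c \<longleftrightarrow> (\<forall>y. c \<cdot> y = 0)"

lemma noncommutative_table_centerless: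
  assumes t: "noncommutative_table e h f a u" and c: "central c"
  shows "c = 0"
proof -
  have ind: "indep 5 (nth [e, h, f, a, u])"
    using t by (simp add: noncommutative_table_def)
  have coeff: "p = 0 \<and> q = 0 \<and> r = 0 \<and> s = 0 \<and> v = 0"
    if "p *s e + q *s h + r *s f + s *s a + v *s u = 0" for p q r s v
    using ind that unfolding indep5 by blast
  obtain p q r s v where x: "c = p *s e + q *s h + r *s f + s *s a + v *s u"
    using indep5_coordinates[OF dim5 ind] by blast
  have "(-2 * p) *s e + 0 *s h + (2 * r) *s f + 0 *s a + 0 *s u = c \<cdot> h"
    by (simp add: x br_simps noncommutative_table_eqs[OF t] vec_eq_iff)
  then have "p = 0" "r = 0"
    using c coeff[of "-2 * p" 0 "2 * r" 0 0] two_neq_0 by (auto simp: central_def)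
  have "(2 * q) *s e + 0 *s h + 0 *s f + 0 *s a + 0 *s u = c \<cdot> e"
    by (simp add: x \<open>p = 0\<close> \<open>r = 0\<close> br_simps noncommutative_table_eqs[OF t] vec_eq_iff)
  then have "q = 0"
    using c coeff[of "2 * q" 0 0 0 0] two_neq_0 by (auto simp: central_def)
  have "0 *s e + 0 *s h + 0 *s f + 0 *s a + (s - v) *s u = c \<cdot> (a + u)"
    "0 *s e + 0 *s h + 0 *s f + 0 *s a + s *s u = c \<cdot> u"
    by (simp_all add: x br_simps noncommutative_table_eqs[OF t] vec_eq_iff algebra_simps)
  then have "s = 0" "v = 0"
    using c coeff[of 0 0 0 0 s] coeff[of 0 0 0 0 "s - v"] by (auto simp: central_def)
  then show ?thesis
    by (simp add: x \<open>p = 0\<close> \<open>q = 0\<close> \<open>r = 0\<close>)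
qed

lemma ext_table_centerless:
  assumes t: "ext_table e h f v0 v1 b d" and c: "central c"
  shows "c = 0"
proof -
  have ind: "indep 5 (nth [e, h, f, v0, v1])"
    using t by (simp add: ext_table_def)
  have coeff: "p = 0 \<and> q = 0 \<and> r = 0 \<and> s = 0 \<and> v = 0"
    if "p *s e + q *s h + r *s f + s *s v0 + v *s v1 = 0" for p q r s v
    using ind that unfolding indep5 by blast
  obtain p q r s v where x: "c = p *s e + q *s h + r *s f + s *s v0 + v *s v1"
    using indep5_coordinates[OF dim5 ind] by blast
  note simps = x br_simps ext_table_eqs[OF t] ext_table_anti[OF t] vec_eq_iff
  have "0 *s e + 0 *s h + 0 *s f + q *s v0 + r *s v1 = c \<cdot> v0"
    "0 *s e + 0 *s h + 0 *s f + p *s v0 + (- q) *s v1 = c \<cdot> v1"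
    by (simp_all add: simps)
  then have "q = 0" "r = 0" "p = 0"
    using c coeff[of 0 0 0 q r] coeff[of 0 0 0 p "- q"] by (auto simp: central_def)
  then have "0 *s e + 0 *s h + 0 *s f + (- s) *s v0 + v *s v1 = c \<cdot> h"
    by (simp add: simps)
  then have "s = 0" "v = 0"
    using c coeff[of 0 0 0 "- s" v] by (auto simp: central_def)
  then show ?thesis
    by (simp add: x \<open>p = 0\<close> \<open>q = 0\<close> \<open>r = 0\<close>)
qed

text \<open>
  Properties of the five types that suffice to tell them apart. For the second, a nonzero
  central element is easier to obtain from a description of the algebra than a complete table.
\<close>

primrec entry_criterion :: "entry \<Rightarrow> bool" where
  "entry_criterion Witt \<longleftrightarrow> (\<exists>x h e1 e2 e3. witt_table x h e1 e2 e3)"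
| "entry_criterion Central \<longleftrightarrow> (\<exists>c. c \<noteq> 0 \<and> central c)"
| "entry_criterion Noncommutative \<longleftrightarrow> (\<exists>e h f a u. noncommutative_table e h f a u)"
| "entry_criterion Split_V1 \<longleftrightarrow> (\<exists>e h f v0 v1. ext_table e h f v0 v1 0 0)"
| "entry_criterion Nonsplit_V1 \<longleftrightarrow> (3::'k) = 0 \<and> (\<exists>e h f v0 v1. ext_table e h f v0 v1 1 0)"

text \<open>
  Only the first algebra has no nonzero abelian ideal, only the second has a center, and only
  the third of the others is not perfect. The last two differ by the extension being split.
\<close>

lemma entry_criterion_unique:
  assumes "entry_criterion i" "entry_criterion j"
  shows "i = j"
proof -
  have witt: "k = Witt" if wit: "entry_criterion Witt" and other: "entry_criterion k" for k
  proof (rule ccontr)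
    assume "k \<noteq> Witt"
    have "\<exists>J. abelian_ideal J \<and> J \<noteq> {0}"
    proof -
      have line: "abelian_ideal (vec.span {c, c}) \<and> vec.span {c, c} \<noteq> {0}"
        if "c \<noteq> 0" "\<And>y. y \<cdot> c \<in> vec.span {c, c}" for c
        using abelian_ideal_span_pair[of c c] that br_self vec.span_base[of c "{c, c}"] by auto
      consider "entry_criterion Central" | "entry_criterion Noncommutative"
        | "entry_criterion Split_V1 \<or> entry_criterion Nonsplit_V1"
        using other \<open>k \<noteq> Witt\<close> by (cases k) auto
      then show ?thesis
      proof cases
        case 1
        then obtain c where c: "c \<noteq> 0" "central c"
          by auto
        have "y \<cdot> c = 0" for y
          using c(2) br_anti[of y c] by (simp add: central_def)
        then show ?thesis
          using line[OF c(1)] by (metis vec.span_zero)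
      next
        case 2
        then obtain e h f a u where t: "noncommutative_table e h f a u"
          by auto
        have ind: "indep 5 (nth [e, h, f, a, u])"
          using t by (simp add: noncommutative_table_def)
        have "u \<noteq> 0"
          using ind[unfolded indep5, rule_format, of 0 0 0 0 1] by auto
        moreover have "y \<cdot> u \<in> vec.span {u, u}" for y
        proof -
          obtain p q r s v where y: "y = p *s e + q *s h + r *s f + s *s a + v *s u"
            using indep5_coordinates[OF dim5 ind] by blast
          have "y \<cdot> u = s *s u"
            by (simp add: y br_simps noncommutative_table_eqs[OF t])
          then show ?thesis
            by (simp add: vec.span_base vec.span_scale)
        qed
        ultimately show ?thesis
          using line by blast
      next
        case 3
        then obtain e h f v0 v1 b where t: "ext_table e h f v0 v1 b 0"
          by auto
        from ext_table_abelian_ideal[OF t] show ?thesis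
          by blast
      qed
    qed
    then obtain J where J: "abelian_ideal J" "J \<noteq> {0}"
      by blast
    obtain x h e1 e2 e3 where "witt_table x h e1 e2 e3"
      using wit by auto
    from witt_table_no_abelian_ideal[OF this J(1)] J(2) show False
      by blast
  qed
  have central: "k = Central" if cen: "entry_criterion Central" and other: "entry_criterion k" for k
  proof -
    obtain c where c: "c \<noteq> 0" "central c"
      using cen by auto
    show ?thesis
    proof (cases k)
      case Witt
      then show ?thesis
        using witt cen other by blast
    next
      case Noncommutative
      then obtain e h f a u where "noncommutative_table e h f a u"
        using other by auto
      from noncommutative_table_centerless[OF this c(2)] c(1) show ?thesis by contradiction
    next
      case Split_V1
      then obtain e h f v0 v1 where "ext_table e h f v0 v1 0 0"
        using other by auto
      from ext_table_centerless[OF this c(2)] c(1) show ?thesis by contradiction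
    next
      case Nonsplit_V1
      then obtain e h f v0 v1 where "ext_table e h f v0 v1 1 0"
        using other by auto
      from ext_table_centerless[OF this c(2)] c(1) show ?thesis by contradiction
    qed
  qed
  have noncommutative: "k = Noncommutative"
    if non: "entry_criterion Noncommutative" and other: "entry_criterion k" for k
  proof -
    have "\<not> perfect"
      using non noncommutative_table_not_perfect by auto
    then have no: "\<not> ext_table e h f v0 v1 b d" for e h f v0 v1 b d
      using ext_table_perfect by blast
    show ?thesis
    proof (cases k)
      case Witt
      then show ?thesis
        using witt non other by blast
    next
      case Central
      then show ?thesis
        using central non other by blast
    qed (use no other in auto)
  qed
  have nonsplit: "\<not> (entry_criterion Split_V1 \<and> entry_criterion Nonsplit_V1)"
  proof
    assume both: "entry_criterion Split_V1 \<and> entry_criterion Nonsplit_V1"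
    then obtain e h f v0 v1 where t: "ext_table e h f v0 v1 0 0"
      by auto
    obtain E H F w0 w1 where T: "ext_table E H F w0 w1 1 0"
      using both by auto
    show False
      using split_nonsplit_ext_table[OF t T] both by auto
  qed
  show ?thesis
    using assms witt[of i] witt[of j] central[of i] central[of j] noncommutative[of i]
      noncommutative[of j] nonsplit
    by (cases i; cases j) (simp_all del: entry_criterion.simps)
qed

end

section \<open>Coordinates for a Lie algebra of dimension five\<close>

lemma lie_isomorphism_inverse:
  assumes iso: "lie_isomorphism L M \<phi>"
    and closed: "\<And>x y. x \<in> carrier L \<Longrightarrow> y \<in> carrier L \<Longrightarrow> x + y \<in> carrier L"
      "\<And>c x. x \<in> carrier L \<Longrightarrow> smul L c x \<in> carrier L"
      "\<And>x y. x \<in> carrier L \<Longrightarrow> y \<in> carrier L \<Longrightarrow> brk L x y \<in> carrier L"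
  shows "lie_isomorphism M L (the_inv_into (carrier L) \<phi>)"
proof -
  let ?g = "the_inv_into (carrier L) \<phi>"
  have hom: "\<And>x y. x \<in> carrier L \<Longrightarrow> y \<in> carrier L \<Longrightarrow> \<phi> (x + y) = \<phi> x + \<phi> y"
    "\<And>c x. x \<in> carrier L \<Longrightarrow> \<phi> (smul L c x) = smul M c (\<phi> x)"
    "\<And>x y. x \<in> carrier L \<Longrightarrow> y \<in> carrier L \<Longrightarrow> \<phi> (brk L x y) = brk M (\<phi> x) (\<phi> y)"
    and bij: "bij_betw \<phi> (carrier L) (carrier M)"
    using iso by (auto simp: lie_isomorphism_def lie_hom_def)
  have inj: "inj_on \<phi> (carrier L)" and im: "\<phi> ` carrier L = carrier M"
    using bij by (auto simp: bij_betw_def)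
  have g: "?g x \<in> carrier L" "\<phi> (?g x) = x" if "x \<in> carrier M" for x
    using that by (auto intro: f_the_inv_into_f[OF inj] the_inv_into_into[OF inj] simp: im)
  have eq: "?g y = x" if "x \<in> carrier L" "\<phi> x = y" for x y
    using that the_inv_into_f_f[OF inj] by blast
  have "bij_betw ?g (carrier M) (carrier L)"
    by (rule bij_betw_the_inv_into[OF bij])
  moreover have "lie_hom M L ?g"
    unfolding lie_hom_def
    by (auto intro!: eq closed simp: g hom)
  ultimately show ?thesis
    by (simp add: lie_isomorphism_def)
qed

lemma lie_isomorphism_inverse':
  assumes "lie_algebra L" "lie_isomorphism L M \<phi>"
  shows "lie_isomorphism M L (the_inv_into (carrier L) \<phi>)"
proof -
  interpret lie_algebra L by fact
  show ?thesis
    using carrier_subspace brk_closed assms(2)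
    by (intro lie_isomorphism_inverse) (auto intro: subspace_add subspace_scale)
qed

lemma (in lie_algebra) lie_algebra_subalgebra:
  assumes "lie_subalgebra P L"
  shows "lie_algebra (L\<lparr>carrier := P\<rparr>)"
proof -
  have P: "subspace P" "\<And>x. x \<in> P \<Longrightarrow> x \<in> carrier L" "\<And>x y. x \<in> P \<Longrightarrow> y \<in> P \<Longrightarrow> brk L x y \<in> P"
    using assms by (auto simp: lie_subalgebra_def)
  have "vector_space (smul (L\<lparr>carrier := P\<rparr>))"
    using vector_space_axioms by simp
  then interpret P: vector_space "smul (L\<lparr>carrier := P\<rparr>)" .
  show ?thesis
    by unfold_locales
      (use P in \<open>auto simp: brk_add_left brk_add_right brk_smul_left brk_smul_right brk_self jacobi\<close>)
qed

text \<open>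
  The coordinates \<open>\<psi>\<close> transport the structure of \<open>L\<close> to a bracket that is defined on a whole
  type, where no membership in a carrier has to be checked. An isomorphism of \<open>L\<close> with another
  algebra composes with \<open>\<psi>\<close>, so that isomorphic algebras have models with the same bracket;
  invariants of the bracket thus are isomorphism invariants.
\<close>

locale lie_model = lie_algebra L
  for L :: "('k::{field,finite}, 'v::ab_group_add) lie" +
  fixes br :: "'k^'n \<Rightarrow> 'k^'n \<Rightarrow> 'k^'n" (infixl "\<cdot>" 80) and \<psi> :: "'k^'n \<Rightarrow> 'v"
  assumes linear: "Vector_Spaces.linear (*s) (smul L) \<psi>" and inj: "inj \<psi>"
    and range: "range \<psi> = carrier L"
    and hom: "\<psi> (u \<cdot> w) = brk L (\<psi> u) (\<psi> w)"
    and card5: "CARD('n) = 5" and two: "(2::'k) \<noteq> 0"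
begin

lemma psi_add: "\<psi> (u + w) = \<psi> u + \<psi> w" and psi_scale: "\<psi> (c *s u) = smul L c (\<psi> u)"
  using linear by (auto simp: Vector_Spaces.linear_iff)

lemma psi_0: "\<psi> 0 = 0"
  using psi_scale[of 0 0] by simp

lemma psi_minus: "\<psi> (- u) = - \<psi> u"
  using psi_add[of u "- u"] by (simp add: psi_0 eq_neg_iff_add_eq_0 add.commute)

lemma psi_sum: "\<psi> (\<Sum>i\<in>S. g i) = (\<Sum>i\<in>S. \<psi> (g i))"
  by (induction S rule: infinite_finite_induct) (auto simp: psi_0 psi_add)

lemma psi_eq_iff: "\<psi> u = \<psi> w \<longleftrightarrow> u = w"
  using inj by (simp add: inj_eq)

lemma psi_eq_0_iff: "\<psi> u = 0 \<longleftrightarrow> u = 0"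
  using psi_eq_iff[of u 0] by (simp add: psi_0)

lemma psi_carrier: "\<psi> u \<in> carrier L"
  using range by blast

lemma carrier_cases:
  assumes "x \<in> carrier L"
  obtains u where "x = \<psi> u"
  using assms range by blast

lemma psi_mem_image_iff: "\<psi> u \<in> \<psi> ` S \<longleftrightarrow> u \<in> S"
  using inj by (rule inj_image_mem_iff)

sublocale m: finite_lie_bracket br
proof
  have "\<psi> (x \<cdot> (y \<cdot> z) + y \<cdot> (z \<cdot> x) + z \<cdot> (x \<cdot> y)) = \<psi> 0" for x y z
    unfolding psi_add hom psi_0 by (rule jacobi) (rule psi_carrier)+
  then show "x \<cdot> (y \<cdot> z) + y \<cdot> (z \<cdot> x) + z \<cdot> (x \<cdot> y) = 0" for x y z
    unfolding psi_eq_iff .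
  show "(x + y) \<cdot> z = x \<cdot> z + y \<cdot> z" "x \<cdot> (y + z) = x \<cdot> y + x \<cdot> z" "(c *s x) \<cdot> y = c *s x \<cdot> y"
    "x \<cdot> (c *s y) = c *s x \<cdot> y" "x \<cdot> x = 0" for x y z c
    by (simp_all add: psi_eq_iff[symmetric] psi_add psi_scale psi_0 hom brk_add_left brk_add_right
        brk_smul_left brk_smul_right brk_self psi_carrier)
qed (fact card5 two)+

lemma psi_subspace_iff: "subspace (\<psi> ` S) \<longleftrightarrow> vec.subspace S"
proof
  assume "subspace (\<psi> ` S)"
  then have "\<psi> 0 \<in> \<psi> ` S" "\<And>u w. u \<in> S \<Longrightarrow> w \<in> S \<Longrightarrow> \<psi> (u + w) \<in> \<psi> ` S"
    "\<And>c u. u \<in> S \<Longrightarrow> \<psi> (c *s u) \<in> \<psi> ` S"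
    unfolding subspace_def psi_add psi_scale psi_0 by blast+
  then show "vec.subspace S"
    by (simp add: psi_mem_image_iff vec.subspace_def)
next
  assume "vec.subspace S"
  then show "subspace (\<psi> ` S)"
    by (auto simp: subspace_def vec.subspace_def image_iff Bex_def
      simp flip: psi_add psi_scale psi_0 simp: psi_eq_iff)
qed

lemma psi_span: "span (\<psi> ` S) = \<psi> ` vec.span S"
  using module_hom.span_image[OF linear[unfolded linear_iff_module_hom]] .

lemma preimage_image: "I \<subseteq> carrier L \<Longrightarrow> \<psi> ` (\<psi> -` I) = I"
  using range by auto

lemma lie_ideal_iff: "lie_ideal (\<psi> ` J) L \<longleftrightarrow> m.ideal J"
proof -
  have "(\<forall>x\<in>carrier L. \<forall>y\<in>\<psi> ` J. brk L x y \<in> \<psi> ` J) \<longleftrightarrow> (\<forall>x. \<forall>y\<in>J. x \<cdot> y \<in> J)"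
    by (auto simp: range[symmetric] psi_mem_image_iff simp flip: hom)
  moreover have "\<psi> ` J \<subseteq> carrier L"
    using psi_carrier by blast
  ultimately show ?thesis
    by (simp add: lie_ideal_def m.ideal_def psi_subspace_iff)
qed

primrec derived :: "('k^'n) set \<Rightarrow> nat \<Rightarrow> ('k^'n) set" where
  "derived S 0 = S"
| "derived S (Suc n) = vec.span (m.brackets (derived S n))"

lemma lie_prod_image: "lie_prod L (\<psi> ` A) (\<psi> ` B) = \<psi> ` vec.span {a \<cdot> b | a b. a \<in> A \<and> b \<in> B}"
proof -
  have "{brk L a b | a b. a \<in> \<psi> ` A \<and> b \<in> \<psi> ` B} = {brk L (\<psi> a) (\<psi> b) | a b. a \<in> A \<and> b \<in> B}"
    by blast
  also have "\<dots> = \<psi> ` {a \<cdot> b | a b. a \<in> A \<and> b \<in> B}"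
    unfolding hom[symmetric] by blast
  finally have "{brk L a b | a b. a \<in> \<psi> ` A \<and> b \<in> \<psi> ` B} = \<psi> ` {a \<cdot> b | a b. a \<in> A \<and> b \<in> B}" .
  then show ?thesis
    by (simp add: lie_prod_def psi_span)
qed

lemma derived_series_image: "derived_series L (\<psi> ` S) n = \<psi> ` derived S n"
  by (induction n) (simp_all add: lie_prod_image m.brackets_def)

lemma lie_solvable_iff: "lie_solvable L (\<psi> ` S) \<longleftrightarrow> (\<exists>n. derived S n = {0})"
proof -
  have "\<psi> ` D = {0} \<longleftrightarrow> D = {0}" for D
    using inj_image_eq_iff[OF inj, of D "{0}"] by (simp add: psi_0)
  then show ?thesis
    by (simp add: lie_solvable_def derived_series_image)
qed

text \<open>
  The witness is a term of the derived series of smallest dimension: the next term is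
  contained in it and not smaller.
\<close>

lemma perfect_ideal_exists:
  assumes "\<not> lie_solvable L (carrier L)"
  obtains D where "m.ideal D" "D \<noteq> {0}" "vec.span (m.brackets D) = D"
proof -
  have ideal: "m.ideal (derived UNIV n)" for n
  proof (induction n)
    case (Suc n)
    have "x \<cdot> s \<in> vec.span (m.brackets (derived UNIV n))" if sD: "s \<in> m.brackets (derived UNIV n)" for x s
    proof -
      obtain y z where s: "s = y \<cdot> z" "y \<in> derived UNIV n" "z \<in> derived UNIV n"
        using sD by (auto simp: m.brackets_def)
      have "x \<cdot> y \<in> derived UNIV n" "x \<cdot> z \<in> derived UNIV n"
        using Suc s by (auto simp: m.ideal_def)
      then have "(x \<cdot> y) \<cdot> z \<in> m.brackets (derived UNIV n)" "y \<cdot> (x \<cdot> z) \<in> m.brackets (derived UNIV n)"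
        using s by (auto simp: m.brackets_def)
      then show ?thesis
        unfolding s(1) m.br_derivation[of x y z] by (intro vec.span_add vec.span_base)
    qed
    then show ?case
      by (simp add: m.ideal_spanI)
  qed (simp add: m.ideal_def)
  define n where "n = (ARG_MIN (\<lambda>n. vec.dim (derived UNIV n)) n. True)"
  have min: "vec.dim (derived UNIV n) \<le> vec.dim (derived UNIV k)" for k
    unfolding n_def by (rule arg_min_nat_le) simp
  have "derived UNIV (Suc n) \<subseteq> derived UNIV n"
    unfolding derived.simps using ideal[of n]
    by (intro vec.span_minimal) (auto simp: m.ideal_def m.brackets_def)
  then have "derived UNIV (Suc n) = derived UNIV n"
    using ideal[of n] ideal[of "Suc n"] min[of "Suc n"]
    by (intro vec.subspace_dim_equal) (simp_all add: m.ideal_def del: derived.simps)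
  moreover have "derived UNIV n \<noteq> {0}"
    using assms lie_solvable_iff[of UNIV] by (auto simp: range)
  ultimately show thesis
    using that[of "derived UNIV n"] ideal by simp
qed

text \<open>
  If \<open>sl(2)\<close> is a complement of the ideal \<open>R\<close>, an ideal \<open>J\<close> not contained in \<open>R\<close> covers
  \<open>sl(2)\<close> modulo \<open>R\<close>, and so does every term of its derived series because \<open>sl(2)\<close> is perfect.
\<close>

lemma solvable_ideal_subset:
  assumes ind: "indep 5 (nth [e, h, f, r1, r2])" and triple: "m.sl2_triple e h f"
    and R: "m.ideal (vec.span {r1, r2})" and J: "m.ideal J" and solvable: "derived J n = {0}"
  shows "J \<subseteq> vec.span {r1, r2}"
proof (rule ccontr)
  define R where "R = vec.span {r1, r2}"
  assume "\<not> J \<subseteq> vec.span {r1, r2}"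
  then obtain x where x: "x \<in> J" "x \<notin> R"
    by (auto simp: R_def)
  have sub: "vec.subspace R" "vec.subspace J" and idealR: "\<And>x y. y \<in> R \<Longrightarrow> x \<cdot> y \<in> R"
    and idealJ: "\<And>x y. y \<in> J \<Longrightarrow> x \<cdot> y \<in> J"
    using R J by (auto simp: m.ideal_def R_def)
  have idealR': "y \<cdot> x \<in> R" if "y \<in> R" for x y
    using idealR[OF that, of x] m.br_anti[of y x] vec.subspace_neg[OF sub(1)] by simp
  have eqs: "h \<cdot> e = 2 *s e" "h \<cdot> f = -2 *s f" "e \<cdot> f = h"
    using triple by (simp_all add: m.sl2_triple_def)
  note anti = m.sl2_triple_anti[OF triple]
  define covers where "covers K y \<longleftrightarrow> (\<exists>j\<in>K. y - j \<in> R)" for K y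
  have covers_br: "covers (m.brackets K) (y \<cdot> z)" if yz: "covers K y" "covers K z" for K y z
  proof -
    obtain j k where jk: "j \<in> K" "y - j \<in> R" "k \<in> K" "z - k \<in> R"
      using yz by (auto simp: covers_def)
    have "y \<cdot> z - j \<cdot> k = (y - j) \<cdot> z + j \<cdot> (z - k)"
      by (simp add: m.br_simps)
    also have "\<dots> \<in> R"
      using jk idealR idealR' sub by (intro vec.subspace_add) auto
    finally show ?thesis
      using jk by (auto simp: covers_def m.brackets_def)
  qed
  have covers_scale: "covers (vec.span K) y" if yz: "covers K (c *s y)" and "c \<noteq> 0" for K y c
  proof -
    obtain j where j: "j \<in> K" "c *s y - j \<in> R"
      using yz by (auto simp: covers_def)
    have "y - inverse c *s j = inverse c *s (c *s y - j)"
      using \<open>c \<noteq> 0\<close> by (simp add: vec_eq_iff field_simps)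
    also have "\<dots> \<in> R"
      using j sub(1) by (intro vec.subspace_scale)
    finally show ?thesis
      using j by (auto simp: covers_def intro: vec.span_base vec.span_scale)
  qed
  have spanJ: "vec.span J = J"
    using sub(2) by (simp add: vec.span_eq_iff)
  obtain p q r s t where xs: "x = p *s e + q *s h + r *s f + s *s r1 + t *s r2"
    using indep5_coordinates[OF card5 ind] by blast
  have rest: "s *s r1 + t *s r2 \<in> R"
    unfolding R_def m.span_pair by blast
  have "covers J e"
  proof -
    have ex: "e \<cdot> x = (- 2 * q) *s e + r *s h + e \<cdot> (s *s r1 + t *s r2)"
      unfolding xs by (simp add: m.br_simps eqs anti vec_eq_iff algebra_simps)
    have eex: "e \<cdot> (e \<cdot> x) = (- 2 * r) *s e + e \<cdot> (e \<cdot> (s *s r1 + t *s r2))"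
      unfolding ex by (simp add: m.br_simps eqs anti vec_eq_iff algebra_simps)
    have "\<exists>c j. c \<noteq> 0 \<and> j \<in> J \<and> c *s e - j \<in> R"
    proof (cases "r = 0")
      case False
      have "(- 2 * r) *s e - e \<cdot> (e \<cdot> x) = - (e \<cdot> (e \<cdot> (s *s r1 + t *s r2)))"
        unfolding eex by simp
      also have "\<dots> \<in> R"
        using rest by (intro vec.subspace_neg[OF sub(1)] idealR)
      finally show ?thesis
        using False two idealJ[OF idealJ[OF x(1)]] by (metis mult_eq_0_iff neg_equal_0_iff_equal)
    next
      case r: True
      show ?thesis
      proof (cases "q = 0")
        case False
        have "(- 2 * q) *s e - e \<cdot> x = - (e \<cdot> (s *s r1 + t *s r2))"
          unfolding ex r by simp
        also have "\<dots> \<in> R"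
          using rest by (intro vec.subspace_neg[OF sub(1)] idealR)
        finally show ?thesis
          using False two idealJ[OF x(1)] by (metis mult_eq_0_iff neg_equal_0_iff_equal)
      next
        case True
        have "p *s e - x = - (s *s r1 + t *s r2)"
          unfolding xs r True by (simp add: vec_eq_iff)
        also have "\<dots> \<in> R"
          using rest by (intro vec.subspace_neg[OF sub(1)])
        finally have "p *s e - x \<in> R" .
        moreover have "p \<noteq> 0"
          using x(2) rest unfolding xs r True by auto
        ultimately show ?thesis
          using x(1) by blast
      qed
    qed
    then obtain c where "c \<noteq> 0" "covers J (c *s e)"
      by (auto simp: covers_def)
    then show ?thesis
      using covers_scale[of J c e] spanJ by simp
  qed
  then obtain j where j: "j \<in> J" "e - j \<in> R"
    by (auto simp: covers_def)
  have J_br: "covers J (y \<cdot> z)" if yJ: "covers J y" for y z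
  proof -
    obtain j where j: "j \<in> J" "y - j \<in> R"
      using yJ by (auto simp: covers_def)
    have "y \<cdot> z - j \<cdot> z \<in> R"
      using idealR'[OF j(2), of z] by (simp add: m.br_simps)
    moreover have "j \<cdot> z \<in> J"
      using idealJ[OF j(1), of z] m.br_anti[of j z] vec.subspace_neg[OF sub(2)] by simp
    ultimately show ?thesis
      by (auto simp: covers_def)
  qed
  have "covers J h"
    using J_br[OF \<open>covers J e\<close>, of f] by (simp add: eqs)
  then have "covers J (-2 *s f)"
    using J_br[OF \<open>covers J h\<close>, of f] by (simp add: eqs)
  then have "covers J f"
    using covers_scale[of J "-2" f] spanJ two by simp
  have "covers (derived J k) e \<and> covers (derived J k) h \<and> covers (derived J k) f" for k
  proof (induction k)
    case 0
    show ?case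
      using \<open>covers J e\<close> \<open>covers J h\<close> \<open>covers J f\<close> by simp
  next
    case (Suc k)
    then have "covers (m.brackets (derived J k)) (2 *s e)" "covers (m.brackets (derived J k)) (1 *s h)"
      "covers (m.brackets (derived J k)) ((-2) *s f)"
      using covers_br[of "derived J k" h e] covers_br[of "derived J k" e f] covers_br[of "derived J k" h f]
      by (simp_all add: eqs)
    from this[THEN covers_scale] show ?case
      using two by simp
  qed
  then have "covers {0} e"
    using solvable by metis
  then have "e \<in> R"
    by (simp add: covers_def)
  then obtain s t where "e = s *s r1 + t *s r2"
    unfolding R_def m.span_pair by blast
  then have "1 *s e + 0 *s h + 0 *s f + (- s) *s r1 + (- t) *s r2 = 0"
    by (simp add: vec_eq_iff)
  then show False
    using ind unfolding indep5 by (metis zero_neq_one)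
qed

text \<open>
  The inclusion of the radical is the preceding lemma; conversely, \<open>kr\<^sub>1 + kr\<^sub>2\<close> is a solvable
  ideal, with at most one-dimensional first derived algebra.
\<close>

lemma lie_rad_eq:
  assumes ind: "indep 5 (nth [e, h, f, r1, r2])" and triple: "m.sl2_triple e h f"
    and R: "m.ideal (vec.span {r1, r2})" and solvable: "r1 \<cdot> r2 \<in> vec.span {r2}"
  shows "lie_rad L = \<psi> ` vec.span {r1, r2}"
proof -
  have "derived (vec.span {r1, r2}) 1 \<subseteq> vec.span {r2}"
  proof -
    have "r2 \<cdot> r1 \<in> vec.span {r2}"
      using solvable m.br_anti[of r2 r1] vec.span_neg by simp
    then have "(s *s r1 + t *s r2) \<cdot> (s' *s r1 + t' *s r2) \<in> vec.span {r2}" for s t s' t'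
      using solvable by (simp add: m.br_simps vec.span_add vec.span_scale)
    then have "x \<cdot> y \<in> vec.span {r2}" if xy: "x \<in> vec.span {r1, r2}" "y \<in> vec.span {r1, r2}" for x y
      using xy unfolding m.span_pair by blast
    then have "m.brackets (vec.span {r1, r2}) \<subseteq> vec.span {r2}"
      by (auto simp: m.brackets_def)
    then show ?thesis
      by (simp add: vec.span_minimal vec.subspace_span)
  qed
  moreover have "x \<cdot> y = 0" if xy: "x \<in> vec.span {r2}" "y \<in> vec.span {r2}" for x y
    using xy by (auto simp: vec.span_singleton m.br_simps)
  ultimately have "m.brackets (derived (vec.span {r1, r2}) 1) \<subseteq> {0}"
    unfolding m.brackets_def by blast
  then have "derived (vec.span {r1, r2}) (Suc 1) \<subseteq> {0}"
    unfolding derived.simps(2)[of _ 1] by (intro vec.span_minimal) auto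
  then have "derived (vec.span {r1, r2}) (Suc 1) = {0}"
    using vec.span_zero by auto
  then have "lie_solvable L (\<psi> ` vec.span {r1, r2})"
    unfolding lie_solvable_iff by blast
  then have "\<psi> ` vec.span {r1, r2} \<subseteq> lie_rad L"
    using R unfolding lie_rad_def lie_ideal_iff[symmetric] by (intro subsetI span_base) blast
  moreover have "I \<subseteq> \<psi> ` vec.span {r1, r2}" if I: "lie_ideal I L" "lie_solvable L I" for I
  proof -
    have im: "\<psi> ` (\<psi> -` I) = I"
      using I(1) by (intro preimage_image) (simp add: lie_ideal_def)
    have J: "m.ideal (\<psi> -` I)"
      using I(1) unfolding lie_ideal_iff[symmetric] im .
    obtain n where n: "derived (\<psi> -` I) n = {0}"
      using I(2) lie_solvable_iff[of "\<psi> -` I"] unfolding im by blast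
    show ?thesis
      using solvable_ideal_subset[OF ind triple R J n] im by blast
  qed
  then have "lie_rad L \<subseteq> \<psi> ` vec.span {r1, r2}"
    unfolding lie_rad_def by (intro span_minimal) (auto simp: psi_subspace_iff vec.subspace_span)
  ultimately show ?thesis by blast
qed

end

lemma lie_model_exists:
  fixes L :: "('k::{field,finite}, 'v::ab_group_add) lie"
  assumes "lie_algebra L" "lie_dim L = 5" "(2::'k) \<noteq> 0"
  obtains br and \<psi> :: "'k^5 \<Rightarrow> 'v" where "lie_model L br \<psi>"
proof -
  interpret lie_algebra L by fact
  obtain B where B: "B \<subseteq> carrier L" "independent B" "carrier L \<subseteq> span B" "card B = dim (carrier L)"
    by (rule basis_exists)
  have card: "card B = 5"
    using B assms(2) by (simp add: lie_dim_def)
  then have fin: "finite B"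
    by (intro card_ge_0_finite) simp
  have span: "span B = carrier L"
    using B span_minimal[OF B(1) carrier_subspace] by auto
  obtain e :: "5 \<Rightarrow> 'v" where e: "bij_betw e UNIV B"
    using finite_same_card_bij[of "UNIV :: 5 set" B] fin card by auto
  define \<psi> where "\<psi> v = (\<Sum>i\<in>UNIV. smul L (v $ i) (e i))" for v :: "'k^5"
  have linear: "Vector_Spaces.linear (*s) (smul L) \<psi>"
    unfolding Vector_Spaces.linear_iff
    by (auto simp: \<psi>_def scale_left_distrib sum.distrib scale_sum_right intro: vec.vector_space_axioms vector_space_axioms)
  have reindex: "(\<Sum>b\<in>B. smul L (u b) b) = \<psi> (\<chi> i. u (e i))" for u
    unfolding \<psi>_def by (simp add: sum.reindex_bij_betw[OF e, of "\<lambda>b. smul L (u b) b", symmetric])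
  have "u = 0" if "\<psi> u = 0" for u
  proof -
    define c where "c b = u $ (the_inv e b)" for b
    have inv: "the_inv e (e i) = i" for i
      using e by (intro the_inv_f_f) (simp add: bij_betw_def)
    have "(\<Sum>b\<in>B. smul L (c b) b) = 0"
      using that by (simp add: reindex c_def inv)
    then have "c b = 0" if "b \<in> B" for b
      using B(2) that dependent_finite[OF fin] by blast
    then have "u $ i = 0" for i
      using e inv[of i] by (metis UNIV_I bij_betwE c_def)
    then show ?thesis
      by (simp add: vec_eq_iff)
  qed
  then have inj: "inj \<psi>"
    using linear by (metis linear_iff_module_hom module_hom.inj_iff_eq_0)
  have range: "range \<psi> = carrier L"
  proof -
    have "span B = range (\<lambda>u. \<Sum>b\<in>B. smul L (u b) b)"
      by (rule span_finite[OF fin])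
    also have "\<dots> \<subseteq> range \<psi>"
      by (auto simp: reindex)
    finally have "carrier L \<subseteq> range \<psi>"
      by (simp add: span)
    moreover have "\<psi> u \<in> carrier L" for u
      unfolding \<psi>_def using B(1) e carrier_subspace
      by (intro subspace_sum subspace_scale) (auto simp: bij_betw_def)
    ultimately show ?thesis by auto
  qed
  define br where "br u w = the_inv \<psi> (brk L (\<psi> u) (\<psi> w))" for u w
  have "\<psi> u \<in> carrier L" for u
    using range by blast
  then have "\<psi> (br u w) = brk L (\<psi> u) (\<psi> w)" for u w
    unfolding br_def by (intro f_the_inv_into_f[OF inj]) (simp add: range brk_closed)
  then have "lie_model L br \<psi>"
    using linear inj range assms(3)
    by (intro lie_model.intro lie_model_axioms.intro assms(1)) simp_all
  then show thesis
    using that by blast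
qed

lemma lie_model_transfer:
  assumes "lie_model L br \<psi>" "lie_algebra M" "lie_isomorphism L M \<phi>"
  shows "lie_model M br (\<phi> \<circ> \<psi>)"
proof -
  interpret lie_model L br \<psi> by fact
  interpret M: lie_algebra M by fact
  note \<psi>_br = hom
  have hom: "\<And>x y. x \<in> carrier L \<Longrightarrow> y \<in> carrier L \<Longrightarrow> \<phi> (x + y) = \<phi> x + \<phi> y"
    "\<And>c x. x \<in> carrier L \<Longrightarrow> \<phi> (smul L c x) = smul M c (\<phi> x)"
    "\<And>x y. x \<in> carrier L \<Longrightarrow> y \<in> carrier L \<Longrightarrow> \<phi> (brk L x y) = brk M (\<phi> x) (\<phi> y)"
    and bij: "bij_betw \<phi> (carrier L) (carrier M)"
    using assms(3) by (auto simp: lie_isomorphism_def lie_hom_def)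
  show ?thesis
  proof (intro lie_model.intro lie_model_axioms.intro)
    show "Vector_Spaces.linear (*s) (smul M) (\<phi> \<circ> \<psi>)"
      unfolding Vector_Spaces.linear_iff using vec.vector_space_axioms M.vector_space_axioms
      by (auto simp: psi_add psi_scale hom psi_carrier)
    show "inj (\<phi> \<circ> \<psi>)"
      using bij inj range by (intro comp_inj_on) (auto simp: bij_betw_def)
    show "range (\<phi> \<circ> \<psi>) = carrier M"
      unfolding image_comp[symmetric] range using bij by (simp add: bij_betw_def)
    show "(\<phi> \<circ> \<psi>) (br u w) = brk M ((\<phi> \<circ> \<psi>) u) ((\<phi> \<circ> \<psi>) w)" for u w
      by (simp add: \<psi>_br hom psi_carrier)
  qed (fact assms(2) card5 two)+
qed

section \<open>Subalgebras isomorphic to \<open>sl(2)\<close>\<close>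

context lie_model
begin

lemma lie_basis_iff:
  "lie_basis L (map \<psi> ws) S \<longleftrightarrow> indep (length ws) (nth ws) \<and> S = \<psi> ` vec.span (set ws)"
proof -
  have "set ws = nth ws ` {..<length ws}"
    by (auto simp: set_conv_nth)
  then have set: "set (map \<psi> ws) = (\<lambda>i. \<psi> (ws ! i)) ` {..<length ws}"
    by (simp add: image_image)
  have distinct: "distinct (map \<psi> ws) \<longleftrightarrow> inj_on (\<lambda>i. \<psi> (ws ! i)) {..<length ws}"
    by (auto simp: distinct_conv_nth inj_on_def)
  have "distinct (map \<psi> ws) \<and> independent (set (map \<psi> ws)) \<longleftrightarrow> indep (length ws) (nth ws)"
    unfolding set distinct independent_family_iff indep_def
    by (simp add: psi_eq_0_iff flip: psi_scale psi_sum)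
  moreover have "span (set (map \<psi> ws)) = \<psi> ` vec.span (set ws)"
    by (simp add: psi_span)
  ultimately show ?thesis
    by (auto simp: lie_basis_def)
qed

definition triple_span :: "'k^'n \<Rightarrow> 'k^'n \<Rightarrow> 'k^'n \<Rightarrow> ('k^'n) set" where
  "triple_span e h f = {p *s e + q *s h + r *s f | p q r. True}"

lemma triple_subalgebra:
  assumes "m.sl2_triple e h f"
  shows "lie_subalgebra (\<psi> ` triple_span e h f) L"
  unfolding lie_subalgebra_def psi_subspace_iff
proof (intro conjI ballI)
  note eqs = assms[unfolded m.sl2_triple_def] m.sl2_triple_anti[OF assms]
  show "vec.subspace (triple_span e h f)"
  proof (rule vec.subspaceI)
    show "0 \<in> triple_span e h f"
      unfolding triple_span_def mem_Collect_eq by (rule exI[of _ 0], rule exI[of _ 0], rule exI[of _ 0]) simp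
  next
    fix x y assume "x \<in> triple_span e h f" "y \<in> triple_span e h f"
    then obtain p q r p' q' r' where "x = p *s e + q *s h + r *s f" "y = p' *s e + q' *s h + r' *s f"
      by (auto simp: triple_span_def)
    then have "x + y = (p + p') *s e + (q + q') *s h + (r + r') *s f"
      by (simp add: vec_eq_iff algebra_simps)
    then show "x + y \<in> triple_span e h f"
      unfolding triple_span_def by blast
  next
    fix x c assume "x \<in> triple_span e h f"
    then obtain p q r where "x = p *s e + q *s h + r *s f"
      by (auto simp: triple_span_def)
    then have "c *s x = (c * p) *s e + (c * q) *s h + (c * r) *s f"
      by (simp add: vec_eq_iff algebra_simps)
    then show "c *s x \<in> triple_span e h f"
      unfolding triple_span_def by blast
  qed
  show "\<psi> ` triple_span e h f \<subseteq> carrier L"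
    using psi_carrier by blast
  fix x y assume "x \<in> \<psi> ` triple_span e h f" "y \<in> \<psi> ` triple_span e h f"
  then obtain p q r p' q' r' where
    xy: "x = \<psi> (p *s e + q *s h + r *s f)" "y = \<psi> (p' *s e + q' *s h + r' *s f)"
    by (auto simp: triple_span_def)
  have "(p *s e + q *s h + r *s f) \<cdot> (p' *s e + q' *s h + r' *s f) =
      (2 * (q * p') - 2 * (p * q')) *s e + (p * r' - r * p') *s h + (2 * (r * q') - 2 * (q * r')) *s f"
    by (simp add: m.br_simps eqs vec_eq_iff algebra_simps)
  then show "brk L x y \<in> \<psi> ` triple_span e h f"
    unfolding xy hom[symmetric] psi_mem_image_iff triple_span_def by blast
qed

lemma triple_isomorphism:
  assumes triple: "m.sl2_triple e h f" and ind: "indep 3 (nth [e, h, f])"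
  shows "lie_isomorphism sl2 (L\<lparr>carrier := \<psi> ` triple_span e h f\<rparr>)
     (\<lambda>A. \<psi> (A $ 1 $ 2 *s e + A $ 1 $ 1 *s h + A $ 2 $ 1 *s f))"
    (is "lie_isomorphism sl2 ?P ?\<phi>")
proof -
  note eqs = triple[unfolded m.sl2_triple_def] m.sl2_triple_anti[OF triple]
  have trace: "A $ 2 $ 2 = - A $ 1 $ 1" if "A \<in> carrier sl2" for A :: "'k^2^2"
    using that by (simp add: sl2_def trace_def sum_2 eq_neg_iff_add_eq_0 add.commute)
  have "?\<phi> (brk sl2 A B) = brk L (?\<phi> A) (?\<phi> B)" if A: "A \<in> carrier sl2" and B: "B \<in> carrier sl2"
    for A B :: "'k^2^2"
    unfolding hom[symmetric] psi_eq_iff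
    by (simp add: sl2_def matrix_matrix_mult_def sum_2 trace[OF A] trace[OF B] m.br_simps eqs
      vec_eq_iff algebra_simps)
  moreover have "?\<phi> (A + B) = ?\<phi> A + ?\<phi> B" "?\<phi> (smul sl2 c A) = smul L c (?\<phi> A)" for A B :: "'k^2^2" and c
    unfolding psi_add[symmetric] psi_scale[symmetric] psi_eq_iff
    by (simp_all add: sl2_def vec_eq_iff algebra_simps)
  ultimately have "lie_hom sl2 ?P ?\<phi>"
    by (auto simp: lie_hom_def triple_span_def)
  moreover have "inj_on ?\<phi> (carrier sl2)"
  proof (rule inj_onI)
    fix A B :: "'k^2^2" assume AB: "A \<in> carrier sl2" "B \<in> carrier sl2" "?\<phi> A = ?\<phi> B"
    have "(A $ 1 $ 2 - B $ 1 $ 2) *s e + (A $ 1 $ 1 - B $ 1 $ 1) *s h + (A $ 2 $ 1 - B $ 2 $ 1) *s f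
        = (A $ 1 $ 2 *s e + A $ 1 $ 1 *s h + A $ 2 $ 1 *s f) - (B $ 1 $ 2 *s e + B $ 1 $ 1 *s h + B $ 2 $ 1 *s f)"
      by (simp add: vec_eq_iff algebra_simps)
    also have "\<dots> = 0"
      using AB(3) by (simp add: psi_eq_iff)
    finally have "A $ 1 $ 2 - B $ 1 $ 2 = 0 \<and> A $ 1 $ 1 - B $ 1 $ 1 = 0 \<and> A $ 2 $ 1 - B $ 2 $ 1 = 0"
      using ind unfolding indep3 by blast
    then show "A = B"
      using trace[OF AB(1)] trace[OF AB(2)] by (simp add: vec_eq_iff forall_2)
  qed
  moreover have "\<psi> ` triple_span e h f \<subseteq> ?\<phi> ` carrier sl2"
  proof
    fix x assume "x \<in> \<psi> ` triple_span e h f"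
    then obtain p q r where x: "x = \<psi> (p *s e + q *s h + r *s f)"
      by (auto simp: triple_span_def)
    define A :: "'k^2^2" where "A = (\<chi> i j. if i = 1 then if j = 1 then q else p else if j = 1 then r else - q)"
    have "A \<in> carrier sl2" "x = ?\<phi> A"
      by (simp_all add: A_def x sl2_def trace_def sum_2)
    then show "x \<in> ?\<phi> ` carrier sl2"
      by blast
  qed
  ultimately show ?thesis
    by (auto simp: lie_isomorphism_def bij_betw_def lie_hom_def)
qed

lemma isomorphism_triple:
  assumes iso: "lie_isomorphism sl2 (L\<lparr>carrier := P\<rparr>) \<phi>" and P: "P \<subseteq> carrier L"
  obtains e h f where "m.sl2_triple e h f" "indep 3 (nth [e, h, f])" "P = \<psi> ` triple_span e h f"
    "\<And>A. A \<in> carrier sl2 \<Longrightarrow> \<phi> A = \<psi> (A $ 1 $ 2 *s e + A $ 1 $ 1 *s h + A $ 2 $ 1 *s f)"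
proof -
  have \<phi>: "\<And>A B. A \<in> carrier sl2 \<Longrightarrow> B \<in> carrier sl2 \<Longrightarrow> \<phi> (A + B) = \<phi> A + \<phi> B"
    "\<And>c A. A \<in> carrier sl2 \<Longrightarrow> \<phi> (smul sl2 c A) = smul L c (\<phi> A)"
    "\<And>A B. A \<in> carrier sl2 \<Longrightarrow> B \<in> carrier sl2 \<Longrightarrow> \<phi> (brk sl2 A B) = brk L (\<phi> A) (\<phi> B)"
    and inj: "inj_on \<phi> (carrier sl2)" and im: "\<phi> ` carrier sl2 = P"
    using iso by (auto simp: lie_isomorphism_def lie_hom_def bij_betw_def)
  interpret S: lie_algebra "sl2 :: ('k, 'k^2^2) lie"
    by (rule sl2_lie_algebra)
  have in_sl2: "sl2_e \<in> carrier sl2" "sl2_h \<in> carrier sl2" "sl2_f \<in> carrier (sl2 :: ('k, 'k^2^2) lie)"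
    by (auto simp: sl2_simps)
  then have "\<phi> sl2_e \<in> carrier L" "\<phi> sl2_h \<in> carrier L" "\<phi> sl2_f \<in> carrier L"
    using im P by blast+
  then obtain e h f where ehf: "\<phi> sl2_e = \<psi> e" "\<phi> sl2_h = \<psi> h" "\<phi> sl2_f = \<psi> f"
    by (metis carrier_cases)
  have "\<psi> (h \<cdot> e) = \<psi> (2 *s e)" "\<psi> (h \<cdot> f) = \<psi> ((-2) *s f)" "\<psi> (e \<cdot> f) = \<psi> h"
    unfolding hom psi_scale ehf[symmetric] \<phi>(3)[OF in_sl2(2) in_sl2(1), symmetric]
      \<phi>(3)[OF in_sl2(2) in_sl2(3), symmetric] \<phi>(3)[OF in_sl2(1) in_sl2(3), symmetric]
      sl2_structure \<phi>(2)[OF in_sl2(1)] \<phi>(2)[OF in_sl2(3)] by (rule refl)+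
  then have triple: "m.sl2_triple e h f"
    by (simp add: m.sl2_triple_def psi_eq_iff)
  have eq: "\<phi> A = \<psi> (A $ 1 $ 2 *s e + A $ 1 $ 1 *s h + A $ 2 $ 1 *s f)" if "A \<in> carrier sl2" for A
  proof -
    have "A = smul sl2 (A $ 1 $ 2) sl2_e + smul sl2 (A $ 1 $ 1) sl2_h + smul sl2 (A $ 2 $ 1) sl2_f"
      using that by (auto simp: sl2_simps eq_neg_iff_add_eq_0 add.commute)
    then have "\<phi> A = \<phi> (smul sl2 (A $ 1 $ 2) sl2_e + smul sl2 (A $ 1 $ 1) sl2_h + smul sl2 (A $ 2 $ 1) sl2_f)"
      by simp
    also have "\<dots> = \<psi> (A $ 1 $ 2 *s e + A $ 1 $ 1 *s h + A $ 2 $ 1 *s f)"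
      using in_sl2[THEN S.subspace_scale[OF S.carrier_subspace]] S.subspace_add[OF S.carrier_subspace]
      by (simp add: \<phi>(1) \<phi>(2)[OF in_sl2(1)] \<phi>(2)[OF in_sl2(2)] \<phi>(2)[OF in_sl2(3)] ehf psi_add psi_scale)
    finally show ?thesis .
  qed
  define mat :: "'k \<Rightarrow> 'k \<Rightarrow> 'k \<Rightarrow> 'k^2^2" where
    "mat p q r = (\<chi> i j. if i = 1 then if j = 1 then q else p else if j = 1 then r else - q)" for p q r
  have mat: "mat p q r \<in> carrier sl2" "mat p q r $ 1 $ 2 = p" "mat p q r $ 1 $ 1 = q" "mat p q r $ 2 $ 1 = r"
    for p q r
    by (simp_all add: mat_def sl2_def trace_def sum_2)
  have \<phi>_mat: "\<phi> (mat p q r) = \<psi> (p *s e + q *s h + r *s f)" for p q r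
    using eq[OF mat(1)] by (simp add: mat)
  have "p = 0 \<and> q = 0 \<and> r = 0" if "p *s e + q *s h + r *s f = 0" for p q r
  proof -
    have "\<phi> (mat p q r) = \<phi> (mat 0 0 0)"
      using that by (simp add: \<phi>_mat)
    then have "mat p q r = mat 0 0 0"
      by (rule inj_onD[OF inj]) (rule mat(1))+
    then show ?thesis
      using mat by metis
  qed
  then have ind: "indep 3 (nth [e, h, f])"
    unfolding indep3 by blast
  have "P = \<psi> ` triple_span e h f"
  proof
    show "P \<subseteq> \<psi> ` triple_span e h f"
      using eq by (auto simp: im[symmetric] triple_span_def)
    show "\<psi> ` triple_span e h f \<subseteq> P"
      using mat(1) by (auto simp: im[symmetric] triple_span_def \<phi>_mat[symmetric])
  qed
  from that[OF triple ind this eq] show thesis .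
qed

lemma isomorphism_triple':
  assumes iso: "L\<lparr>carrier := P\<rparr> \<cong>\<^sub>L (sl2 :: ('k, 'k^2^2) lie)" and P: "lie_subalgebra P L"
  obtains e h f where "m.sl2_triple e h f" "indep 3 (nth [e, h, f])" "P = \<psi> ` triple_span e h f"
proof -
  obtain \<phi> where "lie_isomorphism (L\<lparr>carrier := P\<rparr>) (sl2 :: ('k, 'k^2^2) lie) \<phi>"
    using iso by (auto simp: lie_iso_def)
  from lie_isomorphism_inverse'[OF lie_algebra_subalgebra[OF P] this]
  show thesis
    by (rule isomorphism_triple) (use P that in \<open>auto simp: lie_subalgebra_def\<close>)
qed

lemma triple_sl2:
  assumes "m.sl2_triple e h f" "indep 3 (nth [e, h, f])"
  shows "L\<lparr>carrier := \<psi> ` triple_span e h f\<rparr> \<cong>\<^sub>L (sl2 :: ('k, 'k^2^2) lie)"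
  using lie_isomorphism_inverse'[OF sl2_lie_algebra triple_isomorphism[OF assms]]
  unfolding lie_iso_def by blast

lemma complement_indep:
  assumes "semidirect_sum L (\<psi> ` triple_span e h f) I"
    and ind: "indep 3 (nth [e, h, f])" "indep 2 (nth [r1, r2])" and I: "\<psi> r1 \<in> I" "\<psi> r2 \<in> I"
  shows "indep 5 (nth [e, h, f, r1, r2])"
  unfolding indep5
proof (intro allI impI)
  fix p q r s t
  assume "p *s e + q *s h + r *s f + s *s r1 + t *s r2 = 0"
  then have "p *s e + q *s h + r *s f = - (s *s r1 + t *s r2)"
    by (simp add: eq_neg_iff_add_eq_0 add.assoc del: minus_add_distrib)
  then have eq: "p *s e + q *s h + r *s f = (- s) *s r1 + (- t) *s r2"
    by (simp add: vec_eq_iff)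
  have "subspace I"
    using assms(1) by (simp add: semidirect_sum_def lie_ideal_def)
  then have "\<psi> ((- s) *s r1 + (- t) *s r2) \<in> I"
    unfolding psi_add psi_scale using I by (intro subspace_add subspace_scale)
  moreover have "\<psi> (p *s e + q *s h + r *s f) \<in> \<psi> ` triple_span e h f"
    unfolding triple_span_def by blast
  ultimately have "\<psi> (p *s e + q *s h + r *s f) = 0"
    using assms(1) unfolding eq semidirect_sum_def by blast
  then have "p *s e + q *s h + r *s f = 0" "(- s) *s r1 + (- t) *s r2 = 0"
    unfolding psi_eq_0_iff eq by simp_all
  then have "p = 0 \<and> q = 0 \<and> r = 0" "- s = 0 \<and> - t = 0"
    using ind unfolding indep3 indep2 by blast+
  then show "p = 0 \<and> q = 0 \<and> r = 0 \<and> s = 0 \<and> t = 0"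
    by simp
qed

lemma table_semidirect:
  assumes ind: "indep 5 (nth [e, h, f, r1, r2])" and triple: "m.sl2_triple e h f"
    and R: "m.ideal (vec.span {r1, r2})"
  shows "semidirect_sum L (\<psi> ` triple_span e h f) (\<psi> ` vec.span {r1, r2})"
  unfolding semidirect_sum_def
proof (intro conjI)
  show "\<psi> ` triple_span e h f \<inter> \<psi> ` vec.span {r1, r2} = {0}"
  proof
    have "0 *s e + 0 *s h + 0 *s f \<in> triple_span e h f"
      unfolding triple_span_def by blast
    then have "0 \<in> triple_span e h f \<inter> vec.span {r1, r2}"
      by (simp add: vec.span_zero)
    then have "\<psi> 0 \<in> \<psi> ` triple_span e h f \<inter> \<psi> ` vec.span {r1, r2}"
      by blast
    then show "{0} \<subseteq> \<psi> ` triple_span e h f \<inter> \<psi> ` vec.span {r1, r2}"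
      by (simp add: psi_0)
    have "u = 0" if u: "u \<in> triple_span e h f" "u \<in> vec.span {r1, r2}" for u
    proof -
      obtain p q r s t where us: "u = p *s e + q *s h + r *s f" "u = s *s r1 + t *s r2"
        using u by (auto simp: triple_span_def m.span_pair)
      have "p *s e + q *s h + r *s f + (- s) *s r1 + (- t) *s r2
          = (p *s e + q *s h + r *s f) - (s *s r1 + t *s r2)"
        by (simp add: vec_eq_iff)
      also have "\<dots> = 0"
        using us by simp
      finally have "p = 0 \<and> q = 0 \<and> r = 0"
        using ind unfolding indep5 by blast
      then show ?thesis
        using us(1) by simp
    qed
    then show "\<psi> ` triple_span e h f \<inter> \<psi> ` vec.span {r1, r2} \<subseteq> {0}"
      by (auto simp: psi_eq_0_iff psi_eq_iff)
  qed
  show "carrier L = {a + b | a b. a \<in> \<psi> ` triple_span e h f \<and> b \<in> \<psi> ` vec.span {r1, r2}}"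
  proof (intro equalityI subsetI)
    fix x assume "x \<in> carrier L"
    then obtain u where x: "x = \<psi> u"
      by (rule carrier_cases)
    obtain p q r s t where u: "u = p *s e + q *s h + r *s f + s *s r1 + t *s r2"
      using indep5_coordinates[OF card5 ind] by blast
    have "x = \<psi> (p *s e + q *s h + r *s f) + \<psi> (s *s r1 + t *s r2)"
      by (simp add: x u psi_add)
    then show "x \<in> {a + b | a b. a \<in> \<psi> ` triple_span e h f \<and> b \<in> \<psi> ` vec.span {r1, r2}}"
      unfolding triple_span_def m.span_pair by blast
  qed (use psi_carrier in \<open>auto simp flip: psi_add\<close>)
qed (simp_all add: triple_subalgebra[OF triple] lie_ideal_iff R)

lemma indep5_prefix: "indep 5 (nth [a, b, c, d, e]) \<Longrightarrow> indep 3 (nth [a, b, c])" for a b c d e :: "'k^'n"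
  unfolding indep5 indep3 by (metis add.right_neutral vector_smult_lzero)

lemma indep5_suffix: "indep 5 (nth [a, b, c, d, e]) \<Longrightarrow> indep 2 (nth [d, e])" for a b c d e :: "'k^'n"
  unfolding indep5 indep2 by (metis add.left_neutral vector_smult_lzero)

lemma lie_center_eq: "lie_center L = \<psi> ` {u. m.central u}"
proof -
  have "\<psi> u \<in> lie_center L \<longleftrightarrow> m.central u" for u
    by (simp add: lie_center_def m.central_def psi_carrier range[symmetric] psi_eq_0_iff flip: hom)
  moreover have "lie_center L \<subseteq> range \<psi>"
    by (auto simp: lie_center_def range)
  ultimately show ?thesis
    by blast
qed

end

section \<open>The entries of the list in coordinates\<close>

context lie_model
begin

lemma central_table_eqs:
  assumes "m.central_table e h f c1 c2"
  shows "h \<cdot> e = 2 *s e" "h \<cdot> f = -2 *s f" "e \<cdot> f = h" "e \<cdot> h = -2 *s e" "f \<cdot> h = 2 *s f" "f \<cdot> e = - h"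
    "e \<cdot> c1 = 0" "h \<cdot> c1 = 0" "f \<cdot> c1 = 0" "e \<cdot> c2 = 0" "h \<cdot> c2 = 0" "f \<cdot> c2 = 0"
    "c1 \<cdot> e = 0" "c1 \<cdot> h = 0" "c1 \<cdot> f = 0" "c2 \<cdot> e = 0" "c2 \<cdot> h = 0" "c2 \<cdot> f = 0" "c1 \<cdot> c2 = 0" "c2 \<cdot> c1 = 0"
  using assms m.sl2_triple_anti[of e h f] m.br_anti[of c1 e] m.br_anti[of c1 h] m.br_anti[of c1 f]
    m.br_anti[of c2 e] m.br_anti[of c2 h] m.br_anti[of c2 f] m.br_anti[of c2 c1]
  by (auto simp: m.central_table_def m.commutes_with_triple_def m.sl2_triple_def)

lemma central_table_listed:
  assumes t: "m.central_table e h f c1 c2"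
  shows "listed Central L"
proof -
  have ind: "indep 5 (nth [e, h, f, c1, c2])" and triple: "m.sl2_triple e h f"
    using t by (simp_all add: m.central_table_def)
  note eqs = central_table_eqs[OF t]
  have central: "m.central c" if c: "c \<in> vec.span {c1, c2}" for c
    unfolding m.central_def
  proof
    fix y
    obtain p q r s u where y: "y = p *s e + q *s h + r *s f + s *s c1 + u *s c2"
      using indep5_coordinates[OF card5 ind] by blast
    show "c \<cdot> y = 0"
      using c by (auto simp: m.span_pair y m.br_simps eqs)
  qed
  have R: "m.ideal (vec.span {c1, c2})"
  proof (rule m.ideal_spanI)
    fix x s assume "s \<in> {c1, c2}"
    then have "s \<cdot> x = 0"
      using central vec.span_base m.central_def by blast
    then show "x \<cdot> s \<in> vec.span {c1, c2}"
      using m.br_anti[of x s] by (simp add: vec.span_zero)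
  qed
  have "m.central c \<longleftrightarrow> c \<in> vec.span {c1, c2}" for c
  proof
    assume c: "m.central c"
    have coeff: "p = 0 \<and> q = 0 \<and> r = 0 \<and> s = 0 \<and> v = 0"
      if "p *s e + q *s h + r *s f + s *s c1 + v *s c2 = 0" for p q r s v
      using ind that unfolding indep5 by blast
    obtain p q r s v where x: "c = p *s e + q *s h + r *s f + s *s c1 + v *s c2"
      using indep5_coordinates[OF card5 ind] by blast
    have "(-2 * p) *s e + 0 *s h + (2 * r) *s f + 0 *s c1 + 0 *s c2 = c \<cdot> h"
      by (simp add: x m.br_simps eqs vec_eq_iff)
    then have "p = 0" "r = 0"
      using c coeff[of "-2 * p" 0 "2 * r" 0 0] two by (auto simp: m.central_def)
    have "(2 * q) *s e + 0 *s h + 0 *s f + 0 *s c1 + 0 *s c2 = c \<cdot> e"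
      by (simp add: x \<open>p = 0\<close> \<open>r = 0\<close> m.br_simps eqs vec_eq_iff)
    then have "q = 0"
      using c coeff[of "2 * q" 0 0 0 0] two by (auto simp: m.central_def)
    show "c \<in> vec.span {c1, c2}"
      unfolding m.span_pair x \<open>p = 0\<close> \<open>q = 0\<close> \<open>r = 0\<close> by auto
  qed (rule central)
  then have center: "lie_center L = \<psi> ` vec.span {c1, c2}"
    by (simp add: lie_center_eq)
  have rad: "lie_rad L = \<psi> ` vec.span {c1, c2}"
    by (rule lie_rad_eq[OF ind triple R]) (simp add: eqs vec.span_zero)
  have "semidirect_sum L (\<psi> ` triple_span e h f) (lie_rad L)"
    unfolding rad by (rule table_semidirect[OF ind triple R])
  then show ?thesis
    using triple_sl2[OF triple indep5_prefix[OF ind]] rad center by (auto simp only: listed.simps)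
qed

text \<open>
  If the center, which is the radical, were zero, then \<open>L\<close> would be the complement, of
  dimension three.
\<close>

lemma listed_central:
  assumes "listed Central L"
  shows "m.entry_criterion Central"
proof (rule ccontr)
  assume no: "\<not> m.entry_criterion Central"
  obtain P where P: "semidirect_sum L P (lie_rad L)" "L\<lparr>carrier := P\<rparr> \<cong>\<^sub>L (sl2 :: ('k, 'k^2^2) lie)"
    "lie_rad L = lie_center L"
    using assms by auto
  have "lie_rad L \<subseteq> {0}"
    using no by (auto simp: P(3) lie_center_eq psi_eq_0_iff)
  have "carrier L \<subseteq> P"
  proof
    fix x assume "x \<in> carrier L"
    then obtain a b where "x = a + b" "a \<in> P" "b \<in> lie_rad L"
      using P(1) unfolding semidirect_sum_def by blast
    then show "x \<in> P"
      using \<open>lie_rad L \<subseteq> {0}\<close> by auto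
  qed
  have sub: "lie_subalgebra P L"
    using P(1) by (simp add: semidirect_sum_def)
  obtain e h f where "m.sl2_triple e h f" "indep 3 (nth [e, h, f])" and eq: "P = \<psi> ` triple_span e h f"
    by (rule isomorphism_triple'[OF P(2) sub])
  have "u \<in> triple_span e h f" for u
  proof -
    have "\<psi> u \<in> P"
      using \<open>carrier L \<subseteq> P\<close> psi_carrier by (rule subsetD)
    then show ?thesis
      unfolding eq psi_mem_image_iff .
  qed
  moreover have "triple_span e h f \<subseteq> vec.span {e, h, f}"
    unfolding triple_span_def by (intro subsetI, elim CollectE exE, simp) (intro vec.span_add vec.span_scale vec.span_base; simp)
  ultimately have "vec.span {e, h, f} = UNIV"
    by blast
  moreover have "card {e, h, f} < CARD('n)"
    using card_insert_le_m1[of 3 "{h, f}" e] card_insert_le_m1[of 2 "{f}" h] by (simp add: card5)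
  ultimately show False
    using m.span_neq_UNIV[of "{e, h, f}"] by simp
qed

lemma noncommutative_table_listed:
  assumes t: "m.noncommutative_table e h f a u"
  shows "listed Noncommutative L"
proof -
  have ind: "indep 5 (nth [e, h, f, a, u])" and triple: "m.sl2_triple e h f"
    using t by (simp_all add: m.noncommutative_table_def)
  note eqs = m.noncommutative_table_eqs[OF t]
  have R: "m.ideal (vec.span {a, u})"
  proof (rule m.ideal_spanI)
    fix x s assume s: "s \<in> {a, u}"
    obtain p q r v w where x: "x = p *s e + q *s h + r *s f + v *s a + w *s u"
      using indep5_coordinates[OF card5 ind] by blast
    have "x \<cdot> a = 0 *s a + (- w) *s u" "x \<cdot> u = 0 *s a + v *s u"
      by (simp_all add: x m.br_simps eqs vec_eq_iff)
    then show "x \<cdot> s \<in> vec.span {a, u}"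
      using s unfolding m.span_pair by blast
  qed
  have rad: "lie_rad L = \<psi> ` vec.span {a, u}"
    by (rule lie_rad_eq[OF ind triple R]) (simp add: eqs vec.span_base)
  have semi: "semidirect_sum L (\<psi> ` triple_span e h f) (lie_rad L)"
    unfolding rad by (rule table_semidirect[OF ind triple R])
  have "{x \<cdot> y | x y. x \<in> triple_span e h f \<and> y \<in> vec.span {a, u}} \<subseteq> {0}"
    by (auto simp: triple_span_def m.span_pair m.br_simps eqs)
  then have "vec.span {x \<cdot> y | x y. x \<in> triple_span e h f \<and> y \<in> vec.span {a, u}} = {0}"
    using vec.span_minimal[OF _ vec.subspace_single_0] vec.span_zero by blast
  then have prod: "lie_prod L (\<psi> ` triple_span e h f) (lie_rad L) = {0}"
    unfolding rad lie_prod_image by (simp add: psi_0)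
  have "lie_basis L (map \<psi> [a, u]) (lie_rad L)"
    unfolding lie_basis_iff using indep5_suffix[OF ind] by (simp add: rad numeral_2_eq_2)
  then have "lie_basis L [\<psi> a, \<psi> u] (lie_rad L)" "brk L (\<psi> a) (\<psi> u) = \<psi> u"
    by (simp_all add: eqs flip: hom)
  then show ?thesis
    using semi triple_sl2[OF triple indep5_prefix[OF ind]] prod unfolding listed.simps by blast
qed

lemma lie_basis_cases:
  assumes basis: "lie_basis L xs S" and "S \<subseteq> carrier L"
  obtains ws where "xs = map \<psi> ws" "indep (length ws) (nth ws)" "S = \<psi> ` vec.span (set ws)"
proof -
  have "set xs \<subseteq> carrier L"
    using basis assms(2) span_superset[of "set xs"] by (auto simp: lie_basis_def)
  then have "xs = map \<psi> (map (the_inv \<psi>) xs)"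
    by (induction xs) (auto simp: f_the_inv_into_f[OF inj] range)
  then show thesis
    using that lie_basis_iff basis by metis
qed

lemma semidirect_carrier: "semidirect_sum L P I \<Longrightarrow> I \<subseteq> carrier L \<and> P \<subseteq> carrier L \<and> lie_subalgebra P L"
  unfolding semidirect_sum_def lie_ideal_def lie_subalgebra_def
  by (elim conjE, intro conjI) assumption+

lemma listed_noncommutative:
  assumes "listed Noncommutative L"
  shows "m.entry_criterion Noncommutative"
proof -
  obtain P x y where P: "semidirect_sum L P (lie_rad L)" "L\<lparr>carrier := P\<rparr> \<cong>\<^sub>L (sl2 :: ('k, 'k^2^2) lie)"
    and basis: "lie_basis L [x, y] (lie_rad L)" "brk L x y = y" and prod: "lie_prod L P (lie_rad L) = {0}"
    using assms by auto
  obtain e h f where triple: "m.sl2_triple e h f" "indep 3 (nth [e, h, f])" "P = \<psi> ` triple_span e h f"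
    by (rule isomorphism_triple'[OF P(2)]) (use semidirect_carrier[OF P(1)] in blast)
  have "lie_rad L \<subseteq> carrier L"
    using semidirect_carrier[OF P(1)] by blast
  then obtain ws where "[x, y] = map \<psi> ws" and ws: "indep (length ws) (nth ws)" "lie_rad L = \<psi> ` vec.span (set ws)"
    by (rule lie_basis_cases[OF basis(1)])
  then obtain a u where au: "ws = [a, u]" "x = \<psi> a" "y = \<psi> u"
    by (auto simp: Cons_eq_map_conv)
  have inI: "a \<in> vec.span {a, u}" "u \<in> vec.span {a, u}"
    by (simp_all add: vec.span_base)
  have rad: "lie_rad L = \<psi> ` vec.span {a, u}"
    using ws au by simp
  have "indep 5 (nth [e, h, f, a, u])"
    using P(1) triple ws au inI unfolding triple(3)
    by (intro complement_indep) (auto simp: numeral_2_eq_2 rad)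
  moreover have commute: "p \<cdot> c = 0" if pc: "p \<in> triple_span e h f" "c \<in> vec.span {a, u}" for p c
  proof -
    have "p \<cdot> c \<in> {x \<cdot> y | x y. x \<in> triple_span e h f \<and> y \<in> vec.span {a, u}}"
      using pc by blast
    then have "\<psi> (p \<cdot> c) \<in> lie_prod L P (lie_rad L)"
      unfolding triple(3) rad lie_prod_image by (intro imageI vec.span_base)
    then show ?thesis
      by (simp add: prod psi_eq_0_iff)
  qed
  moreover have "e \<in> triple_span e h f" "h \<in> triple_span e h f" "f \<in> triple_span e h f"
  proof -
    have "1 *s e + 0 *s h + 0 *s f \<in> triple_span e h f" "0 *s e + 1 *s h + 0 *s f \<in> triple_span e h f"
      "0 *s e + 0 *s h + 1 *s f \<in> triple_span e h f"
      unfolding triple_span_def by blast+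
    then show "e \<in> triple_span e h f" "h \<in> triple_span e h f" "f \<in> triple_span e h f"
      by simp_all
  qed
  moreover have "a \<cdot> u = u"
    using basis(2) unfolding au(2,3) hom[symmetric] psi_eq_iff .
  ultimately have "m.noncommutative_table e h f a u"
    using triple(1) inI by (simp add: m.noncommutative_table_def m.commutes_with_triple_def)
  then show ?thesis
    unfolding m.entry_criterion.simps by blast
qed

end

context lie_model
begin

lemma split_table_listed:
  assumes t: "m.ext_table e h f v0 v1 0 0"
  shows "listed Split_V1 L"
proof -
  have ind: "indep 5 (nth [e, h, f, v0, v1])" and triple: "m.sl2_triple e h f"
    using t by (simp_all add: m.ext_table_def m.sl2_triple_def)
  note eqs = m.ext_table_eqs[OF t] m.ext_table_anti[OF t]
  have R: "m.ideal (vec.span {v0, v1})" and abelian: "\<And>x y. x \<in> vec.span {v0, v1} \<Longrightarrow> y \<in> vec.span {v0, v1} \<Longrightarrow> x \<cdot> y = 0"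
    using m.ext_table_abelian_ideal(1)[OF t] by (auto simp: m.abelian_ideal_def)
  have rad: "lie_rad L = \<psi> ` vec.span {v0, v1}"
    by (rule lie_rad_eq[OF ind triple R]) (simp add: eqs vec.span_zero)
  have semi: "semidirect_sum L (\<psi> ` triple_span e h f) (lie_rad L)"
    unfolding rad by (rule table_semidirect[OF ind triple R])
  have "{x \<cdot> y | x y. x \<in> vec.span {v0, v1} \<and> y \<in> vec.span {v0, v1}} \<subseteq> {0}"
    using abelian by blast
  then have "vec.span {x \<cdot> y | x y. x \<in> vec.span {v0, v1} \<and> y \<in> vec.span {v0, v1}} = {0}"
    using vec.span_minimal[OF _ vec.subspace_single_0] vec.span_zero by blast
  then have prod: "lie_prod L (lie_rad L) (lie_rad L) = {0}"
    unfolding rad lie_prod_image by (simp add: psi_0)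
  define \<theta> where "\<theta> v = \<psi> (v $ 1 *s v0 + v $ 2 *s v1)" for v :: "'k^2"
  have "is_V1_module L (\<psi> ` triple_span e h f) (lie_rad L)"
    unfolding is_V1_module_def
  proof (intro exI conjI ballI allI)
    show "lie_isomorphism sl2 (L\<lparr>carrier := \<psi> ` triple_span e h f\<rparr>)
        (\<lambda>A. \<psi> (A $ 1 $ 2 *s e + A $ 1 $ 1 *s h + A $ 2 $ 1 *s f))"
      by (rule triple_isomorphism[OF triple indep5_prefix[OF ind]])
    show "Vector_Spaces.linear (*s) (smul L) \<theta>"
      unfolding Vector_Spaces.linear_iff
    proof (intro conjI allI)
      show "\<theta> (u + w) = \<theta> u + \<theta> w" "\<theta> (c *s u) = smul L c (\<theta> u)" for u w c
        unfolding \<theta>_def psi_add[symmetric] psi_scale[symmetric] psi_eq_iff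
        by (simp_all add: vec_eq_iff algebra_simps)
    qed (rule vec.vector_space_axioms vector_space_axioms)+
    show "bij_betw \<theta> UNIV (lie_rad L)"
      unfolding bij_betw_def
    proof
      show "inj \<theta>"
      proof (rule injI)
        fix u w assume "\<theta> u = \<theta> w"
        then have "u $ 1 *s v0 + u $ 2 *s v1 = w $ 1 *s v0 + w $ 2 *s v1"
          by (simp add: \<theta>_def psi_eq_iff)
        then have "(u $ 1 - w $ 1) *s v0 + (u $ 2 - w $ 2) *s v1 = 0"
          by (simp add: vec_eq_iff algebra_simps)
        then have "u $ 1 - w $ 1 = 0 \<and> u $ 2 - w $ 2 = 0"
          using indep5_suffix[OF ind] unfolding indep2 by blast
        then show "u = w"
          by (simp add: vec_eq_iff forall_2)
      qed
      show "range \<theta> = lie_rad L"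
      proof
        show "range \<theta> \<subseteq> lie_rad L"
          unfolding \<theta>_def rad m.span_pair by blast
        show "lie_rad L \<subseteq> range \<theta>"
        proof
          fix x assume "x \<in> lie_rad L"
          then obtain s u where "x = \<psi> (s *s v0 + u *s v1)"
            unfolding rad m.span_pair by blast
          then have "x = \<theta> (\<chi> i. if i = 1 then s else u)"
            by (simp add: \<theta>_def)
          then show "x \<in> range \<theta>"
            by blast
        qed
      qed
    qed
    show "brk L (\<psi> (A $ 1 $ 2 *s e + A $ 1 $ 1 *s h + A $ 2 $ 1 *s f)) (\<theta> v) = \<theta> (A *v v)"
      if A: "A \<in> carrier sl2" for A :: "'k^2^2" and v
    proof -
      have "A $ 2 $ 2 = - A $ 1 $ 1"
        using A by (simp add: sl2_def trace_def sum_2 eq_neg_iff_add_eq_0 add.commute)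
      then show ?thesis
        unfolding \<theta>_def hom[symmetric] psi_eq_iff
        by (simp add: matrix_vector_mult_def sum_2 m.br_simps eqs vec_eq_iff algebra_simps)
    qed
  qed
  then show ?thesis
    using semi triple_sl2[OF triple indep5_prefix[OF ind]] prod unfolding listed.simps by blast
qed

lemma listed_split:
  assumes "listed Split_V1 L"
  shows "m.entry_criterion Split_V1"
proof -
  obtain P where P: "semidirect_sum L P (lie_rad L)" and prod: "lie_prod L (lie_rad L) (lie_rad L) = {0}"
    and V1: "is_V1_module L P (lie_rad L)"
    using assms by auto
  obtain \<phi> and \<theta> :: "'k^2 \<Rightarrow> 'v" where \<phi>: "lie_isomorphism sl2 (L\<lparr>carrier := P\<rparr>) \<phi>"
    and \<theta>: "Vector_Spaces.linear (*s) (smul L) \<theta>" "bij_betw \<theta> UNIV (lie_rad L)"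
    and act: "\<And>A v. A \<in> carrier sl2 \<Longrightarrow> brk L (\<phi> A) (\<theta> v) = \<theta> (A *v v)"
    using V1 unfolding is_V1_module_def by blast
  have sub: "lie_rad L \<subseteq> carrier L" "P \<subseteq> carrier L"
    using semidirect_carrier[OF P] by blast+
  obtain e h f where triple: "m.sl2_triple e h f" "indep 3 (nth [e, h, f])" "P = \<psi> ` triple_span e h f"
    "\<forall>A\<in>carrier sl2. \<phi> A = \<psi> (A $ 1 $ 2 *s e + A $ 1 $ 1 *s h + A $ 2 $ 1 *s f)"
    by (rule isomorphism_triple[OF \<phi> sub(2)], rule that, assumption+, blast)
  have in_rad: "\<theta> v \<in> lie_rad L" for v
    using \<theta>(2) by (auto simp: bij_betw_def)
  obtain v0 v1 where v: "\<theta> (axis 1 1) = \<psi> v0" "\<theta> (axis 2 1) = \<psi> v1"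
    using carrier_cases in_rad sub(1) by (metis subsetD)
  have add: "\<theta> (u + w) = \<theta> u + \<theta> w" and scale: "\<theta> (c *s u) = smul L c (\<theta> u)" for u w c
    using \<theta>(1) by (auto simp: Vector_Spaces.linear_iff)
  have "\<theta> 0 = 0"
    using scale[of 0 0] by simp
  have minus: "\<theta> (- u) = - \<theta> u" for u
    using scale[of "- 1" u] by (simp add: vector_smult_lneg)
  have "indep 2 (nth [v0, v1])"
    unfolding indep2
  proof (intro allI impI)
    fix r s assume "r *s v0 + s *s v1 = 0"
    then have "\<psi> (r *s v0 + s *s v1) = 0"
      by (simp only: psi_0)
    then have "\<theta> (r *s axis 1 1 + s *s axis 2 1) = \<theta> 0"
      unfolding add scale v psi_add psi_scale \<open>\<theta> 0 = 0\<close> .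
    then have "r *s axis 1 1 + s *s axis 2 1 = (0 :: 'k^2)"
      using \<theta>(2) unfolding bij_betw_def by (metis injD)
    then show "r = 0 \<and> s = 0"
      by (simp add: vec_eq_iff forall_2 axis_def)
  qed
  then have ind: "indep 5 (nth [e, h, f, v0, v1])"
    using P triple(2) in_rad unfolding triple(3) by (intro complement_indep) (auto simp flip: v)
  have in_sl2: "sl2_e \<in> carrier sl2" "sl2_h \<in> carrier sl2" "sl2_f \<in> carrier (sl2 :: ('k, 'k^2^2) lie)"
    by (auto simp: sl2_simps)
  have ehf: "\<phi> sl2_e = \<psi> e" "\<phi> sl2_h = \<psi> h" "\<phi> sl2_f = \<psi> f"
    by (simp_all add: triple(4) in_sl2 psi_eq_iff) (simp_all add: sl2_e_def sl2_h_def sl2_f_def)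
  have "\<psi> (h \<cdot> v0) = \<psi> v0" "\<psi> (h \<cdot> v1) = \<psi> (- v1)" "\<psi> (e \<cdot> v0) = \<psi> 0" "\<psi> (e \<cdot> v1) = \<psi> v0"
    "\<psi> (f \<cdot> v0) = \<psi> v1" "\<psi> (f \<cdot> v1) = \<psi> 0"
    unfolding hom v[symmetric] ehf[symmetric] act[OF in_sl2(1)] act[OF in_sl2(2)] act[OF in_sl2(3)]
      V1_structure psi_0 psi_minus \<open>\<theta> 0 = 0\<close> minus by (rule refl)+
  moreover have "\<psi> (v0 \<cdot> v1) = \<psi> 0"
  proof -
    have "brk L (\<psi> v0) (\<psi> v1) \<in> lie_prod L (lie_rad L) (lie_rad L)"
      unfolding lie_prod_def using in_rad v by (intro span_base) (metis (mono_tags, lifting) mem_Collect_eq)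
    then show ?thesis
      by (simp add: prod hom psi_0)
  qed
  ultimately have "m.ext_table e h f v0 v1 0 0"
    using ind triple(1) by (simp add: m.ext_table_def m.sl2_triple_def psi_eq_iff)
  then show ?thesis
    unfolding m.entry_criterion.simps by blast
qed

text \<open>
  The projection \<open>\<pi>\<close> is given by the first three coordinates. A section of it would map
  \<open>sl2_h\<close> and \<open>sl2_e\<close> to representatives of \<open>h\<close> and \<open>e\<close> whose bracket lacks the term \<open>v\<^sub>1\<close>,
  which is impossible modulo 3.
\<close>

lemma nonsplit_table_listed:
  assumes t: "m.ext_table e h f v0 v1 1 0" and char: "CHAR('k) = 3"
  shows "listed Nonsplit_V1 L"
proof -
  have ind: "indep 5 (nth [e, h, f, v0, v1])"
    using t by (simp_all add: m.ext_table_def)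
  note eqs = m.ext_table_eqs[OF t] m.ext_table_anti[OF t]
  have three: "(3::'k) = 0"
    using of_nat_CHAR[where 'a='k] by (simp add: char)
  have two_eq: "(2::'k) = - 1"
    using three by (simp add: eq_neg_iff_add_eq_0)
  obtain g where g: "\<And>i. i < 5 \<Longrightarrow> form (g i)"
    "\<And>i j. i < 5 \<Longrightarrow> j < 5 \<Longrightarrow> g i ([e, h, f, v0, v1] ! j) = (if i = j then 1 else 0)"
    using indep_dual_forms[OF ind] by blast
  define mat where "mat u = ((\<chi> i j. if i = 1 then if j = 1 then g 1 u else g 0 u
    else if j = 1 then g 2 u else - g 1 u) :: 'k^2^2)" for u :: "'k^'n"
  have g_basis: "g i e = (if i = 0 then 1 else 0)" "g i h = (if i = 1 then 1 else 0)"
    "g i f = (if i = 2 then 1 else 0)" "g i v0 = (if i = 3 then 1 else 0)" "g i v1 = (if i = 4 then 1 else 0)"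
    if "i < 5" for i
    using g(2)[OF that, of 0] g(2)[OF that, of 1] g(2)[OF that, of 2] g(2)[OF that, of 3] g(2)[OF that, of 4]
    by simp_all
  have forms: "form (g 0)" "form (g 1)" "form (g 2)"
    using g(1) by simp_all
  note f_simps = forms[THEN form_add] forms[THEN form_scale] forms[THEN form_minus] forms[THEN form_0]
    forms[THEN form_diff] g_basis
  have mat_coords: "mat (p *s e + q *s h + r *s f + s *s v0 + u *s v1)
      = (\<chi> i j. if i = 1 then if j = 1 then q else p else if j = 1 then r else - q)" for p q r s u
    by (simp add: mat_def f_simps vec_eq_iff del: One_nat_def)
  have mat_sl2: "mat u \<in> carrier sl2" for u
    by (simp add: mat_def sl2_def trace_def sum_2)
  define \<pi> where "\<pi> x = mat (the_inv \<psi> x)" for x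
  have \<pi>: "\<pi> (\<psi> u) = mat u" for u
    by (simp add: \<pi>_def the_inv_f_f[OF inj])
  define \<theta> where "\<theta> v = \<psi> (v $ 1 *s v0 + v $ 2 *s v1)" for v :: "'k^2"
  have mat_br: "mat (x \<cdot> y) = brk sl2 (mat x) (mat y)" for x y
  proof -
    obtain p q r s u where x: "x = p *s e + q *s h + r *s f + s *s v0 + u *s v1"
      using indep5_coordinates[OF card5 ind] by blast
    obtain p' q' r' s' u' where y: "y = p' *s e + q' *s h + r' *s f + s' *s v0 + u' *s v1"
      using indep5_coordinates[OF card5 ind] by blast
    have "\<exists>a b. x \<cdot> y = (2 * (q * p') - 2 * (p * q')) *s e + (p * r' - r * p') *s h
        + (2 * (r * q') - 2 * (q * r')) *s f + a *s v0 + b *s v1"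
      by (rule exI[of _ "q * s' - s * q' + p * u' - u * p'"],
          rule exI[of _ "q * p' - p * q' - q * u' + u * q' + r * s' - s * r'"])
        (simp add: x y m.br_simps eqs vec_eq_iff algebra_simps)
    then obtain a b where xy: "x \<cdot> y = (2 * (q * p') - 2 * (p * q')) *s e + (p * r' - r * p') *s h
        + (2 * (r * q') - 2 * (q * r')) *s f + a *s v0 + b *s v1"
      by blast
    show ?thesis
      unfolding xy unfolding x y mat_coords
      by (simp add: sl2_def matrix_matrix_mult_def sum_2 vec_eq_iff forall_2 algebra_simps)
  qed
  have mat_linear: "mat (x + y) = mat x + mat y" "mat (c *s x) = smul sl2 c (mat x)" for x y c
    by (simp_all add: mat_def sl2_def f_simps vec_eq_iff forall_2 del: One_nat_def)
  have "V1_extension L \<theta> \<pi>"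
    unfolding V1_extension_def
  proof (intro conjI allI ballI)
    show "Vector_Spaces.linear (*s) (smul L) \<theta>"
      unfolding Vector_Spaces.linear_iff
    proof (intro conjI allI)
      show "\<theta> (u + w) = \<theta> u + \<theta> w" "\<theta> (c *s u) = smul L c (\<theta> u)" for u w c
        unfolding \<theta>_def psi_add[symmetric] psi_scale[symmetric] psi_eq_iff
        by (simp_all add: vec_eq_iff algebra_simps)
    qed (rule vec.vector_space_axioms vector_space_axioms)+
    show "inj \<theta>"
    proof (rule injI)
      fix u w assume "\<theta> u = \<theta> w"
      then have "u $ 1 *s v0 + u $ 2 *s v1 = w $ 1 *s v0 + w $ 2 *s v1"
        by (simp add: \<theta>_def psi_eq_iff)
      then have "(u $ 1 - w $ 1) *s v0 + (u $ 2 - w $ 2) *s v1 = 0"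
        by (simp add: vec_eq_iff algebra_simps)
      then have "u $ 1 - w $ 1 = 0 \<and> u $ 2 - w $ 2 = 0"
        using indep5_suffix[OF ind] unfolding indep2 by blast
      then show "u = w"
        by (simp add: vec_eq_iff forall_2)
    qed
    show "lie_hom L sl2 \<pi>"
      unfolding lie_hom_def range[symmetric]
      by (auto simp: \<pi> mat_sl2 mat_br mat_linear simp flip: psi_add psi_scale hom)
    show "\<pi> ` carrier L = carrier sl2"
    proof
      show "\<pi> ` carrier L \<subseteq> carrier sl2"
        unfolding range[symmetric] by (auto simp: \<pi> mat_sl2)
      show "carrier sl2 \<subseteq> \<pi> ` carrier L"
      proof
        fix A :: "'k^2^2" assume A: "A \<in> carrier sl2"
        have "A $ 2 $ 2 = - A $ 1 $ 1"
          using A by (simp add: sl2_def trace_def sum_2 eq_neg_iff_add_eq_0 add.commute)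
        then have "A = mat (A $ 1 $ 2 *s e + A $ 1 $ 1 *s h + A $ 2 $ 1 *s f + 0 *s v0 + 0 *s v1)"
          unfolding mat_coords by (simp add: vec_eq_iff forall_2)
        then show "A \<in> \<pi> ` carrier L"
          unfolding \<pi>[symmetric] using psi_carrier by blast
      qed
    qed
    show "range \<theta> = {x \<in> carrier L. \<pi> x = 0}"
    proof
      have "mat (v $ 1 *s v0 + v $ 2 *s v1) = 0" for v :: "'k^2"
        by (simp add: mat_def f_simps vec_eq_iff del: One_nat_def)
      then show "range \<theta> \<subseteq> {x \<in> carrier L. \<pi> x = 0}"
        by (auto simp: \<theta>_def psi_carrier \<pi>)
      show "{x \<in> carrier L. \<pi> x = 0} \<subseteq> range \<theta>"
      proof
        fix x assume x: "x \<in> {x \<in> carrier L. \<pi> x = 0}"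
        then obtain w where w: "x = \<psi> w" "mat w = 0"
          by (auto simp: \<pi> elim!: carrier_cases)
        obtain p q r s u where ws: "w = p *s e + q *s h + r *s f + s *s v0 + u *s v1"
          using indep5_coordinates[OF card5 ind] by blast
        have "p = 0" "q = 0" "r = 0"
          using w(2) unfolding ws mat_coords by (simp_all add: vec_eq_iff forall_2)
        then have "x = \<theta> (\<chi> i. if i = 1 then s else u)"
          by (simp add: \<theta>_def w(1) ws)
        then show "x \<in> range \<theta>"
          by blast
      qed
    qed
    show "brk L (\<theta> v) (\<theta> w) = 0" for v w
      unfolding \<theta>_def hom[symmetric] psi_eq_0_iff by (simp add: m.br_simps eqs)
    show "brk L x (\<theta> v) = \<theta> (\<pi> x *v v)" if "x \<in> carrier L" for x v
    proof -
      obtain w where w: "x = \<psi> w"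
        using \<open>x \<in> carrier L\<close> by (rule carrier_cases)
      obtain p q r s u where ws: "w = p *s e + q *s h + r *s f + s *s v0 + u *s v1"
        using indep5_coordinates[OF card5 ind] by blast
      show ?thesis
        unfolding w \<pi> unfolding ws mat_coords \<theta>_def hom[symmetric] psi_eq_iff
        by (simp add: matrix_vector_mult_def sum_2 m.br_simps eqs vec_eq_iff algebra_simps)
    qed
  qed
  moreover have "\<not> split_extension L \<pi>"
  proof
    assume "split_extension L \<pi>"
    then obtain \<sigma> where \<sigma>: "lie_hom sl2 L \<sigma>" "\<And>A. A \<in> carrier sl2 \<Longrightarrow> \<pi> (\<sigma> A) = A"
      by (auto simp: split_extension_def)
    have in_sl2: "sl2_e \<in> carrier sl2" "sl2_h \<in> carrier (sl2 :: ('k, 'k^2^2) lie)"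
      by (auto simp: sl2_simps)
    then have "\<sigma> sl2_e \<in> carrier L" "\<sigma> sl2_h \<in> carrier L"
      using \<sigma>(1) by (auto simp: lie_hom_def)
    then obtain e' h' where eh: "\<sigma> sl2_e = \<psi> e'" "\<sigma> sl2_h = \<psi> h'"
      by (metis carrier_cases)
    have "brk L (\<sigma> sl2_h) (\<sigma> sl2_e) = smul L 2 (\<sigma> sl2_e)"
      using \<sigma>(1) in_sl2 unfolding lie_hom_def by (metis sl2_structure(1))
    then have br: "h' \<cdot> e' = 2 *s e'"
      unfolding eh hom[symmetric] psi_scale[symmetric] psi_eq_iff .
    have mats: "mat e' = sl2_e" "mat h' = sl2_h"
      using \<sigma>(2)[OF in_sl2(1)] \<sigma>(2)[OF in_sl2(2)] by (simp_all add: eh \<pi>)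
    obtain p q r s u where e': "e' = p *s e + q *s h + r *s f + s *s v0 + u *s v1"
      using indep5_coordinates[OF card5 ind] by blast
    obtain p' q' r' s' u' where h': "h' = p' *s e + q' *s h + r' *s f + s' *s v0 + u' *s v1"
      using indep5_coordinates[OF card5 ind] by blast
    have "p = 1 \<and> q = 0 \<and> r = 0" "p' = 0 \<and> q' = 1 \<and> r' = 0"
      using mats unfolding e' h' mat_coords by (simp_all add: sl2_e_def sl2_h_def vec_eq_iff forall_2)
    then have "e' = e + (s *s v0 + u *s v1)" "h' = h + (s' *s v0 + u' *s v1)"
      by (simp_all add: e' h')
    moreover have "s *s v0 + u *s v1 \<in> vec.span {v0, v1}" "s' *s v0 + u' *s v1 \<in> vec.span {v0, v1}"
      unfolding m.span_pair by blast+
    ultimately show False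
      using m.nonsplit_ext_table[OF t three] br by metis
  qed
  moreover have "lie_basis L (map \<psi> [e, h, f, v0, v1]) (carrier L)"
    unfolding lie_basis_iff
  proof
    have "u \<in> vec.span (set [e, h, f, v0, v1])" for u
    proof -
      obtain p q r s t where u: "u = p *s e + q *s h + r *s f + s *s v0 + t *s v1"
        using indep5_coordinates[OF card5 ind] by blast
      show ?thesis
        unfolding u by (intro vec.span_add vec.span_scale vec.span_base) simp_all
    qed
    then have "vec.span (set [e, h, f, v0, v1]) = UNIV"
      by blast
    then show "carrier L = \<psi> ` vec.span (set [e, h, f, v0, v1])"
      by (simp only: range)
  qed (use ind in \<open>simp add: numeral_eq_Suc\<close>)
  moreover have "brk L (\<psi> h) (\<psi> e) = - \<psi> e + \<psi> v1" "brk L (\<psi> h) (\<psi> f) = \<psi> f"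
    "brk L (\<psi> e) (\<psi> f) = \<psi> h" "brk L (\<psi> h) (\<psi> v0) = \<psi> v0" "brk L (\<psi> h) (\<psi> v1) = - \<psi> v1"
    "brk L (\<psi> e) (\<psi> v0) = 0" "brk L (\<psi> e) (\<psi> v1) = \<psi> v0" "brk L (\<psi> f) (\<psi> v0) = \<psi> v1"
    "brk L (\<psi> f) (\<psi> v1) = 0" "brk L (\<psi> v0) (\<psi> v1) = 0"
    by (simp_all add: eqs psi_0 psi_minus[symmetric] psi_add[symmetric] psi_eq_iff two_eq vector_smult_lneg
      flip: hom)
  ultimately show ?thesis
    unfolding listed.simps list.map using char by blast
qed

lemma listed_nonsplit:
  assumes "listed Nonsplit_V1 L"
  shows "m.entry_criterion Nonsplit_V1"
proof -
  obtain x1 x2 x3 x4 x5 where basis: "lie_basis L [x1, x2, x3, x4, x5] (carrier L)"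
    and brs: "brk L x2 x1 = - x1 + x5" "brk L x2 x4 = x4" "brk L x1 x4 = 0" "brk L x3 x4 = x5"
      "brk L x2 x3 = x3" "brk L x2 x5 = - x5" "brk L x1 x5 = x4" "brk L x3 x5 = 0" "brk L x1 x3 = x2"
      "brk L x4 x5 = 0"
    using assms by auto
  have "CHAR('k) = 3"
    using assms by simp
  then have three: "(3::'k) = 0"
    using of_nat_CHAR[where 'a='k] by simp
  have two_eq: "(2::'k) = - 1"
    using three by (simp add: eq_neg_iff_add_eq_0)
  obtain ws where "[x1, x2, x3, x4, x5] = map \<psi> ws" and ws: "indep (length ws) (nth ws)"
    by (rule lie_basis_cases[OF basis subset_refl])
  then obtain e h f v0 v1 where x: "ws = [e, h, f, v0, v1]" "x1 = \<psi> e" "x2 = \<psi> h" "x3 = \<psi> f"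
    "x4 = \<psi> v0" "x5 = \<psi> v1"
    by (auto simp: Cons_eq_map_conv)
  have "m.ext_table e h f v0 v1 1 0"
    using ws brs unfolding x hom[symmetric] psi_minus[symmetric] psi_add[symmetric] psi_eq_iff psi_eq_0_iff
    by (simp add: m.ext_table_def two_eq numeral_eq_Suc vector_smult_lneg)
  then show ?thesis
    using three unfolding m.entry_criterion.simps by blast
qed

end

text \<open>
  The coefficients are the differences \<open>(n choose r) - (n choose (r - 1))\<close> of
  \<open>f r * g (n + 1 - r)\<close>, in agreement with the table for the basis \<open>x\<^sup>(\<^sup>r\<^sup>) \<partial>\<close>.
\<close>

lemma W11_bracket:
  fixes f g :: "nat \<Rightarrow> 'k::field"
  assumes char: "CHAR('k) = 5" and f: "f \<in> O11" and g: "g \<in> O11"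
  shows "brk W11 f g 0 = f 0 * g 1 - g 0 * f 1" "brk W11 f g 1 = f 0 * g 2 - g 0 * f 2"
    "brk W11 f g 2 = f 0 * g 3 - g 0 * f 3 + (f 1 * g 2 - g 1 * f 2)"
    "brk W11 f g 3 = f 0 * g 4 - g 0 * f 4 + 2 * (f 1 * g 3 - g 1 * f 3)"
    "brk W11 f g 4 = 3 * (f 1 * g 4 - g 1 * f 4) + 2 * (f 2 * g 3 - g 2 * f 3)"
proof -
  have "f 5 = 0" "g 5 = 0"
    using f g by (simp_all add: O11_def char)
  then show "brk W11 f g 0 = f 0 * g 1 - g 0 * f 1" "brk W11 f g 1 = f 0 * g 2 - g 0 * f 2"
    "brk W11 f g 2 = f 0 * g 3 - g 0 * f 3 + (f 1 * g 2 - g 1 * f 2)"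
    "brk W11 f g 3 = f 0 * g 4 - g 0 * f 4 + 2 * (f 1 * g 3 - g 1 * f 3)"
    "brk W11 f g 4 = 3 * (f 1 * g 4 - g 1 * f 4) + 2 * (f 2 * g 3 - g 2 * f 3)"
    by (simp_all add: W11_def O11_mult_def O11_deriv_def char numeral_eq_Suc algebra_simps)
qed

lemma W11_closed: "f \<in> O11 \<Longrightarrow> g \<in> O11 \<Longrightarrow> brk W11 f g \<in> O11"
  by (auto simp: W11_def O11_def O11_mult_def)

lemma O11_ext:
  fixes f g :: "nat \<Rightarrow> 'k::field"
  assumes char: "CHAR('k) = 5" and f: "f \<in> O11" and g: "g \<in> O11"
    and eq: "f 0 = g 0" "f 1 = g 1" "f 2 = g 2" "f 3 = g 3" "f 4 = g 4"
  shows "f = g"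
proof
  fix n :: nat
  consider "n \<ge> 5" | "n = 0" | "n = 1" | "n = 2" | "n = 3" | "n = 4"
    by linarith
  then show "f n = g n"
    using f g eq by cases (auto simp: O11_def char)
qed

context lie_model
begin

lemma witt_table_listed:
  assumes t: "m.witt_table x h e1 e2 e3" and char: "CHAR('k) = 5"
  shows "listed Witt L"
proof -
  have ind: "indep 5 (nth [x, h, e1, e2, e3])"
    using t by (simp add: m.witt_table_def)
  have eqs: "x \<cdot> h = x" "x \<cdot> e1 = h" "x \<cdot> e2 = e1" "x \<cdot> e3 = e2" "h \<cdot> e1 = e1" "h \<cdot> e2 = 2 *s e2"
    "h \<cdot> e3 = 3 *s e3" "e1 \<cdot> e2 = 2 *s e3" "e1 \<cdot> e3 = 0" "e2 \<cdot> e3 = 0"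
    using t by (simp_all add: m.witt_table_def)
  have anti: "h \<cdot> x = - x" "e1 \<cdot> x = - h" "e2 \<cdot> x = - e1" "e3 \<cdot> x = - e2" "e1 \<cdot> h = - e1"
    "e2 \<cdot> h = - 2 *s e2" "e3 \<cdot> h = - 3 *s e3" "e2 \<cdot> e1 = - 2 *s e3" "e3 \<cdot> e1 = 0" "e3 \<cdot> e2 = 0"
    using eqs m.br_anti[of h x] m.br_anti[of e1 x] m.br_anti[of e2 x] m.br_anti[of e3 x] m.br_anti[of e1 h]
      m.br_anti[of e2 h] m.br_anti[of e3 h] m.br_anti[of e2 e1] m.br_anti[of e3 e1] m.br_anti[of e3 e2]
    by (simp_all add: vec_eq_iff)
  define \<theta> where "\<theta> c = c 0 *s x + c 1 *s h + c 2 *s e1 + c 3 *s e2 + c 4 *s e3" for c :: "nat \<Rightarrow> 'k"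
  have "lie_isomorphism W11 L (\<psi> \<circ> \<theta>)"
    unfolding lie_isomorphism_def lie_hom_def
  proof (intro conjI ballI allI)
    show "(\<psi> \<circ> \<theta>) ` carrier W11 \<subseteq> carrier L"
      using psi_carrier by auto
    show "(\<psi> \<circ> \<theta>) (c + d) = (\<psi> \<circ> \<theta>) c + (\<psi> \<circ> \<theta>) d" for c d
      by (simp add: psi_add[symmetric] psi_eq_iff \<theta>_def vec_eq_iff algebra_simps)
    show "(\<psi> \<circ> \<theta>) (smul W11 a c) = smul L a ((\<psi> \<circ> \<theta>) c)" for a c
      by (simp add: psi_scale[symmetric] psi_eq_iff \<theta>_def vec_eq_iff algebra_simps W11_def)
    show "(\<psi> \<circ> \<theta>) (brk W11 c d) = brk L ((\<psi> \<circ> \<theta>) c) ((\<psi> \<circ> \<theta>) d)"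
      if cd: "c \<in> carrier W11" "d \<in> carrier W11" for c d
    proof -
      have "c \<in> O11" "d \<in> O11"
        using cd by (simp_all add: W11_def)
      have "\<theta> (brk W11 c d) = \<theta> c \<cdot> \<theta> d"
        unfolding \<theta>_def W11_bracket[OF char \<open>c \<in> O11\<close> \<open>d \<in> O11\<close>]
        by (simp add: m.br_simps eqs anti vec_eq_iff algebra_simps)
      then show ?thesis
        by (simp add: hom)
    qed
    show "bij_betw (\<psi> \<circ> \<theta>) (carrier W11) (carrier L)"
      unfolding bij_betw_def
    proof
      show "inj_on (\<psi> \<circ> \<theta>) (carrier W11)"
      proof (rule inj_onI)
        fix c d assume cd: "c \<in> carrier W11" "d \<in> carrier W11" "(\<psi> \<circ> \<theta>) c = (\<psi> \<circ> \<theta>) d"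
        have "(c 0 - d 0) *s x + (c 1 - d 1) *s h + (c 2 - d 2) *s e1 + (c 3 - d 3) *s e2 + (c 4 - d 4) *s e3
            = \<theta> c - \<theta> d"
          by (simp add: \<theta>_def vec_eq_iff algebra_simps)
        also have "\<dots> = 0"
          using cd(3) by (simp add: psi_eq_iff)
        finally have "c 0 - d 0 = 0 \<and> c 1 - d 1 = 0 \<and> c 2 - d 2 = 0 \<and> c 3 - d 3 = 0 \<and> c 4 - d 4 = 0"
          using ind unfolding indep5 by blast
        then show "c = d"
          using cd(1,2) by (intro O11_ext[OF char]) (simp_all add: W11_def)
      qed
      show "(\<psi> \<circ> \<theta>) ` carrier W11 = carrier L"
      proof
        show "carrier L \<subseteq> (\<psi> \<circ> \<theta>) ` carrier W11"
        proof
          fix y assume "y \<in> carrier L"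
          then obtain u where y: "y = \<psi> u"
            by (rule carrier_cases)
          obtain p q r s t where u: "u = p *s x + q *s h + r *s e1 + s *s e2 + t *s e3"
            using indep5_coordinates[OF card5 ind] by blast
          define c where "c n = (if n = 0 then p else if n = 1 then q else if n = 2 then r
            else if n = 3 then s else if n = 4 then t else 0)" for n :: nat
          have "c \<in> carrier W11" "y = (\<psi> \<circ> \<theta>) c"
            by (simp_all add: c_def W11_def O11_def char y u \<theta>_def)
          then show "y \<in> (\<psi> \<circ> \<theta>) ` carrier W11"
            by blast
        qed
      qed (use psi_carrier in auto)
    qed
  qed
  moreover have "x + y \<in> O11" "smul W11 c x \<in> O11" if "x \<in> O11" "y \<in> O11" for x y :: "nat \<Rightarrow> 'k" and c
    using that by (simp_all add: O11_def W11_def)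
  ultimately have "lie_isomorphism L W11 (the_inv_into (carrier W11) (\<psi> \<circ> \<theta>))"
    using W11_closed by (intro lie_isomorphism_inverse) (simp_all add: W11_def)
  then show ?thesis
    using char by (auto simp: lie_iso_def)
qed

text \<open>
  The table holds for the preimages of the basis vectors; as the isomorphism is injective, it
  is checked in \<open>W11\<close>, coordinate by coordinate.
\<close>

lemma listed_witt:
  assumes "listed Witt L"
  shows "m.entry_criterion Witt"
proof -
  have char: "CHAR('k) = 5"
    using assms by simp
  obtain \<phi> where "lie_isomorphism L (W11 :: ('k, nat \<Rightarrow> 'k) lie) \<phi>"
    using assms by (auto simp: lie_iso_def)
  then have \<phi>: "\<And>x y. x \<in> carrier L \<Longrightarrow> y \<in> carrier L \<Longrightarrow> \<phi> (x + y) = \<phi> x + \<phi> y"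
    "\<And>c x. x \<in> carrier L \<Longrightarrow> \<phi> (smul L c x) = (\<lambda>n. c * \<phi> x n)"
    "\<And>x y. x \<in> carrier L \<Longrightarrow> y \<in> carrier L \<Longrightarrow> \<phi> (brk L x y) = brk W11 (\<phi> x) (\<phi> y)"
    and inj_\<phi>: "inj_on \<phi> (carrier L)" and im: "\<phi> ` carrier L = O11"
    by (auto simp: lie_isomorphism_def lie_hom_def bij_betw_def W11_def)
  define \<theta> where "\<theta> u = \<phi> (\<psi> u)" for u
  have add: "\<theta> (u + w) = \<theta> u + \<theta> w" and scale: "\<theta> (c *s u) = (\<lambda>n. c * \<theta> u n)"
    and br: "\<theta> (u \<cdot> w) = brk W11 (\<theta> u) (\<theta> w)" and in_O11: "\<theta> u \<in> O11" for u w c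
    using im psi_carrier[of u] by (auto simp: \<theta>_def psi_add psi_scale hom \<phi> psi_carrier)
  have eq: "u = w" if "\<theta> u = \<theta> w" for u w
    using that inj_onD[OF inj_\<phi>, of "\<psi> u" "\<psi> w"] by (simp add: \<theta>_def psi_carrier psi_eq_iff)
  have "\<theta> 0 = (\<lambda>n. 0)"
    using scale[of 0 0] by simp
  have ex: "\<exists>u. \<theta> u = O11_basis i" for i
  proof -
    have "O11_basis i \<in> (O11 :: (nat \<Rightarrow> 'k) set)"
      by (auto simp: O11_def O11_basis_def)
    then show ?thesis
      unfolding im[symmetric] \<theta>_def range[symmetric] by auto
  qed
  obtain x h e1 e2 e3 where basis: "\<theta> x = O11_basis 0" "\<theta> h = O11_basis 1" "\<theta> e1 = O11_basis 2"
    "\<theta> e2 = O11_basis 3" "\<theta> e3 = O11_basis 4"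
    using ex by metis
  have ext: "u = w" if "\<theta> u 0 = \<theta> w 0" "\<theta> u 1 = \<theta> w 1" "\<theta> u 2 = \<theta> w 2" "\<theta> u 3 = \<theta> w 3" "\<theta> u 4 = \<theta> w 4" for u w
    using that by (intro eq O11_ext[OF char] in_O11)
  have br_entries: "\<theta> (u \<cdot> w) 0 = \<theta> u 0 * \<theta> w 1 - \<theta> w 0 * \<theta> u 1" "\<theta> (u \<cdot> w) 1 = \<theta> u 0 * \<theta> w 2 - \<theta> w 0 * \<theta> u 2"
    "\<theta> (u \<cdot> w) 2 = \<theta> u 0 * \<theta> w 3 - \<theta> w 0 * \<theta> u 3 + (\<theta> u 1 * \<theta> w 2 - \<theta> w 1 * \<theta> u 2)"
    "\<theta> (u \<cdot> w) 3 = \<theta> u 0 * \<theta> w 4 - \<theta> w 0 * \<theta> u 4 + 2 * (\<theta> u 1 * \<theta> w 3 - \<theta> w 1 * \<theta> u 3)"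
    "\<theta> (u \<cdot> w) 4 = 3 * (\<theta> u 1 * \<theta> w 4 - \<theta> w 1 * \<theta> u 4) + 2 * (\<theta> u 2 * \<theta> w 3 - \<theta> w 2 * \<theta> u 3)" for u w
    unfolding br by (rule W11_bracket[OF char in_O11 in_O11])+
  have "x \<cdot> h = x" "x \<cdot> e1 = h" "x \<cdot> e2 = e1" "x \<cdot> e3 = e2" "h \<cdot> e1 = e1" "h \<cdot> e2 = 2 *s e2"
    "h \<cdot> e3 = 3 *s e3" "e1 \<cdot> e2 = 2 *s e3" "e1 \<cdot> e3 = 0" "e2 \<cdot> e3 = 0"
    by (rule ext; simp add: br_entries basis O11_basis_def char scale \<open>\<theta> 0 = (\<lambda>n. 0)\<close> del: One_nat_def)+
  moreover have "indep 5 (nth [x, h, e1, e2, e3])"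
    unfolding indep5
  proof (intro allI impI)
    fix p q r s t
    assume "p *s x + q *s h + r *s e1 + s *s e2 + t *s e3 = 0"
    then have "\<theta> (p *s x + q *s h + r *s e1 + s *s e2 + t *s e3) n = 0" for n
      by (simp add: \<open>\<theta> 0 = (\<lambda>n. 0)\<close>)
    from this[of 0] this[of 1] this[of 2] this[of 3] this[of 4]
    show "p = 0 \<and> q = 0 \<and> r = 0 \<and> s = 0 \<and> t = 0"
      by (simp add: add scale basis O11_basis_def char del: One_nat_def)
  qed
  ultimately have "m.witt_table x h e1 e2 e3"
    by (simp add: m.witt_table_def)
  then show ?thesis
    unfolding m.entry_criterion.simps by blast
qed

lemma listed_criterion: "listed i L \<Longrightarrow> m.entry_criterion i"
  using listed_witt listed_central listed_noncommutative listed_split listed_nonsplit by (cases i) blast+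

end

lemma CHAR_eqI:
  assumes "(of_nat n :: 'k::idom) = 0" "CHAR('k) \<noteq> 1" "prime n"
  shows "CHAR('k) = n"
  using assms by (auto simp: of_nat_eq_0_iff_char_dvd prime_nat_iff)

theorem theorem4p3:
  fixes L :: "('k::{field,finite}, 'v::ab_group_add) lie"
  assumes "CHAR('k) \<ge> 3"
    and "lie_algebra L" and "lie_dim L = 5" and "\<not> lie_solvable L (carrier L)"
  shows "(\<exists>i. listed i L) \<and>
    (\<forall>(M :: ('k, 'w::ab_group_add) lie) i j.
       lie_algebra M \<and> lie_dim M = 5 \<and> listed i L \<and> listed j M \<and> i \<noteq> j \<longrightarrow> \<not> L \<cong>\<^sub>L M)"
proof -
  have two: "(2::'k) \<noteq> 0"
  proof
    assume "(2::'k) = 0"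
    then have "CHAR('k) dvd 2"
      by (simp add: of_nat_eq_0_iff_char_dvd[symmetric])
    then show False
      using assms(1) by (auto dest: dvd_imp_le)
  qed
  obtain br and \<psi> :: "'k^5 \<Rightarrow> 'v" where model: "lie_model L br \<psi>"
    using lie_model_exists[OF assms(2,3) two] by blast
  interpret lie_model L br \<psi>
    by (fact model)
  have five: "CHAR('k) = 5" if "(5::'k) = 0"
    using that assms(1) by (intro CHAR_eqI) auto
  have three: "CHAR('k) = 3" if "(3::'k) = 0"
    using that assms(1) by (intro CHAR_eqI) auto
  obtain D where D: "m.ideal D" "D \<noteq> {0}" "vec.span (m.brackets D) = D"
    by (rule perfect_ideal_exists[OF assms(4)])
  have "\<exists>i. listed i L"
    using m.classification_by_tables[OF D] five three witt_table_listed central_table_listed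
      noncommutative_table_listed split_table_listed nonsplit_table_listed
    by metis
  moreover have "\<not> L \<cong>\<^sub>L M" if M: "lie_algebra M" and ij: "listed i L" "listed j M" "i \<noteq> j"
    for M :: "('k, 'w) lie" and i j
  proof
    assume "L \<cong>\<^sub>L M"
    then obtain \<phi> where \<phi>: "lie_isomorphism L M \<phi>"
      by (auto simp: lie_iso_def)
    interpret M: lie_model M br "\<phi> \<circ> \<psi>"
      by (rule lie_model_transfer[OF model M \<phi>])
    show False
      using m.entry_criterion_unique[OF listed_criterion[OF ij(1)] M.listed_criterion[OF ij(2)]] ij(3)
      by contradiction
  qed
  ultimately show ?thesis
    by blast
qed

end
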